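(* Let $p$ be an odd prime and let $\rho: G_{\mathbb{Q}}\to\mathrm{GL}_2(\overline{\mathbb{F}}_p)$ be a continuous, odd, irreducible representation. Then $k(\rho)=k_{\min}(W(\rho))$.
   Context: Fix an embedding $\overline{\mathbb{Q}}\hookrightarrow\overline{\mathbb{Q}}_p$, so that $G_{\mathbb{Q}_p}\subset G_{\mathbb{Q}}$ is a decomposition group at $p$. Let $I_p$ be its inertia subgroup and $I_{p,w}$ the wild inertia subgroup. Write $\rho_p=\rho|_{G_{\mathbb{Q}_p}}$. Let $\omega$ be the mod $p$ cyclotomic character and $\omega_2$ a fundamental character of level $2$. Peu/très ramifiée: if $\rho_p\sim\begin{pmatrix}\chi_1&\ast\\0&\chi_2\end{pmatrix}$ is a non-split extension with $\chi_1\chi_2^{-1}=\omega$, its extension class lies in $H^1(G_{\mathbb{Q}_p},\overline{\mathbb{F}}_p(\omega))\cong(\mathbb{Q}_p^\times/(\mathbb{Q}_p^\times)^p)\otimes\overline{\mathbb{F}}_p$ (Kummer theory). We say $\rho_p$ is peu ramifiée if this class lies in the image of $\mathbb{Z}_p^\times\otimes\overline{\mathbb{F}}_p$, and très ramifiée otherwise. Serre's weight $k(\rho)$: (1) If $\rho_p$ is irreducible, write $\rho|_{I_p}\sim\omega^a\otimes\mathrm{diag}(\omega_2^{b-a},\omega_2^{p(b-a)})$ with $0\le a<b\le p-1$. Then $k(\rho)=pa+b+1$. (2) Suppose $\rho_p$ is reducible and $\rho|_{I_{p,w}}$ is trivial. Write $\rho|_{I_p}\sim\omega^a\otimes\mathrm{diag}(\omega^{b-a},1)$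 with $0\le a\le b\le p-2$. Then $k(\rho)=pa+b+1$ if $(a,b)\ne(0,0)$, and $k(\rho)=p$ if $(a,b)=(0,0)$. (3) Suppose $\rho_p$ is reducible and $\rho|_{I_{p,w}}$ is non-trivial. Write $\rho|_{I_p}\sim\omega^\alpha\otimes\begin{pmatrix}\omega^{\beta-\alpha}&\ast\\0&1\end{pmatrix}$ with $0\le\alpha\le p-2$ and $1\le\beta\le p-1$. - If $\beta\ne\alpha+1$, then $k(\rho)=1+p\min(\alpha,\beta)+\max(\alpha,\beta)$. - If $\beta=\alpha+1$, then $k(\rho)=2+\alpha(p+1)$ when $\rho_p$ is peu ramifiée, and $k(\rho)=p+1+\alpha(p+1)$ when $\rho_p$ is très ramifiée. Serre weights: $V_{a,b}=\det^a\otimes\mathrm{Sym}^{b-1}\overline{\mathbb{F}}_p^2$ as representations of $\mathrm{GL}_2(\mathbb{F}_p)$, where $0\le a\le p-2$ and $1\le b\le p$. The index $a$ is taken modulo $p-1$. The set $W(\rho)$ satisfies the twist rule $W(\omega^c\otimes\rho)=\{V_{a+c,b}:V_{a,b}\in W(\rho)\}$, so it is determined by the following description up to twist. (i) If $\rho_p$ is irreducible, then up to twist $\rho|_{I_p}\sim\mathrm{diag}(\omega_2^b,\omega_2^{pb})$ with $1\le b\le p-1$, and $W(\rho)=\{V_{0,b},V_{b-1,p+1-b}\}$. (ii) If $\rho_p$ is reducible, then up to twist $\rho|_{I_p}\sim\begin{pmatrix}\omega^b&\ast\\0&1\end{pmatrix}$ with $1\le b\le p-1$; write $\rho_p\sim\begin{pmatrix}\chi_1&\ast\\0&\chi_2\end{pmatrix}$.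 Then $W(\rho)$ is: - $\{V_{0,b}\}$ if $1<b<p-1$ and $\rho_p$ is non-split; - $\{V_{0,b},V_{b,p-1-b}\}$ if $1<b<p-2$ and $\rho_p$ is split; - $\{V_{0,p-2},V_{p-2,p},V_{p-2,1}\}$ if $b=p-2$, $p>3$ and $\rho_p$ is split; - $\{V_{0,p-1}\}$ if $b=p-1$; - $\{V_{0,p}\}$ if $b=1$, $\chi_1\chi_2^{-1}=\omega$ and $\rho_p$ is très ramifiée; - $\{V_{0,p},V_{0,1},V_{1,p-2}\}$ if $b=1$, $p>3$ and $\rho_p$ is split; - $\{V_{0,3},V_{0,1},V_{1,3},V_{1,1}\}$ if $b=1$, $p=3$ and $\rho_p$ is split; - $\{V_{0,p},V_{0,1}\}$ otherwise. For a Serre weight $V$, set $k_{\min}(V)=\min\{k\ge2: V\text{ is a Jordan–Hölder constituent of }\mathrm{Sym}^{k-2}\overline{\mathbb{F}}_p^2\}$, and $k_{\min}(W(\rho))=\min\{k_{\min}(V):V\in W(\rho)\}$. *)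

theory Defs
  imports
    "HOL-Algebra.Algebraic_Closure_Type"
    "Berlekamp_Zassenhaus.Finite_Field"
    "HOL-Computational_Algebra.Fraction_Field"
    "HOL-Analysis.Analysis"
begin

text \<open>Throughout, the prime \<open>p\<close> is \<open>CARD('p)\<close> for a type \<open>'p\<close> of class \<open>prime_card\<close>.\<close>

section \<open>The ring of \<open>p\<close>-adic integers\<close>

text \<open>\<open>\<int>\<^sub>p\<close> is the inverse limit of the rings \<open>\<int>/p\<^sup>n\<int>\<close>; residue classes are represented by
  their least nonnegative representatives.\<close>

typedef (overloaded) ('p :: prime_card) padic_int =
  "{f :: nat \<Rightarrow> int. \<forall>n. f n \<in> {0..<int CARD('p) ^ n} \<and>
      f (Suc n) mod int CARD('p) ^ n = f n}"
  by (intro exI[of _ "\<lambda>_. 0"]) (auto simp: prime_gt_0_nat[OF prime_card])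

setup_lifting type_definition_padic_int

lemma padic_aux:
  assumes "\<And>n. h (Suc n) mod int CARD('p :: prime_card) ^ n = h n mod int CARD('p) ^ n"
  shows "h n mod int CARD('p) ^ n \<in> {0..<int CARD('p) ^ n} \<and>
           (h (Suc n) mod int CARD('p) ^ Suc n) mod int CARD('p) ^ n = h n mod int CARD('p) ^ n"
proof -
  have "0 < int CARD('p) ^ n"
    by simp
  moreover have "(h (Suc n) mod int CARD('p) ^ Suc n) mod int CARD('p) ^ n
      = h (Suc n) mod int CARD('p) ^ n"
    by (rule mod_mod_cancel) simp
  ultimately show ?thesis
    using assms by simp
qed

instantiation padic_int :: (prime_card) comm_ring_1
begin

lift_definition zero_padic_int :: "'a padic_int" is "\<lambda>n. 0 mod int CARD('a) ^ n"
  by (rule padic_aux[where h = "\<lambda>_. 0"]) simp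

lift_definition one_padic_int :: "'a padic_int" is "\<lambda>n. 1 mod int CARD('a) ^ n"
  by (rule padic_aux[where h = "\<lambda>_. 1"]) simp

lift_definition plus_padic_int :: "'a padic_int \<Rightarrow> 'a padic_int \<Rightarrow> 'a padic_int"
  is "\<lambda>f g n. (f n + g n) mod int CARD('a) ^ n"
  by (rule padic_aux) (metis mod_add_eq)

lift_definition uminus_padic_int :: "'a padic_int \<Rightarrow> 'a padic_int"
  is "\<lambda>f n. (- f n) mod int CARD('a) ^ n"
  by (rule padic_aux) (metis mod_minus_eq)

lift_definition minus_padic_int :: "'a padic_int \<Rightarrow> 'a padic_int \<Rightarrow> 'a padic_int"
  is "\<lambda>f g n. (f n - g n) mod int CARD('a) ^ n"
  by (rule padic_aux) (metis mod_diff_eq)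

lift_definition times_padic_int :: "'a padic_int \<Rightarrow> 'a padic_int \<Rightarrow> 'a padic_int"
  is "\<lambda>f g n. (f n * g n) mod int CARD('a) ^ n"
  by (rule padic_aux) (metis mod_mult_eq)

instance
proof
  fix a b c :: "'a padic_int"
  show "a + b + c = a + (b + c)"
    by transfer (simp add: fun_eq_iff mod_simps algebra_simps)
  show "a + b = b + a"
    by transfer (simp add: fun_eq_iff algebra_simps)
  show "0 + a = a"
    by transfer (simp add: fun_eq_iff)
  show "- a + a = 0"
    by transfer (simp add: fun_eq_iff mod_simps)
  show "a - b = a + - b"
    by transfer (simp add: fun_eq_iff mod_simps)
  show "a * b * c = a * (b * c)"
    by transfer (simp add: fun_eq_iff mod_simps algebra_simps)
  show "a * b = b * a"
    by transfer (simp add: fun_eq_iff algebra_simps)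
  show "1 * a = a"
    by transfer (simp add: fun_eq_iff mod_simps)
  show "(a + b) * c = a * c + b * c"
    by transfer (simp add: fun_eq_iff mod_simps algebra_simps)
  show "(0 :: 'a padic_int) \<noteq> 1"
  proof transfer
    have "1 < int CARD('a)"
      using prime_gt_1_nat[OF prime_card[where ?'a = 'a]] by simp
    then have "(0 :: int) mod int CARD('a) ^ 1 \<noteq> 1 mod int CARD('a) ^ 1"
      by simp
    then show "(\<lambda>n. 0 mod int CARD('a) ^ n) \<noteq> (\<lambda>n. 1 mod int CARD('a) ^ n)"
      by meson
  qed
qed

end

lemma padic_compat:
  assumes "\<forall>n. f n \<in> {0..<int CARD('p :: prime_card) ^ n} \<and> f (Suc n) mod int CARD('p) ^ n = f n"
  shows "f (n + k) mod int CARD('p) ^ n = f n"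
proof (induction k)
  case 0
  show ?case using assms by simp
next
  case (Suc k)
  have "f (n + Suc k) mod int CARD('p) ^ n
      = (f (Suc (n + k)) mod int CARD('p) ^ (n + k)) mod int CARD('p) ^ n"
    by (simp add: mod_mod_cancel power_add)
  also have "\<dots> = f n"
    using assms Suc by simp
  finally show ?case .
qed

instance padic_int :: (prime_card) idom
proof
  fix a b :: "'a padic_int"
  assume "a \<noteq> 0" "b \<noteq> 0"
  then show "a * b \<noteq> 0"
  proof transfer
    fix f g :: "nat \<Rightarrow> int"
    let ?q = "int CARD('a)"
    assume f: "\<forall>n. f n \<in> {0..<?q ^ n} \<and> f (Suc n) mod ?q ^ n = f n"
      and g: "\<forall>n. g n \<in> {0..<?q ^ n} \<and> g (Suc n) mod ?q ^ n = g n"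
      and nz: "f \<noteq> (\<lambda>n. 0 mod ?q ^ n)" "g \<noteq> (\<lambda>n. 0 mod ?q ^ n)"
    obtain m n where m: "f m \<noteq> 0" and n: "g n \<noteq> 0"
      using nz by (auto simp: fun_eq_iff)
    have pr: "prime ?q"
      using prime_card[where ?'a = 'a] by simp
    let ?x = "f (m + n)" and ?y = "g (m + n)"
    have x: "\<not> ?q ^ m dvd ?x"
      using padic_compat[OF f, of m n] m by (auto simp: dvd_eq_mod_eq_0)
    have y: "\<not> ?q ^ n dvd ?y"
      using padic_compat[OF g, of n m] n by (auto simp: dvd_eq_mod_eq_0 add.commute)
    have nz': "?x \<noteq> 0" "?y \<noteq> 0"
      using x y by auto
    have "multiplicity ?q ?x < m" "multiplicity ?q ?y < n"
      using x y multiplicity_dvd' not_less by blast+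
    then have "multiplicity ?q (?x * ?y) < m + n"
      using prime_elem_multiplicity_mult_distrib[of ?q ?x ?y] pr nz' by simp
    moreover have "?q ^ (m + n) dvd ?x * ?y \<Longrightarrow> m + n \<le> multiplicity ?q (?x * ?y)"
      using multiplicity_geI pr nz' by (metis mult_eq_0_iff not_prime_unit)
    ultimately have "(?x * ?y) mod ?q ^ (m + n) \<noteq> 0"
      by (auto simp: dvd_eq_mod_eq_0)
    then show "(\<lambda>n. (f n * g n) mod ?q ^ n) \<noteq> (\<lambda>n. 0 mod ?q ^ n)"
      by (auto simp: fun_eq_iff)
  qed
qed

type_synonym 'p qp_bar = "'p padic_int fract alg_closure"
type_synonym 'p fp_bar = "'p mod_ring alg_closure"
type_synonym q_bar = "rat alg_closure"

definition of_Zp :: "'p :: prime_card padic_int \<Rightarrow> 'p qp_bar" where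
  "of_Zp x = to_ac (Fract x 1)"


section \<open>Galois groups\<close>

text \<open>Only used for the perfect fields \<open>\<rat>\<close> and \<open>\<rat>\<^sub>p\<close>, where the algebraic closure is a
  separable closure.\<close>

definition abs_galois :: "('k :: field alg_closure \<Rightarrow> 'k alg_closure) monoid" where
  "abs_galois =
     \<lparr>carrier = {\<sigma>. field_hom \<sigma> \<and> bij \<sigma> \<and> (\<forall>x. \<sigma> (to_ac x) = to_ac x)},
      monoid.mult = (\<circ>), monoid.one = id\<rparr>"

text \<open>A basis of open sets is given by the cosets \<open>\<sigma> Gal(K\<^bsup>alg\<^esup>/K(F))\<close> for finite sets \<open>F\<close>.\<close>

definition krull_topology :: "('k :: field alg_closure \<Rightarrow> 'k alg_closure) topology" where
  "krull_topology = topology_generated_by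
     {{\<tau> \<in> carrier abs_galois. \<forall>x\<in>F. \<tau> x = \<sigma> x} | \<sigma> F. \<sigma> \<in> carrier abs_galois \<and> finite F}"

text \<open>The map \<open>G\<^bsub>\<rat>\<^sub>p\<^esub> \<rightarrow> G\<^bsub>\<rat>\<^esub>\<close> induced by an embedding \<open>\<iota>\<close> of the algebraic closures;
  \<open>\<iota>\<close> is injective with image stable under \<open>G\<^bsub>\<rat>\<^sub>p\<^esub>\<close>.\<close>

definition decomp :: "(q_bar \<Rightarrow> 'p :: prime_card qp_bar) \<Rightarrow> ('p qp_bar \<Rightarrow> 'p qp_bar) \<Rightarrow> (q_bar \<Rightarrow> q_bar)"
  where "decomp \<iota> \<sigma> = (\<lambda>x. the_inv \<iota> (\<sigma> (\<iota> x)))"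

definition integers_bar :: "'p :: prime_card qp_bar set" where
  "integers_bar = {x. \<exists>f :: 'p padic_int poly. lead_coeff f = 1 \<and> poly (map_poly of_Zp f) x = 0}"

definition max_ideal_bar :: "'p :: prime_card qp_bar set" where
  "max_ideal_bar = {x \<in> integers_bar. x = 0 \<or> inverse x \<notin> integers_bar}"

definition inertia :: "('p :: prime_card qp_bar \<Rightarrow> 'p qp_bar) set" where
  "inertia = {\<sigma> \<in> carrier abs_galois. \<forall>x\<in>integers_bar. \<sigma> x - x \<in> max_ideal_bar}"

text \<open>The ramification group, i.e. the kernel of the tame characters of inertia.\<close>

definition wild_inertia :: "('p :: prime_card qp_bar \<Rightarrow> 'p qp_bar) set" where
  "wild_inertia = {\<sigma> \<in> inertia. \<forall>x. x \<noteq> 0 \<longrightarrow> \<sigma> x / x - 1 \<in> max_ideal_bar}"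


section \<open>Characters\<close>

definition cyclo :: "('p :: prime_card qp_bar \<Rightarrow> 'p qp_bar) \<Rightarrow> 'p fp_bar" where
  "cyclo \<sigma> = of_nat (THE n. n < CARD('p) \<and> (\<forall>\<zeta>. \<zeta> ^ CARD('p) = 1 \<longrightarrow> \<sigma> \<zeta> = \<zeta> ^ n))"

text \<open>A reduction map \<open>red\<close> identifies the residue field of \<open>\<rat>\<^sub>p\<^bsup>alg\<^esup>\<close> with the field of
  coefficients. The two fundamental characters of level 2 arise from the two embeddings of
  \<open>\<bbbF>\<^bsub>p\<^sup>2\<^esub>\<close> into the latter.\<close>

definition fundamental_character2 ::
    "(('p :: prime_card qp_bar \<Rightarrow> 'p qp_bar) \<Rightarrow> 'p fp_bar) \<Rightarrow> bool" where
  "fundamental_character2 \<psi> \<longleftrightarrow>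
     (\<exists>(red :: 'p qp_bar \<Rightarrow> 'p fp_bar) \<pi>.
        red 1 = 1 \<and>
        (\<forall>x\<in>integers_bar. \<forall>y\<in>integers_bar. red (x + y) = red x + red y \<and> red (x * y) = red x * red y) \<and>
        \<pi> ^ (CARD('p)\<^sup>2 - 1) = of_nat CARD('p) \<and>
        (\<forall>\<sigma>\<in>inertia. \<psi> \<sigma> = red (\<sigma> \<pi> / \<pi>)))"


section \<open>Two-dimensional representations\<close>

definition GL2 :: "('a :: field ^ 2 ^ 2) monoid" where
  "GL2 = \<lparr>carrier = {A. invertible A}, monoid.mult = (**), monoid.one = mat 1\<rparr>"

definition mat2 :: "'a :: zero \<Rightarrow> 'a \<Rightarrow> 'a \<Rightarrow> 'a \<Rightarrow> 'a ^ 2 ^ 2" where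
  "mat2 a b c d = vector [vector [a, b], vector [c, d]]"

definition scale_mat :: "'a :: times \<Rightarrow> 'a ^ 2 ^ 2 \<Rightarrow> 'a ^ 2 ^ 2" where
  "scale_mat c A = (\<chi> i j. c * A $ i $ j)"

definition rep_equiv_on :: "'g set \<Rightarrow> ('g \<Rightarrow> 'a :: field ^ 2 ^ 2) \<Rightarrow> ('g \<Rightarrow> 'a ^ 2 ^ 2) \<Rightarrow> bool" where
  "rep_equiv_on S \<rho> \<rho>' \<longleftrightarrow> (\<exists>P. invertible P \<and> (\<forall>g\<in>S. \<rho> g = P ** \<rho>' g ** matrix_inv P))"

definition irreducible_rep :: "'g set \<Rightarrow> ('g \<Rightarrow> 'a :: field ^ 2 ^ 2) \<Rightarrow> bool" where
  "irreducible_rep S \<rho> \<longleftrightarrow>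
     (\<forall>U. vec.subspace U \<and> (\<forall>g\<in>S. \<forall>v\<in>U. \<rho> g *v v \<in> U) \<longrightarrow> U = {0} \<or> U = UNIV)"

definition odd_rep :: "((q_bar \<Rightarrow> q_bar) \<Rightarrow> 'a :: field ^ 2 ^ 2) \<Rightarrow> bool" where
  "odd_rep \<rho> \<longleftrightarrow>
     (\<forall>(j :: q_bar \<Rightarrow> complex) c. field_hom j \<and> c \<in> carrier abs_galois \<and> (\<forall>x. j (c x) = cnj (j x))
        \<longrightarrow> det (\<rho> c) = - 1)"

text \<open>In what follows, \<open>r\<close> stands for a representation of \<open>G\<^bsub>\<rat>\<^sub>p\<^esub>\<close>.\<close>

type_synonym 'p local_rep = "('p qp_bar \<Rightarrow> 'p qp_bar) \<Rightarrow> 'p fp_bar ^ 2 ^ 2"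

definition split_rep :: "'p :: prime_card local_rep \<Rightarrow> bool" where
  "split_rep r \<longleftrightarrow>
     (\<exists>\<chi>1 \<chi>2. rep_equiv_on (carrier abs_galois) r (\<lambda>\<sigma>. mat2 (\<chi>1 \<sigma>) 0 0 (\<chi>2 \<sigma>)))"


section \<open>Peu and tres ramifiee extensions\<close>

text \<open>For \<open>y\<^sup>p = x \<in> \<rat>\<^sub>p\<^sup>\<times>\<close>, this is a cocycle representing the Kummer class of \<open>x\<close> in
  \<open>H\<^sup>1(G\<^bsub>\<rat>\<^sub>p\<^esub>, \<bbbF>\<^sub>p(\<omega>))\<close>, where \<open>\<mu>\<^sub>p\<close> is identified with \<open>\<bbbF>\<^sub>p(\<omega>)\<close> by means of the primitive
  \<open>p\<close>-th root of unity \<open>\<zeta>\<close>.\<close>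

definition kummer_cocycle ::
    "'p :: prime_card qp_bar \<Rightarrow> 'p qp_bar \<Rightarrow> ('p qp_bar \<Rightarrow> 'p qp_bar) \<Rightarrow> 'p fp_bar" where
  "kummer_cocycle \<zeta> y \<sigma> = of_nat (THE n. n < CARD('p) \<and> \<sigma> y = \<zeta> ^ n * y)"

text \<open>The class of the cocycle \<open>z\<close> in \<open>H\<^sup>1(G\<^bsub>\<rat>\<^sub>p\<^esub>, \<bbbF>\<^sub>p\<^bsup>alg\<^esup>(\<omega>))\<close> lies in the image of
  \<open>\<int>\<^sub>p\<^sup>\<times> \<otimes> \<bbbF>\<^sub>p\<^bsup>alg\<^esup>\<close>: up to the coboundary of some \<open>t\<close>, it is a finite linear combination of
  Kummer cocycles of units.\<close>

definition unit_class :: "(('p :: prime_card qp_bar \<Rightarrow> 'p qp_bar) \<Rightarrow> 'p fp_bar) \<Rightarrow> bool" where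
  "unit_class z \<longleftrightarrow>
     (\<exists>\<zeta> Y l t. \<zeta> ^ CARD('p) = 1 \<and> \<zeta> \<noteq> 1 \<and>
        finite Y \<and> (\<forall>y\<in>Y. \<exists>u. u dvd 1 \<and> y ^ CARD('p) = of_Zp u) \<and>
        (\<forall>\<sigma>\<in>carrier abs_galois.
           z \<sigma> = (\<Sum>y\<in>Y. l y * kummer_cocycle \<zeta> y \<sigma>) + (cyclo \<sigma> * t - t)))"

text \<open>If \<open>r\<close> is upper triangular with diagonal \<open>\<chi>1, \<chi>2\<close> and upper right entry \<open>u\<close>, then
  \<open>u/\<chi>2\<close> is a cocycle with values in \<open>\<chi>1\<chi>2\<^sup>-\<^sup>1\<close> that represents the extension class.\<close>

definition cyclo_extension ::
    "'p :: prime_card local_rep \<Rightarrow> (('p qp_bar \<Rightarrow> 'p qp_bar) \<Rightarrow> 'p fp_bar) \<Rightarrow> bool" where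
  "cyclo_extension r z \<longleftrightarrow> \<not> split_rep r \<and>
     (\<exists>\<chi>1 \<chi>2 u. rep_equiv_on (carrier abs_galois) r (\<lambda>\<sigma>. mat2 (\<chi>1 \<sigma>) (u \<sigma>) 0 (\<chi>2 \<sigma>)) \<and>
        (\<forall>\<sigma>\<in>carrier abs_galois. \<chi>1 \<sigma> / \<chi>2 \<sigma> = cyclo \<sigma>) \<and>
        (\<forall>\<sigma>\<in>carrier abs_galois. z \<sigma> = u \<sigma> / \<chi>2 \<sigma>))"

definition peu_ramifiee :: "'p :: prime_card local_rep \<Rightarrow> bool" where
  "peu_ramifiee r \<longleftrightarrow> (\<exists>z. cyclo_extension r z \<and> unit_class z)"

definition tres_ramifiee :: "'p :: prime_card local_rep \<Rightarrow> bool" where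
  "tres_ramifiee r \<longleftrightarrow> (\<exists>z. cyclo_extension r z) \<and> \<not> peu_ramifiee r"


section \<open>Serre's weight\<close>

text \<open>In the rule \<open>peu\<close>, the representations with \<open>\<chi>1\<chi>2\<^sup>-\<^sup>1 \<noteq> \<omega>\<close> (where
  \<open>\<chi>1\<chi>2\<^sup>-\<^sup>1\<close> and \<open>\<omega>\<close> agree only on inertia) are counted as peu ramifiee, as in Serre's original definition.\<close>

inductive has_serre_weight ::
    "(('p :: prime_card qp_bar \<Rightarrow> 'p qp_bar) \<Rightarrow> 'p fp_bar) \<Rightarrow> 'p local_rep \<Rightarrow> nat \<Rightarrow> bool"
  for \<omega>2 :: "('p qp_bar \<Rightarrow> 'p qp_bar) \<Rightarrow> 'p fp_bar" and r :: "'p local_rep"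
where
  irreducible:
    "\<lbrakk>irreducible_rep (carrier abs_galois) r; a < b; b \<le> CARD('p) - 1;
      rep_equiv_on inertia r
        (\<lambda>\<sigma>. scale_mat (cyclo \<sigma> ^ a) (mat2 (\<omega>2 \<sigma> ^ (b - a)) 0 0 (\<omega>2 \<sigma> ^ (CARD('p) * (b - a)))))\<rbrakk>
     \<Longrightarrow> has_serre_weight \<omega>2 r (CARD('p) * a + b + 1)"
| tame:
    "\<lbrakk>\<not> irreducible_rep (carrier abs_galois) r; \<forall>\<sigma>\<in>wild_inertia. r \<sigma> = mat 1;
      a \<le> b; b \<le> CARD('p) - 2;
      rep_equiv_on inertia r (\<lambda>\<sigma>. scale_mat (cyclo \<sigma> ^ a) (mat2 (cyclo \<sigma> ^ (b - a)) 0 0 1))\<rbrakk>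
     \<Longrightarrow> has_serre_weight \<omega>2 r (if (a, b) = (0, 0) then CARD('p) else CARD('p) * a + b + 1)"
| generic_wild:
    "\<lbrakk>\<not> irreducible_rep (carrier abs_galois) r; \<exists>\<sigma>\<in>wild_inertia. r \<sigma> \<noteq> mat 1;
      \<alpha> \<le> CARD('p) - 2; 1 \<le> \<beta>; \<beta> \<le> CARD('p) - 1;
      rep_equiv_on inertia r
        (\<lambda>\<sigma>. scale_mat (cyclo \<sigma> ^ \<alpha>) (mat2 (cyclo \<sigma> powi (int \<beta> - int \<alpha>)) (u \<sigma>) 0 1));
      \<beta> \<noteq> \<alpha> + 1\<rbrakk>
     \<Longrightarrow> has_serre_weight \<omega>2 r (1 + CARD('p) * min \<alpha> \<beta> + max \<alpha> \<beta>)"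
| peu:
    "\<lbrakk>\<not> irreducible_rep (carrier abs_galois) r; \<exists>\<sigma>\<in>wild_inertia. r \<sigma> \<noteq> mat 1;
      \<alpha> \<le> CARD('p) - 2; 1 \<le> \<beta>; \<beta> \<le> CARD('p) - 1;
      rep_equiv_on inertia r
        (\<lambda>\<sigma>. scale_mat (cyclo \<sigma> ^ \<alpha>) (mat2 (cyclo \<sigma> powi (int \<beta> - int \<alpha>)) (u \<sigma>) 0 1));
      \<beta> = \<alpha> + 1; \<not> tres_ramifiee r\<rbrakk>
     \<Longrightarrow> has_serre_weight \<omega>2 r (2 + \<alpha> * (CARD('p) + 1))"
| tres:
    "\<lbrakk>\<not> irreducible_rep (carrier abs_galois) r; \<exists>\<sigma>\<in>wild_inertia. r \<sigma> \<noteq> mat 1;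
      \<alpha> \<le> CARD('p) - 2; 1 \<le> \<beta>; \<beta> \<le> CARD('p) - 1;
      rep_equiv_on inertia r
        (\<lambda>\<sigma>. scale_mat (cyclo \<sigma> ^ \<alpha>) (mat2 (cyclo \<sigma> powi (int \<beta> - int \<alpha>)) (u \<sigma>) 0 1));
      \<beta> = \<alpha> + 1; tres_ramifiee r\<rbrakk>
     \<Longrightarrow> has_serre_weight \<omega>2 r (CARD('p) + 1 + \<alpha> * (CARD('p) + 1))"

definition serre_k ::
    "(q_bar \<Rightarrow> 'p :: prime_card qp_bar) \<Rightarrow> (('p qp_bar \<Rightarrow> 'p qp_bar) \<Rightarrow> 'p fp_bar) \<Rightarrow>
      ((q_bar \<Rightarrow> q_bar) \<Rightarrow> 'p fp_bar ^ 2 ^ 2) \<Rightarrow> nat" where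
  "serre_k \<iota> \<omega>2 \<rho> = (THE k. has_serre_weight \<omega>2 (\<rho> \<circ> decomp \<iota>) k)"


section \<open>The set of Serre weights\<close>

text \<open>The pair \<open>(a, b)\<close> with \<open>a \<le> p - 2\<close> and \<open>1 \<le> b \<le> p\<close> stands for the Serre weight
  \<open>V\<^bsub>a,b\<^esub>\<close>.\<close>

definition reducible_weights :: "'p :: prime_card local_rep \<Rightarrow> nat \<Rightarrow> (nat \<times> nat) set" where
  "reducible_weights r b =
    (let p = CARD('p) in
     if 1 < b \<and> b < p - 1 \<and> \<not> split_rep r then {(0, b)}
     else if 1 < b \<and> b < p - 2 \<and> split_rep r then {(0, b), (b, p - 1 - b)}
     else if b = p - 2 \<and> p > 3 \<and> split_rep r then {(0, p - 2), (p - 2, p), (p - 2, 1)}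
     else if b = p - 1 then {(0, p - 1)}
     else if b = 1 \<and> tres_ramifiee r then {(0, p)}
     else if b = 1 \<and> p > 3 \<and> split_rep r then {(0, p), (0, 1), (1, p - 2)}
     else if b = 1 \<and> p = 3 \<and> split_rep r then {(0, 3), (0, 1), (1, 3), (1, 1)}
     else {(0, p), (0, 1)})"

inductive has_weight_set ::
    "(('p :: prime_card qp_bar \<Rightarrow> 'p qp_bar) \<Rightarrow> 'p fp_bar) \<Rightarrow> 'p local_rep \<Rightarrow> (nat \<times> nat) set \<Rightarrow> bool"
  for \<omega>2 :: "('p qp_bar \<Rightarrow> 'p qp_bar) \<Rightarrow> 'p fp_bar"
where
  irreducible:
    "\<lbrakk>irreducible_rep (carrier abs_galois) r; 1 \<le> b; b \<le> CARD('p) - 1;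
      rep_equiv_on inertia r (\<lambda>\<sigma>. mat2 (\<omega>2 \<sigma> ^ b) 0 0 (\<omega>2 \<sigma> ^ (CARD('p) * b)))\<rbrakk>
     \<Longrightarrow> has_weight_set \<omega>2 r {(0, b), (b - 1, CARD('p) + 1 - b)}"
| reducible:
    "\<lbrakk>\<not> irreducible_rep (carrier abs_galois) r; 1 \<le> b; b \<le> CARD('p) - 1;
      rep_equiv_on inertia r (\<lambda>\<sigma>. mat2 (cyclo \<sigma> ^ b) (u \<sigma>) 0 1)\<rbrakk>
     \<Longrightarrow> has_weight_set \<omega>2 r (reducible_weights r b)"
| twist:
    "\<lbrakk>has_weight_set \<omega>2 r W; \<forall>\<sigma>\<in>carrier abs_galois. r' \<sigma> = scale_mat (cyclo \<sigma> ^ c) (r \<sigma>)\<rbrakk>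
     \<Longrightarrow> has_weight_set \<omega>2 r' ((\<lambda>(a, b). ((a + c) mod (CARD('p) - 1), b)) ` W)"

definition serre_weights ::
    "(q_bar \<Rightarrow> 'p :: prime_card qp_bar) \<Rightarrow> (('p qp_bar \<Rightarrow> 'p qp_bar) \<Rightarrow> 'p fp_bar) \<Rightarrow>
      ((q_bar \<Rightarrow> q_bar) \<Rightarrow> 'p fp_bar ^ 2 ^ 2) \<Rightarrow> (nat \<times> nat) set" where
  "serre_weights \<iota> \<omega>2 \<rho> = (THE W. has_weight_set \<omega>2 (\<rho> \<circ> decomp \<iota>) W)"


section \<open>Representations of \<open>GL\<^sub>2(\<bbbF>\<^sub>p)\<close> and minimal weights\<close>

text \<open>\<open>Sym\<^sup>n\<close> of the standard representation with basis \<open>x, y\<close> is the space of homogeneous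
  polynomials of degree \<open>n\<close> in \<open>x, y\<close>; setting \<open>y = 1\<close>, it is identified with the space of
  univariate polynomials of degree at most \<open>n\<close>. The matrix with rows \<open>(a b)\<close>, \<open>(c d)\<close> maps \<open>x\<close> to
  \<open>a x + c y\<close> and \<open>y\<close> to \<open>b x + d y\<close>.\<close>

definition sym_space :: "nat \<Rightarrow> 'p :: prime_card fp_bar poly set" where
  "sym_space n = {f. Polynomial.degree f \<le> n}"

definition sym_act :: "nat \<Rightarrow> 'p :: prime_card mod_ring ^ 2 ^ 2 \<Rightarrow> 'p fp_bar poly \<Rightarrow> 'p fp_bar poly" where
  "sym_act n g f = (\<Sum>i\<le>n. Polynomial.smult (Polynomial.coeff f i)
     ([:to_ac (g $ 2 $ 1), to_ac (g $ 1 $ 1):] ^ i *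
      [:to_ac (g $ 2 $ 2), to_ac (g $ 1 $ 2):] ^ (n - i)))"

definition weight_act ::
    "nat \<times> nat \<Rightarrow> 'p :: prime_card mod_ring ^ 2 ^ 2 \<Rightarrow> 'p fp_bar poly \<Rightarrow> 'p fp_bar poly" where
  "weight_act = (\<lambda>(a, b) g f. Polynomial.smult (to_ac (det g) ^ a) (sym_act (b - 1) g f))"

definition submodule ::
    "('p :: prime_card mod_ring ^ 2 ^ 2 \<Rightarrow> 'p fp_bar poly \<Rightarrow> 'p fp_bar poly) \<Rightarrow>
      'p fp_bar poly set \<Rightarrow> bool" where
  "submodule act U \<longleftrightarrow> module.subspace Polynomial.smult U \<and> (\<forall>g\<in>carrier GL2. \<forall>f\<in>U. act g f \<in> U)"

definition composition_series ::
    "('p :: prime_card mod_ring ^ 2 ^ 2 \<Rightarrow> 'p fp_bar poly \<Rightarrow> 'p fp_bar poly) \<Rightarrow>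
      'p fp_bar poly set \<Rightarrow> 'p fp_bar poly set list \<Rightarrow> bool" where
  "composition_series act M Ms \<longleftrightarrow>
     Ms \<noteq> [] \<and> hd Ms = {0} \<and> last Ms = M \<and> (\<forall>U\<in>set Ms. submodule act U) \<and>
     (\<forall>i. Suc i < length Ms \<longrightarrow> Ms ! i \<subset> Ms ! Suc i \<and>
        \<not> (\<exists>U. submodule act U \<and> Ms ! i \<subset> U \<and> U \<subset> Ms ! Suc i))"

text \<open>\<open>M/N\<close> is isomorphic to \<open>V\<close>: there is an equivariant linear surjection from \<open>M\<close> onto \<open>V\<close>
  with kernel \<open>N\<close>.\<close>

definition quotient_iso ::
    "('p :: prime_card mod_ring ^ 2 ^ 2 \<Rightarrow> 'p fp_bar poly \<Rightarrow> 'p fp_bar poly) \<Rightarrow>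
      'p fp_bar poly set \<Rightarrow> 'p fp_bar poly set \<Rightarrow>
      ('p mod_ring ^ 2 ^ 2 \<Rightarrow> 'p fp_bar poly \<Rightarrow> 'p fp_bar poly) \<Rightarrow> 'p fp_bar poly set \<Rightarrow> bool" where
  "quotient_iso act M N actV V \<longleftrightarrow>
     (\<exists>\<phi>. (\<forall>f\<in>M. \<forall>h\<in>M. \<phi> (f + h) = \<phi> f + \<phi> h) \<and>
        (\<forall>c. \<forall>f\<in>M. \<phi> (Polynomial.smult c f) = Polynomial.smult c (\<phi> f)) \<and>
        (\<forall>g\<in>carrier GL2. \<forall>f\<in>M. \<phi> (act g f) = actV g (\<phi> f)) \<and>
        \<phi> ` M = V \<and> {f \<in> M. \<phi> f = 0} = N)"

definition jh_constituent ::
    "('p :: prime_card mod_ring ^ 2 ^ 2 \<Rightarrow> 'p fp_bar poly \<Rightarrow> 'p fp_bar poly) \<Rightarrow>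
      'p fp_bar poly set \<Rightarrow>
      ('p mod_ring ^ 2 ^ 2 \<Rightarrow> 'p fp_bar poly \<Rightarrow> 'p fp_bar poly) \<Rightarrow> 'p fp_bar poly set \<Rightarrow> bool" where
  "jh_constituent actV V act M \<longleftrightarrow>
     (\<exists>Ms i. composition_series act M Ms \<and> Suc i < length Ms \<and>
        quotient_iso act (Ms ! Suc i) (Ms ! i) actV V)"

definition k_min :: "'p :: prime_card itself \<Rightarrow> nat \<times> nat \<Rightarrow> nat" where
  "k_min _ w = (LEAST k. 2 \<le> k \<and>
     jh_constituent (weight_act w) (sym_space (snd w - 1) :: 'p fp_bar poly set)
       (sym_act (k - 2)) (sym_space (k - 2)))"

definition k_min_set :: "'p :: prime_card itself \<Rightarrow> (nat \<times> nat) set \<Rightarrow> nat" where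
  "k_min_set p W = Min (k_min p ` W)"

end

theory Submission
  imports Defs
begin

text \<open>Only the restriction \<open>r\<close> of \<open>\<rho>\<close> to the decomposition group matters. It factors through a finite quotient,
  so one can choose \<open>N\<close> prime to \<open>p\<close>, a primitive root of unity \<open>\<zeta>\<close> of order \<open>N\<close> and \<open>\<pi> = p\<^bsup>1/N\<^esup>\<close> such that
  the elements fixing \<open>\<zeta>\<close> and \<open>\<pi>\<close> act through a \<open>p\<close>-group, and inertia modulo this normal subgroup is generated
  by some \<open>g\<close> with \<open>g \<pi> = \<zeta> \<pi>\<close>, on which a Frobenius acts by \<open>g \<mapsto> g\<^sup>p\<close>. Both the cyclotomic
  character and the fundamental characters are determined by their values at \<open>g\<close>, so the shape of \<open>r\<close> on inertia,
  and with it the weight and the weight set, are read off from the eigenvalues of \<open>r g\<close> and (in the wildly ramified case)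
  the unique line fixed by wild inertia. On the other side, the weight \<open>V\<^bsub>a,b\<^esub>\<close> first occurs in degree
  \<open>a (p + 1) + b - 1\<close> or \<open>(a + b - p) (p + 1) + 2 p - 1 - b\<close>: multiplication by the Dickson invariant
  \<open>\<theta> = x\<^sup>p y - x y\<^sup>p\<close> embeds the symmetric power of degree \<open>n - p - 1\<close>, and its cokernel has two explicit
  constituents. The theorem is then a finite comparison of formulas.\<close>

text \<open>The weight of \<open>\<rho>\<close> and its weight set are definite descriptions, so
  besides a value each needs uniqueness: every choice of exponents allowed by the rules, and every
  chain of twists leading to a weight set, must give the same answer. This is why the tame generator
  g stays explicit: comparing eigenvalues at g pins exponents down modulo p - 1 or p^2 - 1. On the
  Galois side everything is read off from one valuation on the algebraic closure of Q_p, the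
  valuation of the norm divided by the degree. Hensel's lemma supplies its ultrametric inequality. N
  is chosen so divisible that an eigenvector of bounded degree becomes, after raising to a power of
  p, a power of \<pi> times a unit congruent to an N-th root of unity; an automorphism fixing
  \<zeta> and \<pi> then has no room for a nontrivial eigenvalue of order prime to p. On the modular
  side the induction on the degree runs with a notion weaker than constituent of a composition
  series: being a quotient of a submodule, which passes to the kernel or the image of any
  equivariant map.\<close>

hide_const (open) Polynomials.degree Polynomials.lead_coeff

section \<open>Representations of \<open>GL\<^sub>2(\<bbbF>\<^sub>p)\<close>\<close>

subsection \<open>Homogenization\<close>

text \<open>The degree-n homogenization of f evaluated at (P, Q), the second variable being the
  homogenizing one. The coefficient map \<open>c\<close> is a parameter because two instances occur:
  the identity, for values at points of the plane, and \<open>%x. [:x:]\<close>, for substituting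
  linear forms, which is the group action.\<close>

definition HE :: "('a :: comm_ring_1 => 'b :: comm_ring_1) => nat => 'a poly => 'b => 'b => 'b" where
  "HE c n f P Q = (\<Sum>i\<le>n. c (coeff f i) * (P ^ i * Q ^ (n - i)))"

context
  fixes c :: "'a :: comm_ring_1 => 'b :: comm_ring_1"
  assumes c: "comm_ring_hom c"
begin

interpretation comm_ring_hom c by (rule c)

lemma HE_add: "HE c n (f + g) P Q = HE c n f P Q + HE c n g P Q"
  by (simp add: HE_def hom_distribs ring_distribs sum.distrib)

lemma HE_smult: "HE c n (smult a f) P Q = c a * HE c n f P Q"
  by (simp add: HE_def hom_distribs sum_distrib_left mult.assoc)

lemma HE_0: "HE c n 0 P Q = 0"
  by (simp add: HE_def)

lemma HE_sum: "HE c n (sum f A) P Q = (\<Sum>a\<in>A. HE c n (f a) P Q)"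
  by (induction A rule: infinite_finite_induct) (simp_all add: HE_0 HE_add)

lemma HE_pCons: "HE c (Suc n) (pCons a f) P Q = c a * Q ^ Suc n + P * HE c n f P Q"
  unfolding HE_def sum.atMost_Suc_shift by (simp add: sum_distrib_left mult_ac)

lemma HE_extend:
  assumes "degree f \<le> n"
  shows "HE c (m + n) f P Q = Q ^ m * HE c n f P Q"
proof -
  have "HE c (m + n) f P Q = (\<Sum>i\<le>n. c (coeff f i) * (P ^ i * Q ^ (m + n - i)))"
    unfolding HE_def using assms by (intro sum.mono_neutral_right) (auto simp: coeff_eq_0)
  also have "\<dots> = Q ^ m * HE c n f P Q"
    unfolding HE_def sum_distrib_left
  proof (rule sum.cong)
    fix i assume "i \<in> {..n}"
    then have "m + n - i = m + (n - i)" by simp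
    then show "c (coeff f i) * (P ^ i * Q ^ (m + n - i)) = Q ^ m * (c (coeff f i) * (P ^ i * Q ^ (n - i)))"
      by (simp add: power_add mult_ac)
  qed simp
  finally show ?thesis .
qed

text \<open>Peeling off the constant coefficient of f leaves a multiple of g, read in too high a
  degree and handled by \<open>HE_extend\<close>, and a multiple of the first variable, handled by
  \<open>HE_pCons\<close>.\<close>

lemma HE_mult:
  "degree f \<le> m ==> degree g \<le> n ==> HE c (m + n) (f * g) P Q = HE c m f P Q * HE c n g P Q"
proof (induction f arbitrary: m)
  case (pCons a f)
  show ?case
  proof (cases "f = 0")
    case True
    have "HE c (m + n) [:a:] P Q * 1 = HE c (m + 0) [:a:] P Q * Q ^ n"
      using HE_extend[of "[:a:]" 0 "m + n"] HE_extend[of "[:a:]" 0 m] by (simp add: power_add mult_ac)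
    then show ?thesis using True pCons.prems HE_extend[of g n m] HE_extend[of "[:a:]" 0 m]
      by (simp add: HE_smult) (simp add: HE_def mult_ac)
  next
    case False
    then obtain k where m: "m = Suc k" "degree f \<le> k" using pCons.prems by (cases m) auto
    have "HE c (m + n) (pCons a f * g) P Q = HE c (Suc k + n) (smult a g) P Q + HE c (Suc (k + n)) (pCons 0 (f * g)) P Q"
      by (simp add: m HE_add)
    also have "\<dots> = c a * Q ^ Suc k * HE c n g P Q + P * (HE c k f P Q * HE c n g P Q)"
      unfolding HE_smult HE_extend[OF pCons.prems(2)] HE_pCons pCons.IH[OF m(2) pCons.prems(2)] by simp
    also have "\<dots> = HE c m (pCons a f) P Q * HE c n g P Q"
      unfolding m HE_pCons by (simp add: algebra_simps)
    finally show ?thesis .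
  qed
qed (simp add: HE_0)

lemma HE_power: "degree f \<le> m ==> HE c (k * m) (f ^ k) P Q = HE c m f P Q ^ k"
proof (induction k)
  case 0
  then show ?case by (simp add: HE_def)
next
  case (Suc k)
  have "degree (f ^ k) \<le> k * m"
    using degree_power_le[of f k] Suc.prems by (metis mult.commute mult_le_mono1 order_trans)
  then show ?case using HE_mult[of f m "f ^ k" "k * m"] Suc by simp
qed

end

lemma comm_ring_hom_id: "comm_ring_hom (%x :: 'a :: comm_ring_1. x)"
  by unfold_locales auto

lemma comm_ring_hom_const: "comm_ring_hom (%x :: 'a :: comm_ring_1. [:x:])"
  by unfold_locales (auto simp: one_pCons)

abbreviation hev :: "nat => 'a :: comm_ring_1 poly => 'a => 'a => 'a" where
  "hev \<equiv> HE (%x. x)"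

lemmas hev_add = HE_add[OF comm_ring_hom_id]
  and hev_smult = HE_smult[OF comm_ring_hom_id]
  and hev_mult = HE_mult[OF comm_ring_hom_id]
  and hev_power = HE_power[OF comm_ring_hom_id]
  and hev_sum = HE_sum[OF comm_ring_hom_id]

lemma hev_1: "degree f \<le> n ==> hev n f a 1 = poly f a"
  by (simp add: HE_def) (simp add: poly_altdef coeff_eq_0 sum.mono_neutral_right[of "{..n}" "{..degree f}"])

lemma hev_scale: "hev n f (t * a) (t * b) = t ^ n * hev n f a b"
  unfolding HE_def sum_distrib_left
proof (rule sum.cong)
  fix i assume "i \<in> {..n}"
  then have "t ^ n = t ^ i * t ^ (n - i)" by (simp flip: power_add)
  then show "coeff f i * ((t * a) ^ i * (t * b) ^ (n - i)) = t ^ n * (coeff f i * (a ^ i * b ^ (n - i)))"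
    by (simp add: power_mult_distrib mult_ac)
qed simp

text \<open>The point at infinity (1 : 0) sees only the top coefficient. Together with
  \<open>hev_1\<close> and \<open>hev_scale\<close> this covers all points of the plane.\<close>

lemma hev_right_0: "hev n f 1 0 = coeff f n"
proof -
  have "hev n f 1 0 = (\<Sum>i\<in>{n}. coeff f i * (1 ^ i * 0 ^ (n - i)))"
    unfolding HE_def by (rule sum.mono_neutral_right) (auto simp: power_0_left split: if_splits)
  then show ?thesis by simp
qed

subsection \<open>The symmetric powers\<close>

type_synonym 'p gmat = "'p mod_ring ^ 2 ^ 2"

abbreviation GL :: "'p :: prime_card gmat set" where "GL \<equiv> carrier GL2"

abbreviation rowx :: "'p :: prime_card gmat => 'p fp_bar poly" where
  "rowx g \<equiv> [:to_ac (g $ 2 $ 1), to_ac (g $ 1 $ 1):]"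

abbreviation rowy :: "'p :: prime_card gmat => 'p fp_bar poly" where
  "rowy g \<equiv> [:to_ac (g $ 2 $ 2), to_ac (g $ 1 $ 2):]"

lemma sym_act_HE: "sym_act n g f = HE (%x. [:x:]) n f (rowx g) (rowy g)"
  by (simp add: sym_act_def HE_def)

lemma sym_act_add: "sym_act n g (f + h) = sym_act n g f + sym_act n g h"
  by (simp add: sym_act_HE HE_add[OF comm_ring_hom_const])

lemma sym_act_smult: "sym_act n g (smult a f) = smult a (sym_act n g f)"
  by (simp add: sym_act_HE HE_smult[OF comm_ring_hom_const])

lemma sym_act_0: "sym_act n g 0 = 0"
  by (simp add: sym_act_HE HE_0[OF comm_ring_hom_const])

lemma sym_act_mult:
  "degree f \<le> m ==> degree h \<le> n ==> sym_act (m + n) g (f * h) = sym_act m g f * sym_act n g h"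
  by (simp add: sym_act_HE HE_mult[OF comm_ring_hom_const])

lemma sym_act_power: "degree f \<le> m ==> sym_act (k * m) g (f ^ k) = sym_act m g f ^ k"
  by (simp add: sym_act_HE HE_power[OF comm_ring_hom_const])

lemma degree_row_power: "degree (rowx g ^ i * rowy g ^ (n - i)) \<le> n" if "i \<le> n"
proof -
  have "degree (rowx g ^ i * rowy g ^ (n - i)) \<le> degree (rowx g ^ i) + degree (rowy g ^ (n - i))"
    by (rule degree_mult_le)
  also have "\<dots> \<le> degree (rowx g) * i + degree (rowy g) * (n - i)"
    by (intro add_mono degree_power_le)
  also have "\<dots> \<le> 1 * i + 1 * (n - i)"
    by (intro add_mono mult_right_mono) auto
  finally show ?thesis using that by simp
qed

lemma degree_sym_act: "degree (sym_act n g f) \<le> n"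
  unfolding sym_act_def by (intro degree_sum_le) (auto intro: degree_smult_le[THEN order_trans] degree_row_power)

text \<open>On values the action is precomposition with (a, b) -> (a, b) g, row vector times matrix.
  Conditions on the values at F_p-points are therefore stable under GL_2(F_p).\<close>

lemma hev_sym_act:
  "hev n (sym_act n g f) a b =
     hev n f (to_ac (g $ 1 $ 1) * a + to_ac (g $ 2 $ 1) * b) (to_ac (g $ 1 $ 2) * a + to_ac (g $ 2 $ 2) * b)"
proof -
  have 1: "hev 1 (rowx g) a b = to_ac (g $ 1 $ 1) * a + to_ac (g $ 2 $ 1) * b"
    "hev 1 (rowy g) a b = to_ac (g $ 1 $ 2) * a + to_ac (g $ 2 $ 2) * b"
    by (simp_all add: HE_def)
  have "hev n (smult (coeff f i) (rowx g ^ i * rowy g ^ (n - i))) a b =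
      coeff f i * (hev 1 (rowx g) a b ^ i * hev 1 (rowy g) a b ^ (n - i))" if "i \<le> n" for i
  proof -
    have d: "degree (rowx g ^ i) \<le> i" "degree (rowy g ^ (n - i)) \<le> n - i"
      using degree_power_le[of "rowx g" i] degree_power_le[of "rowy g" "n - i"] by (auto split: if_splits)
    have "hev (i + (n - i)) (rowx g ^ i * rowy g ^ (n - i)) a b
        = hev (i * 1) (rowx g ^ i) a b * hev ((n - i) * 1) (rowy g ^ (n - i)) a b"
      using hev_mult[OF d] by simp
    also have "\<dots> = hev 1 (rowx g) a b ^ i * hev 1 (rowy g) a b ^ (n - i)"
      by (subst (1 2) hev_power) auto
    finally show ?thesis using that by (simp add: hev_smult)
  qed
  then show ?thesis
    unfolding sym_act_def hev_sum by (simp add: 1[symmetric]) (simp add: HE_def)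
qed

section \<open>Powers and determinants over F_p\<close>

lemma mod_ring_fermat: "(x :: 'p :: prime_card mod_ring) ^ CARD('p) = x"
  using finite_field_power_card_eq_same[of x] by simp

lemma to_ac_fermat: "to_ac (x :: 'p :: prime_card mod_ring) ^ CARD('p) = to_ac x"
  by (simp add: mod_ring_fermat flip: to_ac_power)

lemma mod_ring_unit_power: "x ~= 0 ==> (x :: 'p :: prime_card mod_ring) ^ (CARD('p) - 1) = 1"
proof -
  assume x: "x ~= 0"
  have "CARD('p) > 0" by simp
  then have "x * x ^ (CARD('p) - 1) = x * 1"
    by (metis Suc_diff_1 mod_ring_fermat mult.right_neutral power_Suc)
  with x show ?thesis by simp
qed

lemma GL_det: "g \<in> GL \<longleftrightarrow> det g ~= 0"
  by (simp add: GL2_def invertible_det_nz)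

lemma mod_ring_power_cong:
  assumes "(x :: 'p :: prime_card mod_ring) ~= 0" "m mod (CARD('p) - 1) = n mod (CARD('p) - 1)"
  shows "x ^ m = x ^ n"
proof -
  have *: "x ^ m = x ^ (m mod (CARD('p) - 1))" for m
  proof -
    have "x ^ m = x ^ ((CARD('p) - 1) * (m div (CARD('p) - 1)) + m mod (CARD('p) - 1))" by simp
    also have "\<dots> = x ^ (m mod (CARD('p) - 1))"
      unfolding power_add power_mult mod_ring_unit_power[OF assms(1)] by simp
    finally show ?thesis .
  qed
  show ?thesis using *[of m] *[of n] assms(2) by simp
qed

section \<open>Submodules of spaces of forms\<close>

interpretation polyvs: vector_space "Polynomial.smult :: 'a :: field => 'a poly => 'a poly"
  by unfold_locales (simp_all add: smult_add_left smult_add_right)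

lemma submodule_iff:
  "submodule act U \<longleftrightarrow> 0 \<in> U \<and> (\<forall>f\<in>U. \<forall>h\<in>U. f + h \<in> U) \<and> (\<forall>c. \<forall>f\<in>U. smult c f \<in> U) \<and>
     (\<forall>g\<in>GL. \<forall>f\<in>U. act g f \<in> U)"
  by (auto simp: submodule_def polyvs.subspace_def)

lemma submoduleD:
  assumes "submodule act U"
  shows "0 \<in> U" "f \<in> U ==> h \<in> U ==> f + h \<in> U" "f \<in> U ==> smult c f \<in> U" "g \<in> GL ==> f \<in> U ==> act g f \<in> U"
  using assms by (auto simp: submodule_iff)

lemma submodule_diff: "submodule act U ==> f \<in> U ==> h \<in> U ==> f - h \<in> U"
  using submoduleD(2)[of act U f "smult (- 1) h"] submoduleD(3)[of act U h "- 1"] by simp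

lemma submodule_sym_space: "submodule (sym_act n) (sym_space n)"
  by (auto simp: submodule_iff sym_space_def degree_sym_act degree_add_le degree_smult_le[THEN order_trans])

subsection \<open>Simplicity\<close>

text \<open>With y = 1, \<open>transl\<close> substitutes X + 1 for X, and \<open>swap\<close>
  exchanges the two variables. These two elements carry the whole proof of simplicity.\<close>

definition transl :: "'p :: prime_card gmat" where "transl = mat2 1 0 1 1"
definition swap :: "'p :: prime_card gmat" where "swap = mat2 0 1 1 0"

lemma mat2_nth [simp]:
  "mat2 a b c d $ 1 $ 1 = a" "mat2 a b c d $ 1 $ 2 = b" "mat2 a b c d $ 2 $ 1 = c" "mat2 a b c d $ 2 $ 2 = d"
  by (simp_all add: mat2_def)

lemma det_mat2 [simp]: "det (mat2 a b c d) = a * d - b * c"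
  by (simp add: det_2)

lemma sym_act_transl: "degree f \<le> n ==> sym_act n transl f = f \<circ>\<^sub>p [:1, 1:]"
proof -
  assume "degree f \<le> n"
  have "sym_act n transl f = (\<Sum>i\<le>n. smult (coeff f i) ([:1, 1:] ^ i))"
    by (simp add: sym_act_def transl_def one_pCons[symmetric])
  also have "\<dots> = (\<Sum>i\<le>degree f. smult (coeff f i) ([:1, 1:] ^ i))"
    using \<open>degree f \<le> n\<close> by (intro sum.mono_neutral_right) (auto simp: coeff_eq_0)
  also have "\<dots> = f \<circ>\<^sub>p [:1, 1:]"
    by (simp add: pcompose_altdef poly_altdef degree_map_poly coeff_map_poly)
  finally show ?thesis .
qed

lemma weight_act_transl: "degree f \<le> b - 1 ==> weight_act (a, b) transl f = f \<circ>\<^sub>p [:1, 1:]"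
  by (simp add: weight_act_def sym_act_transl) (simp add: transl_def)

lemma transl_GL: "transl \<in> GL" and swap_GL: "swap \<in> GL"
  by (simp_all add: GL_det transl_def swap_def)

lemma of_nat_fp_bar_neq_0: "0 < d ==> d < CARD('p) ==> (of_nat d :: 'p :: prime_card fp_bar) ~= 0"
proof
  assume d: "0 < d" "d < CARD('p)" "(of_nat d :: 'p fp_bar) = 0"
  then have "to_ac (of_nat d :: 'p mod_ring) = 0" by simp
  then have "CARD('p) dvd d" by (simp only: to_ac_eq_0_iff of_nat_0_mod_ring_dvd)
  then show False using d by (auto dest: dvd_imp_le)
qed

text \<open>The finite difference of X^i starts with i X^(i-1), so it lowers the degree by exactly
  one as long as the leading exponent is invertible.\<close>

lemma pcompose_shift_top:
  fixes f :: "'a :: comm_ring_1 poly"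
  assumes "degree f \<le> Suc d"
  shows "degree (f \<circ>\<^sub>p [:1, 1:] - f) \<le> d" "coeff (f \<circ>\<^sub>p [:1, 1:] - f) d = of_nat (Suc d) * coeff f (Suc d)"
proof -
  have c: "coeff (f \<circ>\<^sub>p [:1, 1:]) k = (\<Sum>i\<le>Suc d. coeff f i * of_nat (i choose k))" for k
  proof -
    have "f \<circ>\<^sub>p [:1, 1:] = (\<Sum>i\<le>degree f. smult (coeff f i) ([:1, 1:] ^ i))"
      by (simp add: pcompose_altdef poly_altdef degree_map_poly coeff_map_poly)
    also have "\<dots> = (\<Sum>i\<le>Suc d. smult (coeff f i) ([:1, 1:] ^ i))"
      using assms by (intro sum.mono_neutral_left) (auto simp: coeff_eq_0)
    finally have "coeff (f \<circ>\<^sub>p [:1, 1:]) k = (\<Sum>i\<le>Suc d. coeff f i * coeff ([:1, 1:] ^ i) k)"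
      by (simp add: coeff_sum)
    moreover have "coeff ([:1, 1 :: 'a:] ^ i) k = of_nat (i choose k)" for i :: nat
    proof (cases "k \<le> i")
      case True
      then show ?thesis by (simp add: coeff_linear_poly_power)
    next
      case False
      have "degree ([:1, 1 :: 'a:] ^ i) \<le> i" using degree_power_le[of "[:1, 1 :: 'a:]" i] by simp
      then show ?thesis using False by (simp add: coeff_eq_0 binomial_eq_0)
    qed
    ultimately show ?thesis by simp
  qed
  show "degree (f \<circ>\<^sub>p [:1, 1:] - f) \<le> d"
  proof (rule degree_le, intro allI impI)
    fix k assume "d < k"
    then consider "k = Suc d" | "k > Suc d" by linarith
    then show "coeff (f \<circ>\<^sub>p [:1, 1:] - f) k = 0"
    proof cases
      case 1
      have "(\<Sum>i\<le>Suc d. coeff f i * of_nat (i choose k)) = (\<Sum>i\<in>{Suc d}. coeff f i * of_nat (i choose k))"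
        using 1 by (intro sum.mono_neutral_right) (auto simp: binomial_eq_0)
      then show ?thesis using 1 by (simp add: c)
    next
      case 2
      then show ?thesis using assms by (simp add: c binomial_eq_0 coeff_eq_0)
    qed
  qed
  have "(\<Sum>i\<le>Suc d. coeff f i * of_nat (i choose d)) = (\<Sum>i\<in>{d, Suc d}. coeff f i * of_nat (i choose d))"
    by (intro sum.mono_neutral_right) (auto simp: binomial_eq_0)
  then show "coeff (f \<circ>\<^sub>p [:1, 1:] - f) d = of_nat (Suc d) * coeff f (Suc d)"
    by (simp add: c algebra_simps)
qed

text \<open>A nonzero submodule contains a constant by repeated differencing, hence the top monomial by
  swapping the variables, hence polynomials of every degree by differencing again.\<close>

lemma weight_simple:
  fixes U :: "'p :: prime_card fp_bar poly set"
  assumes b: "1 \<le> b" "b \<le> CARD('p)"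
    and U: "submodule (weight_act (a, b)) U" "U \<subseteq> sym_space (b - 1)" "U ~= {0}"
  shows "U = sym_space (b - 1)"
proof -
  have deg: "degree f \<le> b - 1" if "f \<in> U" for f using that U by (auto simp: sym_space_def)
  have diff: "f \<circ>\<^sub>p [:1, 1:] - f \<in> U" if "f \<in> U" for f
    using submodule_diff[OF U(1) submoduleD(4)[OF U(1) transl_GL that] that] deg[OF that]
    by (simp add: weight_act_transl)
  have step: "\<exists>h\<in>U. h ~= 0 \<and> degree h = d" if "f \<in> U" "f ~= 0" "degree f = Suc d" for f d
  proof (intro bexI conjI)
    \<comment> \<open>The bound b <= p enters here: degrees in U are at most p - 1, so the factor
      Suc d is invertible.\<close>
    have "of_nat (Suc d) ~= (0 :: 'p fp_bar)"
      using deg[OF that(1)] that b by (intro of_nat_fp_bar_neq_0) auto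
    moreover have "coeff f (Suc d) ~= 0" using that by (metis leading_coeff_0_iff)
    ultimately have "of_nat (Suc d) * coeff f (Suc d) ~= 0" by (simp only: mult_eq_0_iff simp_thms)
    then have c: "coeff (f \<circ>\<^sub>p [:1, 1:] - f) d ~= 0"
      using pcompose_shift_top(2)[of f d] that by (metis order_refl)
    then show "f \<circ>\<^sub>p [:1, 1:] - f ~= 0" by auto
    show "degree (f \<circ>\<^sub>p [:1, 1:] - f) = d"
      using pcompose_shift_top(1)[of f d] that c by (intro antisym le_degree) auto
    show "f \<circ>\<^sub>p [:1, 1:] - f \<in> U" by (rule diff) fact
  qed
  have down: "\<exists>h\<in>U. h ~= 0 \<and> degree h = d" if "f \<in> U" "f ~= 0" "degree f = d + k" for f d k
    using that
  proof (induction k arbitrary: f)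
    case (Suc k)
    then obtain h where "h \<in> U" "h ~= 0" "degree h = d + k" using step[of f "d + k"] by auto
    then show ?case by (rule Suc.IH)
  qed auto
  obtain f where f: "f \<in> U" "f ~= 0" using U submoduleD(1)[OF U(1)] by blast
  obtain h where h: "h \<in> U" "h ~= 0" "degree h = 0" using down[OF f, of 0 "degree f"] by auto
  then obtain e where e: "h = [:e:]" "e ~= 0" by (metis degree_0_id pCons_0_0)
  \<comment> \<open>In degree b - 1 the constant e stands for e y^(b-1), which \<open>swap\<close>
    turns into e x^(b-1).\<close>
  have "sym_act (b - 1) swap h = monom e (b - 1)"
  proof -
    have "sym_act (b - 1) swap h = (\<Sum>i\<in>{0}. smult (coeff h i) (rowx swap ^ i * rowy swap ^ (b - 1 - i)))"
      unfolding sym_act_def by (intro sum.mono_neutral_right) (auto simp: e coeff_pCons split: nat.split)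
    then show ?thesis by (simp add: e swap_def monom_altdef)
  qed
  then have "weight_act (a, b) swap h = monom ((- 1) ^ a * e) (b - 1)"
    by (simp add: weight_act_def swap_def smult_monom)
  then have m: "monom ((- 1) ^ a * e) (b - 1) \<in> U" using submoduleD(4)[OF U(1) swap_GL h(1)] by simp
  have ne: "monom ((- 1) ^ a * e) (b - 1) ~= 0" using e by (simp add: monom_eq_0_iff)
  have all: "\<exists>h\<in>U. h ~= 0 \<and> degree h = d" if "d \<le> b - 1" for d
    using down[OF m ne, of d "b - 1 - d"] that e by (simp add: degree_monom_eq)
  \<comment> \<open>U now has an element of every degree up to b - 1, so leading terms can be
    cancelled one after the other.\<close>
  have "f \<in> U" if "degree f \<le> b - 1" for f
    using that
  proof (induction "degree f" arbitrary: f rule: less_induct)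
    case less
    obtain h where h: "h \<in> U" "h ~= 0" "degree h = degree f" using all less by blast
    define t where "t = lead_coeff f / lead_coeff h"
    define f' where "f' = f - smult t h"
    have "coeff h (degree f) ~= 0" using h by (metis leading_coeff_0_iff)
    then have cf: "coeff f' (degree f) = 0" using h by (simp add: f'_def t_def)
    have df: "degree f' \<le> degree f"
      unfolding f'_def using h degree_smult_le[of t h] by (intro degree_diff_le) auto
    have "f' \<in> U"
    proof (cases "f' = 0")
      case True
      then show ?thesis using submoduleD(1)[OF U(1)] by simp
    next
      case False
      then have "degree f' < degree f" using cf df by (metis le_neq_implies_less leading_coeff_0_iff)
      then show ?thesis using less by simp
    qed
    then have "f' + smult t h \<in> U" using h submoduleD(2,3)[OF U(1)] by blast
    then show ?case by (simp add: f'_def)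
  qed
  then show ?thesis using U(2) by (auto simp: sym_space_def)
qed

lemma shift_invariant_const:
  assumes "f \<circ>\<^sub>p [:1, 1:] = f" "degree f < CARD('p)"
  shows "degree (f :: 'p :: prime_card fp_bar poly) = 0"
proof (rule ccontr)
  assume "degree f ~= 0"
  then obtain d where d: "degree f = Suc d" by (cases "degree f") auto
  then have "of_nat (Suc d) * coeff f (Suc d) = 0" using pcompose_shift_top(2)[of f d] assms by simp
  moreover have "of_nat (Suc d) ~= (0 :: 'p fp_bar)" using assms d by (intro of_nat_fp_bar_neq_0) auto
  ultimately show False using d by (metis degree_0 leading_coeff_0_iff mult_eq_0_iff nat.simps(3))
qed

subsection \<open>Equivariant maps and subquotients\<close>

definition equivariant ::
  "('p :: prime_card gmat => 'p fp_bar poly => 'p fp_bar poly) => 'p fp_bar poly set =>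
     ('p gmat => 'p fp_bar poly => 'p fp_bar poly) => ('p fp_bar poly => 'p fp_bar poly) => bool" where
  "equivariant act M act' \<phi> \<longleftrightarrow>
     (\<forall>f\<in>M. \<forall>h\<in>M. \<phi> (f + h) = \<phi> f + \<phi> h) \<and>
     (\<forall>c. \<forall>f\<in>M. \<phi> (smult c f) = smult c (\<phi> f)) \<and>
     (\<forall>g\<in>GL. \<forall>f\<in>M. \<phi> (act g f) = act' g (\<phi> f))"

lemma equivariantD:
  assumes "equivariant act M act' \<phi>"
  shows "f \<in> M ==> h \<in> M ==> \<phi> (f + h) = \<phi> f + \<phi> h" "f \<in> M ==> \<phi> (smult c f) = smult c (\<phi> f)"
    "g \<in> GL ==> f \<in> M ==> \<phi> (act g f) = act' g (\<phi> f)"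
  using assms by (auto simp: equivariant_def)

lemma equivariant_subset: "equivariant act M act' \<phi> ==> N \<subseteq> M ==> equivariant act N act' \<phi>"
  unfolding equivariant_def by (meson subsetD)

lemma equivariant_0: "equivariant act M act' \<phi> ==> 0 \<in> M ==> \<phi> 0 = 0"
  using equivariantD(2)[of act M act' \<phi> 0 0] by simp

lemma equivariant_diff:
  assumes "equivariant act M act' \<phi>" "submodule act M" "f \<in> M" "h \<in> M"
  shows "\<phi> (f - h) = \<phi> f - \<phi> h"
  using equivariantD(1)[OF assms(1), of "f - h" h] submodule_diff[OF assms(2-4)] assms by simp

lemma submodule_image:
  fixes act act' :: "'p :: prime_card gmat => 'p fp_bar poly => 'p fp_bar poly"
  assumes "submodule act A" "equivariant act A act' \<phi>"
  shows "submodule act' (\<phi> ` A)"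
  unfolding submodule_iff
proof (intro conjI ballI allI)
  show "0 \<in> \<phi> ` A" using equivariant_0[OF assms(2)] submoduleD(1)[OF assms(1)] by force
next
  fix f h assume "f \<in> \<phi> ` A" "h \<in> \<phi> ` A"
  then show "f + h \<in> \<phi> ` A"
    using equivariantD(1)[OF assms(2)] submoduleD(2)[OF assms(1)] by (smt (verit) image_iff)
next
  fix c f assume "f \<in> \<phi> ` A"
  then show "smult c f \<in> \<phi> ` A"
    using equivariantD(2)[OF assms(2)] submoduleD(3)[OF assms(1)] by (smt (verit) image_iff)
next
  fix g :: "'p gmat" and f assume "g \<in> GL" "f \<in> \<phi> ` A"
  then show "act' g f \<in> \<phi> ` A"
    using equivariantD(3)[OF assms(2)] submoduleD(4)[OF assms(1)] by (smt (verit) image_iff)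
qed

lemma submodule_kernel:
  assumes A: "submodule act A" "equivariant act A act' \<phi>" and z: "!!g. g \<in> GL ==> act' g 0 = 0"
  shows "submodule act {f \<in> A. \<phi> f = 0}"
  unfolding submodule_iff
  using submoduleD[OF A(1)] equivariantD[OF A(2)] equivariant_0[OF A(2)] z by auto

text \<open>The weight is a quotient of a submodule of M. This is weaker on its face than
  \<open>jh_constituent\<close>, but it is monotone in M and behaves well along exact sequences,
  which is what an induction on the degree requires.\<close>

definition subq ::
  "('p :: prime_card gmat => 'p fp_bar poly => 'p fp_bar poly) => 'p fp_bar poly set => nat \<times> nat => bool" where
  "subq act M v \<longleftrightarrow> (\<exists>A \<phi>. A \<subseteq> M \<and> submodule act A \<and> equivariant act A (weight_act v) \<phi> \<and>
     \<phi> ` A = sym_space (snd v - 1))"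

lemma subq_mono: "subq act M v ==> M \<subseteq> N ==> subq act N v"
  unfolding subq_def by blast

lemma weight_act_0 [simp]: "weight_act v g 0 = 0"
  by (cases v) (simp add: weight_act_def sym_act_0)

text \<open>Restrict the surjection \<open>\<phi>\<close> onto the simple weight to the kernel of
  \<open>\<psi>\<close>: its image there is everything or zero. In the first case the weight is seen
  in the kernel; in the second \<open>\<phi>\<close> factors through \<open>\<psi>\<close> and the
  weight is seen in the image.\<close>

lemma subq_extension:
  assumes sub: "subq act M (a, b)" and b: "1 \<le> b" "b \<le> CARD('p :: prime_card)"
    and \<psi>: "equivariant act M act' \<psi>" and z: "!!g. g \<in> GL ==> act' g 0 = 0"
  shows "subq act {f \<in> M. \<psi> f = 0} (a, b) \<or> subq (act' :: 'p gmat => _) (\<psi> ` M) (a, b)"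
proof -
  obtain A \<phi> where A: "A \<subseteq> M" "submodule act A" "equivariant act A (weight_act (a, b)) \<phi>"
    "\<phi> ` A = sym_space (b - 1)" using sub by (auto simp: subq_def)
  have \<psi>A: "equivariant act A act' \<psi>" using \<psi> A(1) by (rule equivariant_subset)
  define K where "K = {f \<in> A. \<psi> f = 0}"
  have K: "submodule act K" unfolding K_def by (rule submodule_kernel[OF A(2) \<psi>A z])
  have \<phi>K: "equivariant act K (weight_act (a, b)) \<phi>"
    by (rule equivariant_subset[OF A(3)]) (auto simp: K_def)
  show ?thesis
  proof (cases "\<phi> ` K = {0}")
    case False
    have "\<phi> ` K = sym_space (b - 1)"
      using submodule_image[OF K \<phi>K] False A(4) by (intro weight_simple[OF b]) (auto simp: K_def)
    then have "subq act {f \<in> M. \<psi> f = 0} (a, b)"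
      unfolding subq_def using K \<phi>K A(1) by (intro exI[of _ K] exI[of _ \<phi>]) (auto simp: K_def)
    then show ?thesis ..
  next
    case True
    have eq: "\<phi> f = \<phi> h" if "f \<in> A" "h \<in> A" "\<psi> f = \<psi> h" for f h
    proof -
      have "f - h \<in> K"
        using that submodule_diff[OF A(2)] equivariant_diff[OF \<psi>A A(2)] by (simp add: K_def)
      then have "\<phi> (f - h) = 0" using True by blast
      then show ?thesis using equivariant_diff[OF A(3,2)] that by simp
    qed
    \<comment> \<open>The factorization of \<open>\<phi>\<close> through \<open>\<psi>\<close>, by
      an arbitrary choice of preimage; \<open>eq\<close> makes the value independent of the
      choice.\<close>
    define ch where "ch h = \<phi> (SOME f. f \<in> A \<and> \<psi> f = h)" for h
    have ch: "ch (\<psi> f) = \<phi> f" if "f \<in> A" for f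
    proof -
      have "(SOME f'. f' \<in> A \<and> \<psi> f' = \<psi> f) \<in> A \<and> \<psi> (SOME f'. f' \<in> A \<and> \<psi> f' = \<psi> f) = \<psi> f"
        by (rule someI[of _ f]) (use that in auto)
      then show ?thesis unfolding ch_def using eq that by blast
    qed
    have "equivariant act' (\<psi> ` A) (weight_act (a, b)) ch"
      unfolding equivariant_def
    proof (intro conjI ballI allI)
      fix f h assume "f \<in> \<psi> ` A" "h \<in> \<psi> ` A"
      then obtain f' h' where "f = \<psi> f'" "h = \<psi> h'" "f' \<in> A" "h' \<in> A" by blast
      then show "ch (f + h) = ch f + ch h"
        using ch[of "f' + h'"] equivariantD(1)[OF \<psi>A] equivariantD(1)[OF A(3)] submoduleD(2)[OF A(2)] ch by simp
    next
      fix c f assume "f \<in> \<psi> ` A"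
      then obtain f' where "f = \<psi> f'" "f' \<in> A" by blast
      then show "ch (smult c f) = smult c (ch f)"
        using ch[of "smult c f'"] equivariantD(2)[OF \<psi>A] equivariantD(2)[OF A(3)] submoduleD(3)[OF A(2)] ch by simp
    next
      fix g :: "'p gmat" and f assume g: "g \<in> GL" and "f \<in> \<psi> ` A"
      then obtain f' where "f = \<psi> f'" "f' \<in> A" by blast
      then show "ch (act' g f) = weight_act (a, b) g (ch f)"
        using ch[of "act g f'"] equivariantD(3)[OF \<psi>A g] equivariantD(3)[OF A(3) g] submoduleD(4)[OF A(2) g] ch by simp
    qed
    moreover have "submodule act' (\<psi> ` A)" by (rule submodule_image[OF A(2) \<psi>A])
    moreover have "ch ` \<psi> ` A = sym_space (b - 1)"
      using A(4) ch by (simp add: image_image)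
    ultimately have "subq act' (\<psi> ` M) (a, b)"
      unfolding subq_def using A(1) by (intro exI[of _ "\<psi> ` A"] exI[of _ ch]) auto
    then show ?thesis ..
  qed
qed

lemma subq_zero: "\<not> subq act {0} (a, b)"
proof
  assume "subq act {0} (a, b)"
  then obtain A \<phi> where A: "A \<subseteq> {0}" "submodule act A" "equivariant act A (weight_act (a, b)) \<phi>"
    "\<phi> ` A = sym_space (b - 1)" by (auto simp: subq_def)
  then have "A = {0}" using submoduleD(1)[OF A(2)] by blast
  then have "sym_space (b - 1) = {0 :: 'a fp_bar poly}" using A equivariant_0 by (metis image_empty image_insert insertI1)
  moreover have "1 \<in> (sym_space (b - 1) :: 'a fp_bar poly set)" by (simp add: sym_space_def)
  ultimately show False by simp
qed

definition diag2 :: "'p :: prime_card mod_ring => 'p mod_ring => 'p gmat" where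
  "diag2 s t = mat2 s 0 0 t"

text \<open>The constant 1 stands for y^(b-1), a torus eigenvector; its character recovers a and b
  modulo p - 1.\<close>

lemma weight_act_diag_1: "weight_act (a, b) (diag2 s t) 1 = [:to_ac (s ^ a * t ^ a * t ^ (b - 1)):]"
proof -
  have "sym_act (b - 1) (diag2 s t) 1
      = (\<Sum>i\<in>{0}. smult (coeff 1 i) (rowx (diag2 s t) ^ i * rowy (diag2 s t) ^ (b - 1 - i)))"
    unfolding sym_act_def by (intro sum.mono_neutral_right) (auto simp: coeff_eq_0)
  also have "\<dots> = [:to_ac (t ^ (b - 1)):]" by (simp add: diag2_def poly_const_pow)
  finally show ?thesis
    by (simp add: weight_act_def) (simp add: diag2_def power_mult_distrib)
qed

text \<open>For i < j < p - 1 an identity x^i = x^j on all units would give X^(j-i) - 1 as many as p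
  - 1 roots.\<close>

lemma mod_ring_power_eq:
  assumes "!!x :: 'p :: prime_card mod_ring. x ~= 0 ==> x ^ m = x ^ n"
  shows "m mod (CARD('p) - 1) = n mod (CARD('p) - 1)"
proof -
  let ?q = "CARD('p) - 1"
  have q: "?q > 0" using prime_gt_1_nat[OF prime_card[where ?'a = 'p]] by simp
  have *: "j = i" if "i \<le> j" "j < ?q" "!!x :: 'p mod_ring. x ~= 0 ==> x ^ i = x ^ j" for i j
  proof (rule ccontr)
    assume "j ~= i"
    define f :: "'p mod_ring poly" where "f = monom 1 (j - i) - 1"
    have "coeff f (j - i) = 1" using that \<open>j ~= i\<close> by (simp add: f_def)
    then have f0: "f ~= 0" by auto
    have "degree f \<le> j - i" unfolding f_def by (intro degree_diff_le) (auto simp: degree_monom_le)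
    have "poly f x = 0" if "x ~= 0" for x
    proof -
      have "x ^ i * x ^ (j - i) = x ^ i * 1"
        using \<open>!!x :: 'p mod_ring. x ~= 0 ==> x ^ i = x ^ j\<close>[OF that] \<open>i \<le> j\<close>
        by (metis le_add_diff_inverse mult.right_neutral power_add)
      then show ?thesis using that by (simp add: f_def poly_monom)
    qed
    then have "UNIV - {0} \<subseteq> {x. poly f x = 0}" by auto
    then have "card (UNIV - {0 :: 'p mod_ring}) \<le> card {x. poly f x = 0}" by (intro card_mono) auto
    also have "\<dots> \<le> degree f" by (rule card_poly_roots_bound[OF f0])
    also have "card (UNIV - {0 :: 'p mod_ring}) = ?q" by (simp add: card_Diff_subset)
    finally show False using \<open>degree f \<le> j - i\<close> that(2) by linarith
  qed
  have c: "x ^ (m mod ?q) = x ^ (n mod ?q)" if "x ~= 0" for x :: "'p mod_ring"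
    using mod_ring_power_cong[OF that, of "m mod ?q" m] mod_ring_power_cong[OF that, of "n mod ?q" n] assms[OF that]
    by simp
  then show ?thesis
    using *[of "m mod ?q" "n mod ?q"] *[of "n mod ?q" "m mod ?q"] q
    by (metis linear mod_less_divisor)
qed

text \<open>By simplicity of source and target the map is an isomorphism. The constants are the
  translation-invariant line on either side, so they correspond, and comparing torus characters
  there gives a and b - 1 modulo p - 1.\<close>

lemma subq_simple:
  assumes sub: "subq (weight_act (a', b')) (sym_space (b' - 1) :: 'p :: prime_card fp_bar poly set) (a, b)"
    and b: "1 \<le> b" "b \<le> CARD('p)" "1 \<le> b'" "b' \<le> CARD('p)"
  shows "b = b'" "a mod (CARD('p) - 1) = a' mod (CARD('p) - 1)"
proof -
  let ?act = "weight_act (a', b') :: 'p gmat => _"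
  obtain A \<phi> where A: "A \<subseteq> sym_space (b' - 1)" "submodule ?act A" "equivariant ?act A (weight_act (a, b)) \<phi>"
    "\<phi> ` A = sym_space (b - 1)" using sub by (auto simp: subq_def)
  have one: "1 \<in> (sym_space m :: 'p fp_bar poly set)" for m by (simp add: sym_space_def)
  have "A ~= {0}" using A subq_zero[of ?act a b] by (auto simp: subq_def)
  then have Aeq: "A = sym_space (b' - 1)" using weight_simple[OF b(3,4) A(2,1)] by simp
  define K where "K = {f \<in> A. \<phi> f = 0}"
  have K: "submodule ?act K" unfolding K_def by (rule submodule_kernel[OF A(2,3)]) simp
  have "K ~= sym_space (b' - 1)"
  proof
    assume "K = sym_space (b' - 1)"
    then have "\<phi> ` A \<subseteq> {0}" by (auto simp: Aeq K_def)
    then show False using A(4) one[of "b - 1"] by auto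
  qed
  moreover have "K \<subseteq> sym_space (b' - 1)" using A(1) by (auto simp: K_def)
  ultimately have K0: "K = {0}" using weight_simple[OF b(3,4) K] by blast
  have inj: "f = h" if "f \<in> A" "h \<in> A" "\<phi> f = \<phi> h" for f h
  proof -
    have "f - h \<in> K" using that submodule_diff[OF A(2)] equivariant_diff[OF A(3,2)] by (simp add: K_def)
    then show ?thesis using K0 by simp
  qed
  have \<phi>deg: "degree (\<phi> f) \<le> b - 1" if "f \<in> A" for f using that A(4) by (auto simp: sym_space_def)
  have Adeg: "degree f \<le> b' - 1" if "f \<in> A" for f using that Aeq by (auto simp: sym_space_def)
  have shift: "\<phi> (f \<circ>\<^sub>p [:1, 1:]) = \<phi> f \<circ>\<^sub>p [:1, 1:]" if "f \<in> A" for f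
    using equivariantD(3)[OF A(3) transl_GL that] \<phi>deg[OF that] Adeg[OF that] by (simp add: weight_act_transl)
  have 1: "1 \<in> A" using one Aeq by simp
  have "\<phi> 1 \<circ>\<^sub>p [:1, 1:] = \<phi> 1" using shift[OF 1] by simp
  moreover have "degree (\<phi> 1) < CARD('p)" using \<phi>deg[OF 1] b by linarith
  ultimately have "degree (\<phi> 1) = 0" by (rule shift_invariant_const)
  then obtain e where e: "\<phi> 1 = [:e:]" by (metis degree_0_id)
  have e0: "e ~= 0"
  proof
    assume "e = 0"
    then have "\<phi> 1 = \<phi> 0" using e equivariant_0[OF A(3)] submoduleD(1)[OF A(2)] by simp
    then have "1 = (0 :: 'p fp_bar poly)" using inj[OF 1 submoduleD(1)[OF A(2)]] by simp
    then show False by simp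
  qed
  have char: "s ^ a' * t ^ a' * t ^ (b' - 1) = s ^ a * t ^ a * t ^ (b - 1)" if "s ~= 0" "t ~= 0" for s t :: "'p mod_ring"
  proof -
    have g: "diag2 s t \<in> GL" using that by (simp add: GL_det diag2_def)
    have "\<phi> (?act (diag2 s t) 1) = smult (to_ac (s ^ a' * t ^ a' * t ^ (b' - 1))) (\<phi> 1)"
      using equivariantD(2)[OF A(3) 1, of "to_ac (s ^ a' * t ^ a' * t ^ (b' - 1))"]
      by (simp only: weight_act_diag_1) simp
    moreover have "weight_act (a, b) (diag2 s t) (\<phi> 1) = smult e (weight_act (a, b) (diag2 s t) 1)"
      unfolding e by (simp add: weight_act_def flip: sym_act_smult) (simp add: one_pCons mult.commute)
    ultimately have "e * to_ac (s ^ a' * t ^ a' * t ^ (b' - 1)) = e * to_ac (s ^ a * t ^ a * t ^ (b - 1))"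
      using equivariantD(3)[OF A(3) g 1] by (simp only: weight_act_diag_1 e) (simp add: mult.commute)
    then show ?thesis using e0 by (simp only: mult_cancel_left to_ac_eq_iff) simp
  qed
  have "x ^ a' = x ^ a" if "x ~= 0" for x :: "'p mod_ring" using char[OF that, of 1] by simp
  then show aeq: "a mod (CARD('p) - 1) = a' mod (CARD('p) - 1)" using mod_ring_power_eq by metis
  have "x ^ (b' - 1) = x ^ (b - 1)" if "x ~= 0" for x :: "'p mod_ring"
  proof -
    have "x ^ a' = x ^ a" using mod_ring_power_cong[OF that aeq] by simp
    then show ?thesis using char[of 1 x] that by simp
  qed
  then have beq: "(b' - 1) mod (CARD('p) - 1) = (b - 1) mod (CARD('p) - 1)" using mod_ring_power_eq by metis
  \<comment> \<open>The torus character cannot tell b = 1 from b = p. They differ in whether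
    translation acts trivially.\<close>
  have "b = 1 \<longleftrightarrow> b' = 1"
  proof
    assume "b = 1"
    have "f = 1 \<or> degree f = 0" if "f \<in> A" for f
    proof -
      have "degree (\<phi> f) = 0" using \<phi>deg[OF that] \<open>b = 1\<close> by simp
      then have "\<phi> f \<circ>\<^sub>p [:1, 1:] = \<phi> f" by (metis degree_0_id pcompose_const)
      then have "\<phi> (f \<circ>\<^sub>p [:1, 1:]) = \<phi> f" using shift[OF that] by simp
      moreover have "f \<circ>\<^sub>p [:1, 1:] \<in> A"
        using submoduleD(4)[OF A(2) transl_GL that] Adeg[OF that] by (simp add: weight_act_transl)
      ultimately have "f \<circ>\<^sub>p [:1, 1:] = f" using inj that by blast
      then show ?thesis using shift_invariant_const[of f] Adeg[OF that] b by simp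
    qed
    from this[of "monom 1 (b' - 1)"] show "b' = 1"
      using b by (auto simp: Aeq sym_space_def degree_monom_eq monom_eq_1_iff)
  next
    assume "b' = 1"
    have "degree (\<phi> f) = 0" if "f \<in> A" for f
    proof -
      have "degree f = 0" using Adeg[OF that] \<open>b' = 1\<close> by simp
      then have "f \<circ>\<^sub>p [:1, 1:] = f" by (metis degree_0_id pcompose_const)
      then have "\<phi> f \<circ>\<^sub>p [:1, 1:] = \<phi> f" using shift[OF that] by simp
      moreover have "degree (\<phi> f) < CARD('p)" using \<phi>deg[OF that] b by linarith
      ultimately show ?thesis by (rule shift_invariant_const)
    qed
    moreover have "monom 1 (b - 1) \<in> \<phi> ` A" by (simp add: A(4) sym_space_def degree_monom_eq)
    ultimately have "degree (monom (1 :: 'p fp_bar) (b - 1)) = 0" by auto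
    then show "b = 1" using b by (simp add: degree_monom_eq)
  qed
  then show "b = b'"
  proof (cases "b = 1")
    case False
    then have "b' ~= 1" using \<open>b = 1 \<longleftrightarrow> b' = 1\<close> by simp
    have eq: "(b' - 2 + 1) mod (CARD('p) - 1) = (b - 2 + 1) mod (CARD('p) - 1)"
      using beq b False \<open>b' ~= 1\<close> by (metis (no_types, lifting) Suc_1 Suc_diff_Suc Suc_leI add.commute diff_Suc_1 le_neq_implies_less plus_1_eq_Suc)
    have lt: "b' - 2 < CARD('p) - 1" "b - 2 < CARD('p) - 1" using b False \<open>b' ~= 1\<close> by auto
    have "b' - 2 = b - 2"
    proof -
      have "[b' - 2 + 1 = b - 2 + 1] (mod (CARD('p) - 1))" using eq by (simp add: Cong.cong_def)
      then have "[b' - 2 = b - 2] (mod (CARD('p) - 1))" by (simp only: cong_add_rcancel_nat)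
      then show ?thesis using lt by (simp add: Cong.cong_def)
    qed
    then show ?thesis using b False \<open>b' ~= 1\<close> by linarith
  qed simp
qed

subsection \<open>The Dickson invariant\<close>

text \<open>\<open>[:0, 1:]\<close> is x, and y = 1. Read as a form of degree p + 1 this is x y^p -
  x^p y, the Dickson invariant up to sign. Its polynomial degree is only p: the missing degree is
  the zero at infinity.\<close>

definition \<theta> :: "'p :: prime_card fp_bar poly" where
  "\<theta> = [:0, 1:] - [:0, 1:] ^ CARD('p)"

lemma p_ge_2: "CARD('p :: prime_card) \<ge> 2"
  using prime_ge_2_nat[OF prime_card[where ?'a = 'p]] .

lemma sym_act_monom: "i \<le> n ==> sym_act n g (monom c i) = smult c (rowx g ^ i * rowy g ^ (n - i))"
proof -
  assume "i \<le> n"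
  have "sym_act n g (monom c i)
      = (\<Sum>k\<in>{i}. smult (coeff (monom c i) k) (rowx g ^ k * rowy g ^ (n - k)))"
    unfolding sym_act_def using \<open>i \<le> n\<close> by (intro sum.mono_neutral_right) auto
  then show ?thesis by simp
qed

lemma sym_act_diff: "sym_act n g (f - h) = sym_act n g f - sym_act n g h"
  using sym_act_add[of n g "f - h" h] by simp

lemma X_power_monom: "[:0, 1 :: 'a :: comm_semiring_1:] ^ n = monom 1 n"
  by (simp add: monom_altdef)

lemma of_nat_p_fp_bar [simp]: "(of_nat CARD('p) :: 'p :: prime_card fp_bar) = 0"
proof -
  have "to_ac (of_nat CARD('p) :: 'p mod_ring) = to_ac 0" by (simp only: of_nat_card_eq_0)
  then show ?thesis by (simp only: to_ac_of_nat to_ac_0)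
qed

lemma fp_bar_poly_add_power:
  "((x :: 'p :: prime_card fp_bar poly) + y) ^ CARD('p) = x ^ CARD('p) + y ^ CARD('p)"
  by (rule freshmans_dream) (simp_all add: prime_card)

lemma linear_power_p:
  "[:to_ac u, to_ac v:] ^ CARD('p) = [:to_ac u:] + [:to_ac v:] * [:0, 1 :: 'p :: prime_card fp_bar:] ^ CARD('p)"
proof -
  have "[:to_ac u, to_ac v:] = [:to_ac u:] + [:to_ac v:] * [:0, 1 :: 'p fp_bar:]" by simp
  also have "\<dots> ^ CARD('p) = [:to_ac u:] ^ CARD('p) + [:to_ac v:] ^ CARD('p) * [:0, 1:] ^ CARD('p)"
    by (simp only: fp_bar_poly_add_power power_mult_distrib)
  finally show ?thesis by (simp only: poly_const_pow to_ac_fermat)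
qed

lemma theta_monom: "(\<theta> :: 'p :: prime_card fp_bar poly) = monom 1 1 - monom 1 CARD('p)"
  by (simp only: \<theta>_def X_power_monom[symmetric]) simp

text \<open>Frobenius fixes the entries of g, so (x^p, y^p) is transformed by the same matrix as (x,
  y), and \<theta> is the determinant of these two vectors.\<close>

lemma sym_act_theta: "sym_act (CARD('p) + 1) g \<theta> = smult (to_ac (det g)) (\<theta> :: 'p :: prime_card fp_bar poly)"
proof -
  let ?p = "CARD('p)"
  have "sym_act (?p + 1) g \<theta> = rowx g * rowy g ^ ?p - rowx g ^ ?p * rowy g"
    unfolding theta_monom sym_act_diff by (subst (1 2) sym_act_monom) auto
  also have "\<dots> = smult (to_ac (det g)) \<theta>"
  proof -
    have eq: "(C + A * x) * (D + B * y) - (C + A * y) * (D + B * x) = (A * D - B * C) * (x - y)"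
      for A B C D x y :: "'p fp_bar poly"
      by (simp add: algebra_simps)
    have lin: "rowx g = [:to_ac (g $ 2 $ 1):] + [:to_ac (g $ 1 $ 1):] * [:0, 1:]"
      "rowy g = [:to_ac (g $ 2 $ 2):] + [:to_ac (g $ 1 $ 2):] * [:0, 1:]" by simp_all
    have "rowx g * rowy g ^ ?p - rowx g ^ ?p * rowy g =
        ([:to_ac (g $ 1 $ 1):] * [:to_ac (g $ 2 $ 2):] - [:to_ac (g $ 1 $ 2):] * [:to_ac (g $ 2 $ 1):]) * \<theta>"
      unfolding linear_power_p unfolding lin \<theta>_def by (rule eq)
    also have "\<dots> = smult (to_ac (det g)) \<theta>" by (simp add: det_2)
    finally show ?thesis .
  qed
  finally show ?thesis .
qed

lemma degree_theta: "degree (\<theta> :: 'p :: prime_card fp_bar poly) = CARD('p)"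
proof -
  have "degree (monom (1 :: 'p fp_bar) 1) < degree (monom (1 :: 'p fp_bar) CARD('p))"
    using p_ge_2[where ?'p = 'p] by (simp add: degree_monom_eq)
  then have "degree (monom (1 :: 'p fp_bar) 1 - monom 1 CARD('p)) = degree (- monom (1 :: 'p fp_bar) CARD('p))"
    unfolding diff_conv_add_uminus by (intro degree_add_eq_right) simp
  then show ?thesis by (simp add: theta_monom degree_monom_eq)
qed

lemma theta_neq_0 [simp]: "(\<theta> :: 'p :: prime_card fp_bar poly) ~= 0"
  using degree_theta[where ?'p = 'p] by auto

lemma poly_theta: "poly \<theta> (to_ac x) = 0"
  by (simp add: \<theta>_def to_ac_fermat)

section \<open>Forms vanishing at every F_p-point\<close>

lemma vanish_on_Fp:
  assumes "!!x :: 'p :: prime_card mod_ring. poly f (to_ac x) = 0" "degree f < CARD('p)"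
  shows "f = 0"
proof (rule ccontr)
  assume "f ~= 0"
  have "range (to_ac :: 'p mod_ring => _) \<subseteq> {x. poly f x = 0}" using assms by auto
  then have "card (range (to_ac :: 'p mod_ring => _)) \<le> card {x. poly f x = 0}"
    by (intro card_mono poly_roots_finite) (simp_all add: \<open>f ~= 0\<close>)
  also have "\<dots> \<le> degree f" by (rule card_poly_roots_bound) fact
  also have "card (range (to_ac :: 'p mod_ring => _)) = CARD('p)"
    by (simp add: card_image inj_to_ac)
  finally show False using assms by simp
qed

lemma poly_mod_theta: "poly (f mod \<theta>) (to_ac (x :: 'p :: prime_card mod_ring)) = poly f (to_ac x)"
proof -
  have "poly f (to_ac x) = poly (f div \<theta> * \<theta> + f mod \<theta>) (to_ac x)" by simp
  also have "\<dots> = poly (f mod \<theta>) (to_ac x)" unfolding poly_add poly_mult poly_theta by simp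
  finally show ?thesis ..
qed

lemma degree_mod_theta: "degree (f mod (\<theta> :: 'p :: prime_card fp_bar poly)) < CARD('p)"
  using degree_mod_less[of \<theta> f] degree_theta[where ?'p = 'p] p_ge_2[where ?'p = 'p] by auto

definition vanishing :: "nat => 'p :: prime_card fp_bar poly set" where
  "vanishing n = {f \<in> sym_space n. \<forall>u v. hev n f (to_ac u) (to_ac v) = 0}"

text \<open>Vanishing at all (x : 1) makes f divisible by \<theta>; vanishing at (1 : 0) removes the
  top coefficient, which accounts for n - (p + 1) instead of n - p.\<close>

lemma vanishing_theta:
  fixes f :: "'p :: prime_card fp_bar poly"
  assumes "f \<in> vanishing n" "f ~= 0"
  shows "f = \<theta> * (f div \<theta>)" "n \<ge> CARD('p) + 1" "degree (f div \<theta>) \<le> n - (CARD('p) + 1)"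
proof -
  have deg: "degree f \<le> n" using assms by (simp add: vanishing_def sym_space_def)
  have z: "hev n f (to_ac u) (to_ac v) = 0" for u v :: "'p mod_ring" using assms by (auto simp: vanishing_def)
  have "poly f (to_ac x) = 0" for x :: "'p mod_ring" using z[of x 1] hev_1[OF deg] by simp
  then have "f mod \<theta> = 0" by (intro vanish_on_Fp degree_mod_theta) (simp add: poly_mod_theta)
  then show eq: "f = \<theta> * (f div \<theta>)" by (metis add.right_neutral mult_div_mod_eq)
  have "coeff f n = 0" using z[of 1 0] hev_right_0[of n f] by simp
  then have "degree f < n" using deg assms(2) by (metis le_neq_implies_less leading_coeff_0_iff)
  moreover have "f div \<theta> ~= 0" using eq assms(2) by auto
  then have "degree f = CARD('p) + degree (f div \<theta>)"
    using degree_mult_eq[of \<theta> "f div \<theta>"] eq degree_theta[where ?'p = 'p] by simp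
  ultimately show "n \<ge> CARD('p) + 1" "degree (f div \<theta>) \<le> n - (CARD('p) + 1)" by linarith+
qed

lemma degree_theta_power_le: "degree ((\<theta> :: 'p :: prime_card fp_bar poly) ^ j) \<le> j * (CARD('p) + 1)"
  using degree_power_le[of "\<theta> :: 'p fp_bar poly" j] by (simp add: degree_theta algebra_simps)

lemma sym_act_theta_power_mult:
  fixes f :: "'p :: prime_card fp_bar poly"
  assumes "degree f \<le> m"
  shows "sym_act (j * (CARD('p) + 1) + m) g (\<theta> ^ j * f) = smult (to_ac (det g) ^ j) (\<theta> ^ j * sym_act m g f)"
proof -
  have "sym_act (j * (CARD('p) + 1)) g (\<theta> ^ j) = smult (to_ac (det g) ^ j) (\<theta> ^ j :: 'p fp_bar poly)"
    using sym_act_power[of \<theta> "CARD('p) + 1" j g] by (simp add: degree_theta sym_act_theta[simplified] smult_power)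
  then show ?thesis using sym_act_mult[OF degree_theta_power_le assms] by simp
qed

subsection \<open>Power sums and the second constituent\<close>

text \<open>Orthogonality of characters: unless p - 1 divides k, some unit s has s^k ~= 1, and
  replacing x by s x multiplies the sum by s^k. For k = 0 the term at x = 0 counts as 1, so the sum
  is p = 0.\<close>

lemma power_sum:
  "(\<Sum>x\<in>UNIV. to_ac (x :: 'p :: prime_card mod_ring) ^ k) = (if k > 0 \<and> (CARD('p) - 1) dvd k then - 1 else 0)"
proof (cases "k > 0 \<and> (CARD('p) - 1) dvd k")
  case True
  have "x ^ k = 1" if "x ~= 0" for x :: "'p mod_ring"
    using mod_ring_power_cong[OF that, of k 0] True by (auto simp: dvd_eq_mod_eq_0)
  then have "(\<Sum>x\<in>UNIV. to_ac (x :: 'p mod_ring) ^ k) = (\<Sum>x\<in>UNIV - {0 :: 'p mod_ring}. 1)"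
    using True by (intro sum.mono_neutral_cong_right) (auto simp flip: to_ac_power)
  also have "\<dots> = of_nat (CARD('p) - 1)" by (simp add: card_Diff_subset)
  also have "\<dots> = - 1"
    using p_ge_2[where ?'p = 'p] by (simp add: of_nat_diff)
  finally show ?thesis using True by simp
next
  case False
  show ?thesis
  proof (cases "k = 0")
    case True
    then show ?thesis by simp
  next
    case k: False
    then have nd: "\<not> (CARD('p) - 1) dvd k" using False by simp
    have "\<exists>s :: 'p mod_ring. s ~= 0 \<and> s ^ k ~= s ^ 0"
    proof (rule ccontr)
      assume "\<not> ?thesis"
      then have "k mod (CARD('p) - 1) = 0 mod (CARD('p) - 1)"
        by (intro mod_ring_power_eq[where ?'p = 'p]) auto
      then show False using nd by (auto simp: dvd_eq_mod_eq_0)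
    qed
    then obtain s :: "'p mod_ring" where s: "s ~= 0" "s ^ k ~= 1" by auto
    have "bij ((*) s)" using s(1) by (intro bijI) (auto simp: inj_on_def intro!: surjI[of _ "%x. x / s"])
    then have "(\<Sum>x\<in>UNIV. to_ac (x :: 'p mod_ring) ^ k) = (\<Sum>x\<in>UNIV. to_ac (s * x) ^ k)"
      by (intro sum.reindex_bij_betw[symmetric])
    also have "\<dots> = to_ac (s ^ k) * (\<Sum>x\<in>UNIV. to_ac x ^ k)"
      by (simp add: power_mult_distrib sum_distrib_left)
    finally have "(to_ac (s ^ k) - 1) * (\<Sum>x\<in>UNIV. to_ac (x :: 'p mod_ring) ^ k) = 0"
      by (simp add: algebra_simps)
    moreover have "to_ac (s ^ k) - 1 ~= 0" using s by (simp del: to_ac_power)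
    ultimately have "(\<Sum>x\<in>UNIV. to_ac (x :: 'p mod_ring) ^ k) = 0" by simp
    then show ?thesis using nd by simp
  qed
qed

text \<open>An intertwiner from degree n to degree m that depends only on the values of f on F_p^2:
  each point (s, t) contributes f(s, t) times the m-th power of s y - t x, the linear form vanishing
  at that point.\<close>

definition psi :: "nat => nat => 'p :: prime_card fp_bar poly => 'p fp_bar poly" where
  "psi m n f = (\<Sum>(s :: 'p mod_ring, t)\<in>UNIV. smult (hev n f (to_ac s) (to_ac t)) ([:to_ac s, - to_ac t:] ^ m))"

lemma degree_psi: "degree (psi m n f) \<le> m"
proof -
  have "degree ([:to_ac s, - to_ac t:] ^ m) \<le> m" for s t :: "'a mod_ring"
    using degree_power_le[of "[:to_ac s, - to_ac t:]" m] by (auto split: if_splits)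
  then show ?thesis unfolding psi_def
    by (intro degree_sum_le) (auto intro: degree_smult_le[THEN order_trans])
qed

lemma sym_act_sum: "sym_act n g (sum f A) = (\<Sum>a\<in>A. sym_act n g (f a))"
  by (induction A rule: infinite_finite_induct) (simp_all add: sym_act_0 sym_act_add)

lemma cramer:
  fixes a b c d x y :: "'a :: comm_ring_1"
  shows "(a * x + c * y) * d - (b * x + d * y) * c = (a * d - b * c) * x"
    "(a * x + c * y) * b - (b * x + d * y) * a = (a * d - b * c) * - y"
  by (simp_all add: algebra_simps)

text \<open>Reindex the sum by the permutation (s, t) -> (s, t) g of the plane. The form s y - t x
  is the determinant of (s, t) and (x, y), so it scales by det g.\<close>

lemma sym_act_psi:
  fixes f :: "'p :: prime_card fp_bar poly"
  assumes g: "g \<in> GL"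
  shows "sym_act m g (psi m n f) = smult (to_ac (det g) ^ m) (psi m n (sym_act n g f))"
proof -
  let ?T = "%(s, t). (g $ 1 $ 1 * s + g $ 2 $ 1 * t, g $ 1 $ 2 * s + g $ 2 $ 2 * t) :: 'p mod_ring \<times> 'p mod_ring"
  let ?d = "det g"
  have d: "?d ~= 0" using g by (simp add: GL_det)
  have det: "?d = g $ 1 $ 1 * g $ 2 $ 2 - g $ 1 $ 2 * g $ 2 $ 1" by (simp add: det_2)
  have "inj ?T"
  proof (rule injI, clarsimp)
    fix s t s' t' assume 1: "g $ 1 $ 1 * s + g $ 2 $ 1 * t = g $ 1 $ 1 * s' + g $ 2 $ 1 * t'"
      and 2: "g $ 1 $ 2 * s + g $ 2 $ 2 * t = g $ 1 $ 2 * s' + g $ 2 $ 2 * t'"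
    have "?d * s = ?d * s'" "?d * - t = ?d * - t'"
      unfolding det
      using cramer[where a = "g $ 1 $ 1" and b = "g $ 1 $ 2" and c = "g $ 2 $ 1" and d = "g $ 2 $ 2" and x = s and y = t]
        cramer[where a = "g $ 1 $ 1" and b = "g $ 1 $ 2" and c = "g $ 2 $ 1" and d = "g $ 2 $ 2" and x = s' and y = t']
      by (metis 1 2)+
    then show "s = s' \<and> t = t'" using d by simp
  qed
  then have bij: "bij ?T" by (simp add: bij_def finite_UNIV_inj_surj)
  have lin: "sym_act m g ([:to_ac s, - to_ac t:] ^ m)
      = (smult (to_ac s) (rowy g) - smult (to_ac t) (rowx g)) ^ m" for s t :: "'p mod_ring"
  proof -
    have "sym_act 1 g [:to_ac s, - to_ac t:] = smult (to_ac s) (rowy g) - smult (to_ac t) (rowx g)"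
      by (simp add: sym_act_def)
    then show ?thesis using sym_act_power[of "[:to_ac s, - to_ac t:]" 1 m g] by simp
  qed
  have "sym_act m g (psi m n f) =
      (\<Sum>x\<in>UNIV. (%(s, t). smult (hev n f (to_ac s) (to_ac t))
        ((smult (to_ac s) (rowy g) - smult (to_ac t) (rowx g)) ^ m)) x)"
    unfolding psi_def sym_act_sum by (intro sum.cong) (auto simp: sym_act_smult lin)
  also have "\<dots> = (\<Sum>x\<in>UNIV. (%(s, t). smult (hev n f (to_ac s) (to_ac t))
        ((smult (to_ac s) (rowy g) - smult (to_ac t) (rowx g)) ^ m)) (?T x))"
    by (rule sum.reindex_bij_betw[OF bij, symmetric])
  also have "\<dots> = (\<Sum>x\<in>UNIV. smult (to_ac ?d ^ m) ((%(s, t).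
      smult (hev n (sym_act n g f) (to_ac s) (to_ac t)) ([:to_ac s, - to_ac t:] ^ m)) x))"
  proof (intro sum.cong refl)
    fix x :: "'p mod_ring \<times> 'p mod_ring"
    obtain s t where x: "x = (s, t)" by (cases x)
    define s' t' where "s' = g $ 1 $ 1 * s + g $ 2 $ 1 * t" and "t' = g $ 1 $ 2 * s + g $ 2 $ 2 * t"
    have "smult (to_ac s') (rowy g) - smult (to_ac t') (rowx g)
        = [:to_ac (s' * g $ 2 $ 2 - t' * g $ 2 $ 1), to_ac (s' * g $ 1 $ 2 - t' * g $ 1 $ 1):]"
      by simp
    also have "s' * g $ 2 $ 2 - t' * g $ 2 $ 1 = ?d * s" unfolding s'_def t'_def det by (rule cramer)
    also have "s' * g $ 1 $ 2 - t' * g $ 1 $ 1 = ?d * - t" unfolding s'_def t'_def det by (rule cramer)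
    also have "[:to_ac (?d * s), to_ac (?d * - t):] = smult (to_ac ?d) [:to_ac s, - to_ac t:]" by simp
    finally have "(smult (to_ac s') (rowy g) - smult (to_ac t') (rowx g)) ^ m
        = smult (to_ac ?d ^ m) ([:to_ac s, - to_ac t:] ^ m)" by (simp only: smult_power)
    then show "(%(s, t). smult (hev n f (to_ac s) (to_ac t))
        ((smult (to_ac s) (rowy g) - smult (to_ac t) (rowx g)) ^ m)) (?T x) =
        smult (to_ac ?d ^ m) ((%(s, t).
      smult (hev n (sym_act n g f) (to_ac s) (to_ac t)) ([:to_ac s, - to_ac t:] ^ m)) x)"
      by (simp add: x hev_sym_act s'_def t'_def mult.commute)
  qed
  also have "\<dots> = smult (to_ac ?d ^ m) (psi m n (sym_act n g f))"
    by (simp add: psi_def smult_sum2)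
  finally show ?thesis .
qed

lemma psi_add: "psi m n (f + h) = psi m n f + psi m n h"
  by (simp add: psi_def hev_add smult_add_left sum.distrib case_prod_unfold)

lemma psi_smult: "psi m n (smult c f) = smult c (psi m n f)"
  by (simp add: psi_def hev_smult smult_sum2 case_prod_unfold)

lemma const_poly_sum: "[:\<Sum>s\<in>A. h s:] = (\<Sum>s\<in>A. [:h s :: 'a :: comm_ring_1:])"
proof -
  interpret comm_ring_hom "%x :: 'a. [:x:]" by (rule comm_ring_hom_const)
  show ?thesis by (rule hom_sum)
qed

text \<open>The summand is homogeneous of degree n + m in (s, t), so when p - 1 divides n + m it is
  constant on each punctured line. The sum over the plane is then p - 1 = -1 times a sum over the
  projective line, with the top coefficient as the contribution of the point at infinity.\<close>

lemma psi_eq: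
  fixes f :: "'p :: prime_card fp_bar poly"
  assumes f: "degree f \<le> n" and nm: "n + m > 0" "(CARD('p) - 1) dvd (n + m)"
  shows "psi m n f = - ([:coeff f n:] + (\<Sum>x\<in>UNIV. smult (poly f (to_ac x)) ([:to_ac (x :: 'p mod_ring), - 1:] ^ m)))"
proof -
  let ?F = "%s t. smult (hev n f (to_ac s) (to_ac t)) ([:to_ac s, - to_ac t:] ^ m) :: 'p fp_bar poly"
  let ?S = "\<Sum>x\<in>UNIV. smult (poly f (to_ac x)) ([:to_ac (x :: 'p mod_ring), - 1:] ^ m)"
  have nz: "(\<Sum>s\<in>UNIV. ?F s t) = ?S" if "t ~= 0" for t :: "'p mod_ring"
  proof -
    have "bij (%x. t * x)" using that by (intro bijI) (auto simp: inj_on_def intro!: surjI[of _ "%x. x / t"])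
    then have "(\<Sum>s\<in>UNIV. ?F s t) = (\<Sum>x\<in>UNIV. ?F (t * x) t)"
      by (rule sum.reindex_bij_betw[symmetric])
    also have "\<dots> = ?S"
    proof (intro sum.cong refl)
      fix x :: "'p mod_ring"
      have "t ^ (n + m) = 1" using mod_ring_power_cong[OF that, of "n + m" 0] nm by (auto simp: dvd_eq_mod_eq_0)
      then have t: "to_ac t ^ n * to_ac t ^ m = 1" by (simp flip: to_ac_power to_ac_mult power_add)
      have "hev n f (to_ac t * to_ac x) (to_ac t * 1) = to_ac t ^ n * poly f (to_ac x)"
        unfolding hev_scale hev_1[OF f] ..
      moreover have "[:to_ac t * to_ac x, - to_ac t:] = smult (to_ac t) [:to_ac x, - 1:]" by simp
      then have "[:to_ac t * to_ac x, - to_ac t:] ^ m = smult (to_ac t ^ m) ([:to_ac x, - 1:] ^ m)"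
        by (simp only: smult_power)
      ultimately have "?F (t * x) t = smult ((to_ac t ^ n * to_ac t ^ m) * poly f (to_ac x)) ([:to_ac x, - 1:] ^ m)"
        by (simp add: mult_ac)
      then show "?F (t * x) t = smult (poly f (to_ac x)) ([:to_ac x, - 1:] ^ m)" by (simp only: t mult_1)
    qed
    finally show ?thesis .
  qed
  have z: "(\<Sum>s\<in>UNIV. ?F s 0) = - [:coeff f n:]"
  proof -
    have "?F s 0 = smult (coeff f n) [:to_ac s ^ (n + m):]" for s
    proof -
      have "hev n f (to_ac s * 1) (to_ac s * 0) = to_ac s ^ n * coeff f n"
        unfolding hev_scale hev_right_0 ..
      then show ?thesis by (simp add: poly_const_pow power_add mult_ac)
    qed
    then have "(\<Sum>s\<in>UNIV. ?F s 0) = smult (coeff f n) [:\<Sum>s\<in>UNIV. to_ac (s :: 'p mod_ring) ^ (n + m):]"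
      by (simp only: smult_sum2 const_poly_sum)
    then show ?thesis using nm by (simp only: power_sum) simp
  qed
  have "psi m n f = (\<Sum>s\<in>UNIV. \<Sum>t\<in>UNIV. ?F s t)"
    unfolding psi_def UNIV_Times_UNIV[symmetric] by (rule sum.cartesian_product[symmetric])
  also have "\<dots> = (\<Sum>t\<in>UNIV. \<Sum>s\<in>UNIV. ?F s t)" by (rule sum.swap)
  also have "\<dots> = (\<Sum>s\<in>UNIV. ?F s 0) + (\<Sum>t\<in>UNIV - {0 :: 'p mod_ring}. \<Sum>s\<in>UNIV. ?F s t)"
    by (rule sum.remove) auto
  also have "(\<Sum>t\<in>UNIV - {0 :: 'p mod_ring}. \<Sum>s\<in>UNIV. ?F s t) = (\<Sum>t\<in>UNIV - {0 :: 'p mod_ring}. ?S)"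
  proof (rule sum.cong[OF refl])
    fix t :: "'p mod_ring" assume "t \<in> UNIV - {0}"
    then show "(\<Sum>s\<in>UNIV. ?F s t) = ?S" by (intro nz) simp
  qed
  also have "\<dots> = of_nat (CARD('p) - 1) * ?S" by (simp add: card_Diff_subset)
  also have "(of_nat (CARD('p) - 1) :: 'p fp_bar poly) = - 1"
  proof -
    have "(of_nat CARD('p) :: 'p fp_bar poly) = [:of_nat CARD('p):]" by (simp add: of_nat_poly)
    then show ?thesis using p_ge_2[where ?'p = 'p] by (simp add: of_nat_diff)
  qed
  finally show ?thesis unfolding z by simp
qed

text \<open>Only exponents that are positive multiples of p - 1 survive in power sums. As i + l < 2
  (p - 1), the single survivor is i = p - 1 - l.\<close>

lemma moment_sum:
  fixes c :: "'p :: prime_card fp_bar poly"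
  assumes c: "degree c < CARD('p)" and l: "l \<le> CARD('p) - 2"
  shows "(\<Sum>x\<in>UNIV. poly c (to_ac (x :: 'p mod_ring)) * to_ac x ^ l) = - coeff c (CARD('p) - 1 - l)"
proof -
  let ?p = "CARD('p)"
  have p: "?p \<ge> 2" by (rule p_ge_2)
  have "poly c x = (\<Sum>i<?p. coeff c i * x ^ i)" for x
    unfolding poly_altdef using c by (intro sum.mono_neutral_left) (auto simp: coeff_eq_0)
  then have "(\<Sum>x\<in>UNIV. poly c (to_ac (x :: 'p mod_ring)) * to_ac x ^ l)
      = (\<Sum>x\<in>UNIV. \<Sum>i<?p. coeff c i * to_ac (x :: 'p mod_ring) ^ (i + l))"
    by (simp add: sum_distrib_right power_add mult.assoc)
  also have "\<dots> = (\<Sum>i<?p. coeff c i * (\<Sum>x\<in>UNIV. to_ac (x :: 'p mod_ring) ^ (i + l)))"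
    by (subst sum.swap) (simp add: sum_distrib_left)
  also have "\<dots> = (\<Sum>i\<in>{?p - 1 - l}. coeff c i * - 1)"
  proof (rule sum.mono_neutral_cong_right)
    show "\<forall>i\<in>{..<?p} - {?p - 1 - l}. coeff c i * (\<Sum>x\<in>UNIV. to_ac (x :: 'p mod_ring) ^ (i + l)) = 0"
    proof
      fix i assume i: "i \<in> {..<?p} - {?p - 1 - l}"
      have "\<not> (i + l > 0 \<and> (?p - 1) dvd (i + l))"
      proof
        assume *: "i + l > 0 \<and> (?p - 1) dvd (i + l)"
        then obtain q where q: "i + l = (?p - 1) * q" by (elim conjE dvdE)
        have "i + l < (?p - 1) * 2" using i l p by auto
        then have "q < 2" unfolding q by simp
        moreover have "q ~= 0" using * q by auto
        ultimately have "q = 1" by linarith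
        then show False using i q l p by auto
      qed
      then show "coeff c i * (\<Sum>x\<in>UNIV. to_ac (x :: 'p mod_ring) ^ (i + l)) = 0"
        by (simp only: power_sum if_False mult_zero_right)
    qed
    fix i assume "i \<in> {?p - 1 - l}"
    then have "i + l = ?p - 1" using l p by auto
    then show "coeff c i * (\<Sum>x\<in>UNIV. to_ac (x :: 'p mod_ring) ^ (i + l)) = coeff c i * - 1"
      using p by (simp only: power_sum) simp
  qed (use l p in auto)
  finally show ?thesis by simp
qed

lemma coeff_neg_linear_power:
  assumes "k \<le> m"
  shows "coeff ([:x, - 1:] ^ m) k = of_nat (m choose k) * (- 1) ^ k * (x :: 'a :: comm_ring_1) ^ (m - k)"
  using assms by (rule coeff_linear_poly_power)

lemma binomial_fp_bar_neq_0:
  assumes "k \<le> m" "m < CARD('p)"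
  shows "(of_nat (m choose k) :: 'p :: prime_card fp_bar) ~= 0"
proof
  assume "(of_nat (m choose k) :: 'p fp_bar) = 0"
  then have "to_ac (of_nat (m choose k) :: 'p mod_ring) = 0" by simp
  then have "CARD('p) dvd (m choose k)" by (simp only: to_ac_eq_0_iff of_nat_0_mod_ring_dvd)
  also have "(m choose k) dvd fact m" using binomial_fact_lemma[OF assms(1)] by (metis dvd_triv_right)
  finally have "CARD('p) \<le> m" using prime_dvd_fact_iff[OF prime_card[where ?'a = 'p]] by simp
  then show False using assms by simp
qed

text \<open>f and its remainder c modulo \<theta> agree on F_p. The coefficients of
  \<open>psi\<close> are, up to invertible binomials and signs, the coefficients of c in degrees r
  to p - 1, the first one corrected by the value of f at infinity. If they vanish, c has degree at
  most r and also the right value at infinity.\<close>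

lemma psi_kernel:
  fixes f :: "'p :: prime_card fp_bar poly"
  assumes f: "degree f \<le> n" and r: "1 \<le> r" "r \<le> CARD('p) - 1" "n mod (CARD('p) - 1) = r mod (CARD('p) - 1)" "n > 0"
    and ker: "psi (CARD('p) - 1 - r) n f = 0"
  obtains h where "degree h \<le> r" "!!u v. hev r h (to_ac u) (to_ac v) = hev n f (to_ac (u :: 'p mod_ring)) (to_ac v)"
proof -
  let ?p = "CARD('p)"
  define m where "m = ?p - 1 - r"
  have p: "?p \<ge> 2" by (rule p_ge_2)
  have m: "m \<le> ?p - 2" "r + m = ?p - 1" using r p by (auto simp: m_def)
  have "(n + m) mod (?p - 1) = (r + m) mod (?p - 1)" using r(3) by (metis mod_add_left_eq)
  then have dvd: "(?p - 1) dvd (n + m)" by (simp add: m(2) dvd_eq_mod_eq_0)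
  define c where "c = f mod \<theta>"
  have c: "degree c < ?p" "!!x :: 'p mod_ring. poly c (to_ac x) = poly f (to_ac x)"
    by (simp_all add: c_def degree_mod_theta poly_mod_theta)
  have "psi m n f = 0" using ker by (simp add: m_def)
  have "n + m > 0" using r(4) by simp
  from psi_eq[OF f this dvd] have "[:coeff f n:] + (\<Sum>x\<in>UNIV. smult (poly f (to_ac x)) ([:to_ac (x :: 'p mod_ring), - 1:] ^ m)) = - psi m n f"
    by (simp only: minus_minus)
  then have zero: "[:coeff f n:] + (\<Sum>x\<in>UNIV. smult (poly c (to_ac x)) ([:to_ac (x :: 'p mod_ring), - 1:] ^ m)) = 0"
    by (simp only: \<open>psi m n f = 0\<close> minus_zero c)
  have cf: "(if k = 0 then coeff f n else 0) = of_nat (m choose k) * (- 1) ^ k * coeff c (r + k)" if k: "k \<le> m" for k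
  proof -
    have "0 = coeff [:coeff f n:] k + (\<Sum>x\<in>UNIV. poly c (to_ac x) * coeff ([:to_ac (x :: 'p mod_ring), - 1:] ^ m) k)"
      using arg_cong[OF zero, of "%f. coeff f k"] by (simp add: coeff_sum)
    also have "(\<Sum>x\<in>UNIV. poly c (to_ac x) * coeff ([:to_ac (x :: 'p mod_ring), - 1:] ^ m) k)
        = of_nat (m choose k) * (- 1) ^ k * (\<Sum>x\<in>UNIV. poly c (to_ac (x :: 'p mod_ring)) * to_ac x ^ (m - k))"
      unfolding sum_distrib_left coeff_neg_linear_power[OF k] by (intro sum.cong) (simp_all add: mult_ac)
    also have "(\<Sum>x\<in>UNIV. poly c (to_ac (x :: 'p mod_ring)) * to_ac x ^ (m - k)) = - coeff c (?p - 1 - (m - k))"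
      using m by (intro moment_sum c) auto
    also have "?p - 1 - (m - k) = r + k" using m k by auto
    finally have "coeff [:coeff f n:] k = of_nat (m choose k) * (- 1) ^ k * coeff c (r + k)"
      by (simp add: eq_neg_iff_add_eq_0[symmetric])
    then show ?thesis by (simp add: coeff_pCons split: nat.splits if_splits)
  qed
  have top: "coeff c r = coeff f n" using cf[of 0] by simp
  have "coeff c i = 0" if "i > r" for i
  proof (cases "i < ?p")
    case True
    define k where "k = i - r"
    have k: "k \<le> m" "k ~= 0" "i = r + k" using that True m by (auto simp: k_def)
    have "of_nat (m choose k) * (- 1) ^ k * coeff c i = 0" using cf[OF k(1)] k by simp
    moreover have "of_nat (m choose k) ~= (0 :: 'p fp_bar)"
      using m p by (intro binomial_fp_bar_neq_0 k(1)) auto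
    ultimately show ?thesis by auto
  next
    case False
    then show ?thesis using c(1) by (intro coeff_eq_0) auto
  qed
  then have deg: "degree c \<le> r" by (auto intro: degree_le)
  have "hev r c (to_ac u) (to_ac v) = hev n f (to_ac u) (to_ac v)" for u v :: "'p mod_ring"
  proof (cases "v = 0")
    case True
    \<comment> \<open>Both exponents are positive, so the congruence modulo p - 1 is enough even at
      u = 0.\<close>
    have "u ^ r = u ^ n"
    proof (cases "u = 0")
      case False
      then show ?thesis using mod_ring_power_cong[of u r n] r by simp
    qed (use r in \<open>simp add: power_0_left\<close>)
    then have pw: "to_ac u ^ r = to_ac u ^ n" by (simp flip: to_ac_power)
    have "hev r c (to_ac u * 1) (to_ac u * 0) = hev n f (to_ac u * 1) (to_ac u * 0)"
      unfolding hev_scale hev_right_0 pw top ..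
    then show ?thesis using True by simp
  next
    case False
    have "v ^ r = v ^ n" using mod_ring_power_cong[OF False, of r n] r by simp
    then have pw: "to_ac v ^ r = to_ac v ^ n" by (simp flip: to_ac_power)
    have "hev r c (to_ac v * to_ac (u / v)) (to_ac v * 1) = hev n f (to_ac v * to_ac (u / v)) (to_ac v * 1)"
      unfolding hev_scale hev_1[OF deg] hev_1[OF f] pw c(2) ..
    then show ?thesis using False by simp
  qed
  with deg that show ?thesis by blast
qed

text \<open>A test vector: the constant term of the image is a power sum with exponent r + m = p -
  1, which does not vanish. With simplicity of the target this makes \<open>psi\<close> onto in
  degree r + p - 1.\<close>

lemma psi_monom_neq_0:
  assumes r: "1 \<le> r" "r \<le> CARD('p) - 1"
  shows "psi (CARD('p) - 1 - r) (r + (CARD('p) - 1)) (monom 1 r) ~= (0 :: 'p :: prime_card fp_bar poly)"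
proof -
  let ?p = "CARD('p)"
  define m n where "m = ?p - 1 - r" and "n = r + (?p - 1)"
  have p: "?p \<ge> 2" by (rule p_ge_2)
  have nm: "n + m = 2 * (?p - 1)" "r + m = ?p - 1" using r by (auto simp: m_def n_def)
  have deg: "degree (monom (1 :: 'p fp_bar) r) \<le> n" using p by (simp add: degree_monom_eq n_def)
  have top: "coeff (monom (1 :: 'p fp_bar) r) n = 0" using p by (auto simp: n_def)
  have psi: "psi m n (monom 1 r) = - (\<Sum>x\<in>UNIV. smult (to_ac x ^ r) ([:to_ac (x :: 'p mod_ring), - 1:] ^ m))"
    using psi_eq[OF deg, of m] nm p by (simp add: top poly_monom)
  have "coeff (psi m n (monom 1 r)) 0 = - (\<Sum>x\<in>UNIV. to_ac (x :: 'p mod_ring) ^ (r + m))"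
    unfolding psi coeff_minus coeff_sum coeff_smult coeff_neg_linear_power[OF le0] by (simp add: power_add)
  also have "\<dots> = 1" unfolding nm using p by (simp only: power_sum) simp
  finally show ?thesis by (auto simp: m_def n_def)
qed

subsection \<open>Lower bound for the degree\<close>

text \<open>Multiplying Sym^(b-1) by \<theta>^a gives the first formula. For the second, put r = p -
  b: \<open>psi\<close> maps degree r + p - 1 onto V_{r,b}, and \<theta>^(a-r) raises the twist from
  r to a. This route is shorter whenever a >= r, and it requires r >= 1, whence the exception b =
  p.\<close>

definition kf :: "nat => nat => nat => nat" where
  "kf p a b = (if a + b < p \<or> b = p then a * (p + 1) + b - 1 else (a + b - p) * (p + 1) + 2 * p - 1 - b)"

lemma weight_act_sym: "weight_act (0, Suc n) = sym_act n"
  by (intro ext) (simp add: weight_act_def)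

lemma det_power_p: "g \<in> GL ==> m mod (CARD('p) - 1) = n mod (CARD('p) - 1) ==>
    to_ac (det (g :: 'p :: prime_card gmat)) ^ m = to_ac (det g) ^ n"
  using mod_ring_power_cong[of "det g" m n] by (simp add: GL_det flip: to_ac_power)

text \<open>\<open>sym_act_psi\<close> leaves a factor det^m on the other side; since r + m = p - 1
  it moves over as det^r.\<close>

lemma psi_equivariant:
  fixes n :: nat
  assumes "1 \<le> r" "r \<le> CARD('p) - 1"
  shows "equivariant (sym_act n) (sym_space n :: 'p :: prime_card fp_bar poly set)
     (weight_act (r, CARD('p) - r)) (psi (CARD('p) - 1 - r) n)"
proof -
  have m: "CARD('p) - r - 1 = CARD('p) - 1 - r" by simp
  have "psi (CARD('p) - 1 - r) n (sym_act n g f) = weight_act (r, CARD('p) - r) g (psi (CARD('p) - 1 - r) n f)"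
    if g: "g \<in> GL" for g and f :: "'p fp_bar poly"
  proof -
    have "to_ac (det g) ^ r * to_ac (det g) ^ (CARD('p) - 1 - r) = to_ac (det g) ^ 0"
      unfolding power_add[symmetric] by (rule det_power_p[OF g]) (use assms in simp)
    then show ?thesis by (simp add: weight_act_def m sym_act_psi[OF g])
  qed
  then show ?thesis by (auto simp: equivariant_def psi_add psi_smult)
qed

lemma mod_eq_small: "(a :: nat) < q ==> b < q ==> a mod q = b mod q ==> a = b"
  by simp

text \<open>Dividing by \<theta> leaves a symmetric power twisted by det. Removing the twist on both
  sides lowers a by one modulo p - 1.\<close>

lemma subq_untwist:
  fixes M :: "'p :: prime_card fp_bar poly set"
  assumes sub: "subq (weight_act (1, Suc k)) M (a, b)" and a: "(a' + 1) mod (CARD('p) - 1) = a mod (CARD('p) - 1)"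
  shows "subq (sym_act k) M (a', b)"
proof -
  obtain A \<phi> where A: "A \<subseteq> M" "submodule (weight_act (1, Suc k)) A"
    "equivariant (weight_act (1, Suc k)) A (weight_act (a, b)) \<phi>" "\<phi> ` A = sym_space (b - 1)"
    using sub by (auto simp: subq_def)
  have act: "sym_act k g f = smult (inverse (to_ac (det g))) (weight_act (1, Suc k) g f)"
    if "g \<in> GL" for g :: "'p gmat" and f
    using that by (simp add: weight_act_def GL_det)
  have "submodule (sym_act k) A"
    unfolding submodule_iff using submoduleD[OF A(2)] act by auto
  moreover have "equivariant (sym_act k) A (weight_act (a', b)) \<phi>"
    unfolding equivariant_def
  proof (intro conjI ballI allI)
    fix g :: "'p gmat" and f assume g: "g \<in> GL" and f: "f \<in> A"
    have d0: "to_ac (det g) ~= 0" using g by (simp add: GL_det)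
    have "to_ac (det g) ^ (a' + 1) = to_ac (det g) ^ a" using g a by (rule det_power_p)
    then have da: "inverse (to_ac (det g)) * to_ac (det g) ^ a = to_ac (det g) ^ a'"
      using d0 by (simp add: field_simps)
    have "\<phi> (sym_act k g f) = smult (inverse (to_ac (det g))) (\<phi> (weight_act (1, Suc k) g f))"
      using equivariantD(2)[OF A(3) submoduleD(4)[OF A(2) g f]] by (simp add: act[OF g])
    also have "\<dots> = smult (inverse (to_ac (det g)) * to_ac (det g) ^ a) (sym_act (b - 1) g (\<phi> f))"
      using equivariantD(3)[OF A(3) g f] by (simp add: weight_act_def)
    finally show "\<phi> (sym_act k g f) = weight_act (a', b) g (\<phi> f)"
      by (simp only: da) (simp add: weight_act_def)
  qed (use equivariantD[OF A(3)] in auto)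
  ultimately show ?thesis unfolding subq_def using A by (intro exI[of _ A] exI[of _ \<phi>]) auto
qed

text \<open>One division by \<theta> costs p + 1 degrees and moves a to a - 1 modulo p - 1, written
  \<open>a + p - 2\<close> to stay in the natural numbers. For a = 0 the left side is only b -
  1.\<close>

lemma kf_step:
  assumes "p \<ge> 3" "a \<le> p - 2" "1 \<le> b" "b \<le> p"
  shows "kf p a b \<le> kf p ((a + p - 2) mod (p - 1)) b + (p + 1)"
proof (cases "a = 0")
  case True
  then show ?thesis using assms by (auto simp: kf_def)
next
  case False
  then have "a + p - 2 = (a - 1) + (p - 1)" using assms by auto
  then have "(a + p - 2) mod (p - 1) = (a - 1) mod (p - 1)" by (simp only: mod_add_self2)
  also have "\<dots> = a - 1" using False assms by (intro mod_less) auto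
  finally have eq: "(a + p - 2) mod (p - 1) = a - 1" .
  obtain c where c: "a = Suc c" using False by (cases a) auto
  show ?thesis
  proof (cases "b = p \<or> a + b < p")
    case True
    then show ?thesis using assms unfolding eq by (auto simp: kf_def c)
  next
    case nb: False
    show ?thesis
    proof (cases "a + b = p")
      \<comment> \<open>Boundary between the two formulas: at a + b = p the second one holds for a
        and the first one for a - 1.\<close>
      case True
      have "2 * p - 1 - b \<le> c * (p + 1) + b - 1 + (p + 1)"
      proof -
        have "b + a = p" using True by simp
        have "2 * p - 1 - b = p + a - 1" using True by auto
        also have "\<dots> \<le> a * (p + 1) + b - 1" using False by (simp add: c)
        finally show ?thesis using assms by (simp add: c)
      qed
      then show ?thesis using True unfolding eq by (auto simp: kf_def c)
    next
      case False
      then have "a + b > p" using nb by auto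
      then obtain d where d: "a + b = p + Suc d" by (metis add_Suc_right less_imp_Suc_add)
      have "a - 1 + b = p + d" using d c by simp
      then show ?thesis using nb d assms unfolding eq by (auto simp: kf_def c)
    qed
  qed
qed

text \<open>For n >= p the symmetric power is filtered by the kernel of \<open>psi\<close> and,
  inside it, the forms vanishing on F_p^2. The layers map injectively to V_{r,p-r}, to V_{0,r+1} and
  to Sym^(n-p-1) twisted by det. The first two give the bound directly, the third by induction and
  \<open>kf_step\<close>.\<close>

lemma subq_lower:
  assumes odd: "CARD('p :: prime_card) \<ge> 3"
  shows "subq (sym_act n) (sym_space n :: 'p fp_bar poly set) (a, b) ==>
     a \<le> CARD('p) - 2 ==> 1 \<le> b ==> b \<le> CARD('p) ==> kf CARD('p) a b \<le> n"
proof (induction n arbitrary: a rule: less_induct)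
  case (less n)
  let ?p = "CARD('p)"
  have small: "x = y" if "x mod (?p - 1) = y mod (?p - 1)" "x \<le> ?p - 2" "y \<le> ?p - 2" for x y
    using that odd by (intro mod_eq_small[of x "?p - 1" y]) auto
  show ?case
  proof (cases "n \<le> ?p - 1")
    case True
    have q: "subq (weight_act (0, Suc n)) (sym_space (Suc n - 1) :: 'p fp_bar poly set) (a, b)"
      using less.prems(1) by (simp add: weight_act_sym)
    have "b = Suc n" "a mod (?p - 1) = 0 mod (?p - 1)"
      using subq_simple[OF q] less.prems True odd by auto
    then have "b = Suc n" "a = 0" using small[of a 0] less.prems by auto
    then show ?thesis using True odd by (auto simp: kf_def)
  next
    case False
    then have n: "n \<ge> ?p" using odd by linarith
    \<comment> \<open>The representative of n modulo p - 1 in the range 1..p-1; positivity matters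
      for values at the origin of F_p.\<close>
    define r where "r = (if n mod (?p - 1) = 0 then ?p - 1 else n mod (?p - 1))"
    have "n mod (?p - 1) < ?p - 1" using odd by (intro mod_less_divisor) auto
    then have r: "1 \<le> r" "r \<le> ?p - 1" "n mod (?p - 1) = r mod (?p - 1)"
      using odd by (auto simp: r_def)
    \<comment> \<open>n >= p exceeds r and is congruent to it, so a full period p - 1 fits between
      them.\<close>
    have nr: "n \<ge> r + (?p - 1)"
    proof -
      obtain q where q: "n = r + (?p - 1) * q" 
      proof (cases "n mod (?p - 1) = 0")
        case True
        then obtain k where k: "n = (?p - 1) * k" by auto
        with n odd have "k ~= 0" by (intro notI) auto
        then obtain j where "k = Suc j" by (cases k) auto
        then show ?thesis using that[of j] k True by (simp add: r_def)
      next
        case False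
        then show ?thesis using that[of "n div (?p - 1)"] by (simp add: r_def)
      qed
      have "q ~= 0" using q r n odd by (intro notI) auto
      then have "(?p - 1) * 1 \<le> (?p - 1) * q" by (intro mult_le_mono2) auto
      then show ?thesis using q by linarith
    qed
    let ?m = "?p - 1 - r"
    let ?S = "sym_space n :: 'p fp_bar poly set"
    define K where "K = {f \<in> ?S. psi ?m n f = 0}"
    have "subq (sym_act n) K (a, b) \<or> subq (weight_act (r, ?p - r)) (psi ?m n ` ?S) (a, b)"
      unfolding K_def by (rule subq_extension[OF less.prems(1,3,4) psi_equivariant[OF r(1,2)]]) simp
    then show ?thesis
    proof
      assume "subq (weight_act (r, ?p - r)) (psi ?m n ` ?S) (a, b)"
      moreover have "psi ?m n ` ?S \<subseteq> sym_space (?p - r - 1)"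
        using degree_psi[of ?m n, where ?'a = 'p] by (auto simp: sym_space_def)
      ultimately have q: "subq (weight_act (r, ?p - r)) (sym_space (?p - r - 1) :: 'p fp_bar poly set) (a, b)"
        by (rule subq_mono)
      have ab: "b = ?p - r" "a mod (?p - 1) = r mod (?p - 1)"
        using subq_simple[OF q] less.prems r odd by auto
      show ?thesis
      proof (cases "r = ?p - 1")
        case True
        then have "a = 0" using ab small[of a 0] less.prems by auto
        then show ?thesis using ab True odd by (auto simp: kf_def)
      next
        case False
        then have "a = r" using small[OF ab(2) less.prems(2)] r(2) by simp
        then have "a + b = ?p" "b ~= ?p" "2 * ?p - 1 - b = r + (?p - 1)" using ab(1) r(1,2) odd by arith+
        then have "kf ?p a b = r + (?p - 1)" by (simp add: kf_def)
        then show ?thesis using nr by simp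
      qed
    next
      assume subK: "subq (sym_act n) K (a, b)"
      \<comment> \<open>h is a form of degree r with the same values as f on F_p^2; since r < p
        there is at most one.\<close>
      define P where "P f h \<longleftrightarrow> degree h \<le> r \<and>
        (\<forall>u v. hev r h (to_ac u) (to_ac v) = hev n f (to_ac (u :: 'p mod_ring)) (to_ac v))"
        for f h :: "'p fp_bar poly"
      have P_ex: "\<exists>h. P f h" if "f \<in> K" for f
      proof -
        have "degree f \<le> n" "psi ?m n f = 0" using that by (auto simp: K_def sym_space_def)
        moreover have "n > 0" using n odd by linarith
        ultimately obtain h where "degree h \<le> r" "!!u v. hev r h (to_ac u) (to_ac v) = hev n f (to_ac (u :: 'p mod_ring)) (to_ac v)"
          using psi_kernel[of f n r, OF _ r] by blast
        then show ?thesis unfolding P_def by blast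
      qed
      have P_uniq: "h = h'" if "P f h" "P f h'" for f h h'
      proof -
        have deg: "degree h \<le> r" "degree h' \<le> r" using that by (auto simp: P_def)
        have "poly (h - h') (to_ac x) = 0" for x :: "'p mod_ring"
        proof -
          have "hev r h (to_ac x) (to_ac 1) = hev r h' (to_ac x) (to_ac 1)"
            using that unfolding P_def by (elim conjE) (drule spec[of _ x], drule spec[of _ 1], drule spec[of _ x], drule spec[of _ 1], simp only:)
          then show ?thesis using hev_1[OF deg(1)] hev_1[OF deg(2)] by simp
        qed
        moreover have "degree (h - h') \<le> r" using deg by (intro degree_diff_le) auto
        ultimately have "h - h' = 0" using r odd by (intro vanish_on_Fp) auto
        then show ?thesis by simp
      qed
      define \<psi> where "\<psi> f = (THE h. P f h)" for f
      have \<psi>: "P f (\<psi> f)" if "f \<in> K" for f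
        unfolding \<psi>_def using P_ex[OF that] P_uniq by (metis theI)
      have \<psi>_eq: "\<psi> f = h" if "P f h" for f h
        unfolding \<psi>_def using that P_uniq by (intro the_equality)
      have eqv: "equivariant (sym_act n) K (weight_act (0, Suc r)) \<psi>"
        unfolding equivariant_def weight_act_sym
      proof (intro conjI ballI allI)
        fix f h assume "f \<in> K" "h \<in> K"
        then show "\<psi> (f + h) = \<psi> f + \<psi> h"
          using \<psi>[of f] \<psi>[of h] by (intro \<psi>_eq) (auto simp: P_def hev_add degree_add_le)
      next
        fix c f assume "f \<in> K"
        then show "\<psi> (smult c f) = smult c (\<psi> f)"
          using \<psi>[of f] by (intro \<psi>_eq) (auto simp: P_def hev_smult degree_smult_le[THEN order_trans])
      next
        fix g :: "'p gmat" and f assume "g \<in> GL" "f \<in> K"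
        then show "\<psi> (sym_act n g f) = sym_act r g (\<psi> f)"
          using \<psi>[of f] by (intro \<psi>_eq) (auto simp: P_def hev_sym_act degree_sym_act simp flip: to_ac_mult to_ac_add)
      qed
      have "subq (sym_act n) {f \<in> K. \<psi> f = 0} (a, b) \<or> subq (weight_act (0, Suc r)) (\<psi> ` K) (a, b)"
        by (rule subq_extension[OF subK less.prems(3,4) eqv]) simp
      then show ?thesis
      proof
        assume "subq (weight_act (0, Suc r)) (\<psi> ` K) (a, b)"
        moreover have "\<psi> ` K \<subseteq> sym_space (Suc r - 1)" using \<psi> by (auto simp: P_def sym_space_def)
        ultimately have q: "subq (weight_act (0, Suc r)) (sym_space (Suc r - 1) :: 'p fp_bar poly set) (a, b)"
          by (rule subq_mono)
        have ab: "b = Suc r" "a mod (?p - 1) = 0 mod (?p - 1)"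
          using subq_simple[OF q] less.prems r odd by auto
        then have "a = 0" using small[of a 0] less.prems by auto
        then show ?thesis using ab r nr odd by (auto simp: kf_def)
      next
        assume "subq (sym_act n) {f \<in> K. \<psi> f = 0} (a, b)"
        moreover have "{f \<in> K. \<psi> f = 0} \<subseteq> vanishing n"
        proof
          fix f assume "f \<in> {f \<in> K. \<psi> f = 0}"
          then have f: "f \<in> K" "P f 0" using \<psi>[of f] by auto
          then show "f \<in> vanishing n"
            by (auto simp: vanishing_def K_def P_def HE_0[OF comm_ring_hom_id])
        qed
        ultimately have sub: "subq (sym_act n) (vanishing n :: 'p fp_bar poly set) (a, b)" by (rule subq_mono)
        have n': "n \<ge> ?p + 1"
        proof (rule ccontr)
          assume "\<not> n \<ge> ?p + 1"
          then have "vanishing n \<subseteq> {0 :: 'p fp_bar poly}" using vanishing_theta(2) by blast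
          then show False using subq_mono[OF sub] subq_zero by blast
        qed
        define k where "k = n - (?p + 1)"
        have nk: "n = 1 * (?p + 1) + k" using n' by (simp add: k_def)
        have div: "f = \<theta> * (f div \<theta>)" "degree (f div \<theta>) \<le> k" if "f \<in> vanishing n" for f :: "'p fp_bar poly"
          using vanishing_theta[OF that] by (cases "f = 0"; auto simp: k_def)+
        have eqv0: "equivariant (sym_act n) (vanishing n) (weight_act (1, Suc k)) (%f. f div (\<theta> :: 'p fp_bar poly))"
          unfolding equivariant_def
        proof (intro conjI ballI allI)
          fix f h :: "'p fp_bar poly" assume "f \<in> vanishing n" "h \<in> vanishing n"
          then have "f + h = \<theta> * (f div \<theta> + h div \<theta>)" using div(1) by (metis distrib_left)
          then show "(f + h) div \<theta> = f div \<theta> + h div \<theta>" by (metis nonzero_mult_div_cancel_left theta_neq_0)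
        next
          fix c and f :: "'p fp_bar poly" assume "f \<in> vanishing n"
          then show "smult c f div \<theta> = smult c (f div \<theta>)" by (simp add: div_smult_left)
        next
          fix g :: "'p gmat" and f :: "'p fp_bar poly" assume "g \<in> GL" "f \<in> vanishing n"
          then have "sym_act n g f = smult (to_ac (det g) ^ 1) (\<theta> ^ 1 * sym_act k g (f div \<theta>))"
            using sym_act_theta_power_mult[of "f div \<theta>" k 1 g] div[of f] nk by simp
          then show "sym_act n g f div \<theta> = weight_act (1, Suc k) g (f div \<theta>)"
            by (simp add: weight_act_def div_smult_left)
        qed
        have "subq (sym_act n) {f \<in> vanishing n. f div \<theta> = (0 :: 'p fp_bar poly)} (a, b) \<or>
            subq (weight_act (1, Suc k)) ((%f. f div \<theta>) ` (vanishing n :: 'p fp_bar poly set)) (a, b)"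
          by (rule subq_extension[OF sub less.prems(3,4) eqv0]) simp
        moreover have "{f \<in> vanishing n. f div \<theta> = 0} \<subseteq> {0 :: 'p fp_bar poly}"
        proof
          fix f :: "'p fp_bar poly" assume f: "f \<in> {f \<in> vanishing n. f div \<theta> = 0}"
          have "f = \<theta> * (f div \<theta>)" by (rule div(1)) (use f in blast)
          moreover have "f div \<theta> = 0" using f by blast
          ultimately show "f \<in> {0}" by (metis mult_zero_right singletonI)
        qed
        then have "\<not> subq (sym_act n) {f \<in> vanishing n. f div \<theta> = (0 :: 'p fp_bar poly)} (a, b)"
          using subq_mono subq_zero by blast
        ultimately have "subq (weight_act (1, Suc k)) ((%f. f div \<theta>) ` (vanishing n :: 'p fp_bar poly set)) (a, b)"
          by blast
        moreover have "(%f. f div \<theta>) ` (vanishing n :: 'p fp_bar poly set) \<subseteq> sym_space k"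
          using div(2) by (auto simp: sym_space_def)
        ultimately have sk: "subq (weight_act (1, Suc k)) (sym_space k :: 'p fp_bar poly set) (a, b)"
          by (rule subq_mono)
        \<comment> \<open>This is a - 1 modulo p - 1, the weight before the twist by det.\<close>
        define a' where "a' = (a + ?p - 2) mod (?p - 1)"
        have "(a' + 1) mod (?p - 1) = (a + ?p - 2 + 1) mod (?p - 1)" by (simp add: a'_def mod_simps)
        also have "a + ?p - 2 + 1 = a + (?p - 1)" using odd by simp
        also have "(a + (?p - 1)) mod (?p - 1) = a mod (?p - 1)" by (rule mod_add_self2)
        finally have "(a' + 1) mod (?p - 1) = a mod (?p - 1)" .
        with sk have "subq (sym_act k) (sym_space k :: 'p fp_bar poly set) (a', b)"
          by (rule subq_untwist)
        moreover have "a' < ?p - 1" unfolding a'_def using odd by (intro mod_less_divisor) auto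
        then have "a' \<le> ?p - 2" by linarith
        moreover have "k < n" using n' odd by (simp add: k_def)
        ultimately have "kf ?p a' b \<le> k" using less.IH less.prems by blast
        then show ?thesis
          using kf_step[of ?p a b] odd less.prems nk by (simp add: a'_def)
      qed
    qed
  qed
qed

subsection \<open>Existence of composition series\<close>

text \<open>A substitute for dimension: by cancelling leading terms, a strict inclusion of
  submodules is a strict inclusion of degree sets, so chains inside \<open>sym_space n\<close> are
  finite.\<close>

definition deg_set :: "'p :: prime_card fp_bar poly set => nat set" where
  "deg_set U = degree ` (U - {0})"

lemma deg_set_strict:
  assumes "submodule act U" "submodule act V" "U \<subset> V"
  shows "deg_set U \<subset> deg_set V"
proof -
  have sub: "deg_set U \<subseteq> deg_set V" using assms(3) by (auto simp: deg_set_def)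
  have "deg_set U ~= deg_set V"
  proof
    assume eq: "deg_set U = deg_set V"
    have "f \<in> U" if "f \<in> V" for f
      using that
    proof (induction "degree f" arbitrary: f rule: less_induct)
      case less
      show ?case
      proof (cases "f = 0")
        case True
        then show ?thesis using submoduleD(1)[OF assms(1)] by simp
      next
        case False
        then have "degree f \<in> deg_set V" using less.prems by (auto simp: deg_set_def)
        then have "degree f \<in> deg_set U" unfolding eq .
        then obtain h where "h \<in> U - {0}" "degree f = degree h" unfolding deg_set_def by blast
        then have h: "h \<in> U" "h ~= 0" "degree h = degree f" by auto
        define t where "t = lead_coeff f / lead_coeff h"
        define f' where "f' = f - smult t h"
        have "coeff h (degree f) ~= 0" using h by (metis leading_coeff_0_iff)
        then have cf: "coeff f' (degree f) = 0" using h by (simp add: f'_def t_def)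
        have df: "degree f' \<le> degree f"
          unfolding f'_def using h degree_smult_le[of t h] by (intro degree_diff_le) auto
        have f'V: "f' \<in> V" unfolding f'_def
          using less.prems h(1) assms(3) by (intro submodule_diff[OF assms(2)] submoduleD(3)[OF assms(2)]) auto
        have "f' \<in> U"
        proof (cases "f' = 0")
          case True
          then show ?thesis using submoduleD(1)[OF assms(1)] by simp
        next
          case False
          then have "degree f' < degree f" using cf df by (metis le_neq_implies_less leading_coeff_0_iff)
          then show ?thesis using less.hyps f'V by blast
        qed
        then have "f' + smult t h \<in> U" using h submoduleD(2,3)[OF assms(1)] by blast
        then show ?thesis by (simp add: f'_def)
      qed
    qed
    then show False using assms(3) by blast
  qed
  with sub show ?thesis by blast
qed

definition covers ::
  "('p :: prime_card gmat => 'p fp_bar poly => 'p fp_bar poly) => 'p fp_bar poly set => 'p fp_bar poly set => bool" where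
  "covers act A B \<longleftrightarrow> A \<subset> B \<and> \<not> (\<exists>U. submodule act U \<and> A \<subset> U \<and> U \<subset> B)"

definition chain ::
  "('p :: prime_card gmat => 'p fp_bar poly => 'p fp_bar poly) => 'p fp_bar poly set => 'p fp_bar poly set =>
     'p fp_bar poly set list => bool" where
  "chain act A B Ms \<longleftrightarrow> Ms ~= [] \<and> hd Ms = A \<and> last Ms = B \<and> (\<forall>U\<in>set Ms. submodule act U) \<and>
     successively (covers act) Ms"

lemma chain_append_covers:
  "chain act A B Ms ==> covers act B C ==> chain act C D Ns ==> chain act A D (Ms @ Ns)"
  by (auto simp: chain_def successively_append_iff)

lemma chain_join:
  assumes "chain act A B Ms" "chain act B C Ns"
  shows "\<exists>Ls. chain act A C Ls"
proof (cases "tl Ns = []")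
  case True
  then have "Ns = [B]" using assms(2) by (cases Ns) (auto simp: chain_def)
  then have "C = B" using assms(2) by (simp add: chain_def)
  then show ?thesis using assms(1) by blast
next
  case False
  then obtain x xs where Ns: "Ns = B # x # xs"
    using assms(2) by (cases Ns; cases "tl Ns") (auto simp: chain_def)
  have "chain act x C (x # xs)" "covers act B x"
    using assms(2) unfolding chain_def Ns by (auto simp: successively_Cons)
  then show ?thesis using chain_append_covers[OF assms(1)] by blast
qed

text \<open>Induction on the number of degrees in M but not in N: if some submodule lies strictly
  between, both halves have fewer.\<close>

lemma chain_exists:
  assumes "finite (deg_set M)"
  shows "submodule act N ==> submodule act M ==> N \<subseteq> M ==> \<exists>Ms. chain act N M Ms"
  using assms
proof (induction "card (deg_set M - deg_set N)" arbitrary: N M rule: less_induct)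
  case less
  show ?case
  proof (cases "N = M")
    case True
    then show ?thesis using less.prems by (intro exI[of _ "[N]"]) (simp add: chain_def)
  next
    case False
    then have NM: "N \<subset> M" using less.prems by blast
    show ?thesis
    proof (cases "\<exists>U. submodule act U \<and> N \<subset> U \<and> U \<subset> M")
      case True
      then obtain U where U: "submodule act U" "N \<subset> U" "U \<subset> M" by blast
      have s: "deg_set N \<subset> deg_set U" "deg_set U \<subset> deg_set M"
        using deg_set_strict less.prems(1,2) U by blast+
      have fU: "finite (deg_set U)" using s(2) less.prems(4) by (meson finite_subset psubset_imp_subset)
      have "card (deg_set U - deg_set N) < card (deg_set M - deg_set N)"
        using s less.prems(4) by (intro psubset_card_mono) auto
      moreover have "card (deg_set M - deg_set U) < card (deg_set M - deg_set N)"
        using s less.prems(4) by (intro psubset_card_mono) auto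
      ultimately have "\<exists>Ms. chain act N U Ms" "\<exists>Ms. chain act U M Ms"
        using less.hyps[of U N] less.hyps[of M U] less.prems U fU by auto
      then show ?thesis using chain_join by blast
    next
      case none: False
      then have "covers act N M" using NM by (auto simp: covers_def)
      then show ?thesis using less.prems by (intro exI[of _ "[N, M]"]) (auto simp: chain_def)
    qed
  qed
qed

lemma composition_series_chain: "composition_series act M Ms \<longleftrightarrow> chain act {0} M Ms"
  by (auto simp: composition_series_def chain_def successively_conv_nth covers_def)

lemma finite_deg_set: "finite (deg_set (sym_space n))"
  by (rule finite_subset[of _ "{..n}"]) (auto simp: deg_set_def sym_space_def)

text \<open>The multiples of \<theta>^j form a submodule A on which the action is that of Sym^m
  twisted by det^j. The kernel B of the map to the simple weight is covered by A, and chains from 0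
  to B and from A to the top complete a composition series.\<close>

lemma jh_construct:
  fixes \<psi> :: "'p :: prime_card fp_bar poly => 'p fp_bar poly"
  assumes \<psi>: "equivariant (sym_act m) (sym_space m) (weight_act (a', b)) \<psi>" "\<psi> ` sym_space m = sym_space (b - 1)"
    and b: "1 \<le> b" "b \<le> CARD('p)"
  shows "jh_constituent (weight_act (a' + j, b)) (sym_space (b - 1) :: 'p fp_bar poly set)
      (sym_act (j * (CARD('p) + 1) + m)) (sym_space (j * (CARD('p) + 1) + m))"
proof -
  define n where "n = j * (CARD('p) + 1) + m"
  let ?act = "sym_act n :: 'p gmat => _"
  define A where "A = (%f. \<theta> ^ j * f) ` (sym_space m :: 'p fp_bar poly set)"
  define \<phi> where "\<phi> f = \<psi> (f div \<theta> ^ j)" for f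
  have \<theta>j: "(\<theta> ^ j :: 'p fp_bar poly) ~= 0" by simp
  have \<phi>: "\<phi> (\<theta> ^ j * f) = \<psi> f" for f by (simp add: \<phi>_def)
  have act: "?act g (\<theta> ^ j * f) = \<theta> ^ j * smult (to_ac (det g) ^ j) (sym_act m g f)" if "f \<in> sym_space m" for f g
    using that sym_act_theta_power_mult[of f m j g] by (simp add: n_def sym_space_def)
  note S = submoduleD[OF submodule_sym_space[of m]]
  have A: "submodule ?act A"
    unfolding submodule_iff
  proof (intro conjI ballI allI)
    show "0 \<in> A" unfolding A_def by (rule image_eqI[OF _ S(1)]) simp
    fix f h assume "f \<in> A" "h \<in> A"
    then obtain x y where xy: "x \<in> sym_space m" "y \<in> sym_space m" "f = \<theta> ^ j * x" "h = \<theta> ^ j * y"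
      by (auto simp: A_def)
    have "f + h = \<theta> ^ j * (x + y)" by (simp add: xy distrib_left)
    then show "f + h \<in> A" unfolding A_def using S(2)[OF xy(1,2)] by blast
  next
    fix c f assume "f \<in> A"
    then obtain x where x: "x \<in> sym_space m" "f = \<theta> ^ j * x" by (auto simp: A_def)
    have "smult c f = \<theta> ^ j * smult c x" by (simp add: x)
    then show "smult c f \<in> A" unfolding A_def using S(3)[OF x(1), of c] by blast
  next
    fix g :: "'p gmat" and f assume g: "g \<in> GL" and "f \<in> A"
    then obtain x where x: "x \<in> sym_space m" "f = \<theta> ^ j * x" by (auto simp: A_def)
    then show "?act g f \<in> A" unfolding A_def using S(3,4) g act[OF x(1)] by blast
  qed
  have An: "A \<subseteq> sym_space n"
  proof
    fix f assume "f \<in> A"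
    then obtain h where h: "f = \<theta> ^ j * h" "degree h \<le> m" by (auto simp: A_def sym_space_def)
    have "degree f \<le> degree ((\<theta> :: 'p fp_bar poly) ^ j) + degree h" unfolding h by (rule degree_mult_le)
    also have "\<dots> \<le> n" unfolding n_def using h degree_theta_power_le by (intro add_mono)
    finally show "f \<in> sym_space n" by (simp add: sym_space_def)
  qed
  have eqv: "equivariant ?act A (weight_act (a' + j, b)) \<phi>"
    unfolding equivariant_def
  proof (intro conjI ballI allI)
    fix f h assume "f \<in> A" "h \<in> A"
    then obtain f' h' where "f = \<theta> ^ j * f'" "h = \<theta> ^ j * h'" "f' \<in> sym_space m" "h' \<in> sym_space m" by (auto simp: A_def)
    then show "\<phi> (f + h) = \<phi> f + \<phi> h"
      using equivariantD(1)[OF \<psi>(1)] by (simp add: \<phi> flip: distrib_left)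
  next
    fix c f assume "f \<in> A"
    then obtain f' where f': "f = \<theta> ^ j * f'" "f' \<in> sym_space m" by (auto simp: A_def)
    have "\<phi> (\<theta> ^ j * smult c f') = smult c (\<phi> (\<theta> ^ j * f'))"
      unfolding \<phi> using f' equivariantD(2)[OF \<psi>(1)] by simp
    then show "\<phi> (smult c f) = smult c (\<phi> f)" by (simp add: f')
  next
    fix g :: "'p gmat" and f assume g: "g \<in> GL" and "f \<in> A"
    then obtain f' where f': "f = \<theta> ^ j * f'" "f' \<in> sym_space m" by (auto simp: A_def)
    have "\<phi> (?act g f) = \<psi> (smult (to_ac (det g) ^ j) (sym_act m g f'))"
      unfolding f'(1) act[OF f'(2)] \<phi> ..
    also have "\<dots> = smult (to_ac (det g) ^ j) (weight_act (a', b) g (\<psi> f'))"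
      using equivariantD(2)[OF \<psi>(1) S(4)[OF g f'(2)]] equivariantD(3)[OF \<psi>(1) g f'(2)] by simp
    finally show "\<phi> (?act g f) = weight_act (a' + j, b) g (\<phi> f)"
      unfolding f'(1) \<phi> by (simp add: weight_act_def power_add mult.commute)
  qed
  have im: "\<phi> ` A = sym_space (b - 1)" unfolding A_def image_image \<phi> by (rule \<psi>(2))
  define B where "B = {f \<in> A. \<phi> f = 0}"
  have B: "submodule ?act B" unfolding B_def by (rule submodule_kernel[OF A eqv]) simp
  have one: "1 \<in> (sym_space (b - 1) :: 'p fp_bar poly set)" by (simp add: sym_space_def)
  have cov: "covers ?act B A"
    unfolding covers_def
  proof
    obtain f where f: "f \<in> A" "\<phi> f = 1" using one unfolding im[symmetric] by (metis imageE)
    then have "f \<notin> B" by (simp add: B_def)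
    moreover have "B \<subseteq> A" by (auto simp: B_def)
    ultimately show "B \<subset> A" using f(1) by blast
    show "\<not> (\<exists>U. submodule ?act U \<and> B \<subset> U \<and> U \<subset> A)"
    proof
      assume "\<exists>U. submodule ?act U \<and> B \<subset> U \<and> U \<subset> A"
      then obtain U where U: "submodule ?act U" "B \<subset> U" "U \<subset> A" by blast
      have eU: "equivariant ?act U (weight_act (a' + j, b)) \<phi>"
        using eqv U(3) by (intro equivariant_subset[OF eqv]) auto
      obtain u where u: "u \<in> U" "u \<notin> B" using U by blast
      then have "\<phi> u ~= 0" using U by (auto simp: B_def)
      then have "\<phi> ` U ~= {0}" using u by blast
      moreover have "\<phi> ` U \<subseteq> sym_space (b - 1)" using im U(3) by blast
      ultimately have imU: "\<phi> ` U = sym_space (b - 1)"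
        by (intro weight_simple[OF b submodule_image[OF U(1) eU]])
      have "f \<in> U" if f: "f \<in> A" for f
      proof -
        have "\<phi> f \<in> \<phi> ` U" using f im imU by blast
        then obtain u where u: "u \<in> U" "\<phi> f = \<phi> u" by blast
        then have "f - u \<in> B" unfolding B_def
          using f U(3) equivariant_diff[OF eqv A, of f u] submodule_diff[OF A, of f u] by auto
        then have "(f - u) + u \<in> U" using u U(2) submoduleD(2)[OF U(1)] by blast
        then show ?thesis by simp
      qed
      then show False using U(3) by blast
    qed
  qed
  have fin: "finite (deg_set S)" if "S \<subseteq> sym_space n" for S :: "'p fp_bar poly set"
    using finite_deg_set by (rule finite_subset[rotated]) (use that in \<open>auto simp: deg_set_def\<close>)
  have zero: "submodule ?act {0}" by (simp add: submodule_iff sym_act_0)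
  obtain Ms where Ms: "chain ?act {0} B Ms"
    using chain_exists[of B ?act "{0}"] fin[of B] An zero B submoduleD(1)[OF B] by (auto simp: B_def)
  obtain Ns where Ns: "chain ?act A (sym_space n) Ns"
    using chain_exists[of "sym_space n" ?act A] finite_deg_set A submodule_sym_space An by blast
  have "chain ?act {0} (sym_space n) (Ms @ Ns)" by (rule chain_append_covers[OF Ms cov Ns])
  moreover have "Ms ~= []" "Ns ~= []" using Ms Ns by (auto simp: chain_def)
  moreover have "(Ms @ Ns) ! (length Ms - 1) = B"
  proof -
    have "last Ms = B" using Ms by (simp add: chain_def)
    then show ?thesis using \<open>Ms ~= []\<close> last_conv_nth[of Ms] by (simp add: nth_append)
  qed
  moreover have "(Ms @ Ns) ! Suc (length Ms - 1) = A"
    using Ns \<open>Ms ~= []\<close> \<open>Ns ~= []\<close> by (simp add: nth_append chain_def flip: hd_conv_nth)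
  moreover have "quotient_iso ?act A B (weight_act (a' + j, b)) (sym_space (b - 1))"
    unfolding quotient_iso_def using equivariantD[OF eqv] im by (intro exI[of _ \<phi>]) (auto simp: B_def)
  ultimately show ?thesis
    unfolding jh_constituent_def n_def[symmetric] composition_series_chain
    by (intro exI[of _ "Ms @ Ns"] exI[of _ "length Ms - 1"]) (simp add: length_greater_0_conv)
qed

lemma jh_imp_subq:
  fixes M :: "'p :: prime_card fp_bar poly set"
  assumes "jh_constituent (weight_act (a, b)) (sym_space (b - 1)) act M"
  shows "subq act M (a, b)"
proof -
  obtain Ms i where Ms: "chain act {0} M Ms" "Suc i < length Ms"
    "quotient_iso act (Ms ! Suc i) (Ms ! i) (weight_act (a, b)) (sym_space (b - 1))"
    using assms by (auto simp: jh_constituent_def composition_series_chain)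
  have mono: "Ms ! k \<subseteq> Ms ! l" if "k \<le> l" "l < length Ms" for k l
    using that
  proof (induction l rule: dec_induct)
    case (step l)
    have "covers act (Ms ! l) (Ms ! Suc l)"
      using Ms(1) step.prems by (auto simp: chain_def successively_conv_nth)
    then show ?case using step by (auto simp: covers_def)
  qed simp
  have "Ms ! Suc i \<subseteq> Ms ! (length Ms - 1)" using Ms(2) by (intro mono) auto
  also have "\<dots> = M" using Ms(1) by (auto simp: chain_def last_conv_nth)
  finally have sub: "Ms ! Suc i \<subseteq> M" .
  have "submodule act (Ms ! Suc i)" using Ms by (auto simp: chain_def)
  moreover obtain \<phi> where "equivariant act (Ms ! Suc i) (weight_act (a, b)) \<phi>" "\<phi> ` (Ms ! Suc i) = sym_space (b - 1)"
    using Ms(3) by (auto simp: quotient_iso_def equivariant_def)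
  ultimately show ?thesis unfolding subq_def using sub by auto
qed

text \<open>\<open>jh_construct\<close> attains the degree and \<open>subq_lower\<close> excludes
  smaller ones; the summand 2 is the shift between k and Sym^(k-2).\<close>

theorem k_min_eq:
  assumes odd: "CARD('p :: prime_card) \<ge> 3" and a: "a \<le> CARD('p) - 2" and b: "1 \<le> b" "b \<le> CARD('p)"
  shows "k_min TYPE('p) (a, b) = kf CARD('p) a b + 2"
proof -
  let ?p = "CARD('p)"
  have ex: "jh_constituent (weight_act (a, b)) (sym_space (b - 1) :: 'p fp_bar poly set)
      (sym_act (kf ?p a b)) (sym_space (kf ?p a b))"
  proof (cases "a + b < ?p \<or> b = ?p")
    case True
    have "equivariant (sym_act (b - 1)) (sym_space (b - 1) :: 'p fp_bar poly set) (weight_act (0, b)) (%f. f)"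
      by (simp add: equivariant_def weight_act_def)
    then have "jh_constituent (weight_act (0 + a, b)) (sym_space (b - 1) :: 'p fp_bar poly set)
      (sym_act (a * (?p + 1) + (b - 1))) (sym_space (a * (?p + 1) + (b - 1)))"
      by (rule jh_construct) (use b in auto)
    then show ?thesis using True b by (simp add: kf_def)
  next
    case False
    \<comment> \<open>The target of \<open>psi\<close> has degree p - 1 - r, which this choice makes
      equal to b - 1.\<close>
    define r where "r = ?p - b"
    have r: "1 \<le> r" "r \<le> ?p - 1" "?p - r = b" using False b by (auto simp: r_def)
    define m where "m = r + (?p - 1)"
    have m': "?p - 1 - r = b - 1" using r by simp
    have eqv: "equivariant (sym_act m) (sym_space m :: 'p fp_bar poly set) (weight_act (r, b)) (psi (b - 1) m)"
      using psi_equivariant[OF r(1,2), of m] unfolding r(3) m' .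
    have im: "psi (b - 1) m ` sym_space m = (sym_space (b - 1) :: 'p fp_bar poly set)"
    proof (rule weight_simple[OF b submodule_image[OF submodule_sym_space eqv]])
      show "psi (b - 1) m ` sym_space m \<subseteq> (sym_space (b - 1) :: 'p fp_bar poly set)"
        using degree_psi by (auto simp: sym_space_def)
      have "monom (1 :: 'p fp_bar) r \<in> sym_space m" using odd by (auto simp: sym_space_def m_def degree_monom_eq)
      moreover have "psi (b - 1) m (monom (1 :: 'p fp_bar) r) ~= 0"
        using psi_monom_neq_0[OF r(1,2)] unfolding m' m_def .
      ultimately show "psi (b - 1) m ` sym_space m ~= {0 :: 'p fp_bar poly}" by blast
    qed
    have "jh_constituent (weight_act (r + (a + b - ?p), b)) (sym_space (b - 1) :: 'p fp_bar poly set)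
      (sym_act ((a + b - ?p) * (?p + 1) + m)) (sym_space ((a + b - ?p) * (?p + 1) + m))"
      by (rule jh_construct[OF eqv im b])
    moreover have "r + (a + b - ?p) = a" using False b by (auto simp: r_def)
    moreover have "(a + b - ?p) * (?p + 1) + m = kf ?p a b"
      using False b by (auto simp: kf_def m_def r_def)
    ultimately show ?thesis by simp
  qed
  show ?thesis
    unfolding k_min_def
  proof (rule Least_equality)
    show "2 \<le> kf ?p a b + 2 \<and> jh_constituent (weight_act (a, b)) (sym_space (snd (a, b) - 1) :: 'p fp_bar poly set)
        (sym_act (kf ?p a b + 2 - 2)) (sym_space (kf ?p a b + 2 - 2))"
      using ex by simp
    fix k assume "2 \<le> k \<and> jh_constituent (weight_act (a, b)) (sym_space (snd (a, b) - 1) :: 'p fp_bar poly set)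
        (sym_act (k - 2)) (sym_space (k - 2))"
    then have k: "2 \<le> k" "subq (sym_act (k - 2)) (sym_space (k - 2) :: 'p fp_bar poly set) (a, b)"
      using jh_imp_subq by auto
    then have "kf ?p a b \<le> k - 2" using subq_lower[OF odd k(2) a b] by simp
    then show "kf ?p a b + 2 \<le> k" using k(1) by linarith
  qed
qed

section \<open>Galois theory of the algebraic closure\<close>

abbreviation Gal :: "('k :: field alg_closure => 'k alg_closure) set" where
  "Gal \<equiv> carrier abs_galois"

lemma Gal_iff: "sg \<in> Gal \<longleftrightarrow> field_hom sg \<and> bij sg \<and> (\<forall>x. sg (to_ac x) = to_ac x)"
  by (simp add: abs_galois_def)

lemma field_hom_injective:
  assumes "field_hom sg"
  shows "inj sg"
proof -
  interpret field_hom sg by fact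
  show ?thesis
  proof (rule injI, rule ccontr)
    fix x y assume *: "sg x = sg y" "x ~= y"
    have "1 = sg ((x - y) * inverse (x - y))" using *(2) by simp
    also have "\<dots> = 0" using *(1) by (simp only: hom_mult hom_minus) simp
    finally show False by simp
  qed
qed

lemma poly_to_ac_hom:
  assumes "field_hom sg" "!!c. sg (to_ac c) = to_ac c"
  shows "poly (map_poly to_ac f) (sg x) = sg (poly (map_poly to_ac f) x)"
proof -
  interpret field_hom sg by fact
  have "map_poly sg (map_poly to_ac f) = map_poly to_ac f"
    by (rule poly_eqI) (simp add: coeff_map_poly assms(2))
  then show ?thesis
    using poly_map_poly[of "map_poly to_ac f" x] by simp
qed

lemma map_poly_to_ac_eq_0_iff [simp]: "map_poly to_ac f = 0 \<longleftrightarrow> f = 0"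
  by (metis map_poly_eq_0_iff to_ac_0 to_ac_eq_0_iff)

lemma degree_map_poly_to_ac [simp]: "degree (map_poly to_ac f) = degree f"
  by (rule degree_map_poly) simp

text \<open>An injective endomorphism over the base permutes the finitely many roots of any
  polynomial over the base, and every element is such a root.\<close>

lemma k_hom_bij:
  fixes sg :: "'k :: field alg_closure => 'k alg_closure"
  assumes "field_hom sg" "!!c. sg (to_ac c) = to_ac c"
  shows "bij sg"
proof -
  have inj: "inj sg" by (rule field_hom_injective) fact
  have "y \<in> range sg" for y
  proof -
    obtain f where f: "f ~= 0" "poly (map_poly to_ac f) y = 0"
      by (rule alg_closure_algebraic)
    let ?S = "{x. poly (map_poly to_ac f) x = 0}"
    have fin: "finite ?S" by (rule poly_roots_finite) (simp add: f)
    interpret field_hom sg by fact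
    have "sg ` ?S \<subseteq> ?S" by (auto simp: poly_to_ac_hom[OF assms])
    then have "sg ` ?S = ?S"
      using fin inj by (metis endo_inj_surj inj_on_subset subset_UNIV)
    then show ?thesis using f by blast
  qed
  with inj show ?thesis by (auto simp: bij_def)
qed

lemma GalI: "field_hom sg ==> (!!c. sg (to_ac c) = to_ac c) ==> sg \<in> Gal"
  by (simp add: Gal_iff k_hom_bij)

lemma Gal_hom: "sg \<in> Gal ==> field_hom sg"
  and Gal_bij: "sg \<in> Gal ==> bij sg"
  and Gal_to_ac [simp]: "sg \<in> Gal ==> sg (to_ac c) = to_ac c"
  by (simp_all add: Gal_iff)

lemma field_homI:
  assumes "!!x y. h (x + y) = h x + h y" "!!x y. h (x * y) = h x * h y" "h 1 = (1 :: 'b :: field)"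
  shows "field_hom (h :: 'a :: field => 'b)"
proof -
  have "h 0 + h 0 = h 0 + 0" using assms(1)[of 0 0] by simp
  then have "h 0 = 0" by (simp only: add_left_cancel)
  then show ?thesis by unfold_locales (auto simp: assms)
qed

context
  fixes sg :: "'k :: field alg_closure => 'k alg_closure"
  assumes sg: "sg \<in> Gal"
begin

interpretation field_hom sg using sg by (rule Gal_hom)

lemma Gal_add: "sg (x + y) = sg x + sg y" by (rule hom_add)
lemma Gal_mult: "sg (x * y) = sg x * sg y" by (rule hom_mult)
lemma Gal_diff: "sg (x - y) = sg x - sg y" by (rule hom_minus)
lemma Gal_uminus: "sg (- x) = - sg x" by (rule hom_uminus)
lemma Gal_divide: "sg (x / y) = sg x / sg y" by (rule hom_div)
lemma Gal_inverse: "sg (inverse x) = inverse (sg x)" by (rule hom_inverse)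
lemma Gal_power: "sg (x ^ n) = sg x ^ n" by (rule hom_power)
lemma Gal_sum: "sg (sum f A) = (\<Sum>a\<in>A. sg (f a))" by (rule hom_sum)
lemma Gal_0: "sg 0 = 0" by simp
lemma Gal_1: "sg 1 = 1" by simp
lemma Gal_of_nat: "sg (of_nat n) = of_nat n" by (rule hom_of_nat)
lemma Gal_eq_iff: "sg x = sg y \<longleftrightarrow> x = y"
  using field_hom_injective[OF Gal_hom[OF sg]] by (auto dest: injD)
lemma Gal_eq_0_iff: "sg x = 0 \<longleftrightarrow> x = 0"
  using Gal_eq_iff[of x 0] by simp
lemma Gal_poly: "poly (map_poly to_ac f) (sg x) = sg (poly (map_poly to_ac f) x)"
  using sg by (intro poly_to_ac_hom) (auto simp: Gal_iff)

end

lemmas Gal_simps = Gal_add Gal_mult Gal_diff Gal_uminus Gal_divide Gal_inverse Gal_power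
  Gal_0 Gal_1 Gal_of_nat Gal_eq_iff Gal_eq_0_iff

lemma Gal_id [simp]: "id \<in> Gal"
  by (rule GalI) (auto intro: field_homI)

lemma Gal_comp: "sg \<in> Gal ==> \<tau> \<in> Gal ==> sg \<circ> \<tau> \<in> Gal"
  by (rule GalI) (auto intro!: field_homI simp: Gal_simps)

lemma Gal_inv:
  assumes "sg \<in> Gal"
  shows "inv_into UNIV sg \<in> Gal"
proof -
  have surj: "sg (inv_into UNIV sg x) = x" for x
    using Gal_bij[OF assms] by (simp add: bij_is_surj surj_f_inv_f)
  show ?thesis
  proof (rule GalI, rule field_homI)
    fix x y
    show "inv_into UNIV sg (x + y) = inv_into UNIV sg x + inv_into UNIV sg y"
      by (subst Gal_eq_iff[OF assms, symmetric]) (simp add: Gal_simps assms surj)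
    show "inv_into UNIV sg (x * y) = inv_into UNIV sg x * inv_into UNIV sg y"
      by (subst Gal_eq_iff[OF assms, symmetric]) (simp add: Gal_simps assms surj)
    show "inv_into UNIV sg 1 = 1"
      by (subst Gal_eq_iff[OF assms, symmetric]) (simp add: Gal_simps assms surj)
    show "inv_into UNIV sg (to_ac c) = to_ac c" for c
      by (subst Gal_eq_iff[OF assms, symmetric]) (simp add: Gal_simps assms surj)
  qed
qed

lemma Gal_inv_left: "sg \<in> Gal ==> inv_into UNIV sg (sg x) = x"
  and Gal_inv_right: "sg \<in> Gal ==> sg (inv_into UNIV sg x) = x"
  by (auto dest!: Gal_bij simp: bij_is_inj bij_is_surj surj_f_inv_f inv_f_f)

lemma Gal_pow: "sg \<in> Gal ==> sg ^^ n \<in> Gal"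
  by (induction n) (auto intro: Gal_comp simp del: id_apply simp flip: id_def)

subsection \<open>Extension of homomorphisms\<close>

text \<open>Since the closure is algebraic, subrings containing the base field are subfields.\<close>

definition ext_subring :: "'k :: field alg_closure set => bool" where
  "ext_subring E \<longleftrightarrow> (\<forall>c. to_ac c \<in> E) \<and> (\<forall>x\<in>E. \<forall>y\<in>E. x + y \<in> E \<and> x * y \<in> E)"

lemma ext_subring_range: "ext_subring (range to_ac)"
  by (auto simp: ext_subring_def simp flip: to_ac_add to_ac_mult)

context
  fixes E :: "'k :: field alg_closure set"
  assumes E: "ext_subring E"
begin

lemma ext_to_ac: "to_ac c \<in> E"
  and ext_add: "x \<in> E ==> y \<in> E ==> x + y \<in> E"
  and ext_mult: "x \<in> E ==> y \<in> E ==> x * y \<in> E"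
  using E by (auto simp: ext_subring_def)

lemma ext_0: "0 \<in> E" and ext_1: "1 \<in> E"
  using ext_to_ac[of 0] ext_to_ac[of 1] by simp_all

lemma ext_uminus: "x \<in> E ==> - x \<in> E"
  using ext_mult[of "to_ac (- 1)" x] ext_to_ac[of "- 1"] by simp

lemma ext_diff: "x \<in> E ==> y \<in> E ==> x - y \<in> E"
  using ext_add[of x "- y"] ext_uminus by simp

lemma ext_sum: "(!!i. i \<in> A ==> f i \<in> E) ==> sum f A \<in> E"
  by (induction A rule: infinite_finite_induct) (auto simp: ext_0 ext_add)

lemma ext_power: "x \<in> E ==> x ^ n \<in> E"
  by (induction n) (auto simp: ext_1 ext_mult)

lemma ext_of_nat: "of_nat n \<in> E"
  using ext_to_ac[of "of_nat n"] by simp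

lemma ext_poly: "(!!i. coeff f i \<in> E) ==> x \<in> E ==> poly f x \<in> E"
  by (auto simp: poly_altdef intro!: ext_sum ext_mult ext_power)

text \<open>Strip factors X from a relation satisfied by x until the constant term is nonzero, then
  solve for the inverse.\<close>

lemma ext_inverse:
  assumes "x \<in> E"
  shows "inverse x \<in> E"
proof (cases "x = 0")
  case False
  have *: "f ~= 0 ==> poly (map_poly to_ac f) x = 0 ==>
      \<exists>a g. a ~= 0 \<and> to_ac a + x * poly (map_poly to_ac g) x = 0" for f
  proof (induction f)
    case (pCons a f)
    show ?case
    proof (cases "a = 0")
      case True
      then show ?thesis using pCons False by (auto simp: map_poly_pCons)
    qed (use pCons in \<open>auto simp: map_poly_pCons\<close>)
  qed auto
  obtain f where "f ~= 0" "poly (map_poly to_ac f) x = 0"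
    by (rule alg_closure_algebraic)
  with * obtain a g where ag: "a ~= 0" "to_ac a + x * poly (map_poly to_ac g) x = 0" by blast
  then have "inverse x = to_ac (- inverse a) * poly (map_poly to_ac g) x"
    using False by (simp add: field_simps) (metis add.commute eq_neg_iff_add_eq_0)
  also have "\<dots> \<in> E" using assms
    by (intro ext_mult ext_to_ac ext_poly) (auto simp: coeff_map_poly ext_to_ac)
  finally show ?thesis .
qed (simp add: ext_0)

text \<open>f is a minimal polynomial of x over E. Division with remainder reduces any polynomial
  over E vanishing at x to a multiple of f, which vanishes at every root y of f.\<close>

lemma minimal_root_transfer:
  assumes f: "!!i. coeff f i \<in> E" "poly f y = 0"
    and min: "!!h. (!!i. coeff h i \<in> E) ==> h ~= 0 ==> poly h x = 0 ==> degree f \<le> degree h"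
    and f0: "poly f x = 0" "f ~= 0"
  shows "(!!i. coeff g i \<in> E) ==> poly g x = 0 ==> poly g y = 0"
proof (induction "degree g" arbitrary: g rule: less_induct)
  case less
  show ?case
  proof (cases "g = 0")
    case False
    then have le: "degree f \<le> degree g" using less min by blast
    define c where "c = lead_coeff g * inverse (lead_coeff f)"
    define h where "h = g - monom c (degree g - degree f) * f"
    have c: "c \<in> E" unfolding c_def by (intro ext_mult ext_inverse less f)
    have hE: "coeff h i \<in> E" for i
      unfolding h_def coeff_diff coeff_monom_mult
      using less(2) f(1) c by (auto intro!: ext_diff ext_mult ext_0)
    have hx: "poly h x = 0" by (simp add: h_def less f0)
    have lc: "coeff h (degree g) = 0"
      using le f0 by (simp add: h_def coeff_monom_mult c_def)
    have "degree (monom c (degree g - degree f) * f) \<le> degree g"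
    proof -
      have "degree (monom c (degree g - degree f) * f) \<le> degree (monom c (degree g - degree f)) + degree f"
        by (rule degree_mult_le)
      also have "\<dots> \<le> (degree g - degree f) + degree f" by (intro add_right_mono degree_monom_le)
      finally show ?thesis using le by simp
    qed
    then have "degree h \<le> degree g"
      unfolding h_def by (intro degree_diff_le) auto
    have "poly h y = 0"
    proof (cases "h = 0")
      case False
      then have "degree h < degree g"
        using lc \<open>degree h \<le> degree g\<close> by (metis le_neq_implies_less leading_coeff_0_iff)
      then show ?thesis using less hE hx by blast
    qed simp
    then show ?thesis by (simp add: h_def f)
  qed simp
qed

end

text \<open>The graph of a homomorphism over the base, kept as a relation so that unions of chains
  are immediate. Closure under the ring operations and the condition at 0 give single-valuedness,
  and the domain is a field by \<open>ext_inverse\<close>.\<close>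

definition partial_hom :: "('k :: field alg_closure \<times> 'k alg_closure) set => bool" where
  "partial_hom R \<longleftrightarrow> (\<forall>c. (to_ac c, to_ac c) \<in> R) \<and>
     (\<forall>a b c d. (a, b) \<in> R --> (c, d) \<in> R --> (a + c, b + d) \<in> R \<and> (a * c, b * d) \<in> R) \<and>
     (\<forall>b. (0, b) \<in> R --> b = 0)"

context
  fixes R :: "('k :: field alg_closure \<times> 'k alg_closure) set"
  assumes R: "partial_hom R"
begin

lemma ph_to_ac: "(to_ac s, to_ac s) \<in> R"
  and ph_add: "(a, b) \<in> R ==> (c, d) \<in> R ==> (a + c, b + d) \<in> R"
  and ph_mult: "(a, b) \<in> R ==> (c, d) \<in> R ==> (a * c, b * d) \<in> R"
  and ph_zero: "(0, b) \<in> R ==> b = 0"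
  using R by (auto simp: partial_hom_def)

lemma ph_00: "(0, 0) \<in> R" and ph_11: "(1, 1) \<in> R"
  using ph_to_ac[of 0] ph_to_ac[of 1] by simp_all

lemma ph_uminus: "(a, b) \<in> R ==> (- a, - b) \<in> R"
  using ph_mult[of "to_ac (- 1)" "to_ac (- 1)" a b] ph_to_ac[of "- 1"] by simp

lemma ph_diff: "(a, b) \<in> R ==> (c, d) \<in> R ==> (a - c, b - d) \<in> R"
  using ph_add[of a b "- c" "- d"] ph_uminus by simp

lemma ph_unique: "(a, b) \<in> R ==> (a, c) \<in> R ==> b = c"
  using ph_diff[of a b a c] ph_zero by fastforce

lemma ph_sum: "(!!i. i \<in> A ==> (f i, g i) \<in> R) ==> (sum f A, sum g A) \<in> R"
  by (induction A rule: infinite_finite_induct) (auto simp: ph_00 ph_add)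

lemma ph_Domain: "ext_subring (Domain R)"
  unfolding ext_subring_def using ph_to_ac ph_add ph_mult by (meson Domain_iff)

lemma ph_inverse:
  assumes "(a, b) \<in> R" "a ~= 0"
  obtains c where "(inverse a, c) \<in> R" "b * c = 1"
proof -
  from assms obtain c where c: "(inverse a, c) \<in> R"
    using ext_inverse[OF ph_Domain] by (meson Domain_iff)
  have "(1, b * c) \<in> R" using ph_mult[OF assms(1) c] assms(2) by simp
  then have "b * c = 1" using ph_11 ph_unique by blast
  with c that show ?thesis by blast
qed

text \<open>The classical one-step extension: transport a minimal polynomial of x over the domain
  along the homomorphism, choose a root y of the result, and send x to y.\<close>

lemma ph_extend:
  obtains R' y where "partial_hom R'" "R \<subseteq> R'" "(x, y) \<in> R'"
proof -
  \<comment> \<open>Pairs of polynomials with corresponding coefficients: the second is the image of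
    the first under the partial homomorphism.\<close>
  define P where "P = {(f, g). \<forall>i. (coeff f i, coeff g i) \<in> R}"
  have P_add: "(f + f', g + g') \<in> P" and P_mult: "(f * f', g * g') \<in> P"
    if "(f, g) \<in> P" "(f', g') \<in> P" for f g f' g'
    using that by (auto simp: P_def coeff_mult intro!: ph_add ph_sum ph_mult)
  have P_diff: "(f - f', g - g') \<in> P" if "(f, g) \<in> P" "(f', g') \<in> P" for f g f' g'
    using that by (auto simp: P_def intro!: ph_diff)
  have P_monom: "(monom a n, monom b n) \<in> P" if "(a, b) \<in> R" for a b n
    using that by (auto simp: P_def coeff_monom ph_00)
  have P_to_ac: "(map_poly to_ac h, map_poly to_ac h) \<in> P" for h
    by (auto simp: P_def coeff_map_poly ph_to_ac)
  define Q where "Q = (%n. \<exists>f g. (f, g) \<in> P \<and> f ~= 0 \<and> poly f x = 0 \<and> degree f = n)"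
  obtain h where h: "h ~= 0" "poly (map_poly to_ac h) x = 0"
    by (rule alg_closure_algebraic)
  then have "Q (degree h)" using P_to_ac[of h] unfolding Q_def
    by (metis degree_map_poly_to_ac map_poly_to_ac_eq_0_iff)
  then have "Q (LEAST n. Q n)" by (rule LeastI)
  then obtain f g where f: "(f, g) \<in> P" "f ~= 0" "poly f x = 0" "degree f = (LEAST n. Q n)"
    unfolding Q_def by blast
  have min: "degree f \<le> degree f'" if "(f', g') \<in> P" "f' ~= 0" "poly f' x = 0" for f' g'
    unfolding f(4) using that by (intro Least_le) (auto simp: Q_def)
  have lc: "(lead_coeff f, coeff g (degree f)) \<in> R" using f(1) by (simp add: P_def)
  obtain c where c: "(inverse (lead_coeff f), c) \<in> R" "coeff g (degree f) * c = 1"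
    using ph_inverse[OF lc] f(2) by auto
  have "degree f > 0" using f(2,3) by (metis degree_0_id gr0I poly_pCons poly_0 add.right_neutral mult_zero_right pCons_0_0)
  moreover have "degree f \<le> degree g" using c(2) by (intro le_degree) auto
  ultimately obtain y where y: "poly g y = 0"
    using alg_closed_imp_poly_has_root[of g] by auto
  \<comment> \<open>Well-definedness of x -> y: division by f on the source side runs in parallel
    with division by g on the target side.\<close>
  have key: "poly g' y = 0" if "(f', g') \<in> P" "poly f' x = 0" for f' g'
    using that
  proof (induction "degree f'" arbitrary: f' g' rule: less_induct)
    case less
    show ?case
    proof (cases "f' = 0")
      case True
      then have "g' = 0" using less(2) by (auto simp: P_def poly_eq_iff intro: ph_zero)
      then show ?thesis by simp
    next
      case False
      then have le: "degree f \<le> degree f'" using less min by blast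
      define d where "d = degree f' - degree f"
      define a b where "a = lead_coeff f' * inverse (lead_coeff f)"
        and "b = coeff g' (degree f') * c"
      have ab: "(a, b) \<in> R" unfolding a_def b_def using less(2) c by (auto simp: P_def intro!: ph_mult)
      define f'' g'' where "f'' = f' - monom a d * f" and "g'' = g' - monom b d * g"
      have in_P: "(f'', g'') \<in> P" unfolding f''_def g''_def
        by (intro P_diff P_mult P_monom less ab f)
      have x: "poly f'' x = 0" by (simp add: f''_def less f)
      have lc: "coeff f'' (degree f') = 0"
        using le f(2) by (simp add: f''_def coeff_monom_mult a_def d_def)
      have "degree (monom a d * f) \<le> degree f'"
        using le unfolding d_def
        by (metis degree_monom_le degree_mult_le add_le_mono1 le_add_diff_inverse2 order_trans)
      then have "degree f'' \<le> degree f'"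
        unfolding f''_def by (intro degree_diff_le) auto
      have "poly g'' y = 0"
      proof (cases "f'' = 0")
        case True
        then have "g'' = 0" using in_P by (auto simp: P_def poly_eq_iff intro: ph_zero)
        then show ?thesis by simp
      next
        case False
        then have "degree f'' < degree f'"
          using lc \<open>degree f'' \<le> degree f'\<close> by (metis le_neq_implies_less leading_coeff_0_iff)
        then show ?thesis using less in_P x by blast
      qed
      then show ?thesis by (simp add: g''_def y)
    qed
  qed
  define R' where "R' = {(poly f x, poly g y) | f g. (f, g) \<in> P}"
  have "partial_hom R'"
    unfolding partial_hom_def
  proof (intro conjI allI impI)
    fix a b c d
    show "(to_ac s, to_ac s) \<in> R'" for s
      using P_monom[OF ph_to_ac, of s 0] unfolding R'_def
      by (smt (verit) mem_Collect_eq monom_0 poly_const_conv)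
    show "b = 0" if "(0, b) \<in> R'" using that key by (auto simp: R'_def)
    assume "(a, b) \<in> R'" "(c, d) \<in> R'"
    then obtain f g f' g' where "(f, g) \<in> P" "(f', g') \<in> P" "a = poly f x" "b = poly g y"
      "c = poly f' x" "d = poly g' y" by (auto simp: R'_def)
    then show "(a + c, b + d) \<in> R'" "(a * c, b * d) \<in> R'"
      unfolding R'_def using P_add P_mult by (metis (mono_tags, lifting) mem_Collect_eq poly_add,
          metis (mono_tags, lifting) mem_Collect_eq poly_mult)
  qed
  moreover have "R \<subseteq> R'"
  proof (rule subrelI)
    fix a b assume "(a, b) \<in> R"
    from P_monom[OF this, of 0] show "(a, b) \<in> R'" unfolding R'_def
      by (smt (verit) mem_Collect_eq monom_0 poly_const_conv)
  qed
  moreover have "(x, y) \<in> R'"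
    using P_monom[OF ph_11, of 1] unfolding R'_def
    by (auto intro!: exI[of _ "monom 1 1"] simp: poly_monom)
  ultimately show ?thesis using that by blast
qed

end

text \<open>Zorn's lemma: a maximal extension is total by \<open>ph_extend\<close>, and a total one
  is bijective by \<open>k_hom_bij\<close>.\<close>

lemma ph_extend_Gal:
  fixes R :: "('k :: field alg_closure \<times> 'k alg_closure) set"
  assumes "partial_hom R"
  obtains sg where "sg \<in> Gal" "!!a b. (a, b) \<in> R ==> sg a = b"
proof -
  define \<R> where "\<R> = {R'. partial_hom R' \<and> R \<subseteq> R'}"
  have "\<Union>\<C> \<in> \<R>" if "\<C> ~= {}" "subset.chain \<R> \<C>" for \<C>
  proof -
    have "\<C> \<subseteq> \<R>" using \<open>subset.chain \<R> \<C>\<close> by (simp add: subset_chain_def)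
    then have C: "partial_hom S" "R \<subseteq> S" if "S \<in> \<C>" for S
      using that by (auto simp: \<R>_def)
    have two: "\<exists>U\<in>\<C>. S \<subseteq> U \<and> T \<subseteq> U" if "S \<in> \<C>" "T \<in> \<C>" for S T
    proof -
      have "S \<subseteq> T \<or> T \<subseteq> S" using that \<open>subset.chain \<R> \<C>\<close> by (simp add: subset_chain_def)
      then show ?thesis using that by auto
    qed
    obtain S0 where "S0 \<in> \<C>" using \<open>\<C> ~= {}\<close> by blast
    have "partial_hom (\<Union>\<C>)"
      unfolding partial_hom_def
    proof (intro conjI allI impI)
      show "(to_ac c, to_ac c) \<in> \<Union>\<C>" for c using ph_to_ac[OF C(1)[OF \<open>S0 \<in> \<C>\<close>]] \<open>S0 \<in> \<C>\<close> by blast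
      show "b = 0" if "(0, b) \<in> \<Union>\<C>" for b using that C(1) ph_zero by (meson UnionE)
      fix a b c d assume "(a, b) \<in> \<Union>\<C>" "(c, d) \<in> \<Union>\<C>"
      then obtain U where U: "U \<in> \<C>" "(a, b) \<in> U" "(c, d) \<in> U" using two by (meson UnionE subsetD)
      then show "(a + c, b + d) \<in> \<Union>\<C>" "(a * c, b * d) \<in> \<Union>\<C>"
        using ph_add[OF C(1)[OF U(1)] U(2,3)] ph_mult[OF C(1)[OF U(1)] U(2,3)] U(1) by auto
    qed
    then show ?thesis using C \<open>S0 \<in> \<C>\<close> by (auto simp: \<R>_def)
  qed
  moreover have "\<R> ~= {}" using assms by (auto simp: \<R>_def)
  ultimately obtain M where M: "M \<in> \<R>" "!!S. S \<in> \<R> ==> M \<subseteq> S ==> S = M"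
    using subset_Zorn_nonempty[of \<R>] by blast
  have phM: "partial_hom M" and RM: "R \<subseteq> M" using M by (auto simp: \<R>_def)
  have total: "\<exists>y. (x, y) \<in> M" for x
  proof -
    obtain R' y where "partial_hom R'" "M \<subseteq> R'" "(x, y) \<in> R'"
      by (rule ph_extend[OF phM])
    then show ?thesis using M(2)[of R'] RM by (auto simp: \<R>_def)
  qed
  define sg where "sg x = (SOME y. (x, y) \<in> M)" for x
  have sgM: "(x, sg x) \<in> M" for x
    unfolding sg_def using total by (rule someI_ex)
  have sg_eq: "sg x = y" if "(x, y) \<in> M" for x y
    using ph_unique[OF phM sgM that] .
  have "sg \<in> Gal"
  proof (rule GalI, rule field_homI)
    show "sg (x + y) = sg x + sg y" "sg (x * y) = sg x * sg y" for x y
      by (intro sg_eq ph_add[OF phM] ph_mult[OF phM] sgM)+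
    show "sg (to_ac c) = to_ac c" for c by (intro sg_eq ph_to_ac[OF phM])
    show "sg 1 = 1" by (intro sg_eq ph_11[OF phM])
  qed
  with that sg_eq RM show ?thesis by blast
qed

text \<open>The hypothesis makes f(x) -> f(y), for f over E, a well-defined partial homomorphism
  fixing E.\<close>

theorem Gal_transitive:
  fixes E :: "'k :: field alg_closure set"
  assumes E: "ext_subring E"
    and xy: "!!f. (!!i. coeff f i \<in> E) ==> poly f x = 0 ==> poly f y = 0"
  obtains sg where "sg \<in> Gal" "sg x = y" "!!e. e \<in> E ==> sg e = e"
proof -
  define R where "R = {(poly f x, poly f y) | f. \<forall>i. coeff f i \<in> E}"
  have RI: "(poly f x, poly f y) \<in> R" if "!!i. coeff f i \<in> E" for f
    using that by (auto simp: R_def)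
  have const: "(e, e) \<in> R" if "e \<in> E" for e
  proof -
    have "coeff [:e:] i \<in> E" for i using that ext_0[OF E] by (cases i) auto
    from RI[OF this] show ?thesis by simp
  qed
  have "partial_hom R"
    unfolding partial_hom_def
  proof (intro conjI allI impI)
    show "(to_ac c, to_ac c) \<in> R" for c using const ext_to_ac[OF E] by blast
    show "b = 0" if "(0, b) \<in> R" for b using that xy by (force simp: R_def)
    fix a b c d assume "(a, b) \<in> R" "(c, d) \<in> R"
    then obtain f g where fg: "!!i. coeff f i \<in> E" "!!i. coeff g i \<in> E"
      "a = poly f x" "b = poly f y" "c = poly g x" "d = poly g y" by (auto simp: R_def)
    have "coeff (f + g) i \<in> E" "coeff (f * g) i \<in> E" for i
      using fg by (auto simp: coeff_mult intro!: ext_add[OF E] ext_mult[OF E] ext_sum[OF E])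
    from RI[OF this(1)] RI[OF this(2)] fg
    show "(a + c, b + d) \<in> R" "(a * c, b * d) \<in> R" by simp_all
  qed
  then obtain sg where sg: "sg \<in> Gal" "!!a b. (a, b) \<in> R ==> sg a = b" by (rule ph_extend_Gal) blast
  have "coeff [:0, 1:] i \<in> E" for i
    using ext_0[OF E] ext_1[OF E] by (simp add: coeff_pCons split: nat.split)
  from RI[OF this] have "(x, y) \<in> R" by simp
  with sg const that show ?thesis by blast
qed

text \<open>In characteristic 0 the derivative of a minimal polynomial of x over E is nonzero of
  smaller degree and cannot vanish at x, so x is a simple root. If the degree exceeds 1 there is
  another root, and some automorphism over E moves x there.\<close>

theorem Gal_fixed:
  fixes x :: "'k :: field_char_0 alg_closure"
  assumes E: "ext_subring E"
    and fixed: "!!sg. sg \<in> Gal ==> (!!e. e \<in> E ==> sg e = e) ==> sg x = x"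
  shows "x \<in> E"
proof -
  define Q where "Q = (%n. \<exists>f. (\<forall>i. coeff f i \<in> E) \<and> f ~= 0 \<and> poly f x = 0 \<and> degree f = n)"
  obtain h where h: "h ~= 0" "poly (map_poly to_ac h) x = 0"
    by (rule alg_closure_algebraic)
  then have "Q (degree h)" unfolding Q_def
    by (intro exI[of _ "map_poly to_ac h"]) (auto simp: coeff_map_poly ext_to_ac[OF E])
  then have "Q (LEAST n. Q n)" by (rule LeastI)
  then obtain f where f: "!!i. coeff f i \<in> E" "f ~= 0" "poly f x = 0" "degree f = (LEAST n. Q n)"
    unfolding Q_def by blast
  have min: "degree f \<le> degree g" if "!!i. coeff g i \<in> E" "g ~= 0" "poly g x = 0" for g
    unfolding f(4) using that by (intro Least_le) (auto simp: Q_def)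
  obtain q where q: "f = [:- x, 1:] * q" using f(3) by (metis dvdE poly_eq_0_iff_dvd)
  have q0: "q ~= 0" using f(2) q by auto
  have deg: "degree f = Suc (degree q)" unfolding q using q0 by (subst degree_mult_eq) auto
  show ?thesis
  proof (cases "degree q = 0")
    case True
    then obtain c where c: "q = [:c:]" by (metis degree_0_id)
    have "c ~= 0" using q0 c by auto
    have "coeff f 0 = - x * c" "coeff f 1 = c" by (simp_all add: q c)
    then have "x = - coeff f 0 * inverse (coeff f 1)" using \<open>c ~= 0\<close> by simp
    also have "\<dots> \<in> E" by (intro ext_mult[OF E] ext_uminus[OF E] ext_inverse[OF E] f)
    finally show ?thesis .
  next
    case False
    then obtain y where y: "poly q y = 0" using alg_closed_imp_poly_has_root[of q] by auto
    have dE: "coeff (pderiv f) i \<in> E" for i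
      unfolding coeff_pderiv by (intro ext_mult[OF E] ext_of_nat[OF E] f)
    have "pderiv f ~= 0" using deg by (simp add: pderiv_eq_0_iff)
    then have "poly (pderiv f) x ~= 0"
      using min[OF dE] degree_pderiv[of f] deg by auto
    moreover have "poly (pderiv f) x = poly q x"
      unfolding q pderiv_mult by (simp add: pderiv_pCons)
    ultimately have "poly q x ~= 0" by simp
    with y have "y ~= x" by auto
    have fy: "poly f y = 0" using y by (simp add: q)
    have "poly g y = 0" if "!!i. coeff g i \<in> E" "poly g x = 0" for g
      using minimal_root_transfer[OF E f(1) fy min f(3,2) that] .
    then obtain sg where "sg \<in> Gal" "sg x = y" "!!e. e \<in> E ==> sg e = e"
      by (rule Gal_transitive[OF E]) auto
    with fixed \<open>y ~= x\<close> show ?thesis by blast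
  qed
qed

subsection \<open>Orbits\<close>

definition gorb :: "'k :: field alg_closure => 'k alg_closure set" where
  "gorb x = (%sg. sg x) ` Gal"

lemma gorb_self [simp]: "x \<in> gorb x"
  unfolding gorb_def using Gal_id by (metis id_apply image_eqI)

lemma gorb_Gal: "sg \<in> Gal ==> sg x \<in> gorb x"
  by (auto simp: gorb_def)

lemma gorb_roots:
  assumes "poly (map_poly to_ac f) x = 0" "y \<in> gorb x"
  shows "poly (map_poly to_ac f) y = 0"
  using assms by (auto simp: gorb_def Gal_poly Gal_0)

lemma finite_gorb [simp]: "finite (gorb x)"
proof -
  obtain f where f: "f ~= 0" "poly (map_poly to_ac f) x = 0"
    by (rule alg_closure_algebraic)
  have "gorb x \<subseteq> {y. poly (map_poly to_ac f) y = 0}" using gorb_roots[OF f(2)] by auto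
  then show ?thesis by (rule finite_subset) (simp add: poly_roots_finite f)
qed

lemma card_gorb_pos [simp]: "card (gorb x) > 0"
  by (metis card_gt_0_iff empty_iff finite_gorb gorb_self)

lemma Gal_image_stable:
  assumes "finite S" "sg \<in> Gal" "!!x. x \<in> S ==> sg x \<in> S"
  shows "sg ` S = S"
  using assms by (metis Gal_bij bij_is_inj endo_inj_surj image_subsetI inj_on_subset subset_UNIV)

lemma gorb_trans: "y \<in> gorb x ==> z \<in> gorb y ==> z \<in> gorb x"
  unfolding gorb_def using Gal_comp by (smt (verit, del_insts) comp_apply image_iff)

lemma gorb_sym: "y \<in> gorb x ==> x \<in> gorb y"
proof -
  assume "y \<in> gorb x"
  then obtain sg where sg: "sg \<in> Gal" "y = sg x" by (auto simp: gorb_def)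
  then show ?thesis using gorb_Gal[OF Gal_inv[OF sg(1)], of y] by (simp add: Gal_inv_left)
qed

lemma gorb_eq: "y \<in> gorb x ==> gorb y = gorb x"
  using gorb_trans gorb_sym by blast

lemma gorb_image: "sg \<in> Gal ==> sg ` gorb x = gorb x"
  by (rule Gal_image_stable) (auto intro: gorb_trans gorb_Gal)

lemma gorb_Gal_eq: "sg \<in> Gal ==> gorb (sg x) = gorb x"
  by (rule gorb_eq) (rule gorb_Gal)

lemma Gal_fixed_base:
  fixes x :: "'k :: field_char_0 alg_closure"
  assumes "!!sg. sg \<in> Gal ==> sg x = x"
  shows "x \<in> range to_ac"
  using Gal_fixed[OF ext_subring_range] assms by blast

lemma gpoly_exists:
  fixes x :: "'k :: field_char_0 alg_closure"
  shows "\<exists>f. map_poly to_ac f = (\<Prod>y\<in>gorb x. [:- y, 1:])"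
proof -
  let ?P = "\<Prod>y\<in>gorb x. [:- y, 1:]"
  have "coeff ?P i \<in> range to_ac" for i
  proof (rule Gal_fixed_base)
    fix sg :: "'k alg_closure => 'k alg_closure"
    assume sg: "sg \<in> Gal"
    interpret field_hom sg using sg by (rule Gal_hom)
    interpret mp: map_poly_idom_hom sg ..
    have "map_poly sg ?P = (\<Prod>y\<in>gorb x. [:- sg y, 1:])"
      by (simp add: mp.hom_prod hom_distribs)
    also have "\<dots> = (\<Prod>y\<in>sg ` gorb x. [:- y, 1:])"
      by (subst prod.reindex) (auto simp: inj_on_def Gal_simps sg)
    finally have "map_poly sg ?P = ?P" by (simp add: gorb_image sg)
    then show "sg (coeff ?P i) = coeff ?P i" by (metis coeff_map_poly_hom)
  qed
  then have "map_poly to_ac (map_poly of_ac ?P) = ?P"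
    by (intro poly_eqI) (simp add: coeff_map_poly to_ac_of_ac)
  then show ?thesis by blast
qed

text \<open>The minimal polynomial of x over a base of characteristic 0, obtained as the product
  over the conjugates, whose coefficients are Galois invariant and hence descend.\<close>

definition gpoly :: "'k :: field alg_closure => 'k poly" where
  "gpoly x = (SOME f. map_poly to_ac f = (\<Prod>y\<in>gorb x. [:- y, 1:]))"

context
  fixes x :: "'k :: field_char_0 alg_closure"
begin

lemma gpoly: "map_poly to_ac (gpoly x) = (\<Prod>y\<in>gorb x. [:- y, 1:])"
  unfolding gpoly_def using gpoly_exists by (rule someI_ex)

lemma poly_gpoly: "poly (map_poly to_ac (gpoly x)) z = (\<Prod>y\<in>gorb x. z - y)"
  by (simp add: gpoly poly_prod)

lemma gpoly_root: "poly (map_poly to_ac (gpoly x)) x = 0"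
  unfolding poly_gpoly using gorb_self finite_gorb by (metis prod_zero right_minus_eq)

lemma degree_gpoly: "degree (gpoly x) = card (gorb x)"
proof -
  have "degree (gpoly x) = degree (\<Prod>y\<in>gorb x. [:- y, 1:])"
    by (metis gpoly degree_map_poly_to_ac)
  also have "\<dots> = card (gorb x)"
    by (subst degree_prod_eq_sum_degree) auto
  finally show ?thesis .
qed

lemma gpoly_monic: "lead_coeff (gpoly x) = 1"
proof -
  have "to_ac (lead_coeff (gpoly x)) = lead_coeff (map_poly to_ac (gpoly x))"
    by (simp add: coeff_map_poly)
  also have "\<dots> = 1" unfolding gpoly by (simp add: lead_coeff_prod)
  finally show ?thesis by simp
qed

lemma gpoly_coeff_0: "to_ac (coeff (gpoly x) 0) = (\<Prod>y\<in>gorb x. - y)"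
  using poly_gpoly[of 0] by (simp add: poly_0_coeff_0 coeff_map_poly)

end

lemma card_gorb_le_degree:
  assumes "f ~= 0" "poly (map_poly to_ac f) x = 0"
  shows "card (gorb x) \<le> degree f"
proof -
  have "gorb x \<subseteq> {y. poly (map_poly to_ac f) y = 0}" using gorb_roots[OF assms(2)] by auto
  moreover have "finite {y. poly (map_poly to_ac f) y = 0}" by (simp add: poly_roots_finite assms)
  ultimately have "card (gorb x) \<le> card {y. poly (map_poly to_ac f) y = 0}" by (rule card_mono[rotated])
  also have "\<dots> \<le> degree (map_poly to_ac f)"
    by (rule card_poly_roots_bound) (simp add: assms)
  finally show ?thesis by simp
qed

section \<open>Arithmetic of the \<open>p\<close>-adic integers\<close>

abbreviation pZ :: "'p :: prime_card padic_int" where "pZ \<equiv> of_nat CARD('p)"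

lemma pI_gt_1: "1 < int CARD('p :: prime_card)"
  using prime_gt_1_nat[OF prime_card[where ?'a = 'p]] by simp

lemma Rep_padic_range:
  "0 \<le> Rep_padic_int (x :: 'p :: prime_card padic_int) n" "Rep_padic_int x n < int CARD('p) ^ n"
  using Rep_padic_int[of x] by auto

lemma Rep_padic_mod:
  "Rep_padic_int (x :: 'p :: prime_card padic_int) (n + k) mod int CARD('p) ^ n = Rep_padic_int x n"
  using padic_compat[where ?'p = 'p, of "Rep_padic_int x" n k] Rep_padic_int[of x] by auto

lemma Rep_padic_Suc:
  "Rep_padic_int (x :: 'p :: prime_card padic_int) (Suc n) mod int CARD('p) ^ n = Rep_padic_int x n"
  using Rep_padic_int[of x] by auto

lemma Rep_padic_of_nat: "Rep_padic_int (of_nat m :: 'p :: prime_card padic_int) n = int m mod int CARD('p) ^ n"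
  by (induction m) (simp_all add: zero_padic_int.rep_eq one_padic_int.rep_eq plus_padic_int.rep_eq mod_simps)

lemma Rep_padic_of_int: "Rep_padic_int (of_int m :: 'p :: prime_card padic_int) n = m mod int CARD('p) ^ n"
  by (cases m) (simp_all add: Rep_padic_of_nat uminus_padic_int.rep_eq one_padic_int.rep_eq
      plus_padic_int.rep_eq minus_padic_int.rep_eq mod_simps)

lemma padic_exists:
  assumes "!!n. f n \<in> {0..<int CARD('p :: prime_card) ^ n}" "!!n. f (Suc n) mod int CARD('p) ^ n = f n"
  obtains x :: "'p :: prime_card padic_int" where "Rep_padic_int x = f"
  using Abs_padic_int_inverse[where ?'p = 'p, of f] assms by (auto intro: that)

lemma padic_of_nat_neq_0: "n > 0 ==> (of_nat n :: 'p :: prime_card padic_int) ~= 0"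
proof
  assume n: "n > 0" and "(of_nat n :: 'p padic_int) = 0"
  then have "Rep_padic_int (of_nat n :: 'p padic_int) n = 0" by (simp add: zero_padic_int.rep_eq)
  then have "int n mod int CARD('p) ^ n = 0" by (simp add: Rep_padic_of_nat)
  moreover have "n < CARD('p) ^ n" 
    using pI_gt_1[where ?'p = 'p] by (intro power_gt_expt) auto
  then have "int n < int CARD('p) ^ n" by (metis of_nat_less_iff of_nat_power)
  ultimately show False using n by simp
qed

instance padic_int :: (prime_card) ring_char_0
proof
  show "inj (of_nat :: nat => 'a padic_int)"
  proof (rule injI)
    fix m n assume *: "(of_nat m :: 'a padic_int) = of_nat n"
    show "m = n"
    proof (rule ccontr)
      assume "m ~= n"
      then consider "m < n" | "n < m" by linarith
      then show False
      proof cases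
        case 1
        then have "of_nat n = (of_nat m + of_nat (n - m) :: 'a padic_int)" by (simp flip: of_nat_add)
        then have "(of_nat (n - m) :: 'a padic_int) = 0" using * by simp
        then show False using 1 padic_of_nat_neq_0[of "n - m"] by (metis zero_less_diff)
      next
        case 2
        then have "of_nat m = (of_nat n + of_nat (m - n) :: 'a padic_int)" by (simp flip: of_nat_add)
        then have "(of_nat (m - n) :: 'a padic_int) = 0" using * by simp
        then show False using 2 padic_of_nat_neq_0[of "m - n"] by (metis zero_less_diff)
      qed
    qed
  qed
qed

section \<open>Divisibility and units in Z_p\<close>

lemma padic_eqI: "(!!n. Rep_padic_int x n = Rep_padic_int y n) ==> x = y"
  by (metis Rep_padic_int_inject ext)

lemma pZ_power_dvd_iff: "pZ ^ n dvd (x :: 'p :: prime_card padic_int) \<longleftrightarrow> Rep_padic_int x n = 0"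
proof
  assume "pZ ^ n dvd x"
  then obtain y where "x = pZ ^ n * y" by (elim dvdE)
  then show "Rep_padic_int x n = 0"
    by (simp add: times_padic_int.rep_eq Rep_padic_of_nat flip: of_nat_power)
next
  assume x: "Rep_padic_int x n = 0"
  let ?q = "int CARD('p)"
  \<comment> \<open>The quotient of x by p^n, modulo p^k, is read off at level n + k of x.\<close>
  define f where "f k = Rep_padic_int x (n + k) div ?q ^ n" for k
  have pos: "?q ^ k > 0" for k using pI_gt_1[where ?'p = 'p] by simp
  obtain y :: "'p padic_int" where y: "Rep_padic_int y = f"
  proof (rule padic_exists[where ?'p = 'p, of f])
    fix k
    have "?q ^ n * f k \<le> Rep_padic_int x (n + k)"
      unfolding f_def using pos[of n] by (simp flip: minus_mod_eq_mult_div)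
    also have "\<dots> < ?q ^ n * ?q ^ k" 
      using Rep_padic_range(2)[of x "n + k"] by (simp add: power_add)
    finally have "f k < ?q ^ k" using pos[of n] by simp
    then show "f k \<in> {0..<?q ^ k}" using pos[of n] Rep_padic_range(1)[of x "n + k"]
      by (simp add: f_def pos_imp_zdiv_nonneg_iff)
    have "Rep_padic_int x (n + k) = Rep_padic_int x (Suc (n + k)) mod (?q ^ n * ?q ^ k)"
      using Rep_padic_Suc[of x "n + k"] by (simp add: power_add)
    also have "\<dots> = ?q ^ n * (f (Suc k) mod ?q ^ k) + Rep_padic_int x (Suc (n + k)) mod ?q ^ n"
      using pos by (subst zmod_zmult2_eq) (auto simp: f_def less_imp_le)
    finally have "f k = ?q ^ n * (f (Suc k) mod ?q ^ k) div ?q ^ n"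
      using Rep_padic_mod[of x n "Suc k"] x by (simp add: f_def)
    then show "f (Suc k) mod ?q ^ k = f k" using pos[of n] by simp
  qed
  have "x = pZ ^ n * y"
  proof (rule padic_eqI)
    fix k
    have "?q ^ n * f k = Rep_padic_int x (n + k) - Rep_padic_int x (n + k) mod ?q ^ n"
      by (simp add: f_def minus_mod_eq_mult_div)
    also have "\<dots> = Rep_padic_int x (n + k)" by (simp add: Rep_padic_mod x)
    finally have "(?q ^ n * f k) mod ?q ^ k = Rep_padic_int x k"
      using Rep_padic_mod[of x k n] by (simp add: add.commute)
    then show "Rep_padic_int x k = Rep_padic_int (pZ ^ n * y) k"
      by (simp add: times_padic_int.rep_eq Rep_padic_of_nat y mod_simps flip: of_nat_power)
  qed
  then show "pZ ^ n dvd x" by simp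
qed

lemma pZ_dvd_iff: "pZ dvd (x :: 'p :: prime_card padic_int) \<longleftrightarrow> Rep_padic_int x 1 = 0"
  using pZ_power_dvd_iff[of 1 x] by simp

lemma padic_eq_0I: "(!!n. pZ ^ n dvd (x :: 'p :: prime_card padic_int)) ==> x = 0"
  by (rule padic_eqI) (simp add: pZ_power_dvd_iff zero_padic_int.rep_eq)

lemma pZ_not_unit: "\<not> pZ dvd (1 :: 'p :: prime_card padic_int)"
  using pI_gt_1[where ?'p = 'p] by (simp add: pZ_dvd_iff one_padic_int.rep_eq)

text \<open>If p does not divide x, then x is invertible modulo every p^n; these inverses are
  unique, hence compatible, and assemble to an element of Z_p.\<close>

lemma padic_unit_iff: "x dvd 1 \<longleftrightarrow> \<not> pZ dvd (x :: 'p :: prime_card padic_int)"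
proof
  assume "x dvd 1"
  then show "\<not> pZ dvd x" using pZ_not_unit dvd_trans by blast
next
  let ?q = "int CARD('p)"
  assume nd: "\<not> pZ dvd x"
  have pr: "prime ?q" using prime_card[where ?'a = 'p] by simp
  have pos: "?q ^ k > 0" for k using pI_gt_1[where ?'p = 'p] by simp
  have cop: "coprime (Rep_padic_int x n) (?q ^ n)" for n
  proof (cases n)
    case (Suc m)
    have "Rep_padic_int x n mod ?q = Rep_padic_int x 1"
      using Rep_padic_mod[of x 1 m] Suc by simp
    then have "\<not> ?q dvd Rep_padic_int x n" using nd by (auto simp: pZ_dvd_iff dvd_eq_mod_eq_0)
    then have "coprime ?q (Rep_padic_int x n)" using pr by (simp add: prime_imp_coprime)
    then show ?thesis by (simp add: coprime_commute)
  qed simp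
  have ex: "\<exists>y\<in>{0..<?q ^ n}. (Rep_padic_int x n * y) mod ?q ^ n = 1 mod ?q ^ n" for n
  proof -
    obtain y where "[Rep_padic_int x n * y = 1] (mod ?q ^ n)"
      using cong_solve_coprime_int[OF cop] by blast
    then show ?thesis using pos[of n]
      by (intro bexI[of _ "y mod ?q ^ n"]) (auto simp: Cong.cong_def mod_simps)
  qed
  have uniq: "y = z" if "y \<in> {0..<?q ^ n}" "z \<in> {0..<?q ^ n}"
    "(Rep_padic_int x n * y) mod ?q ^ n = 1 mod ?q ^ n" "(Rep_padic_int x n * z) mod ?q ^ n = 1 mod ?q ^ n"
    for y z n
  proof -
    have "[Rep_padic_int x n * y = Rep_padic_int x n * z] (mod ?q ^ n)" using that by (simp add: Cong.cong_def)
    then have "[y = z] (mod ?q ^ n)" using cop by (simp add: cong_mult_lcancel)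
    then show ?thesis using that by (auto simp: Cong.cong_def)
  qed
  obtain f where f: "!!n. f n \<in> {0..<?q ^ n}" "!!n. (Rep_padic_int x n * f n) mod ?q ^ n = 1 mod ?q ^ n"
    using ex by metis
  have "f (Suc n) mod ?q ^ n = f n" for n
  proof (rule uniq)
    show "f (Suc n) mod ?q ^ n \<in> {0..<?q ^ n}" using pos[of n] by auto
    have "(Rep_padic_int x n * (f (Suc n) mod ?q ^ n)) mod ?q ^ n
      = ((Rep_padic_int x (Suc n) * f (Suc n)) mod ?q ^ Suc n) mod ?q ^ n"
      unfolding Rep_padic_Suc[of x n, symmetric]
      by (subst mod_mod_cancel) (auto simp: mod_simps)
    also have "\<dots> = 1 mod ?q ^ n" unfolding f by (rule mod_mod_cancel) auto
    finally show "(Rep_padic_int x n * (f (Suc n) mod ?q ^ n)) mod ?q ^ n = 1 mod ?q ^ n" .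
  qed (use f in auto)
  then obtain y :: "'p padic_int" where "Rep_padic_int y = f" using f padic_exists by blast
  then have "x * y = 1" using f by (intro padic_eqI) (simp add: times_padic_int.rep_eq one_padic_int.rep_eq)
  then show "x dvd 1" by (metis dvdI)
qed

lemma padic_decomp:
  assumes "(x :: 'p :: prime_card padic_int) ~= 0"
  obtains k u where "x = pZ ^ k * u" "u dvd 1"
proof -
  obtain n where n: "\<not> pZ ^ n dvd x" using assms padic_eq_0I by blast
  define m where "m = (LEAST n. \<not> pZ ^ n dvd x)"
  have m: "\<not> pZ ^ m dvd x" unfolding m_def using n by (rule LeastI)
  then have "m ~= 0" by (metis one_dvd power_0)
  then obtain k where k: "m = Suc k" by (cases m) auto
  have "pZ ^ k dvd x" using not_less_Least[of k "%n. \<not> pZ ^ n dvd x"] k by (simp add: m_def)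
  then obtain u where u: "x = pZ ^ k * u" by (elim dvdE)
  have "\<not> pZ dvd u" using m u k by (auto simp: mult_dvd_mono mult.commute)
  then show ?thesis using that u by (simp add: padic_unit_iff)
qed

section \<open>Completeness and Hensel's lemma\<close>

lemma padic_complete:
  fixes a :: "nat => 'p :: prime_card padic_int"
  assumes "!!k. pZ ^ k dvd a (Suc k) - a k"
  obtains x where "!!k. pZ ^ k dvd x - a k"
proof -
  let ?q = "int CARD('p)"
  have iff: "pZ ^ n dvd x - y \<longleftrightarrow> Rep_padic_int x n = Rep_padic_int y n" for n and x y :: "'p padic_int"
  proof -
    have "pZ ^ n dvd x - y \<longleftrightarrow> Rep_padic_int x n mod ?q ^ n = Rep_padic_int y n mod ?q ^ n"
      by (simp add: pZ_power_dvd_iff minus_padic_int.rep_eq mod_eq_dvd_iff dvd_eq_mod_eq_0)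
    then show ?thesis using Rep_padic_range[of x n] Rep_padic_range[of y n] by simp
  qed
  obtain x :: "'p padic_int" where "Rep_padic_int x = (%k. Rep_padic_int (a k) k)"
  proof (rule padic_exists[where ?'p = 'p, of "%k. Rep_padic_int (a k) k"])
    show "Rep_padic_int (a (Suc k)) (Suc k) mod ?q ^ k = Rep_padic_int (a k) k" for k
      using Rep_padic_Suc[of "a (Suc k)" k] assms[of k] by (simp add: iff)
  qed (use Rep_padic_range in auto)
  then show ?thesis using that iff by metis
qed

lemma padic_complete_poly:
  fixes G :: "nat => 'p :: prime_card padic_int poly"
  assumes "!!k. [:pZ ^ k:] dvd G (Suc k) - G k" "!!k. degree (G k) \<le> n"
  obtains H where "!!k. [:pZ ^ k:] dvd H - G k" "degree H \<le> n"
proof -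
  have "\<exists>x. \<forall>k. pZ ^ k dvd x - coeff (G k) i" for i
    using assms(1) by (rule_tac padic_complete[of "%k. coeff (G k) i"]) (auto simp: const_poly_dvd_iff)
  then obtain x where x: "!!i k. pZ ^ k dvd x i - coeff (G k) i" by metis
  define H where "H = (\<Sum>i\<le>n. monom (x i) i)"
  have c: "coeff H i = (if i \<le> n then x i else 0)" for i
    by (simp add: H_def coeff_sum coeff_monom if_distrib sum.delta cong: if_cong)
  have "[:pZ ^ k:] dvd H - G k" for k
    unfolding const_poly_dvd_iff
  proof
    fix i
    show "pZ ^ k dvd coeff (H - G k) i"
      using x[of k i] assms(2)[of k] by (auto simp: c coeff_eq_0)
  qed
  moreover have "degree H \<le> n" by (rule degree_le) (simp add: c)
  ultimately show ?thesis using that by blast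
qed

lemma monic_division:
  fixes f g :: "'a :: idom poly"
  assumes "lead_coeff g = 1"
  obtains q r where "f = g * q + r" "r = 0 \<or> degree r < degree g" "degree q \<le> degree f - degree g"
proof -
  obtain q r where qr: "pseudo_divmod f g = (q, r)" by fastforce
  have g0: "g ~= 0" using assms by auto
  have 1: "f = g * q + r" and 2: "r = 0 \<or> degree r < degree g"
    using pseudo_divmod[OF g0 qr] assms by auto
  have "degree q \<le> degree f - degree g"
  proof (cases "q = 0")
    case False
    then have "degree g + degree q = degree (g * q)" using g0 by (simp add: degree_mult_eq)
    also have "g * q = f - r" using 1 by simp
    also have "degree (f - r) \<le> max (degree f) (degree r)" by (rule degree_diff_le_max)
    finally show ?thesis using 2 by auto
  qed simp
  with 1 2 that show ?thesis by blast
qed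

text \<open>Hensel's lemma for the factorization \<open>F \<equiv> F \<sqdot> 1\<close>, when the reduction of \<open>F\<close> has smaller degree
  than \<open>F\<close>.\<close>

lemma hensel_monic:
  fixes F :: "'p :: prime_card padic_int poly"
  assumes F: "coeff F d = 1" "!!i. i > d ==> pZ dvd coeff F i"
  obtains G H where "F = G * H" "degree G = d" "lead_coeff G = 1"
proof -
  define n where "n = degree F"
  have dn: "d \<le> n" unfolding n_def using F(1) by (intro le_degree) auto
  \<comment> \<open>Factorization to order k + 1. The condition H = 1 modulo p is carried along
    because it lets a single division by the monic G correct both factors.\<close>
  define good where "good = (%k (G, H). lead_coeff G = 1 \<and> degree G = d \<and> degree H \<le> n \<and>
     [:pZ:] dvd H - 1 \<and> [:pZ ^ Suc k:] dvd F - G * H)"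
  define step where "step = (%k (G, H) (G', H'). [:pZ ^ k:] dvd G' - (G :: 'p padic_int poly) \<and> [:pZ ^ k:] dvd H' - (H :: 'p padic_int poly))"
  have c0: "coeff (poly_cutoff (Suc d) F) i = (if i \<le> d then coeff F i else 0)" for i
    by (simp add: coeff_poly_cutoff)
  have deg0: "degree (poly_cutoff (Suc d) F) = d"
    by (rule antisym[OF degree_le le_degree]) (auto simp: c0 F)
  have init: "good 0 (poly_cutoff (Suc d) F, 1)"
    using F(2) by (auto simp: good_def deg0 c0 F const_poly_dvd_iff)
  have next_ex: "\<exists>y. good (Suc k) y \<and> step k x y" if x: "good k x" for k x
  proof -
    obtain G H where GH: "x = (G, H)" by fastforce
    have ih: "lead_coeff G = 1" "degree G = d" "degree H \<le> n" "[:pZ:] dvd H - 1" "[:pZ ^ Suc k:] dvd F - G * H"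
      using x by (auto simp: good_def GH)
    obtain E where E: "F - G * H = [:pZ ^ Suc k:] * E" using ih(5) by (elim dvdE)
    obtain K where K: "H - 1 = [:pZ:] * K" using ih(4) by (elim dvdE)
    obtain Q R where QR: "E = G * Q + R" "R = 0 \<or> degree R < degree G" "degree Q \<le> degree E - degree G"
      using monic_division[OF ih(1)] by metis
    have "[:pZ ^ Suc k:] ~= (0 :: 'p padic_int poly)" by simp
    have degE: "degree E = degree (F - G * H)"
      unfolding E using \<open>[:pZ ^ Suc k:] ~= 0\<close> by (simp add: degree_mult_eq)
    have G0: "G ~= 0" using ih by auto
    have "degree (F - G * H) \<le> max n (d + degree H)"
      using ih degree_mult_le[of G H] by (intro degree_diff_le) (auto simp: n_def)
    then have degQ: "degree Q \<le> n" using QR(3) degE ih(2,3) dn by auto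
    \<comment> \<open>With F - G H = c (G Q + R) and c = p^(k+1), adding c R to G and c Q to H
      leaves the error c R (1 - H) - c^2 R Q, divisible by p c since H = 1 modulo p.\<close>
    define G' H' where "G' = G + [:pZ ^ Suc k:] * R" and "H' = H + [:pZ ^ Suc k:] * Q"
    have dR: "R = 0 \<or> degree ([:pZ ^ Suc k:] * R) < d"
      using QR(2) ih(2) \<open>[:pZ ^ Suc k:] ~= 0\<close> by (auto simp: degree_mult_eq)
    have "degree G' = d" "lead_coeff G' = 1"
      using dR ih unfolding G'_def by (auto simp: degree_add_eq_left coeff_eq_0)
    moreover have "degree H' \<le> n"
      unfolding H'_def using ih degQ \<open>[:pZ ^ Suc k:] ~= 0\<close>
      by (intro degree_add_le) (auto simp: degree_mult_eq[OF \<open>[:pZ ^ Suc k:] ~= 0\<close>] degree_smult_le[THEN order_trans])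
    moreover have "H' - 1 = [:pZ:] * (K + [:pZ ^ k:] * Q)"
      using K by (simp add: H'_def algebra_simps)
    then have "[:pZ:] dvd H' - 1" by (metis dvdI)
    moreover have "F - G' * H' = [:pZ ^ Suc (Suc k):] * (- (R * K) - [:pZ ^ k:] * (R * Q))"
    proof -
      let ?P = "[:pZ:] :: 'p padic_int poly"
      have P: "[:pZ ^ j:] = ?P ^ j" for j by (simp add: poly_const_pow)
      have PS: "[:pZ ^ Suc j:] = ?P * ?P ^ j" for j using P[of "Suc j"] by (simp only: power_Suc)
      have PSS: "[:pZ ^ Suc (Suc j):] = ?P * (?P * ?P ^ j)" for j
        using P[of "Suc (Suc j)"] by (simp only: power_Suc)
      have *: "F' - (G + c * d * R) * (1 + c * K + c * d * Q) = c * (c * d) * (- (R * K) - d * (R * Q))"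
        if "F' = G * (1 + c * K) + c * d * (G * Q + R)" for F' c d :: "'p padic_int poly"
        unfolding that by (simp add: algebra_simps)
      have H: "H = 1 + ?P * K" using K by (simp only: algebra_simps)
      have "F = G * H + ?P * ?P ^ k * (G * Q + R)"
        using E unfolding QR unfolding PS by (simp only: algebra_simps)
      then show ?thesis unfolding G'_def H'_def unfolding PSS unfolding PS unfolding P H by (rule *)
    qed
    then have "[:pZ ^ Suc (Suc k):] dvd F - G' * H'" by (metis dvdI)
    ultimately have "good (Suc k) (G', H')" by (simp add: good_def)
    moreover have "step k x (G', H')"
      by (auto simp: step_def GH G'_def H'_def const_poly_dvd_iff)
    ultimately show ?thesis by blast
  qed
  obtain f where f: "!!k. good k (f k)" "!!k. step k (f k) (f (Suc k))"
    using dependent_nat_choice[of good step] init next_ex by blast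
  define G H where "G k = fst (f k)" and "H k = snd (f k)" for k
  have GH: "lead_coeff (G k) = 1" "degree (G k) = d" "degree (H k) \<le> n" "[:pZ ^ Suc k:] dvd F - G k * H k"
    "[:pZ ^ k:] dvd G (Suc k) - G k" "[:pZ ^ k:] dvd H (Suc k) - H k" for k
    using f[of k] by (auto simp: good_def step_def G_def H_def split: prod.splits)
  obtain G' where G': "!!k. [:pZ ^ k:] dvd G' - G k" "degree G' \<le> d"
    using padic_complete_poly[of G d] GH by (metis order_refl)
  obtain H' where H': "!!k. [:pZ ^ k:] dvd H' - H k"
    using padic_complete_poly[of H n] GH by metis
  have "pZ ^ k dvd coeff G' d - 1" for k
    using G'(1)[of k] GH(1,2)[of k] by (auto simp: const_poly_dvd_iff dest: spec[of _ d])
  then have "coeff G' d - 1 = 0" by (rule padic_eq_0I)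
  then have lc: "coeff G' d = 1" by simp
  then have dG': "degree G' = d" using G'(2) by (metis le_antisym le_degree zero_neq_one)
  have "[:pZ ^ k:] dvd F - G' * H'" for k
  proof -
    have 1: "[:pZ ^ k:] dvd F - G k * H k"
      using GH(4)[of k] by (rule dvd_trans[rotated]) (simp add: const_poly_dvd_const_poly_iff)
    have "F - G' * H' = (F - G k * H k) - (G' - G k) * H k - G' * (H' - H k)"
      by (simp add: algebra_simps)
    also have "[:pZ ^ k:] dvd \<dots>"
      by (intro dvd_diff 1 dvd_mult dvd_mult2 G' H')
    finally show ?thesis .
  qed
  then have "coeff (F - G' * H') i = 0" for i
    by (intro padic_eq_0I) (simp only: const_poly_dvd_iff)
  then have "F - G' * H' = 0" by (intro poly_eqI) simp
  with that dG' lc show ?thesis by simp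
qed

lemma hensel_split:
  fixes F :: "'p :: prime_card padic_int poly"
  assumes F: "coeff F d dvd 1" "!!i. i > d ==> pZ dvd coeff F i"
  obtains G H where "F = G * H" "degree G = d" "F ~= 0"
proof -
  obtain u where u: "1 = coeff F d * u" using F(1) by (elim dvdE)
  have "coeff (smult u F) d = 1" "!!i. i > d ==> pZ dvd coeff (smult u F) i"
    using F u by (simp_all add: mult.commute)
  then obtain G H where GH: "smult u F = G * H" "degree G = d" by (rule hensel_monic) blast
  have "F = smult (coeff F d * u) F" by (simp flip: u)
  also have "\<dots> = G * smult (coeff F d) H" using GH by (metis mult_smult_right smult_smult)
  finally have "F = G * smult (coeff F d) H" .
  moreover have "F ~= 0" using u by auto
  ultimately show ?thesis using that GH(2) by blast
qed

section \<open>The valuation of the algebraic closure of \<open>\<rat>\<^sub>p\<close>\<close>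

instance fract :: ("{idom, ring_char_0}") field_char_0
proof
  show "inj (of_nat :: nat => 'a fract)"
    by (rule injI) (simp add: of_nat_fract eq_fract)
qed

section \<open>The valuation of Q_p\<close>

definition iZ :: "'p :: prime_card padic_int => 'p padic_int fract" where
  "iZ x = Fract x 1"

lemma of_Zp_iZ: "of_Zp x = to_ac (iZ x)"
  by (simp add: of_Zp_def iZ_def)

abbreviation pQ :: "'p :: prime_card padic_int fract" where
  "pQ \<equiv> of_nat CARD('p)"

lemma iZ_add: "iZ (x + y) = iZ x + iZ y" and iZ_mult: "iZ (x * y) = iZ x * iZ y"
  and iZ_uminus: "iZ (- x) = - iZ x" and iZ_1: "iZ 1 = 1" and iZ_0: "iZ 0 = 0"
  and iZ_eq_iff: "iZ x = iZ y \<longleftrightarrow> x = y" and iZ_pZ: "iZ pZ = pQ"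
  by (simp_all add: iZ_def One_fract_def Zero_fract_def eq_fract of_nat_fract)

lemma iZ_eq_0_iff: "iZ x = 0 \<longleftrightarrow> x = 0"
  using iZ_eq_iff[of x 0] by (simp add: iZ_0)

lemma iZ_power: "iZ (x ^ n) = iZ x ^ n"
  by (induction n) (simp_all add: iZ_1 iZ_mult)

lemma iZ_hom: "inj_idom_hom iZ"
proof
  show "x = 0" if "iZ x = 0" for x :: "'a padic_int" using that by (simp add: iZ_eq_0_iff)
qed (simp_all add: iZ_add iZ_mult iZ_1 iZ_0)

interpretation iZ: inj_idom_hom iZ by (rule iZ_hom)
interpretation iZ_poly: map_poly_inj_idom_hom iZ ..

lemma pQ_neq_0 [simp]: "(pQ :: 'p :: prime_card padic_int fract) ~= 0"
  by simp

lemma pQ_decomp_unique: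
  fixes u u' :: "'p :: prime_card padic_int"
  assumes "pQ powi k * iZ u = pQ powi l * iZ u'" "u dvd 1" "u' dvd 1"
  shows "k = l"
proof -
  have *: False if "k < l" "pQ powi k * iZ u = pQ powi l * iZ u'" "u dvd 1" for k l and u u' :: "'p padic_int"
  proof -
    have "iZ u = pQ powi (l - k) * iZ u'"
      using that(2) by (simp add: power_int_diff field_simps)
    also have "pQ powi (l - k) = iZ pZ * iZ (pZ ^ (nat (l - k) - 1))"
    proof -
      have "l - k = 1 + int (nat (l - k) - 1)" using that(1) by simp
      then have "pQ powi (l - k) = pQ powi (1 + int (nat (l - k) - 1))" by simp
      also have "\<dots> = pQ * pQ ^ (nat (l - k) - 1)" by (subst power_int_add) auto
      finally show ?thesis by (simp add: iZ_pZ iZ_power)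
    qed
    finally have "u = pZ * (pZ ^ (nat (l - k) - 1) * u')"
      by (simp only: mult.assoc iZ_mult[symmetric] iZ_eq_iff)
    then have "pZ dvd u" by (metis dvdI)
    then show False using that(3) by (simp add: padic_unit_iff)
  qed
  show ?thesis using *[of k l u u'] *[of l k u' u] assms by (metis linorder_neqE)
qed

definition vQ :: "'p :: prime_card padic_int fract => int" where
  "vQ q = (THE k. \<exists>u. u dvd 1 \<and> q = pQ powi k * iZ u)"

lemma vQ_eqI: "u dvd 1 ==> vQ (pQ powi k * iZ u) = k"
  unfolding vQ_def by (rule the_equality) (use pQ_decomp_unique in \<open>blast+\<close>)

lemma vQ_decomp:
  assumes "q ~= 0"
  obtains u where "u dvd 1" "q = pQ powi (vQ q) * iZ u"
proof -
  obtain a b where ab: "q = Fract a b" "b ~= 0" by (rule Fract_cases[of q])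
  then have "a ~= 0" using assms by (auto simp: Zero_fract_def eq_fract)
  obtain i u where i: "a = pZ ^ i * u" "u dvd 1" using padic_decomp[OF \<open>a ~= 0\<close>] .
  obtain j v where j: "b = pZ ^ j * v" "v dvd 1" using padic_decomp[OF \<open>b ~= 0\<close>] .
  obtain v' where v': "1 = v * v'" using j(2) by (elim dvdE)
  have "v' dvd 1" using v' by (metis dvd_triv_right)
  have "v ~= 0" using v' by auto
  have "q = iZ a / iZ b" using ab by (simp add: iZ_def)
  also have "\<dots> = pQ powi (int i - int j) * (iZ u / iZ v)"
    by (simp add: i j iZ_mult iZ_power iZ_pZ power_int_diff)
  also have "iZ u / iZ v = iZ (u * v')"
    using v' \<open>v ~= 0\<close> by (simp add: iZ_def eq_fract mult.commute mult.left_commute)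
  finally have q: "q = pQ powi (int i - int j) * iZ (u * v')" .
  have un: "u * v' dvd 1" using i(2) \<open>v' dvd 1\<close> by (metis mult_dvd_mono mult_1)
  have "vQ q = int i - int j" unfolding q using un by (rule vQ_eqI)
  with q un that show ?thesis by metis
qed

lemma vQ_mult:
  assumes "q ~= 0" "r ~= 0"
  shows "vQ (q * r) = vQ q + vQ r"
proof -
  obtain u where u: "u dvd 1" "q = pQ powi (vQ q) * iZ u" using vQ_decomp[OF assms(1)] .
  obtain v where v: "v dvd 1" "r = pQ powi (vQ r) * iZ v" using vQ_decomp[OF assms(2)] .
  have "u * v dvd 1" using u v by (metis mult_dvd_mono mult_1)
  moreover have "q * r = pQ powi (vQ q + vQ r) * iZ (u * v)"
    by (subst u(2), subst v(2)) (simp add: power_int_add iZ_mult)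
  ultimately show ?thesis by (metis vQ_eqI)
qed

lemma vQ_unit: "u dvd 1 ==> vQ (iZ u) = 0"
  using vQ_eqI[of u 0] by simp

lemma vQ_1: "vQ 1 = 0" using vQ_unit[of 1] by (simp add: iZ_1)

lemma vQ_pQ_powi: "vQ (pQ powi k) = k" using vQ_eqI[of 1 k] by (simp add: iZ_1)

lemma vQ_minus_1: "vQ (- 1) = 0" using vQ_unit[of "- 1"] by (simp add: iZ_1 iZ_uminus)

lemma vQ_power: "q ~= 0 ==> vQ (q ^ n) = int n * vQ q"
  by (induction n) (simp_all add: vQ_1 vQ_mult algebra_simps)

lemma vQ_nonneg_iff:
  assumes "q ~= 0"
  shows "vQ q \<ge> 0 \<longleftrightarrow> q \<in> range iZ"
proof
  assume *: "vQ q \<ge> 0"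
  obtain u where u: "u dvd 1" "q = pQ powi (vQ q) * iZ u" using vQ_decomp[OF assms] .
  have "q = iZ (pZ ^ nat (vQ q) * u)"
    using u * by (simp add: iZ_mult iZ_power iZ_pZ power_int_def)
  then show "q \<in> range iZ" by blast
next
  assume "q \<in> range iZ"
  then obtain a where a: "q = iZ a" by blast
  then have "a ~= 0" using assms by (auto simp: iZ_0)
  then obtain k u where "a = pZ ^ k * u" "u dvd 1" using padic_decomp by blast
  then have "q = pQ powi int k * iZ u" using a by (simp add: iZ_mult iZ_power iZ_pZ)
  then show "vQ q \<ge> 0" using vQ_eqI[OF \<open>u dvd 1\<close>, of "int k"] by simp
qed

lemma vQ_pos_dvd:
  assumes "a ~= 0"
  shows "vQ (iZ a) > 0 \<longleftrightarrow> pZ dvd a"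
proof -
  obtain k u where ku: "a = pZ ^ k * u" "u dvd 1" using padic_decomp[OF assms] .
  have "iZ a = pQ powi int k * iZ u" using ku by (simp add: iZ_mult iZ_power iZ_pZ)
  then have v: "vQ (iZ a) = int k" using vQ_eqI[OF ku(2), of "int k"] by simp
  show ?thesis
  proof (cases k)
    case 0
    then show ?thesis using v ku by (simp add: padic_unit_iff)
  next
    case (Suc m)
    then have "a = pZ * (pZ ^ m * u)" using ku by (simp add: mult.assoc)
    then have "pZ dvd a" by (metis dvdI)
    then show ?thesis using v Suc by simp
  qed
qed

subsection \<open>The valuation\<close>

text \<open>The constant term of the minimal polynomial is the norm up to sign, so this is the
  valuation of the norm divided by the degree, the extension of the p-adic valuation. The point 0 is
  handled separately by \<open>wge\<close>.\<close>

definition w :: "'p :: prime_card qp_bar => real" where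
  "w x = real_of_int (vQ (coeff (gpoly x) 0)) / real (card (gorb x))"

lemma zero_notin_gorb: "z ~= 0 ==> 0 \<notin> gorb z"
proof
  assume z: "z ~= 0" "0 \<in> gorb z"
  then obtain sg where sg: "sg \<in> Gal" "0 = sg z" by (auto simp: gorb_def)
  then show False using z(1) Gal_eq_0_iff[OF sg(1), of z] by simp
qed

lemma gpoly_coeff_0_neq_0:
  fixes x :: "'k :: field_char_0 alg_closure"
  assumes "x ~= 0"
  shows "coeff (gpoly x) 0 ~= 0"
proof -
  have "0 \<notin> gorb x" using assms by (rule zero_notin_gorb)
  then have "(\<Prod>y\<in>gorb x. - y) ~= 0" by auto
  then show ?thesis using gpoly_coeff_0[of x] by auto
qed

lemma w_eq_norm:
  assumes "x ~= 0" "to_ac c = (\<Prod>y\<in>gorb x. y)"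
  shows "w x = real_of_int (vQ c) / real (card (gorb x))"
proof -
  have "to_ac (coeff (gpoly x) 0) = (\<Prod>y\<in>gorb x. (- 1) * y)" by (simp add: gpoly_coeff_0)
  also have "\<dots> = (- 1) ^ card (gorb x) * (\<Prod>y\<in>gorb x. y)"
    by (simp only: prod.distrib prod_constant)
  also have "\<dots> = to_ac ((- 1) ^ card (gorb x) * c)" by (simp add: assms(2))
  finally have eq: "coeff (gpoly x) 0 = (- 1) ^ card (gorb x) * c"
    by (simp only: to_ac_eq_iff)
  then have "c ~= 0" using gpoly_coeff_0_neq_0[OF assms(1)] by auto
  then have "vQ (coeff (gpoly x) 0) = vQ c"
    unfolding eq by (simp add: vQ_mult vQ_power vQ_minus_1)
  then show ?thesis by (simp add: w_def)
qed

lemma norm_exists: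
  fixes x :: "'k :: field_char_0 alg_closure"
  shows "\<exists>c. to_ac c = (\<Prod>y\<in>gorb x. y)"
proof -
  have "(\<Prod>y\<in>gorb x. y) = (\<Prod>y\<in>gorb x. (- 1) * - y)" by simp
  also have "\<dots> = (- 1) ^ card (gorb x) * (\<Prod>y\<in>gorb x. - y)"
    by (simp only: prod.distrib prod_constant)
  also have "\<dots> = to_ac ((- 1) ^ card (gorb x) * coeff (gpoly x) 0)"
    by (simp add: gpoly_coeff_0)
  finally show ?thesis by metis
qed

text \<open>To compare elements of different degrees, norms are taken over the joint orbit of (x,
  y). An equivariant f maps it onto the orbit of f (x, y) with fibres of equal size, so x, y and x *
  y are all evaluated with the same denominator.\<close>

lemma w_via_pairs:
  fixes x y :: "'p :: prime_card qp_bar"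
  defines "\<Omega> \<equiv> (%sg. (sg x, sg y)) ` Gal"
  assumes equiv: "!!sg a b. sg \<in> Gal ==> f (sg a, sg b) = sg (f (a, b))"
    and nz: "f (x, y) ~= 0"
  shows "\<exists>c. to_ac c = (\<Prod>\<omega>\<in>\<Omega>. f \<omega>) \<and> c ~= 0 \<and> w (f (x, y)) = real_of_int (vQ c) / real (card \<Omega>)"
proof -
  define z where "z = f (x, y)"
  have "\<Omega> \<subseteq> gorb x \<times> gorb y" by (auto simp: \<Omega>_def gorb_Gal)
  then have fin: "finite \<Omega>" by (rule finite_subset) simp
  have im: "f ` \<Omega> = gorb z"
    unfolding \<Omega>_def gorb_def z_def using equiv by (force simp: image_image)
  define m where "m = card {\<omega> \<in> \<Omega>. f \<omega> = z}"
  have fib: "card {\<omega> \<in> \<Omega>. f \<omega> = t} = m" if t: "t \<in> gorb z" for t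
  proof -
    obtain \<tau> where \<tau>: "\<tau> \<in> Gal" "t = \<tau> z" using t by (auto simp: gorb_def)
    let ?h = "%(a, b). (\<tau> a, \<tau> b)"
    have "bij_betw ?h {\<omega> \<in> \<Omega>. f \<omega> = z} {\<omega> \<in> \<Omega>. f \<omega> = t}"
    proof (rule bij_betwI')
      fix \<omega> \<omega>' show "(?h \<omega> = ?h \<omega>') = (\<omega> = \<omega>')"
        by (cases \<omega>; cases \<omega>') (simp add: Gal_eq_iff[OF \<tau>(1)])
    next
      fix \<omega> assume "\<omega> \<in> {\<omega> \<in> \<Omega>. f \<omega> = z}"
      then obtain sg where sg: "sg \<in> Gal" "\<omega> = (sg x, sg y)" "f \<omega> = z" by (auto simp: \<Omega>_def)
      have "?h \<omega> = ((\<tau> \<circ> sg) x, (\<tau> \<circ> sg) y)" by (simp add: sg)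
      then have "?h \<omega> \<in> \<Omega>" unfolding \<Omega>_def using Gal_comp[OF \<tau>(1) sg(1)] by blast
      moreover have "f (?h \<omega>) = t" using sg equiv[OF \<tau>(1)] by (simp add: \<tau>)
      ultimately show "?h \<omega> \<in> {\<omega> \<in> \<Omega>. f \<omega> = t}" by simp
    next
      fix \<omega> assume "\<omega> \<in> {\<omega> \<in> \<Omega>. f \<omega> = t}"
      then obtain sg where sg: "sg \<in> Gal" "\<omega> = (sg x, sg y)" "f \<omega> = t" by (auto simp: \<Omega>_def)
      let ?\<rho> = "inv_into UNIV \<tau>"
      have \<rho>: "?\<rho> \<in> Gal" using \<tau>(1) by (rule Gal_inv)
      let ?o = "((?\<rho> \<circ> sg) x, (?\<rho> \<circ> sg) y)"
      have "?o \<in> \<Omega>" unfolding \<Omega>_def using Gal_comp[OF \<rho> sg(1)] by blast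
      moreover have "f ?o = z" using sg equiv[OF \<rho>] \<tau> by (simp add: Gal_inv_left)
      moreover have "\<omega> = ?h ?o" using sg \<tau> by (simp add: Gal_inv_right)
      ultimately show "\<exists>\<omega>'\<in>{\<omega> \<in> \<Omega>. f \<omega> = z}. \<omega> = ?h \<omega>'" by blast
    qed
    then show ?thesis by (simp add: m_def bij_betw_same_card)
  qed
  have "(x, y) \<in> \<Omega>" unfolding \<Omega>_def by (rule image_eqI[of _ _ id]) auto
  then have m0: "m > 0" unfolding m_def using fin by (auto simp: card_gt_0_iff z_def)
  have cardO: "card \<Omega> = card (gorb z) * m"
  proof -
    have "card \<Omega> = (\<Sum>\<omega>\<in>\<Omega>. 1)" by simp
    also have "\<dots> = (\<Sum>t\<in>gorb z. \<Sum>\<omega> | \<omega> \<in> \<Omega> \<and> f \<omega> = t. 1)"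
      unfolding im[symmetric] by (rule sum.image_gen[OF fin])
    also have "\<dots> = card (gorb z) * m" using fib by simp
    finally show ?thesis .
  qed
  obtain c where c: "to_ac c = (\<Prod>y\<in>gorb z. y)" using norm_exists by metis
  have "(\<Prod>\<omega>\<in>\<Omega>. f \<omega>) = (\<Prod>t\<in>gorb z. \<Prod>\<omega> | \<omega> \<in> \<Omega> \<and> f \<omega> = t. f \<omega>)"
    unfolding im[symmetric] by (rule prod.image_gen[OF fin])
  also have "\<dots> = (\<Prod>t\<in>gorb z. t ^ m)" using fib by simp
  also have "\<dots> = to_ac (c ^ m)" by (simp add: c prod_power_distrib)
  finally have "to_ac (c ^ m) = (\<Prod>\<omega>\<in>\<Omega>. f \<omega>)" by simp
  moreover have "0 \<notin> gorb z" using nz zero_notin_gorb by (simp add: z_def)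
  then have "c ~= 0" using c by auto
  moreover have "w z = real_of_int (vQ (c ^ m)) / real (card \<Omega>)"
    using w_eq_norm[OF _ c] nz m0 \<open>c ~= 0\<close> by (simp add: z_def vQ_power cardO)
  ultimately show ?thesis by (intro exI[of _ "c ^ m"]) (simp add: z_def)
qed

lemma w_mult:
  assumes "x ~= 0" "y ~= 0"
  shows "w (x * y) = w x + w y"
proof -
  let ?O = "(%sg. (sg x, sg y)) ` Gal"
  obtain c where c: "to_ac c = (\<Prod>\<omega>\<in>?O. fst \<omega>)" "c ~= 0" "w x = real_of_int (vQ c) / real (card ?O)"
    using w_via_pairs[of fst x y] assms by auto
  obtain d where d: "to_ac d = (\<Prod>\<omega>\<in>?O. snd \<omega>)" "d ~= 0" "w y = real_of_int (vQ d) / real (card ?O)"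
    using w_via_pairs[of snd x y] assms by auto
  obtain e where e: "to_ac e = (\<Prod>\<omega>\<in>?O. fst \<omega> * snd \<omega>)"
    "w (x * y) = real_of_int (vQ e) / real (card ?O)"
    using w_via_pairs[of "%\<omega>. fst \<omega> * snd \<omega>" x y] assms by (auto simp: Gal_simps)
  have "to_ac e = to_ac (c * d)" by (simp add: c d e prod.distrib)
  then have "e = c * d" by (simp only: to_ac_eq_iff)
  then show ?thesis using c d e by (simp add: vQ_mult add_divide_distrib)
qed

lemma w_Gal: "sg \<in> Gal ==> w (sg x) = w x"
proof -
  assume "sg \<in> Gal"
  then have "gorb (sg x) = gorb x" by (rule gorb_Gal_eq)
  then show ?thesis by (simp add: w_def gpoly_def)
qed

lemma w_to_ac:
  assumes "q ~= 0"
  shows "w (to_ac q) = real_of_int (vQ q)"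
proof -
  have "gorb (to_ac q) = {to_ac q}" using gorb_self by (auto simp: gorb_def)
  then show ?thesis using w_eq_norm[of "to_ac q" q] assms by simp
qed

lemma w_1 [simp]: "w 1 = 0"
  using w_to_ac[of 1] by (simp add: vQ_1)

lemma w_minus_1 [simp]: "w (- 1) = 0"
  using w_to_ac[of "- 1"] by (simp add: vQ_minus_1)

lemma w_uminus: "w (- x) = w x"
  using w_mult[of "- 1" x] by (cases "x = 0") auto

lemma w_inverse: "x ~= 0 ==> w (inverse x) = - w x"
  using w_mult[of x "inverse x"] by simp

lemma w_divide: "x ~= 0 ==> y ~= 0 ==> w (x / y) = w x - w y"
  using w_mult[of x "inverse y"] by (simp add: w_inverse divide_inverse)

lemma w_power: "x ~= 0 ==> w (x ^ n) = real n * w x"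
  by (induction n) (simp_all add: w_mult algebra_simps)

lemma w_powi: "x ~= 0 ==> w (x powi k) = real_of_int k * w x"
  by (cases "k \<ge> 0") (auto simp: power_int_def w_power w_inverse)

lemma w_p: "w (of_nat CARD('p) :: 'p :: prime_card qp_bar) = 1"
proof -
  have "vQ (pQ :: 'p padic_int fract) = 1" using vQ_pQ_powi[of 1] by simp
  then show ?thesis using w_to_ac[of "pQ :: 'p padic_int fract"] by simp
qed

text \<open>An integral norm forces all coefficients to be integral. Otherwise scale the polynomial
  to be primitive: then neither the leading nor the constant coefficient is a unit, so the last unit
  coefficient sits at some 0 < d < n, and Hensel's lemma splits off a factor of degree d. One of the
  two factors has x as a root and degree below the size of the orbit.\<close>

lemma gpoly_integral:
  fixes x :: "'p :: prime_card qp_bar"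
  assumes "x ~= 0" "w x \<ge> 0"
  obtains f where "gpoly x = map_poly iZ f"
proof -
  define P n where "P = gpoly x" and "n = degree P"
  have n: "n = card (gorb x)" by (simp add: n_def P_def degree_gpoly)
  have n0: "n > 0" by (simp add: n)
  have mon: "coeff P n = 1" using gpoly_monic[of x] by (simp add: P_def n_def)
  have P0: "coeff P 0 ~= 0" unfolding P_def by (rule gpoly_coeff_0_neq_0) fact
  have v0: "vQ (coeff P 0) \<ge> 0"
    using assms(2) n0 unfolding w_def P_def[symmetric] n[symmetric]
    by (simp add: zero_le_divide_iff)
  have "coeff P i \<in> range iZ" for i
  proof (rule ccontr)
    assume i: "coeff P i \<notin> range iZ"
    then have i0: "coeff P i ~= 0" by (metis iZ_0 rangeI)
    define S where "S = {i. coeff P i ~= 0}"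
    have "S \<subseteq> {..n}" unfolding S_def n_def using le_degree by auto
    then have finS: "finite S" by (rule finite_subset) simp
    define m where "m = Min ((%i. vQ (coeff P i)) ` S)"
    have "S ~= {}" using i0 by (auto simp: S_def)
    have m_le: "m \<le> vQ (coeff P j)" if "coeff P j ~= 0" for j
      unfolding m_def using finS that by (intro Min_le) (auto simp: S_def)
    have "m < 0" using m_le[OF i0] vQ_nonneg_iff[OF i0] i by simp
    have "m \<in> (%i. vQ (coeff P i)) ` S"
      unfolding m_def using finS \<open>S ~= {}\<close> by (intro Min_in) auto
    then obtain j where j: "coeff P j ~= 0" "vQ (coeff P j) = m" by (auto simp: S_def)
    have vscale: "vQ (pQ powi (- m) * q) = vQ q - m" if "q ~= 0" for q :: "'p padic_int fract"
      using that by (simp add: vQ_mult vQ_pQ_powi)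
    have "\<exists>a. iZ a = pQ powi (- m) * coeff P k" for k
    proof (cases "coeff P k = 0")
      case False
      then have "pQ powi (- m) * coeff P k \<in> range iZ"
        using m_le[OF False] vscale[OF False] by (subst vQ_nonneg_iff[symmetric]) auto
      then show ?thesis by force
    qed (metis iZ_0 mult_zero_right)
    then obtain a where a: "!!k. iZ (a k) = pQ powi (- m) * coeff P k" by metis
    define F where "F = (\<Sum>k\<le>n. monom (a k) k)"
    have a0: "a k = 0" if "k > n" for k
    proof -
      have "iZ (a k) = 0" using that by (simp add: a n_def coeff_eq_0)
      then show ?thesis by (simp add: iZ_eq_0_iff)
    qed
    have cF: "coeff F k = a k" for k
      using a0 by (auto simp: F_def coeff_sum coeff_monom if_distrib sum.delta cong: if_cong)
    have mapF: "map_poly iZ F = smult (pQ powi (- m)) P"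
      by (rule poly_eqI) (simp add: cF a)
    have degF: "degree F = n"
    proof -
      have "degree F = degree (map_poly iZ F)" by simp
      also have "\<dots> = n" unfolding mapF by (simp add: n_def)
      finally show ?thesis .
    qed
    have unit: "a k dvd 1 \<longleftrightarrow> coeff P k ~= 0 \<and> vQ (coeff P k) = m" for k
    proof (cases "coeff P k = 0")
      case True
      then have "a k = 0" using a[of k] by (simp add: iZ_eq_0_iff)
      then show ?thesis using True by simp
    next
      case False
      then have "a k ~= 0" using a[of k] by (auto simp: iZ_0)
      then have "pZ dvd a k \<longleftrightarrow> vQ (iZ (a k)) > 0" by (simp add: vQ_pos_dvd)
      then show ?thesis using False m_le[OF False] by (auto simp: padic_unit_iff a vscale)
    qed
    define d where "d = Max {k. a k dvd 1}"
    have sub: "{k. a k dvd 1} \<subseteq> {..n}"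
    proof (intro subsetI, rule ccontr)
      fix k assume "k \<in> {k. a k dvd 1}" "k \<notin> {..n}"
      then show False using a0[of k] by simp
    qed
    then have fin: "finite {k. a k dvd 1}" by (rule finite_subset) simp
    have "{k. a k dvd 1} ~= {}" using j unit[of j] by auto
    then have "d \<in> {k. a k dvd 1}" unfolding d_def by (intro Max_in fin)
    then have d: "a d dvd 1" by simp
    have big: "pZ dvd a k" if "k > d" for k
    proof (rule ccontr)
      assume "\<not> pZ dvd a k"
      then have "k \<le> d" unfolding d_def by (intro Max_ge fin) (simp add: padic_unit_iff)
      with that show False by simp
    qed
    have "d ~= n" using d \<open>m < 0\<close> unit[of n] by (auto simp: mon vQ_1)
    then have dn: "d < n" using d sub by (metis (mono_tags, lifting) CollectI atMost_iff le_neq_implies_less subsetD)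
    have d0: "d > 0"
    proof (rule ccontr)
      assume "\<not> d > 0"
      then have "a 0 dvd 1" using d by simp
      then show False using v0 \<open>m < 0\<close> unit[of 0] by simp
    qed
    have "coeff F d dvd 1" "!!i. i > d ==> pZ dvd coeff F i" using d big by (simp_all add: cF)
    then obtain G H where GH: "F = G * H" "degree G = d" "F ~= 0" by (rule hensel_split) blast
    have GH0: "G ~= 0" "H ~= 0" using GH by auto
    have "degree H = n - d" using GH GH0 degF by (simp add: degree_mult_eq)
    have "poly (map_poly to_ac (map_poly iZ F)) x = 0"
    proof -
      have "map_poly to_ac (map_poly iZ F) = smult (to_ac (pQ powi (- m))) (map_poly to_ac P)"
        unfolding mapF by (rule poly_eqI) (simp add: coeff_map_poly)
      then show ?thesis using gpoly_root[of x] by (simp add: P_def)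
    qed
    moreover have "map_poly to_ac (map_poly iZ F) = map_poly to_ac (map_poly iZ G) * map_poly to_ac (map_poly iZ H)"
    proof -
      interpret t: map_poly_comm_ring_hom to_ac by unfold_locales auto
      show ?thesis by (simp add: GH iZ_poly.hom_mult t.hom_mult)
    qed
    ultimately consider "poly (map_poly to_ac (map_poly iZ G)) x = 0" | "poly (map_poly to_ac (map_poly iZ H)) x = 0"
      by auto
    then show False
    proof cases
      case 1
      then have "n \<le> degree (map_poly iZ G)"
        unfolding n using GH0 by (intro card_gorb_le_degree) auto
      then show False using dn GH by simp
    next
      case 2
      then have "n \<le> degree (map_poly iZ H)"
        unfolding n using GH0 by (intro card_gorb_le_degree) auto
      then show False using d0 n0 \<open>degree H = n - d\<close> by simp
    qed
  qed
  then have "\<forall>i. \<exists>a. coeff P i = iZ a" by blast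
  then have "\<exists>a. \<forall>i. coeff P i = iZ (a i)" by (rule choice)
  then obtain a where a: "!!i. coeff P i = iZ (a i)" by blast
  define f where "f = (\<Sum>k\<le>n. monom (a k) k)"
  have "a k = 0" if "k > n" for k
  proof -
    have "iZ (a k) = 0" using that a[of k] by (simp add: n_def coeff_eq_0)
    then show ?thesis by (simp only: iZ_eq_0_iff)
  qed
  then have "coeff f k = a k" for k
    by (auto simp: f_def coeff_sum coeff_monom if_distrib sum.delta cong: if_cong)
  then have "P = map_poly iZ f" by (intro poly_eqI) (simp add: a)
  then show ?thesis using that by (simp add: P_def)
qed

section \<open>Integrality and the ultrametric inequality\<close>

lemma map_poly_of_Zp: "map_poly of_Zp f = map_poly to_ac (map_poly iZ f)"
  by (rule poly_eqI) (simp add: coeff_map_poly of_Zp_iZ iZ_0)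

lemma of_Zp_hom: "inj_idom_hom of_Zp"
  by unfold_locales (simp_all add: of_Zp_iZ iZ_add iZ_mult iZ_1 iZ_0 iZ_eq_0_iff)

interpretation of_Zp: inj_idom_hom of_Zp by (rule of_Zp_hom)

lemma w_of_Zp: "a ~= 0 ==> w (of_Zp a) \<ge> 0"
  using vQ_nonneg_iff[of "iZ a"] by (simp add: of_Zp_iZ w_to_ac iZ_eq_0_iff)

definition wge :: "'p :: prime_card qp_bar => real => bool" where
  "wge x c \<longleftrightarrow> x = 0 \<or> w x \<ge> c"

lemma wge_0 [simp]: "wge 0 c" by (simp add: wge_def)

lemma wge_of_Zp: "wge (of_Zp a) 0"
  using w_of_Zp[of a] by (auto simp: wge_def)

lemma wge_mult: "wge x a ==> wge y b ==> wge (x * y) (a + b)"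
  by (cases "x = 0 \<or> y = 0") (auto simp: wge_def w_mult)

text \<open>The norm of 1 + x is, up to sign, the value at -1 of the minimal polynomial of x, and
  this lies in Z_p by \<open>gpoly_integral\<close>.\<close>

lemma wge_one_plus:
  assumes "wge x 0"
  shows "wge (1 + x) 0"
proof (cases "x = 0 \<or> 1 + x = 0")
  case False
  then have "x ~= 0" "w x \<ge> 0" using assms by (auto simp: wge_def)
  then obtain f where f: "gpoly x = map_poly iZ f" by (rule gpoly_integral)
  have orb: "gorb (1 + x) = (%y. 1 + y) ` gorb x"
    by (force simp: gorb_def Gal_simps image_image)
  have inj: "inj_on (%y. 1 + y) (gorb x)" by (simp add: inj_on_def)
  have "(\<Prod>y\<in>gorb (1 + x). y) = (\<Prod>y\<in>gorb x. 1 + y)"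
    unfolding orb by (subst prod.reindex[OF inj]) simp
  also have "\<dots> = (\<Prod>y\<in>gorb x. (- 1) * (- 1 - y))" by (rule prod.cong) auto
  also have "\<dots> = (- 1) ^ card (gorb x) * poly (map_poly to_ac (gpoly x)) (- 1)"
    by (simp only: prod.distrib poly_gpoly prod_constant)
  also have "poly (map_poly to_ac (gpoly x)) (- 1) = of_Zp (poly f (- 1))"
    using of_Zp.poly_map_poly[of f "- 1"] by (simp add: f map_poly_of_Zp of_Zp.hom_uminus)
  also have "(- 1) ^ card (gorb x) * \<dots> = of_Zp ((- 1) ^ card (gorb x) * poly f (- 1))"
    by (simp add: of_Zp.hom_mult of_Zp.hom_power of_Zp.hom_uminus)
  finally obtain a where a: "(\<Prod>y\<in>gorb (1 + x). y) = of_Zp a" by blast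
  have "0 \<notin> gorb (1 + x)" using False zero_notin_gorb by blast
  then have "of_Zp a ~= 0" unfolding a[symmetric] by simp
  then have "a ~= 0" by auto
  have "w (1 + x) = real_of_int (vQ (iZ a)) / real (card (gorb (1 + x)))"
    using False a by (intro w_eq_norm) (auto simp: of_Zp_iZ)
  moreover have "vQ (iZ a) \<ge> 0" using \<open>a ~= 0\<close> by (subst vQ_nonneg_iff) (auto simp: iZ_eq_0_iff)
  ultimately show ?thesis by (simp add: wge_def)
qed (auto simp: wge_def)

lemma wge_add:
  assumes "wge x c" "wge y c"
  shows "wge (x + y) c"
proof -
  have *: "wge (x + y) c" if "x ~= 0" "y ~= 0" "w x \<le> w y" "wge x c" for x y :: "'a qp_bar"
  proof -
    have "wge (y / x) 0" using that by (auto simp: wge_def w_divide)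
    then have "wge (1 + y / x) 0" by (rule wge_one_plus)
    then have "wge (x * (1 + y / x)) (c + 0)" using that by (intro wge_mult)
    then show ?thesis using that by (simp add: field_simps)
  qed
  show ?thesis
  proof (cases "x = 0 \<or> y = 0")
    case False
    then show ?thesis using *[of x y] *[of y x] assms by (metis add.commute linear)
  qed (use assms in auto)
qed

lemma wge_uminus: "wge (- x) c \<longleftrightarrow> wge x c"
  by (auto simp: wge_def w_uminus)

lemma wge_diff: "wge x c ==> wge y c ==> wge (x - y) c"
  using wge_add[of x c "- y"] by (simp add: wge_uminus)

lemma wge_sum: "(!!i. i \<in> A ==> wge (f i) c) ==> wge (sum f A) c"
  by (induction A rule: infinite_finite_induct) (auto intro: wge_add)

text \<open>If w x < 0, the leading term of a monic integral relation has strictly smaller valuation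
  than all other terms. Conversely the minimal polynomial is itself such a relation.\<close>

lemma integers_bar_iff: "x \<in> integers_bar \<longleftrightarrow> wge x 0"
proof
  assume "x \<in> integers_bar"
  then obtain f where f: "lead_coeff f = 1" "poly (map_poly of_Zp f) x = 0" by (auto simp: integers_bar_def)
  show "wge x 0"
  proof (rule ccontr)
    assume "\<not> wge x 0"
    then have x: "x ~= 0" "w x < 0" by (auto simp: wge_def)
    define n where "n = degree f"
    have n0: "n > 0"
    proof (rule ccontr)
      assume "\<not> n > 0"
      then have "degree f = 0" by (simp add: n_def)
      then have "f = 1" using f(1) by (metis degree_0_id one_pCons)
      then show False using f(2) by simp
    qed
    have "(\<Sum>i\<le>n. of_Zp (coeff f i) * x ^ i) = 0"
      using f(2) by (simp add: poly_altdef n_def)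
    then have "of_Zp (coeff f n) * x ^ n = - (\<Sum>i<n. of_Zp (coeff f i) * x ^ i)"
      by (simp add: lessThan_Suc_atMost[symmetric] eq_neg_iff_add_eq_0 add.commute)
    then have eq: "x ^ n = - (\<Sum>i<n. of_Zp (coeff f i) * x ^ i)"
      using f(1) by (simp add: n_def)
    have "wge (\<Sum>i<n. of_Zp (coeff f i) * x ^ i) (real (n - 1) * w x)"
    proof (rule wge_sum)
      fix i assume "i \<in> {..<n}"
      then have "real (n - 1) * w x \<le> real i * w x"
        using x by (intro mult_right_mono_neg) auto
      then have "wge (x ^ i) (real (n - 1) * w x)" using x by (simp add: wge_def w_power)
      then show "wge (of_Zp (coeff f i) * x ^ i) (real (n - 1) * w x)"
        using wge_mult[OF wge_of_Zp] by fastforce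
    qed
    then have "wge (x ^ n) (real (n - 1) * w x)" by (simp only: eq wge_uminus)
    then have "x ^ n = 0 \<or> real (n - 1) * w x \<le> real n * w x"
      unfolding wge_def w_power[OF x(1)] .
    then have "real (n - 1) * w x \<le> real n * w x" using x(1) by (metis power_not_zero)
    moreover have "real n * w x < real (n - 1) * w x"
      using x n0 by (intro mult_strict_right_mono_neg) auto
    ultimately show False by linarith
  qed
next
  assume *: "wge x 0"
  show "x \<in> integers_bar"
  proof (cases "x = 0")
    case True
    then show ?thesis by (auto simp: integers_bar_def map_poly_pCons intro!: exI[of _ "[:0, 1:]"])
  next
    case False
    then have "w x \<ge> 0" using * by (simp add: wge_def)
    then obtain f where f: "gpoly x = map_poly iZ f" using gpoly_integral False by blast
    have "iZ (lead_coeff f) = lead_coeff (map_poly iZ f)" by simp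
    also have "\<dots> = iZ 1" using gpoly_monic[of x] by (simp add: f iZ_1)
    finally have "lead_coeff f = 1" by (simp only: iZ_eq_iff)
    moreover have "poly (map_poly of_Zp f) x = 0"
      using gpoly_root[of x] by (simp add: map_poly_of_Zp f)
    ultimately show ?thesis by (auto simp: integers_bar_def)
  qed
qed

lemma max_ideal_bar_iff: "x \<in> max_ideal_bar \<longleftrightarrow> x = 0 \<or> w x > 0"
  by (auto simp: max_ideal_bar_def integers_bar_iff wge_def w_inverse)

lemma w_fraction:
  fixes x :: "'p :: prime_card qp_bar"
  obtains k :: int where "w x = real_of_int k / real (card (gorb x))"
  using w_def by blast

lemma w_add_distinct:
  assumes "x ~= 0" "y ~= 0" "w x < w y"
  shows "x + y ~= 0" "w (x + y) = w x"
proof -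
  show nz: "x + y ~= 0"
  proof
    assume "x + y = 0"
    then have "y = - x" by (simp add: eq_neg_iff_add_eq_0 add.commute)
    then show False using assms by (simp add: w_uminus)
  qed
  have "wge (x + y) (w x)" using assms by (intro wge_add) (auto simp: wge_def)
  moreover have "\<not> w (x + y) > w x"
  proof
    assume *: "w (x + y) > w x"
    have "wge ((x + y) - y) (min (w (x + y)) (w y))"
      by (intro wge_diff) (auto simp: wge_def)
    then show False using * assms by (auto simp: wge_def)
  qed
  ultimately show "w (x + y) = w x" using nz by (simp add: wge_def)
qed

text \<open>The term of least valuation is unique, and the ultrametric inequality keeps the others
  from cancelling it.\<close>

lemma sum_distinct_w_neq_0:
  fixes f :: "'i => 'p :: prime_card qp_bar"
  assumes "finite A" "!!i. i \<in> A ==> f i ~= 0" "inj_on (%i. w (f i)) A" "A ~= {}"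
  shows "sum f A ~= 0"
proof -
  obtain m where m: "m \<in> A" "!!i. i \<in> A ==> w (f m) \<le> w (f i)"
    using arg_min_if_finite[OF assms(1,4), of "%i. w (f i)"] by (meson not_le)
  define S where "S = sum f (A - {m})"
  have eq: "sum f A = f m + S" unfolding S_def using assms m by (intro sum.remove) auto
  show ?thesis
  proof (cases "S = 0")
    case True
    then show ?thesis using eq assms(2) m by simp
  next
    case False
    have ne: "A - {m} ~= {}"
    proof
      assume "A - {m} = {}"
      then have "S = 0" unfolding S_def by (simp only: sum.empty)
      with False show False by simp
    qed
    let ?c = "Min ((%i. w (f i)) ` (A - {m}))"
    have "wge S ?c" unfolding S_def using assms(1)
      by (intro wge_sum) (auto simp: wge_def intro!: Min_le)
    moreover have "?c > w (f m)"
      using assms ne m by (subst Min_gr_iff) (auto simp: inj_on_def order.strict_iff_order)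
    ultimately have "w (f m) < w S" using False by (simp add: wge_def)
    then show ?thesis using w_add_distinct[of "f m" S] assms(2) m False by (simp add: eq)
  qed
qed

section \<open>Residue field, roots of unity and tame ramification\<close>

subsection \<open>Roots of unity\<close>

lemma separable_card_roots:
  fixes f :: "'a :: alg_closed_field poly"
  assumes "f ~= 0" "!!x. poly f x = 0 ==> poly (pderiv f) x ~= 0"
  shows "card {x. poly f x = 0} = degree f"
  using assms
proof (induction "degree f" arbitrary: f)
  case 0
  then obtain c where "f = [:c:]" "c ~= 0" by (metis degree_0_id pCons_0_0)
  then show ?case by simp
next
  case (Suc n)
  obtain a where a: "poly f a = 0"
    using alg_closed_imp_poly_has_root[of f] Suc.hyps(2) by auto
  then have "[:- a, 1:] dvd f" by (simp add: poly_eq_0_iff_dvd)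
  then obtain g where g: "f = [:- a, 1:] * g" by (elim dvdE)
  have g0: "g ~= 0" using g Suc.prems(1) by auto
  have dg: "degree f = Suc (degree g)" unfolding g using g0 by (subst degree_mult_eq) auto
  have df: "poly (pderiv f) x = (x - a) * poly (pderiv g) x + poly g x" for x
    unfolding g pderiv_mult by (simp add: pderiv_pCons left_diff_distrib)
  have ga: "poly g a ~= 0" using Suc.prems(2)[OF a] by (simp add: df)
  have "card {x. poly g x = 0} = degree g"
  proof (rule Suc.hyps(1))
    show "n = degree g" using Suc.hyps(2) dg by simp
    show "poly (pderiv g) x ~= 0" if "poly g x = 0" for x
      using Suc.prems(2)[of x] that by (simp add: df) (simp add: g)
  qed fact
  moreover have "{x. poly f x = 0} = insert a {x. poly g x = 0}" by (auto simp: g)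
  moreover have "finite {x. poly g x = 0}" by (rule poly_roots_finite) fact
  ultimately show ?case using ga dg by simp
qed

definition mu :: "nat => 'a :: field set" where "mu n = {x. x ^ n = 1}"

lemma mu_neq_0: "x \<in> mu n ==> n > 0 ==> x ~= 0"
  by (auto simp: mu_def power_0_left)

lemma card_mu:
  assumes "of_nat n ~= (0 :: 'a :: alg_closed_field)"
  shows "card (mu n :: 'a set) = n" "finite (mu n :: 'a set)"
proof -
  have n: "n > 0" using assms by (cases n) auto
  define f :: "'a poly" where "f = monom 1 n - 1"
  have cn: "coeff f n = 1" using n by (simp add: f_def)
  then have f0: "f ~= 0" by auto
  have roots: "{x. poly f x = 0} = mu n" by (auto simp: f_def poly_monom mu_def)
  have deg: "degree f = n"
  proof (rule antisym)
    show "degree f \<le> n" unfolding f_def by (intro degree_diff_le) (auto simp: degree_monom_le)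
    show "n \<le> degree f" by (intro le_degree) (simp add: cn)
  qed
  have "poly (pderiv f) x ~= 0" if "poly f x = 0" for x
  proof -
    have "x \<in> mu n" using that roots by auto
    then have "x ~= 0" using n by (rule mu_neq_0)
    then show ?thesis using assms by (simp add: f_def pderiv_diff pderiv_monom poly_monom)
  qed
  then have "card {x. poly f x = 0} = degree f" using f0 by (intro separable_card_roots)
  then show "card (mu n :: 'a set) = n" by (simp only: roots deg)
  show "finite (mu n :: 'a set)" unfolding roots[symmetric] by (rule poly_roots_finite) fact
qed

lemma mu_power: "x \<in> mu n ==> x ^ k \<in> mu n"
proof -
  have "(x ^ k) ^ n = (x ^ n) ^ k" by (simp add: mult.commute flip: power_mult)
  then show "x \<in> mu n ==> x ^ k \<in> mu n" by (simp add: mu_def)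
qed

definition prim :: "'a :: field => nat => bool" where
  "prim z n \<longleftrightarrow> (\<forall>k. z ^ k = 1 \<longleftrightarrow> n dvd k)"

lemma primD: "prim z n ==> z ^ k = 1 \<longleftrightarrow> n dvd k"
  by (simp add: prim_def)

lemma prim_mu: "prim z n ==> z \<in> mu n"
  by (simp add: prim_def mu_def)

lemma prim_neq_0: "prim z n ==> n > 0 ==> z ~= 0"
  using prim_mu mu_neq_0 by blast

lemma prim_power_eq_iff:
  assumes "prim z n" "n > 0"
  shows "z ^ i = z ^ j \<longleftrightarrow> i mod n = j mod n"
proof -
  have *: "z ^ i = z ^ j \<longleftrightarrow> i mod n = j mod n" if "i \<le> j" for i j
  proof -
    have "z ^ i = z ^ j \<longleftrightarrow> z ^ i * 1 = z ^ i * z ^ (j - i)"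
      using that by (simp flip: power_add)
    also have "\<dots> \<longleftrightarrow> z ^ (j - i) = 1"
      using prim_neq_0[OF assms] by (subst mult_cancel_left) auto
    also have "\<dots> \<longleftrightarrow> i mod n = j mod n"
      unfolding primD[OF assms(1)] using mod_eq_dvd_iff_nat[OF that, of n] by metis
    finally show ?thesis .
  qed
  show ?thesis
  proof (cases "i \<le> j")
    case True
    then show ?thesis by (rule *)
  next
    case False
    then show ?thesis using *[of j i] by auto
  qed
qed

lemma prim_mu_cases:
  assumes "prim (z :: 'a :: alg_closed_field) n" "of_nat n ~= (0 :: 'a)" "x \<in> mu n"
  obtains t where "x = z ^ t" "t < n"
proof -
  have n: "n > 0" using assms by (cases n) auto
  have "(%t. z ^ t) ` {..<n} = mu n"
  proof (rule card_subset_eq)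
    show "finite (mu n :: 'a set)" by (rule card_mu) fact
    show "(%t. z ^ t) ` {..<n} \<subseteq> mu n"
      using prim_mu[OF assms(1)] by (auto intro: mu_power)
    have "inj_on (%t. z ^ t) {..<n}"
      by (auto simp: inj_on_def prim_power_eq_iff[OF assms(1) n])
    then show "card ((%t. z ^ t) ` {..<n}) = card (mu n :: 'a set)"
      by (simp add: card_image card_mu assms)
  qed
  then show ?thesis using assms(3) that by blast
qed

lemma prim_power_dvd: "prim z n ==> m dvd n ==> n > 0 ==> prim (z ^ (n div m)) m"
proof -
  assume *: "prim z n" "m dvd n" "n > 0"
  then obtain d where d: "n = m * d" by (elim dvdE)
  then have "d > 0" "m > 0" using * by auto
  then show ?thesis using * d
    by (auto simp: prim_def simp flip: power_mult)
qed

lemma prim_mult: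
  assumes "prim x a" "prim y b" "coprime a b"
  shows "prim (x * y) (a * b)"
  unfolding prim_def
proof (intro allI iffI)
  fix k assume xy: "(x * y) ^ k = 1"
  have "(x * y) ^ (k * b) = 1" using xy by (simp add: power_mult)
  moreover have "y ^ (k * b) = 1" using assms(2) by (simp add: prim_def)
  ultimately have "a dvd k * b" using assms(1) by (simp add: power_mult_distrib prim_def)
  then have 1: "a dvd k" using assms(3) by (simp add: coprime_dvd_mult_left_iff)
  have "(x * y) ^ (k * a) = 1" using xy by (simp add: power_mult)
  moreover have "x ^ (k * a) = 1" using assms(1) by (simp add: prim_def)
  ultimately have "b dvd k * a" using assms(2) by (simp add: power_mult_distrib prim_def)
  moreover have "coprime b a" using assms(3) by (simp only: coprime_commute)
  ultimately have "b dvd k" by (simp add: coprime_dvd_mult_left_iff)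
  with 1 show "a * b dvd k" using assms(3) by (rule divides_mult)
next
  fix k assume "a * b dvd k"
  then have "a dvd k" "b dvd k" by (auto dest: dvd_mult_left dvd_mult_right)
  then have "x ^ k = 1" "y ^ k = 1" using assms by (simp_all add: prim_def)
  then show "(x * y) ^ k = 1" by (simp add: power_mult_distrib)
qed

text \<open>Counting: for e = Suc d the q^e-th roots of unity outnumber the q^d-th ones, and a root
  outside the smaller group has exact order q^e.\<close>

lemma prim_exists_prime_power:
  assumes "prime q" "of_nat q ~= (0 :: 'a :: alg_closed_field)"
  obtains x :: "'a :: alg_closed_field" where "prim x (q ^ e)"
proof (cases e)
  case 0
  then show ?thesis using that[of 1] by (simp add: prim_def)
next
  case (Suc d)
  have "card (mu (q ^ d) :: 'a set) < card (mu (q ^ e) :: 'a set)"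
    using assms prime_gt_1_nat[OF assms(1)] by (simp add: card_mu Suc)
  moreover have "finite (mu (q ^ d) :: 'a set)" using assms by (intro card_mu) auto
  ultimately have "\<not> (mu (q ^ e) :: 'a set) \<subseteq> mu (q ^ d)" by (meson card_mono not_le)
  then obtain x :: 'a where x: "x ^ (q ^ e) = 1" "x ^ (q ^ d) ~= 1" by (auto simp: mu_def)
  have "prim x (q ^ e)"
    unfolding prim_def
  proof (intro allI iffI)
    fix k assume k: "x ^ k = 1"
    define m where "m = gcd k (q ^ e)"
    have xm: "x ^ m = 1"
    proof (cases "k = 0")
      case True
      then show ?thesis using x by (simp add: m_def)
    next
      case False
      obtain a b where "k * a = q ^ e * b + m" using bezout_nat[OF False, of "q ^ e"] by (auto simp: m_def)
      then have "x ^ (k * a) = x ^ (q ^ e * b) * x ^ m" by (simp add: power_add)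
      then show ?thesis using k x(1) by (simp add: power_mult)
    qed
    obtain i where i: "m = q ^ i" "i \<le> e"
      using divides_primepow_nat[OF assms(1), of m e] by (auto simp: m_def)
    have "i = e"
    proof (rule ccontr)
      assume "i ~= e"
      then have "i \<le> d" using i Suc by simp
      then have "q ^ d = m * q ^ (d - i)" by (simp add: i flip: power_add)
      then have "x ^ (q ^ d) = 1" using xm by (simp add: power_mult)
      then show False using x by simp
    qed
    then show "q ^ e dvd k" using i by (metis gcd_dvd1 m_def)
  next
    fix k assume "q ^ e dvd k"
    then show "x ^ k = 1" using x(1) by (auto simp: power_mult elim!: dvdE)
  qed
  then show ?thesis by (rule that)
qed

lemma prim_exists:
  "of_nat n ~= (0 :: 'a :: alg_closed_field) ==> \<exists>x :: 'a. prim x n"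
proof (induction n rule: less_induct)
  case (less n)
  have n: "n > 0" using less.prems by (cases n) auto
  show ?case
  proof (cases "n = 1")
    case True
    then show ?thesis by (intro exI[of _ 1]) (simp add: prim_def)
  next
    case False
    then obtain q where q: "prime q" "q dvd n" using prime_factor_nat by blast
    obtain m where m: "n = q ^ multiplicity q n * m" "\<not> q dvd m"
      using multiplicity_decompose'[of n q] q n by (metis gr_implies_not0 not_prime_unit)
    define e where "e = multiplicity q n"
    have nm: "n = q ^ e * m" using m(1) by (simp only: e_def)
    have "e ~= 0" using nm m(2) q(2) by (cases e) auto
    have nz: "of_nat q ~= (0 :: 'a)" "of_nat m ~= (0 :: 'a)"
      using less.prems \<open>e ~= 0\<close> unfolding nm by (auto simp: power_0_left)
    have "e > 0" using \<open>e ~= 0\<close> by simp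
    then have "1 < q ^ e" using prime_gt_1_nat[OF q(1)] by (intro one_less_power \<open>e > 0\<close>)
    moreover have "m > 0" using nm n by (cases m) auto
    ultimately have "m < n" using nm by simp
    then obtain y :: 'a where y: "prim y m" using less.IH nz by blast
    obtain x :: 'a where x: "prim x (q ^ e)" using prim_exists_prime_power[OF q(1) nz(1)] .
    have "coprime (q ^ e) m" using prime_imp_coprime[OF q(1) m(2)] by simp
    then have "prim (x * y) (q ^ e * m)" by (rule prim_mult[OF x y])
    then show ?thesis using nm by auto
  qed
qed

text \<open>Pigeonhole on the iterates of the q-th power map inside R, followed by cancellation. The
  bound d <= card R is what allows one level n to serve for all elements of bounded degree in
  \<open>tame_level\<close>.\<close>

lemma frobenius_periodic:
  fixes \<alpha> :: "'a :: field"
  assumes R: "finite R" "!!x. x \<in> R ==> x ^ q \<in> R" and \<alpha>: "\<alpha> \<in> R" "\<alpha> ~= 0"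
    and inj: "!!x y :: 'a. x ^ q = y ^ q ==> x = y" and q: "q > 0"
  shows "\<exists>d. 1 \<le> d \<and> d \<le> card R \<and> \<alpha> ^ (q ^ d - 1) = 1" (is ?thesis)
proof -
  have inR: "\<alpha> ^ (q ^ i) \<in> R" for i
    by (induction i) (use \<alpha> R in \<open>auto simp: power_mult mult.commute[of q]\<close>)
  have "\<not> inj_on (%i. \<alpha> ^ (q ^ i)) {..card R}"
  proof
    assume "inj_on (%i. \<alpha> ^ (q ^ i)) {..card R}"
    then have "card ((%i. \<alpha> ^ (q ^ i)) ` {..card R}) = Suc (card R)" by (simp add: card_image)
    moreover have "card ((%i. \<alpha> ^ (q ^ i)) ` {..card R}) \<le> card R"
      using R inR by (intro card_mono) auto
    ultimately show False by simp
  qed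
  then obtain i j where ij: "i ~= j" "i \<le> card R" "j \<le> card R" "\<alpha> ^ (q ^ i) = \<alpha> ^ (q ^ j)"
    by (auto simp: inj_on_def)
  have key: ?thesis if "i < j" "j \<le> card R" "\<alpha> ^ (q ^ i) = \<alpha> ^ (q ^ j)" for i j
  proof -
    have "\<alpha> = \<alpha> ^ (q ^ d)" if "\<alpha> ^ (q ^ i) = \<alpha> ^ (q ^ (i + d))" for i d
      using that
    proof (induction i)
      case (Suc i)
      have "(\<alpha> ^ (q ^ i)) ^ q = (\<alpha> ^ (q ^ (i + d))) ^ q"
        using Suc.prems by (simp flip: power_mult add: mult.commute)
      then show ?case using inj Suc.IH by blast
    qed simp
    from this[of i "j - i"] that have *: "\<alpha> = \<alpha> ^ (q ^ (j - i))" by simp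
    have "\<alpha> * 1 = \<alpha> * \<alpha> ^ (q ^ (j - i) - 1)"
      using * q by (metis Suc_diff_1 mult.right_neutral power_Suc zero_less_power)
    then have "\<alpha> ^ (q ^ (j - i) - 1) = 1" using \<alpha> by (simp only: mult_cancel_left) simp
    then show ?thesis using that by (intro exI[of _ "j - i"]) auto
  qed
  show ?thesis using ij key[of i j] key[of j i] by (metis linorder_neqE_nat)
qed

subsection \<open>The prime field\<close>

lemma of_nat_p_fpb [simp]: "(of_nat CARD('p) :: 'p :: prime_card fp_bar) = 0"
proof -
  have "to_ac (of_nat CARD('p) :: 'p mod_ring) = to_ac 0" by (simp only: of_nat_card_eq_0)
  then show ?thesis by (simp only: to_ac_of_nat to_ac_0)
qed

lemma of_nat_fpb_eq_0_iff: "(of_nat n :: 'p :: prime_card fp_bar) = 0 \<longleftrightarrow> CARD('p) dvd n"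
proof
  assume "(of_nat n :: 'p fp_bar) = 0"
  then have "to_ac (of_nat n :: 'p mod_ring) = 0" by simp
  then show "CARD('p) dvd n" by (simp only: to_ac_eq_0_iff of_nat_0_mod_ring_dvd)
qed (auto elim!: dvdE)

lemma fpb_add_power: "((x :: 'p :: prime_card fp_bar) + y) ^ CARD('p) = x ^ CARD('p) + y ^ CARD('p)"
  by (rule freshmans_dream) (simp_all add: prime_card)

lemma fpb_uminus_power: "(- x :: 'p :: prime_card fp_bar) ^ CARD('p) = - (x ^ CARD('p))"
proof -
  have p: "CARD('p) > 0" by simp
  have "x ^ CARD('p) + (- x) ^ CARD('p) = 0"
    using p by (simp add: fpb_add_power[symmetric] power_0_left)
  then show ?thesis by (simp add: eq_neg_iff_add_eq_0 add.commute)
qed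

lemma fpb_diff_power: "((x :: 'p :: prime_card fp_bar) - y) ^ CARD('p) = x ^ CARD('p) - y ^ CARD('p)"
  using fpb_add_power[of x "- y"] by (simp add: fpb_uminus_power)

lemma fpb_power_inj: "(x :: 'p :: prime_card fp_bar) ^ CARD('p) = y ^ CARD('p) ==> x = y"
proof -
  assume "x ^ CARD('p) = y ^ CARD('p)"
  then have "(x - y) ^ CARD('p) = 0" by (simp add: fpb_diff_power)
  then show ?thesis by simp
qed

lemma fpb_power_p_power_inj: "(x :: 'p :: prime_card fp_bar) ^ (CARD('p) ^ s) = y ^ (CARD('p) ^ s) ==> x = y"
  by (induction s) (auto simp: power_mult mult.commute[of "CARD('p)"] dest: fpb_power_inj)

lemma fpb_sum_power: "(sum f A :: 'p :: prime_card fp_bar) ^ CARD('p) = (\<Sum>a\<in>A. f a ^ CARD('p))"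
  by (induction A rule: infinite_finite_induct) (simp_all add: fpb_add_power power_0_left)

lemma to_ac_fermat': "to_ac (x :: 'p :: prime_card mod_ring) ^ CARD('p) = to_ac x"
  using finite_field_power_card_eq_same[of x] by (simp flip: to_ac_power)

lemma fpb_fixed_iff: "(x :: 'p :: prime_card fp_bar) ^ CARD('p) = x \<longleftrightarrow> x \<in> range to_ac"
proof
  assume x: "x ^ CARD('p) = x"
  define f :: "'p fp_bar poly" where "f = monom 1 CARD('p) - monom 1 1"
  have p: "CARD('p) > 1" using prime_gt_1_nat[OF prime_card[where ?'a = 'p]] .
  have "coeff f CARD('p) = 1" using p by (simp add: f_def)
  then have f0: "f ~= 0" by auto
  have "degree f \<le> CARD('p)" unfolding f_def using p by (intro degree_diff_le) (auto simp: degree_monom_eq)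
  have sub: "range to_ac \<subseteq> {x. poly f x = 0}" by (auto simp: f_def poly_monom to_ac_fermat')
  have fin: "finite {x. poly f x = 0}" by (rule poly_roots_finite) fact
  have "card {x. poly f x = 0} \<le> CARD('p)"
    using card_poly_roots_bound[OF f0] \<open>degree f \<le> CARD('p)\<close> by linarith
  also have "CARD('p) = card (range (to_ac :: 'p mod_ring => _))" by (simp add: card_image inj_to_ac)
  finally have "range to_ac = {x. poly f x = 0}"
    using card_seteq[OF fin sub] by simp
  then show "x \<in> range to_ac" using x by (simp add: f_def poly_monom)
qed (auto simp: to_ac_fermat')

lemma poly_fixed_coeffs_power:
  fixes f :: "'p :: prime_card fp_bar poly"
  assumes "!!i. coeff f i ^ CARD('p) = coeff f i"
  shows "poly f (x ^ CARD('p)) = poly f x ^ CARD('p)"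
  by (simp add: poly_altdef fpb_sum_power power_mult_distrib assms flip: power_mult)
     (simp add: mult.commute)

lemma fpb_root_of_unity:
  fixes \<alpha> :: "'p :: prime_card fp_bar"
  assumes "\<alpha> ~= 0"
  obtains n where "n > 0" "\<not> CARD('p) dvd n" "\<alpha> \<in> mu n"
proof -
  let ?p = "CARD('p)"
  have p: "?p > 1" using prime_gt_1_nat[OF prime_card[where ?'a = 'p]] .
  obtain f where f: "f ~= 0" "poly (map_poly to_ac f) \<alpha> = 0"
    by (rule alg_closure_algebraic)
  let ?R = "{x. poly (map_poly to_ac f) x = 0}"
  have cl: "x ^ ?p \<in> ?R" if "x \<in> ?R" for x
    using that poly_fixed_coeffs_power[of "map_poly to_ac f" x]
    by (simp add: coeff_map_poly to_ac_fermat' power_0_left)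
  have fin: "finite ?R" by (simp add: poly_roots_finite f)
  have "\<exists>d. 1 \<le> d \<and> d \<le> card ?R \<and> \<alpha> ^ (?p ^ d - 1) = 1"
    by (rule frobenius_periodic[OF fin cl]) (use f assms in \<open>auto dest: fpb_power_inj\<close>)
  then obtain d where d: "1 \<le> d" "\<alpha> ^ (?p ^ d - 1) = 1" by blast
  have "?p dvd ?p ^ d" using d(1) by (simp add: dvd_power)
  moreover have "1 < ?p ^ d" using p d(1) by (intro one_less_power) auto
  ultimately have "\<not> ?p dvd ?p ^ d - 1"
    using p dvd_diff_nat[of ?p "?p ^ d" "?p ^ d - 1"] by auto
  then show ?thesis using that[of "?p ^ d - 1"] d \<open>1 < ?p ^ d\<close> by (simp add: mu_def)
qed

subsection \<open>The residue map\<close>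

text \<open>The reduction map that occurs in the definition of the fundamental characters. It is
  controlled only on the integers, so its arithmetic carries \<open>wge\<close> hypotheses
  throughout.\<close>

locale residue =
  fixes red :: "'p :: prime_card qp_bar => 'p fp_bar"
  assumes red_1: "red 1 = 1"
    and red_add': "x \<in> integers_bar ==> y \<in> integers_bar ==> red (x + y) = red x + red y"
    and red_mult': "x \<in> integers_bar ==> y \<in> integers_bar ==> red (x * y) = red x * red y"
begin

lemma p_prime: "Factorial_Ring.prime CARD('p)" by (rule prime_card)
lemma p_gt_1: "CARD('p) > 1" using prime_gt_1_nat[OF p_prime] .
lemma p_pos: "CARD('p) > 0" using p_gt_1 by linarith

lemma red_add: "wge x 0 ==> wge y 0 ==> red (x + y) = red x + red y"
  and red_mult: "wge x 0 ==> wge y 0 ==> red (x * y) = red x * red y"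
  using red_add' red_mult' by (simp_all add: integers_bar_iff)

lemma wge_1 [simp]: "wge 1 0" by (simp add: wge_def)

lemma wge_mult_0: "wge x 0 ==> wge y 0 ==> wge (x * y) 0"
  using wge_mult[of x 0 y 0] by simp

lemma wge_power: "wge x 0 ==> wge (x ^ n) 0"
  by (induction n) (auto intro: wge_mult_0)

lemma wge_prod: "(!!i. i \<in> A ==> wge (f i) 0) ==> wge (prod f A) 0"
  by (induction A rule: infinite_finite_induct) (auto intro: wge_mult_0)

lemma wge_of_nat: "wge (of_nat n) 0"
  by (induction n) (auto intro: wge_add)

lemma wge_Gal: "sg \<in> Gal ==> wge (sg x) c \<longleftrightarrow> wge x c"
  by (simp add: wge_def w_Gal Gal_eq_0_iff)

lemma red_0 [simp]: "red 0 = 0"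
proof -
  have "red 0 + red 0 = red 0 + 0" using red_add[of 0 0] by simp
  then show ?thesis by (simp only: add_left_cancel)
qed

lemma red_uminus: "wge x 0 ==> red (- x) = - red x"
  using red_add[of x "- x"] by (simp add: wge_uminus eq_neg_iff_add_eq_0 add.commute)

lemma red_diff: "wge x 0 ==> wge y 0 ==> red (x - y) = red x - red y"
  using red_add[of x "- y"] by (simp add: wge_uminus red_uminus)

lemma red_power: "wge x 0 ==> red (x ^ n) = red x ^ n"
  by (induction n) (simp_all add: red_1 red_mult wge_power)

lemma red_sum: "(!!i. i \<in> A ==> wge (f i) 0) ==> red (sum f A) = (\<Sum>i\<in>A. red (f i))"
  by (induction A rule: infinite_finite_induct) (simp_all add: red_add wge_sum)

lemma red_prod: "(!!i. i \<in> A ==> wge (f i) 0) ==> red (prod f A) = (\<Prod>i\<in>A. red (f i))"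
  by (induction A rule: infinite_finite_induct) (simp_all add: red_1 red_mult wge_prod)

lemma red_of_nat: "red (of_nat n) = of_nat n"
  by (induction n) (simp_all add: red_1 red_add wge_of_nat)

lemma red_p: "red (of_nat CARD('p)) = 0"
  by (simp add: red_of_nat)

text \<open>Valuations are rational with the orbit size n as denominator, so x^n becomes a unit
  after division by a power of p.\<close>

lemma w_unit_part:
  assumes "x ~= (0 :: 'p qp_bar)"
  obtains k where "w x = real_of_int k / real (card (gorb x))"
    "w (x ^ card (gorb x) / of_nat CARD('p) powi k) = 0" "x ^ card (gorb x) / of_nat CARD('p) powi k ~= 0"
proof -
  obtain k where k: "w x = real_of_int k / real (card (gorb x))" by (rule w_fraction)
  have "w (x ^ card (gorb x) / of_nat CARD('p) powi k) = real (card (gorb x)) * w x - real_of_int k"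
    using assms p_pos by (simp add: w_divide w_power w_powi w_p)
  also have "real (card (gorb x)) * w x = real_of_int k"
    using card_gorb_pos[of x] unfolding k by (metis nonzero_mult_div_cancel_left of_nat_0_less_iff order_less_irrefl times_divide_eq_right)
  also have "real_of_int k - real_of_int k = 0" by simp
  finally show ?thesis using that[OF k] assms p_pos by simp
qed

text \<open>Units reduce to units because their inverses are integral. For w x > 0 some power of x
  is a positive power of p times a unit, and p reduces to 0.\<close>

lemma red_eq_0_iff:
  assumes "wge x 0"
  shows "red x = 0 \<longleftrightarrow> x = 0 \<or> w x > 0"
proof (cases "x = 0")
  case False
  then have wx: "w x \<ge> 0" using assms by (simp add: wge_def)
  show ?thesis
  proof (cases "w x = 0")
    case True
    then have "wge (inverse x) 0" using False by (simp add: wge_def w_inverse)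
    then have "red x * red (inverse x) = 1" using red_mult[of x "inverse x"] assms False by (simp add: red_1)
    then show ?thesis using False True by auto
  next
    case ne: False
    then have pos: "w x > 0" using wx by simp
    obtain k where k: "w x = real_of_int k / real (card (gorb x))"
      "w (x ^ card (gorb x) / of_nat CARD('p) powi k) = 0" using w_unit_part[OF False] by blast
    have "k > 0" using pos card_gorb_pos[of x] by (simp add: k zero_less_divide_iff)
    then obtain j where j: "k = int (Suc j)" by (metis gr0_implies_Suc zero_less_imp_eq_int)
    define u where "u = x ^ card (gorb x) / of_nat CARD('p) powi k"
    have "x ^ card (gorb x) = of_nat CARD('p) ^ Suc j * u" using p_pos unfolding u_def j power_int_of_nat by (simp del: power_Suc)
    also have "red \<dots> = red (of_nat CARD('p) ^ Suc j) * red u"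
      using k(2) by (intro red_mult wge_power wge_of_nat) (simp add: wge_def u_def)
    also have "red (of_nat CARD('p) ^ Suc j) = 0"
      unfolding red_power[OF wge_of_nat] red_p by simp
    finally have "red x ^ card (gorb x) = 0" by (simp add: red_power[OF assms])
    then show ?thesis using pos by simp
  qed
qed simp

lemma red_eq_iff:
  assumes "wge x 0" "wge y 0"
  shows "red x = red y \<longleftrightarrow> x = y \<or> w (x - y) > 0"
  using red_eq_0_iff[of "x - y"] assms by (simp add: red_diff wge_diff)

lemma red_Gal:
  assumes "wge x 0" "wge y 0" "red x = red y" "sg \<in> Gal"
  shows "red (sg x) = red (sg y)"
proof -
  have d: "sg x - sg y = sg (x - y)" by (rule Gal_diff[OF assms(4), symmetric])
  have "x = y \<or> w (x - y) > 0" using assms(3) red_eq_iff[OF assms(1,2)] by simp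
  then show ?thesis
    using red_eq_iff[of "sg x" "sg y"] assms(1,2) unfolding d wge_Gal[OF assms(4)] w_Gal[OF assms(4)]
    by auto
qed

lemma red_of_Zp: "red (of_Zp a) \<in> range to_ac"
proof -
  define n where "n = nat (Rep_padic_int a 1)"
  have "Rep_padic_int (a - of_nat n) 1 = 0"
    using Rep_padic_range[of a 1] by (simp add: minus_padic_int.rep_eq Rep_padic_of_nat Rep_padic_of_int n_def)
  then have "pZ dvd a - of_nat n" by (simp only: pZ_dvd_iff)
  then obtain b where "a - of_nat n = pZ * b" by (elim dvdE)
  then have b: "a = of_nat n + pZ * b" by (simp only: diff_eq_eq add.commute)
  have "of_Zp a = of_nat n + of_nat CARD('p) * of_Zp b"
    unfolding b by (simp add: of_Zp.hom_add of_Zp.hom_mult of_Zp.hom_of_nat)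
  then have "red (of_Zp a) = of_nat n"
    by (simp add: red_add red_mult wge_of_nat wge_of_Zp wge_mult_0 red_p red_of_nat)
  also have "\<dots> = to_ac (of_nat n)" by simp
  finally show ?thesis by blast
qed

lemma red_of_Zp_fixed: "red (of_Zp a) ^ CARD('p) = red (of_Zp a)"
  using red_of_Zp fpb_fixed_iff by blast

lemma red_poly:
  assumes "!!i. wge (coeff f i) 0" "wge x 0"
  shows "red (poly f x) = poly (map_poly red f) (red x)"
proof -
  have "red (poly f x) = (\<Sum>i\<le>degree f. red (coeff f i) * red x ^ i)"
    unfolding poly_altdef using assms by (subst red_sum) (auto simp: red_mult wge_power red_power wge_mult_0)
  also have "\<dots> = (\<Sum>i\<le>degree f. coeff (map_poly red f) i * red x ^ i)"
    by (simp add: coeff_map_poly)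
  also have "\<dots> = poly (map_poly red f) (red x)"
    unfolding poly_altdef by (intro sum.mono_neutral_right) (auto simp: degree_map_poly_le coeff_eq_0 intro: order_trans[OF degree_map_poly_le])
  finally show ?thesis .
qed

lemma wge_mu: "z \<in> mu n ==> n > 0 ==> w z = 0"
proof -
  assume z: "z \<in> mu n" "n > 0"
  then have "real n * w z = 0" using w_power[OF mu_neq_0[OF z], of n] by (simp add: mu_def)
  then show ?thesis using z by simp
qed

lemma wge_mu': "z \<in> mu n ==> n > 0 ==> wge z 0"
  by (simp add: wge_mu wge_def)

lemma red_mu: "z \<in> mu n ==> n > 0 ==> red z \<in> mu n"
  using red_power[of z n] by (simp add: wge_mu') (simp add: mu_def red_1)

text \<open>For z ~= 1 the sum 1 + z + ... + z^(n-1) vanishes, but it would reduce to n, which is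
  nonzero in characteristic p.\<close>

lemma red_mu_eq_1:
  assumes z: "z \<in> mu n" "\<not> CARD('p) dvd n" "red z = 1"
  shows "z = 1"
proof (rule ccontr)
  assume "z ~= 1"
  have n: "n > 0" using z(2) by (cases n) auto
  have "(z - 1) * (\<Sum>i<n. z ^ i) = 0"
    using z(1) by (simp add: mu_def power_diff_1_eq[symmetric])
  then have "(\<Sum>i<n. z ^ i) = 0" using \<open>z ~= 1\<close> by simp
  then have "0 = red (\<Sum>i<n. z ^ i)" by simp
  also have "\<dots> = (\<Sum>i<n. red z ^ i)"
    using wge_mu'[OF z(1) n] by (subst red_sum) (auto simp: wge_power red_power)
  also have "\<dots> = of_nat n" by (simp add: z)
  finally show False using z(2) of_nat_fpb_eq_0_iff[of n, where ?'p = 'p] by simp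
qed

lemma red_mu_inj:
  assumes "x \<in> mu n" "y \<in> mu n" "\<not> CARD('p) dvd n" "red x = red y"
  shows "x = y"
proof -
  have n: "n > 0" using assms(3) by (cases n) auto
  have y0: "y ~= 0" using mu_neq_0[OF assms(2) n] .
  have xy: "x / y \<in> mu n" using assms by (simp add: mu_def power_divide)
  have "red (x / y * y) = red (x / y) * red y"
    using xy assms n by (intro red_mult wge_mu')
  moreover have "red y ~= 0" using red_mu[OF assms(2) n] n by (rule mu_neq_0)
  ultimately have "red (x / y) = 1" using y0 assms by simp
  then have "x / y = 1" using red_mu_eq_1[OF xy assms(3)] by blast
  then show ?thesis using y0 by simp
qed

text \<open>Both groups of n-th roots of unity have n elements, and reduction is injective between
  them.\<close>

lemma red_mu_surj:
  assumes "\<alpha> \<in> mu n" "\<not> CARD('p) dvd n"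
  obtains z where "z \<in> mu n" "red z = \<alpha>"
proof -
  have n: "n > 0" using assms(2) by (cases n) auto
  have c1: "card (mu n :: 'p qp_bar set) = n" "finite (mu n :: 'p qp_bar set)"
    using n by (intro card_mu; simp)+
  have c2: "card (mu n :: 'p fp_bar set) = n" "finite (mu n :: 'p fp_bar set)"
    using assms(2) by (intro card_mu; simp add: of_nat_fpb_eq_0_iff)+
  have "inj_on red (mu n)" using red_mu_inj assms(2) by (auto simp: inj_on_def)
  then have "card (red ` mu n) = n" by (simp add: card_image c1)
  moreover have "red ` mu n \<subseteq> mu n" using red_mu n by blast
  ultimately have "red ` mu n = mu n" using c2 by (intro card_subset_eq) auto
  then have "\<alpha> \<in> red ` mu n" using assms(1) by simp
  then obtain z where "\<alpha> = red z" "z \<in> mu n" by (rule imageE)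
  then show ?thesis by (intro that[of z]) simp_all
qed

lemma teichmueller:
  assumes "\<alpha> ~= 0"
  obtains n z where "n > 0" "\<not> CARD('p) dvd n" "z \<in> mu n" "red z = \<alpha>"
proof -
  obtain n where n: "n > 0" "\<not> CARD('p) dvd n" "\<alpha> \<in> mu n" using fpb_root_of_unity[OF assms] .
  obtain z where "z \<in> mu n" "red z = \<alpha>" using red_mu_surj[OF n(3,2)] .
  then show ?thesis by (rule that[OF n(1,2)])
qed

lemma red_prim:
  assumes "prim z n" "\<not> CARD('p) dvd n"
  shows "prim (red z) n"
  unfolding prim_def
proof
  fix k
  have n: "n > 0" using assms(2) by (cases n) auto
  have z: "z \<in> mu n" using assms by (simp add: prim_mu)
  have zk: "z ^ k \<in> mu n" using z by (rule mu_power)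
  have "red z ^ k = red (z ^ k)" using wge_mu'[OF z n] by (simp add: red_power)
  then show "red z ^ k = 1 \<longleftrightarrow> n dvd k"
    using red_mu_eq_1[OF zk assms(2)] primD[OF assms(1), of k] red_1 by metis
qed

lemma Gal_mu:
  assumes "sg \<in> Gal" "z \<in> mu n"
  shows "sg z \<in> mu n"
proof -
  have "sg z ^ n = sg (z ^ n)" by (rule Gal_power[OF assms(1), symmetric])
  then show ?thesis using assms by (simp add: mu_def Gal_1)
qed

text \<open>The minimal polynomial of x reduces to a polynomial over F_p, so its value at x^p
  reduces to 0 along with its value at x. As a product over the conjugates of x, one of its factors
  at x^p must reduce to 0.\<close>

lemma red_gpoly:
  assumes x: "x ~= 0" "w x = 0"
  shows "\<exists>sg\<in>Gal. red (sg x) = red x ^ CARD('p)"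
proof -
  obtain f where f: "gpoly x = map_poly iZ f" using gpoly_integral[OF x(1)] x(2) by auto
  have P: "map_poly to_ac (gpoly x) = map_poly of_Zp f" by (simp add: f map_poly_of_Zp)
  define F where "F = map_poly red (map_poly of_Zp f)"
  have cF: "coeff F i ^ CARD('p) = coeff F i" for i
    by (simp add: F_def coeff_map_poly red_of_Zp_fixed)
  have xw: "wge x 0" using x by (simp add: wge_def)
  have ev: "red (poly (map_poly of_Zp f) z) = poly F (red z)" if "wge z 0" for z
    unfolding F_def using that by (intro red_poly) (auto simp: coeff_map_poly wge_of_Zp)
  have "poly F (red x) = 0" using ev[OF xw] gpoly_root[of x] by (simp add: P)
  then have "poly F (red x ^ CARD('p)) = 0"
    using poly_fixed_coeffs_power[of F, OF cF] p_pos by (simp add: power_0_left)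
  then have "0 = red (poly (map_poly of_Zp f) (x ^ CARD('p)))"
    using ev[of "x ^ CARD('p)"] xw by (simp add: wge_power red_power)
  also have "\<dots> = red (\<Prod>y\<in>gorb x. x ^ CARD('p) - y)" by (simp add: P[symmetric] poly_gpoly)
  also have "\<dots> = (\<Prod>y\<in>gorb x. red x ^ CARD('p) - red y)"
  proof -
    have "wge y 0" if "y \<in> gorb x" for y using that xw by (auto simp: gorb_def wge_Gal)
    then show ?thesis using xw by (subst red_prod) (auto simp: wge_diff wge_power red_diff red_power)
  qed
  finally obtain y where "y \<in> gorb x" "red x ^ CARD('p) = red y" by (auto simp: prod_zero_iff)
  then show ?thesis by (auto simp: gorb_def)
qed

lemma Frobenius_exists:
  assumes "prim (z :: 'p qp_bar) n" "\<not> CARD('p) dvd n"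
  obtains sg where "sg \<in> Gal" "sg z = z ^ CARD('p)"
proof -
  have n: "n > 0" using assms(2) by (cases n) auto
  have z: "z \<in> mu n" using assms by (simp add: prim_mu)
  obtain sg where sg: "sg \<in> Gal" "red (sg z) = red z ^ CARD('p)"
    using red_gpoly[OF mu_neq_0[OF z n] wge_mu[OF z n]] by blast
  have "z ^ CARD('p) \<in> mu n" using z by (rule mu_power)
  moreover have "red (sg z) = red (z ^ CARD('p))" using sg(2) wge_mu'[OF z n] by (simp add: red_power)
  ultimately have "sg z = z ^ CARD('p)" using red_mu_inj Gal_mu[OF sg(1) z] assms(2) by blast
  with sg(1) that show ?thesis by blast
qed

text \<open>Galois acts on roots of unity of order prime to \<open>p\<close> through powers of Frobenius: lift to
  \<open>\<int>\<^sub>p\<close> the polynomial whose roots are the Frobenius conjugates of the reduction.\<close>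

lemma Gal_on_mu:
  assumes sg: "sg \<in> Gal" and z: "(z :: 'p qp_bar) \<in> mu n" "\<not> CARD('p) dvd n"
  obtains i where "sg z = z ^ (CARD('p) ^ i)"
proof -
  have n: "n > 0" using z(2) by (cases n) auto
  define \<alpha> where "\<alpha> = red z"
  define R where "R = range (%i. \<alpha> ^ (CARD('p) ^ i))"
  have "\<alpha> \<in> mu n" unfolding \<alpha>_def using z n by (intro red_mu)
  then have "R \<subseteq> mu n" by (auto simp: R_def intro: mu_power)
  moreover have "finite (mu n :: 'p fp_bar set)"
    using z(2) by (intro card_mu) (simp add: of_nat_fpb_eq_0_iff)
  ultimately have finR: "finite R" by (rule finite_subset)
  have clR: "x ^ CARD('p) \<in> R" if xR: "x \<in> R" for x
  proof -
    obtain i where "x = \<alpha> ^ (CARD('p) ^ i)" using xR by (auto simp: R_def)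
    then have "x ^ CARD('p) = \<alpha> ^ (CARD('p) ^ Suc i)" by (simp flip: power_mult add: mult.commute)
    then show ?thesis unfolding R_def by blast
  qed
  have bijR: "(%x. x ^ CARD('p)) ` R = R"
    using finR clR by (intro endo_inj_surj) (auto simp: inj_on_def dest: fpb_power_inj)
  define f where "f = (\<Prod>x\<in>R. [:- x, 1:])"
  have "coeff f i ^ CARD('p) = coeff f i" for i
  proof -
    define fr where "fr = (%x :: 'p fp_bar. x ^ CARD('p))"
    have hom: "field_hom fr"
      by (rule field_homI) (simp_all add: fr_def fpb_add_power power_mult_distrib)
    interpret field_hom fr by (rule hom)
    interpret mp: map_poly_idom_hom fr ..
    have "map_poly fr f = (\<Prod>x\<in>R. [:- fr x, 1:])"
      by (simp add: f_def mp.hom_prod hom_distribs)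
    also have "\<dots> = (\<Prod>x\<in>fr ` R. [:- x, 1:])"
      by (subst prod.reindex) (auto simp: inj_on_def fr_def dest: fpb_power_inj)
    also have "fr ` R = R" using bijR by (simp add: fr_def)
    finally have "map_poly fr f = f" by (simp add: f_def)
    then have "fr (coeff f i) = coeff f i" by (metis coeff_map_poly_hom)
    then show ?thesis by (simp add: fr_def)
  qed
  then have "\<forall>i. \<exists>c. coeff f i = to_ac c" using fpb_fixed_iff by blast
  then obtain c where c: "!!i. coeff f i = to_ac (c i)" by metis
  have "\<forall>i. \<exists>m. c i = of_nat m" using surj_of_nat_mod_ring by blast
  then obtain m where m: "!!i. c i = of_nat (m i)" by metis
  have fm: "coeff f i = of_nat (m i)" for i using c m by simp
  \<comment> \<open>A lift of f with natural numbers as coefficients, so that every automorphism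
    commutes with its evaluation.\<close>
  define F :: "'p qp_bar poly" where "F = (\<Sum>i\<le>degree f. monom (of_nat (m i)) i)"
  have redF: "red (poly F x) = poly f (red x)" if "wge x 0" for x
  proof -
    have "poly F x = (\<Sum>i\<le>degree f. of_nat (m i) * x ^ i)" by (simp add: F_def poly_sum poly_monom)
    also have "red \<dots> = (\<Sum>i\<le>degree f. of_nat (m i) * red x ^ i)"
      using that by (subst red_sum) (auto simp: wge_mult_0 wge_of_nat wge_power red_mult red_of_nat red_power)
    finally show ?thesis by (simp add: poly_altdef fm)
  qed
  have sgF: "poly F (sg x) = sg (poly F x)" for x
    by (simp add: F_def poly_sum poly_monom Gal_sum[OF sg] Gal_simps sg)
  have zw: "wge z 0" using z n by (intro wge_mu')
  have "red z \<in> R" unfolding R_def \<alpha>_def by (rule range_eqI[of _ _ 0]) simp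
  then have "poly f (red z) = 0" using finR by (auto simp: f_def poly_prod)
  then have r0: "red (poly F z) = red 0" using redF[OF zw] by simp
  have Fw: "wge (poly F z) 0"
    unfolding F_def poly_sum poly_monom by (intro wge_sum wge_mult_0 wge_of_nat wge_power zw)
  have "red (sg (poly F z)) = red (sg 0)" by (rule red_Gal[OF Fw wge_0 r0 sg])
  then have "red (poly F (sg z)) = 0" unfolding sgF Gal_0[OF sg] by simp
  then have "poly f (red (sg z)) = 0"
    using redF[of "sg z"] zw wge_Gal[OF sg] by simp
  then have "(\<Prod>x\<in>R. red (sg z) - x) = 0" by (simp add: f_def poly_prod)
  then have "red (sg z) \<in> R" unfolding prod_zero_iff[OF finR] by (metis right_minus_eq)
  then obtain i where "red (sg z) = \<alpha> ^ (CARD('p) ^ i)" unfolding R_def by blast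
  then have "red (sg z) = red (z ^ (CARD('p) ^ i))" using zw by (simp add: red_power \<alpha>_def)
  moreover have "z ^ (CARD('p) ^ i) \<in> mu n" using z(1) by (rule mu_power)
  ultimately have "sg z = z ^ (CARD('p) ^ i)" using red_mu_inj[OF Gal_mu[OF sg z(1)] _ z(2)] by blast
  then show ?thesis by (rule that)
qed

end

subsection \<open>The maximal unramified extension\<close>

definition unram :: "'p :: prime_card qp_bar set" where
  "unram = {poly (map_poly to_ac h) z | h z n. n > 0 \<and> \<not> CARD('p) dvd n \<and> z \<in> mu n}"

lemma to_ac_comm_ring_hom: "comm_ring_hom (to_ac :: 'k :: field => _)"
  by unfold_locales auto

lemma unram_repr:
  assumes "x \<in> unram" "y \<in> (unram :: 'p :: prime_card qp_bar set)"
  obtains z n h k where "prim z n" "\<not> CARD('p) dvd n" "x = poly (map_poly to_ac h) z" "y = poly (map_poly to_ac k) z"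
proof -
  interpret comm_ring_hom "to_ac :: 'p padic_int fract => _" by (rule to_ac_comm_ring_hom)
  obtain h1 z1 n1 where 1: "x = poly (map_poly to_ac h1) z1" "n1 > 0" "\<not> CARD('p) dvd n1" "z1 \<in> mu n1"
    using assms(1) by (auto simp: unram_def)
  obtain h2 z2 n2 where 2: "y = poly (map_poly to_ac h2) z2" "n2 > 0" "\<not> CARD('p) dvd n2" "z2 \<in> mu n2"
    using assms(2) by (auto simp: unram_def)
  define n where "n = n1 * n2"
  have n: "n > 0" "\<not> CARD('p) dvd n"
    using 1 2 prime_dvd_mult_iff[OF prime_card[where ?'a = 'p]] by (auto simp: n_def)
  then have n0: "of_nat n ~= (0 :: 'p qp_bar)" by simp
  obtain z :: "'p qp_bar" where z: "prim z n" using prim_exists[OF n0] by blast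
  have "z1 ^ (n1 * n2) = 1" "z2 ^ (n2 * n1) = 1" using 1(4) 2(4) by (simp_all only: power_mult mu_def mem_Collect_eq power_one)
  then have "z1 \<in> mu n" "z2 \<in> mu n" by (simp_all add: mu_def n_def mult.commute[of n1 n2])
  then obtain s t where st: "z1 = z ^ s" "z2 = z ^ t" using prim_mu_cases[OF z n0] by metis
  have cmp: "poly (map_poly to_ac h) (z ^ s) = poly (map_poly to_ac (h \<circ>\<^sub>p monom 1 s)) z" for h s
    by (simp add: map_poly_pcompose poly_pcompose poly_monom map_poly_hom_monom)
  show ?thesis
    by (rule that[OF z n(2), of "h1 \<circ>\<^sub>p monom 1 s" "h2 \<circ>\<^sub>p monom 1 t"]) (simp_all only: 1(1) 2(1) st cmp)
qed

lemma unramI: "prim z n ==> \<not> CARD('p) dvd n ==> poly (map_poly to_ac h) z \<in> (unram :: 'p :: prime_card qp_bar set)"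
  unfolding unram_def using prim_mu by (metis (mono_tags, lifting) dvd_0_right gr0I mem_Collect_eq)

lemma unram_ext: "ext_subring (unram :: 'p :: prime_card qp_bar set)"
  unfolding ext_subring_def
proof (intro conjI allI ballI)
  interpret comm_ring_hom "to_ac :: 'p padic_int fract => _" by (rule to_ac_comm_ring_hom)
  interpret mp: map_poly_comm_ring_hom "to_ac :: 'p padic_int fract => _" ..
  have one: "prim (1 :: 'p qp_bar) 1" "\<not> CARD('p) dvd 1"
    using prime_gt_1_nat[OF prime_card[where ?'a = 'p]] by (auto simp: prim_def)
  show "to_ac c \<in> (unram :: 'p qp_bar set)" for c
    using unramI[OF one, of "[:c:]"] by (simp add: map_poly_pCons)
  fix x y :: "'p qp_bar" assume "x \<in> unram" "y \<in> unram"
  then obtain z n h k where z: "prim z n" "\<not> CARD('p) dvd n" "x = poly (map_poly to_ac h) z" "y = poly (map_poly to_ac k) z"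
    using unram_repr by blast
  show "x + y \<in> unram" using unramI[OF z(1,2), of "h + k"] by (simp add: z mp.hom_add)
  show "x * y \<in> unram" using unramI[OF z(1,2), of "h * k"] by (simp add: z mp.hom_mult)
qed

lemma mu_unram: "z \<in> mu n ==> n > 0 ==> \<not> CARD('p) dvd n ==> z \<in> (unram :: 'p :: prime_card qp_bar set)"
  unfolding unram_def by (intro CollectI exI[of _ "[:0, 1:]"] exI[of _ z] exI[of _ n]) (simp add: map_poly_pCons)

text \<open>Divide by the power of p given by the least valuation among the coefficients.\<close>

lemma primitive_scaling:
  fixes P :: "'p :: prime_card padic_int fract poly"
  assumes "P ~= 0"
  obtains m F j where "map_poly iZ F = smult (pQ powi m) P" "coeff F j dvd 1"
proof -
  define S where "S = {i. coeff P i ~= 0}"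
  have "S \<subseteq> {..degree P}" unfolding S_def using le_degree by auto
  then have finS: "finite S" by (rule finite_subset) simp
  have "lead_coeff P ~= 0" using assms by simp
  then have "S ~= {}" unfolding S_def by blast
  define m where "m = Min ((%i. vQ (coeff P i)) ` S)"
  have m_le: "m \<le> vQ (coeff P j)" if "coeff P j ~= 0" for j
    unfolding m_def using finS that by (intro Min_le) (auto simp: S_def)
  have "m \<in> (%i. vQ (coeff P i)) ` S"
    unfolding m_def using finS \<open>S ~= {}\<close> by (intro Min_in) auto
  then obtain j where j: "coeff P j ~= 0" "vQ (coeff P j) = m" by (auto simp: S_def)
  have vscale: "vQ (pQ powi (- m) * q) = vQ q - m" if "q ~= 0" for q :: "'p padic_int fract"
    using that by (simp add: vQ_mult vQ_pQ_powi)
  have "\<exists>a. pQ powi (- m) * coeff P k = iZ a" for k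
  proof (cases "coeff P k = 0")
    case False
    then have "pQ powi (- m) * coeff P k \<in> range iZ"
      using m_le[OF False] vscale[OF False] by (subst vQ_nonneg_iff[symmetric]) auto
    then show ?thesis by blast
  qed (auto intro!: exI[of _ 0] simp: iZ_0)
  then obtain a where a: "!!k. pQ powi (- m) * coeff P k = iZ (a k)" by metis
  define F where "F = (\<Sum>k\<le>degree P. monom (a k) k)"
  have a0: "a k = 0" if "k > degree P" for k
  proof -
    have "iZ (a k) = 0" using that by (simp add: coeff_eq_0 flip: a)
    then show ?thesis by (simp only: iZ_eq_0_iff)
  qed
  have cF: "coeff F k = a k" for k
    using a0 by (auto simp: F_def coeff_sum coeff_monom if_distrib sum.delta cong: if_cong)
  have "map_poly iZ F = smult (pQ powi (- m)) P"
    by (rule poly_eqI) (simp add: cF flip: a)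
  moreover have "a j dvd 1"
  proof -
    have "iZ (a j) ~= 0" using j(1) by (simp flip: a)
    then have "a j ~= 0" by (simp add: iZ_eq_0_iff)
    moreover have "vQ (iZ (a j)) = 0" using vscale[OF j(1)] j(2) by (simp flip: a)
    ultimately show ?thesis using vQ_pos_dvd[of "a j"] by (simp add: padic_unit_iff)
  qed
  ultimately show ?thesis using that[of F "- m" j] cF by simp
qed

context residue
begin

lemma red_of_Zp_unit: "u dvd 1 ==> red (of_Zp u) ~= 0"
proof -
  assume u: "u dvd 1"
  then have u0: "u ~= 0" by auto
  have "w (of_Zp u) = 0" using u0 vQ_unit[OF u] by (simp add: of_Zp_iZ w_to_ac iZ_eq_0_iff)
  then show ?thesis using u0 by (simp add: red_eq_0_iff wge_of_Zp)
qed

text \<open>Reduce h modulo the minimal polynomial of z and scale it to be primitive. Its reduction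
  G is then nonzero of degree below the orbit size. If G vanished at \<open>red z\<close> it would
  vanish at all Frobenius powers, hence at the reductions of all conjugates of z, which are
  distinct: too many roots. So the valuation comes from the scaling factor alone.\<close>

lemma w_int_prim:
  assumes z: "prim (z :: 'p qp_bar) n" "\<not> CARD('p) dvd n" and x: "poly (map_poly to_ac h) z ~= 0"
  shows "w (poly (map_poly to_ac h) z) \<in> \<int>"
proof -
  interpret comm_ring_hom "to_ac :: 'p padic_int fract => _" by (rule to_ac_comm_ring_hom)
  interpret mp: map_poly_comm_ring_hom "to_ac :: 'p padic_int fract => _" ..
  have n: "n > 0" using z(2) by (cases n) auto
  have zmu: "z \<in> mu n" using z by (simp add: prim_mu)
  define h' where "h' = h mod gpoly z"
  have "h = gpoly z * (h div gpoly z) + h'" by (simp add: h'_def)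
  then have "poly (map_poly to_ac h) z = poly (map_poly to_ac (gpoly z * (h div gpoly z) + h')) z" by simp
  also have "\<dots> = poly (map_poly to_ac h') z" by (simp add: mp.hom_add mp.hom_mult gpoly_root)
  finally have eq: "poly (map_poly to_ac h) z = poly (map_poly to_ac h') z" .
  have h'0: "h' ~= 0" using x eq by auto
  have "gpoly z ~= 0" using gpoly_monic[of z] by auto
  then have degh: "degree h' < card (gorb z)"
    using degree_mod_less[of "gpoly z" h] h'0 by (simp add: h'_def degree_gpoly)
  obtain m F j where F: "map_poly iZ F = smult (pQ powi m) h'" "coeff F j dvd 1"
    using primitive_scaling[OF h'0] by blast
  have degF: "degree F = degree h'"
  proof -
    have "degree F = degree (map_poly iZ F)" by simp
    then show ?thesis unfolding F by simp
  qed
  have val: "poly (map_poly of_Zp F) z = of_nat CARD('p) powi m * poly (map_poly to_ac h) z"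
  proof -
    have "map_poly of_Zp F = smult (to_ac (pQ powi m)) (map_poly to_ac h')"
      unfolding map_poly_of_Zp F by (rule poly_eqI) (simp add: coeff_map_poly)
    moreover have "to_ac (pQ powi m) = (of_nat CARD('p) :: 'p qp_bar) powi m"
      by (cases "m \<ge> 0") (auto simp: power_int_def)
    ultimately show ?thesis by (simp add: eq)
  qed
  define G where "G = map_poly red (map_poly of_Zp F)"
  have cG: "coeff G i = red (of_Zp (coeff F i))" for i by (simp add: G_def coeff_map_poly)
  have "coeff G j ~= 0" using F(2) by (simp add: cG red_of_Zp_unit)
  then have G0: "G ~= 0" by auto
  have degG: "degree G \<le> degree F"
    by (rule degree_le) (simp add: cG coeff_eq_0)
  have zw: "wge z 0" using zmu n by (rule wge_mu')
  have redz: "red (poly (map_poly of_Zp F) z) = poly G (red z)"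
    unfolding G_def using zw by (intro red_poly) (auto simp: coeff_map_poly wge_of_Zp)
  have "poly G (red z) ~= 0"
  proof
    assume zero: "poly G (red z) = 0"
    have pw: "poly G (red z ^ (CARD('p) ^ i)) = 0" for i
    proof (induction i)
      case (Suc i)
      have "poly G ((red z ^ (CARD('p) ^ i)) ^ CARD('p)) = poly G (red z ^ (CARD('p) ^ i)) ^ CARD('p)"
        by (rule poly_fixed_coeffs_power) (simp add: cG red_of_Zp_fixed)
      also have "\<dots> = 0" using Suc p_pos by (simp add: power_0_left)
      finally show ?case by (simp add: mult.commute flip: power_mult)
    qed (simp add: zero)
    have orb: "gorb z \<subseteq> mu n" using zmu Gal_mu by (auto simp: gorb_def)
    have "red y \<in> {x. poly G x = 0}" if y: "y \<in> gorb z" for y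
    proof -
      obtain sg where "sg \<in> Gal" "y = sg z" using y by (auto simp: gorb_def)
      then obtain i where "y = z ^ (CARD('p) ^ i)" using Gal_on_mu[OF _ zmu z(2)] by metis
      then show ?thesis using pw[of i] zw by (simp add: red_power)
    qed
    then have "red ` gorb z \<subseteq> {x. poly G x = 0}" by blast
    then have "card (red ` gorb z) \<le> card {x. poly G x = 0}"
      by (intro card_mono poly_roots_finite G0)
    also have "\<dots> \<le> degree G" by (rule card_poly_roots_bound[OF G0])
    also have "card (red ` gorb z) = card (gorb z)"
    proof (rule card_image, rule inj_onI)
      fix x y assume xy: "x \<in> gorb z" "y \<in> gorb z" "red x = red y"
      show "x = y" by (rule red_mu_inj[OF _ _ z(2) xy(3)]) (use orb xy in blast)+
    qed
    finally show False using degG degF degh by linarith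
  qed
  then have nz: "red (poly (map_poly of_Zp F) z) ~= 0" by (simp add: redz)
  have "wge (poly (map_poly of_Zp F) z) 0"
    unfolding poly_altdef by (intro wge_sum wge_mult_0 wge_power zw) (simp add: coeff_map_poly wge_of_Zp)
  then have "w (poly (map_poly of_Zp F) z) = 0"
    using nz by (auto simp: red_eq_0_iff wge_def)
  then have "real_of_int m + w (poly (map_poly to_ac h) z) = 0"
    using x p_pos by (simp add: val w_mult w_powi w_p)
  then have "w (poly (map_poly to_ac h) z) = real_of_int (- m)" by simp
  then show ?thesis by (simp only: Ints_of_int)
qed

lemma w_unram:
  assumes "(x :: 'p qp_bar) \<in> unram" "x ~= 0"
  shows "w x \<in> \<int>"
proof -
  obtain z n h k where x: "prim z n" "\<not> CARD('p) dvd n" "x = poly (map_poly to_ac h) z" "x = poly (map_poly to_ac k) z"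
    using unram_repr[OF assms(1,1)] .
  show ?thesis using w_int_prim[OF x(1,2), of h] assms(2) unfolding x(3)[symmetric] by simp
qed

subsection \<open>Inertia\<close>

lemma inertia_iff: "(sg :: 'p qp_bar => _) \<in> inertia \<longleftrightarrow> sg \<in> Gal \<and> (\<forall>x. wge x 0 --> red (sg x) = red x)"
proof -
  have "sg x - x \<in> max_ideal_bar \<longleftrightarrow> red (sg x) = red x" if "sg \<in> Gal" "wge x 0" for x
    using red_eq_iff[of "sg x" x] that by (auto simp: max_ideal_bar_iff wge_Gal)
  then show ?thesis by (auto simp: inertia_def integers_bar_iff)
qed

lemma inertia_Gal: "(sg :: 'p qp_bar => _) \<in> inertia ==> sg \<in> Gal"
  by (simp add: inertia_def)

lemma inertia_red: "(sg :: 'p qp_bar => _) \<in> inertia ==> wge x 0 ==> red (sg x) = red x"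
  by (simp add: inertia_iff)

lemma inertia_id: "(id :: 'p qp_bar => _) \<in> inertia"
  by (simp add: inertia_iff del: id_apply) simp

lemma inertia_comp: "(sg :: 'p qp_bar => _) \<in> inertia ==> \<tau> \<in> inertia ==> sg \<circ> \<tau> \<in> inertia"
  by (simp add: inertia_iff Gal_comp wge_Gal)

lemma inertia_pow: "(sg :: 'p qp_bar => _) \<in> inertia ==> sg ^^ n \<in> inertia"
  by (induction n) (auto intro: inertia_comp inertia_id simp del: id_apply simp flip: id_def)

lemma inertia_conj:
  assumes "(sg :: 'p qp_bar => _) \<in> inertia" "h \<in> Gal"
  shows "h \<circ> sg \<circ> inv_into UNIV h \<in> inertia"
  unfolding inertia_iff
proof (intro conjI allI impI)
  have hi: "inv_into UNIV h \<in> Gal" using assms(2) by (rule Gal_inv)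
  show "h \<circ> sg \<circ> inv_into UNIV h \<in> Gal"
    using assms hi inertia_Gal by (intro Gal_comp)
  fix x :: "'p qp_bar" assume x: "wge x 0"
  let ?y = "inv_into UNIV h x"
  have y: "wge ?y 0" using x by (simp add: wge_Gal[OF hi])
  have "red (h (sg ?y)) = red (h ?y)"
    by (rule red_Gal) (use y assms inertia_Gal[OF assms(1)] in \<open>simp_all add: wge_Gal inertia_red\<close>)
  then show "red ((h \<circ> sg \<circ> inv_into UNIV h) x) = red x"
    by (simp add: Gal_inv_right[OF assms(2)])
qed

lemma inertia_mu: "(sg :: 'p qp_bar => _) \<in> inertia ==> z \<in> mu n ==> \<not> CARD('p) dvd n ==> sg z = z"
proof -
  assume *: "(sg :: 'p qp_bar => _) \<in> inertia" "z \<in> mu n" "\<not> CARD('p) dvd n"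
  then have n: "n > 0" by (cases n) auto
  have "red (sg z) = red z" using * n by (intro inertia_red wge_mu')
  then show ?thesis using red_mu_inj[OF Gal_mu[OF inertia_Gal]] * by blast
qed

text \<open>Every nonzero residue class contains a root of unity of order prime to p, so fixing
  these means acting trivially on the residue field.\<close>

lemma unram_fixed_inertia:
  assumes "sg \<in> Gal" "!!t :: 'p qp_bar. t \<in> unram ==> sg t = t"
  shows "(sg :: 'p qp_bar => _) \<in> inertia"
  unfolding inertia_iff
proof (intro conjI allI impI)
  fix x :: "'p qp_bar" assume x: "wge x 0"
  show "red (sg x) = red x"
  proof (cases "red x = 0")
    case True
    then have "red x = red 0" by simp
    then have "red (sg x) = red (sg 0)" by (intro red_Gal[OF x _ _ assms(1)]) simp_all
    then show ?thesis using True by (simp add: Gal_0 assms(1))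
  next
    case False
    then obtain n z where z: "n > 0" "\<not> CARD('p) dvd n" "z \<in> mu n" "red z = red x" by (rule teichmueller)
    have "red (sg x) = red (sg z)" by (rule red_Gal[OF x wge_mu'[OF z(3,1)] _ assms(1)]) (simp add: z)
    also have "sg z = z" using z by (intro assms(2) mu_unram)
    finally show ?thesis using z by simp
  qed
qed (rule assms)

lemma w_uniformizer:
  assumes "\<pi> ^ n = (of_nat CARD('p) :: 'p qp_bar)" "n > 0"
  shows "\<pi> ~= 0" "w \<pi> = 1 / real n"
proof -
  show nz: "\<pi> ~= 0" using assms p_pos by (auto simp: power_0_left)
  have "real n * w \<pi> = 1" using w_power[OF nz, of n] by (simp add: assms(1) w_p)
  then show "w \<pi> = 1 / real n" using assms(2) by (simp add: field_simps)
qed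

text \<open>Sorting the terms of a relation \<open>f(\<pi>) = 0\<close> over the unramified extension by exponents modulo
  \<open>n\<close> gives summands of pairwise distinct valuations, which must all vanish; so
  \<open>f(\<zeta>\<pi>) = 0\<close>.\<close>

lemma tame_generator:
  assumes n: "n > 0" "\<not> CARD('p) dvd n" and z: "z \<in> mu n" and \<pi>: "\<pi> ^ n = (of_nat CARD('p) :: 'p qp_bar)"
  obtains g where "g \<in> inertia" "g \<pi> = z * \<pi>"
proof -
  note T = unram_ext[where ?'p = 'p]
  note \<pi>0 = w_uniformizer[OF \<pi> n(1)]
  have key: "poly f (z * \<pi>) = 0" if f: "!!i. coeff f i \<in> unram" "poly f \<pi> = 0" for f
  proof -
    \<comment> \<open>Using \<pi>^n = p, the terms with exponent congruent to l modulo n are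
      collected into \<pi>^l times an unramified coefficient.\<close>
    define C where "C l = (\<Sum>i | i \<le> degree f \<and> i mod n = l. coeff f i * of_nat CARD('p) ^ (i div n))" for l
    have CT: "C l \<in> unram" for l
      unfolding C_def using f by (intro ext_sum[OF T] ext_mult[OF T] ext_power[OF T] ext_of_nat[OF T])
    have grp: "poly f (x * \<pi>) = (\<Sum>l<n. x ^ l * \<pi> ^ l * C l)" if x: "x ^ n = 1" for x
    proof -
      have "poly f (x * \<pi>) = (\<Sum>i\<le>degree f. coeff f i * (x * \<pi>) ^ i)" by (simp add: poly_altdef)
      also have "\<dots> = (\<Sum>l<n. \<Sum>i | i \<in> {..degree f} \<and> i mod n = l. coeff f i * (x * \<pi>) ^ i)"
        using n by (intro sum.group[symmetric]) auto
      also have "\<dots> = (\<Sum>l<n. x ^ l * \<pi> ^ l * C l)"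
      proof (rule sum.cong[OF refl])
        fix l
        have "coeff f i * (x * \<pi>) ^ i = x ^ l * \<pi> ^ l * (coeff f i * of_nat CARD('p) ^ (i div n))" if "i mod n = l" for i
        proof -
          have "i = n * (i div n) + l" using that by (metis mult_div_mod_eq)
          then have "(x * \<pi>) ^ i = (x * \<pi>) ^ (n * (i div n) + l)" by (rule arg_cong)
          also have "\<dots> = (x ^ n * \<pi> ^ n) ^ (i div n) * (x ^ l * \<pi> ^ l)"
            by (simp only: power_add power_mult power_mult_distrib)
          finally show ?thesis by (simp add: x \<pi> mult_ac)
        qed
        then show "(\<Sum>i | i \<in> {..degree f} \<and> i mod n = l. coeff f i * (x * \<pi>) ^ i) = x ^ l * \<pi> ^ l * C l"
          unfolding C_def sum_distrib_left by (intro sum.cong) auto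
      qed
      finally show ?thesis .
    qed
    have "C l = 0" if l: "l < n" for l
    proof (rule ccontr)
      assume "C l ~= 0"
      define A where "A = {l. l < n \<and> C l ~= 0}"
      have "(\<Sum>l\<in>A. \<pi> ^ l * C l) = (\<Sum>l<n. \<pi> ^ l * C l)"
        by (rule sum.mono_neutral_left) (auto simp: A_def)
      also have "\<dots> = 0" using grp[of 1] f(2) by simp
      finally have zero: "(\<Sum>l\<in>A. \<pi> ^ l * C l) = 0" .
      have "(\<Sum>l\<in>A. \<pi> ^ l * C l) ~= 0"
      proof (rule sum_distinct_w_neq_0)
        show "finite A" by (simp add: A_def)
        show "A ~= {}" using l \<open>C l ~= 0\<close> by (auto simp: A_def)
        show "\<pi> ^ l * C l ~= 0" if "l \<in> A" for l using that \<pi>0(1) by (simp add: A_def)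
        show "inj_on (%l. w (\<pi> ^ l * C l)) A"
        proof (rule inj_onI)
          fix l l' assume l: "l \<in> A" and l': "l' \<in> A" and eq: "w (\<pi> ^ l * C l) = w (\<pi> ^ l' * C l')"
          \<comment> \<open>Unramified elements have integral valuation, so the valuation of \<pi>^l
            C l has fractional part l / n, which recovers l.\<close>
          have "w (C l) \<in> \<int>" "w (C l') \<in> \<int>" using l l' CT w_unram by (auto simp: A_def)
          then obtain i j where ij: "w (C l) = of_int i" "w (C l') = of_int j" by (auto elim!: Ints_cases)
          have "w (\<pi> ^ l * C l) = real l / real n + of_int i" "w (\<pi> ^ l' * C l') = real l' / real n + of_int j"
            using l l' \<pi>0 ij by (simp_all add: A_def w_mult w_power)
          then have "real l / real n + of_int i = real l' / real n + of_int j" using eq by simp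
          then have "real n * (real l / real n + of_int i) = real n * (real l' / real n + of_int j)" by (rule arg_cong)
          then have "real l + real n * of_int i = real l' + real n * of_int j"
            using n(1) by (simp add: distrib_left)
          then have "real_of_int (int l + int n * i) = real_of_int (int l' + int n * j)" by simp
          then have "int l + int n * i = int l' + int n * j" by (simp only: of_int_eq_iff)
          then have "(int l + int n * i) mod int n = (int l' + int n * j) mod int n" by simp
          then show "l = l'" using l l' by (simp add: A_def)
        qed
      qed
      with zero show False by simp
    qed
    then show ?thesis using grp[of z] z by (simp add: mu_def)
  qed
  obtain sg where "sg \<in> Gal" "sg \<pi> = z * \<pi>" "!!e. e \<in> unram ==> sg e = e"
    using Gal_transitive[OF T, of \<pi> "z * \<pi>"] key by blast
  then show ?thesis using that unram_fixed_inertia by blast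
qed

lemma red_unit_ratio:
  assumes "(sg :: 'p qp_bar => _) \<in> inertia" "v ~= 0" "w v = 0"
  shows "red (sg v / v) = 1"
proof -
  have sg: "sg \<in> Gal" using assms(1) by (rule inertia_Gal)
  have vw: "wge v 0" using assms by (simp add: wge_def)
  have "wge (sg v / v) 0" using assms(2,3) by (simp add: wge_def w_divide w_Gal[OF sg] Gal_eq_0_iff[OF sg])
  then have "red (sg v / v * v) = red (sg v / v) * red v" using vw by (rule red_mult)
  then have "red v = red (sg v / v) * red v" using assms inertia_red[OF assms(1) vw] by simp
  moreover have "red v ~= 0" using assms by (simp add: red_eq_0_iff[OF vw])
  ultimately show ?thesis by simp
qed

text \<open>y is \<pi>^k times a unit, and by \<open>red_unit_ratio\<close> the unit contributes
  1.\<close>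

lemma tame_character:
  assumes sg: "(sg :: 'p qp_bar => _) \<in> inertia" and n: "n > 0" and \<pi>: "\<pi> ^ n = (of_nat CARD('p) :: 'p qp_bar)" "sg \<pi> = z * \<pi>" "z \<in> mu n"
    and y: "y ~= 0" "w y = real k / real n"
  shows "red (sg y / y) = red z ^ k"
proof -
  note \<pi>0 = w_uniformizer[OF \<pi>(1) n]
  have G: "sg \<in> Gal" using sg by (rule inertia_Gal)
  define v where "v = y / \<pi> ^ k"
  have v: "v ~= 0" "w v = 0" using y \<pi>0 by (simp_all add: v_def w_divide w_power)
  have z0: "z ~= 0" using \<pi>(3) n by (rule mu_neq_0)
  have eq: "sg y / y = (sg v / v) * z ^ k"
    using \<pi>0(1) y(1) z0 \<pi>(2) by (simp add: v_def Gal_simps G power_mult_distrib field_simps)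
  have "wge (sg v / v) 0" using v by (simp add: wge_def w_divide w_Gal[OF G] Gal_eq_0_iff[OF G])
  then have "red (sg y / y) = red (sg v / v) * red (z ^ k)"
    unfolding eq using \<pi>(3) n by (intro red_mult[OF _ wge_power[OF wge_mu'[OF \<pi>(3) n]]])
  then show ?thesis using red_unit_ratio[OF sg v] \<pi>(3) n by (simp add: red_power wge_mu')
qed

subsection \<open>The tame quotient\<close>

lemma funpow_fixed: "f x = x ==> (f ^^ n) x = x"
  by (induction n) auto

text \<open>The cycle through x has length at most card F, and every such number divides the
  factorial.\<close>

lemma perm_fact_fixed:
  assumes "finite F" "!!x. x \<in> F ==> f x \<in> F" "inj f" "x \<in> F"
  shows "(f ^^ fact (card F)) x = x"
proof -
  have inF: "(f ^^ i) x \<in> F" for i by (induction i) (use assms in auto)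
  have "\<not> inj_on (%i. (f ^^ i) x) {..card F}"
  proof
    assume "inj_on (%i. (f ^^ i) x) {..card F}"
    then have "card ((%i. (f ^^ i) x) ` {..card F}) = Suc (card F)" by (simp add: card_image)
    moreover have "card ((%i. (f ^^ i) x) ` {..card F}) \<le> card F"
      using assms(1) inF by (intro card_mono) auto
    ultimately show False by simp
  qed
  then obtain i j where ij: "i ~= j" "i \<le> card F" "j \<le> card F" "(f ^^ i) x = (f ^^ j) x"
    by (auto simp: inj_on_def)
  have "\<exists>k>0. k \<le> card F \<and> (f ^^ k) x = x" if "i < j" "j \<le> card F" "(f ^^ i) x = (f ^^ j) x" for i j
  proof -
    have "(f ^^ i) x = (f ^^ i) ((f ^^ (j - i)) x)"
      using that by (simp flip: funpow_add[unfolded comp_def fun_eq_iff, rule_format])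
    moreover have "inj (f ^^ i)" using assms(3) by (rule inj_fn)
    ultimately have "(f ^^ (j - i)) x = x" by (metis injD)
    then show ?thesis using that by (intro exI[of _ "j - i"]) auto
  qed
  then obtain k where k: "k > 0" "k \<le> card F" "(f ^^ k) x = x" using ij by (metis linorder_neqE_nat)
  then have "k dvd fact (card F)" by (simp add: dvd_fact)
  then obtain m where "fact (card F) = k * m" by (elim dvdE)
  then show ?thesis using funpow_fixed[of "f ^^ k" x m, OF k(3)] by (simp add: funpow_mult)
qed

lemma p_part:
  assumes "m > 0"
  obtains a m' where "m = CARD('p) ^ a * m'" "\<not> CARD('p) dvd m'" "m' > 0"
proof -
  obtain m' where m': "m = CARD('p) ^ multiplicity CARD('p) m * m'" "\<not> CARD('p) dvd m'"
    using multiplicity_decompose'[of m "CARD('p)"] assms p_gt_1 by (metis gr_implies_not0 nat_dvd_1_iff_1 order_less_irrefl)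
  moreover have "m' > 0" using m'(2) by (cases m') auto
  ultimately show ?thesis using that by blast
qed

lemma coprime_p: "\<not> CARD('p) dvd m ==> coprime m (CARD('p) ^ a)"
  using prime_imp_coprime[OF p_prime] by (simp add: coprime_commute)

lemma not_p_dvd_mult: "\<not> CARD('p) dvd m ==> \<not> CARD('p) dvd n ==> \<not> CARD('p) dvd m * n"
  using prime_dvd_mult_iff[OF p_prime] by blast

lemma not_p_dvd_power_minus_1: "d \<ge> 1 ==> \<not> CARD('p) dvd CARD('p) ^ d - 1"
proof
  assume d: "d \<ge> 1" "CARD('p) dvd CARD('p) ^ d - 1"
  have "CARD('p) dvd CARD('p) ^ d" using d(1) by (simp add: dvd_power)
  then have "CARD('p) dvd CARD('p) ^ d - (CARD('p) ^ d - 1)" using d(2) by (rule dvd_diff_nat)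
  moreover have "CARD('p) ^ d - (CARD('p) ^ d - 1) = 1" using p_pos by simp
  ultimately show False using p_gt_1 by simp
qed

lemma mu_sum_zero:
  assumes "0 < i" "i < m" "\<not> CARD('p) dvd m"
  shows "(\<Sum>\<eta>\<in>mu m. inverse \<eta> ^ i) = (0 :: 'p qp_bar)"
proof -
  have m: "m > 0" "of_nat m ~= (0 :: 'p qp_bar)" using assms by auto
  obtain \<xi> :: "'p qp_bar" where \<xi>: "prim \<xi> m" using prim_exists[OF m(2)] by blast
  have \<xi>m: "\<xi> \<in> mu m" "\<xi> ~= 0" using \<xi> m by (auto simp: prim_mu prim_neq_0)
  have "bij_betw (%\<eta>. \<xi> * \<eta>) (mu m) (mu m)"
  proof (rule bij_betw_byWitness[where f' = "%\<eta>. \<eta> / \<xi>"])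
    show "\<forall>a\<in>mu m. \<xi> * a / \<xi> = a" "\<forall>a\<in>mu m. \<xi> * (a / \<xi>) = a" using \<xi>m by auto
    show "(%\<eta>. \<xi> * \<eta>) ` mu m \<subseteq> mu m" "(%\<eta>. \<eta> / \<xi>) ` mu m \<subseteq> mu m"
      using \<xi>m by (auto simp: mu_def power_mult_distrib power_divide)
  qed
  then have "(\<Sum>\<eta>\<in>mu m. inverse \<eta> ^ i) = (\<Sum>\<eta>\<in>mu m. inverse (\<xi> * \<eta>) ^ i)"
    by (rule sum.reindex_bij_betw[symmetric])
  also have "\<dots> = inverse (\<xi> ^ i) * (\<Sum>\<eta>\<in>mu m. inverse \<eta> ^ i)"
    by (simp add: power_mult_distrib power_inverse sum_distrib_left)
  finally have "(1 - inverse (\<xi> ^ i)) * (\<Sum>\<eta>\<in>mu m. inverse \<eta> ^ i) = 0" by (simp add: left_diff_distrib)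
  moreover have "\<xi> ^ i ~= 1" using primD[OF \<xi>, of i] assms by (auto dest: dvd_imp_le)
  ultimately show ?thesis by (auto simp: inverse_eq_1_iff)
qed

text \<open>Level of tameness. If \<open>sg\<close> fixes \<open>\<mu>\<^sub>n\<close> and \<open>\<pi> = p\<^bsup>1/n\<^esup>\<close>, the prime-to-\<open>p\<close> part of \<open>sg\<close> acts on
  the span of \<open>F\<close> with root of unity eigenvalues; an eigenvector \<open>z\<close> with eigenvalue \<open>\<eta>\<close> has bounded
  degree, so that (for \<open>n\<close> divisible enough) a \<open>p\<close>-power of \<open>z\<close> is a power of \<open>\<pi>\<close> times a unit whose
  residue class lies in \<open>\<mu>\<^sub>n\<close>, and this forces \<open>\<eta> = 1\<close>.\<close>

lemma tame_level:
  assumes F: "finite F" "!!sg x. sg \<in> Gal ==> x \<in> F ==> sg x \<in> F"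
  obtains n where "n > 0" "\<not> CARD('p) dvd n" "(CARD('p)\<^sup>2 - 1) dvd n"
    "!!\<pi> sg. \<pi> ^ n = (of_nat CARD('p) :: 'p qp_bar) ==> sg \<in> Gal ==> (!!z. z \<in> mu n ==> sg z = z) ==> sg \<pi> = \<pi> ==>
       \<exists>a. \<forall>x\<in>F. (sg ^^ (CARD('p) ^ a)) x = x"
proof -
  let ?p = "CARD('p)"
  define c where "c = card F"
  obtain a m where am: "fact c = ?p ^ a * m" "\<not> ?p dvd m" "m > 0" using p_part[of "fact c"] by auto
  \<comment> \<open>B bounds the degree of the eigenvectors below: a conjugate of such a vector is
    determined by the conjugate of its eigenvalue, an m-th root of unity, and by m elements of F.
    Then B' absorbs the prime-to-p part of any degree up to B.\<close>
  define B where "B = m * c ^ m"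
  obtain b B' where B': "fact B = ?p ^ b * B'" "\<not> ?p dvd B'" "B' > 0" using p_part[of "fact B"] by auto
  \<comment> \<open>Makes n divisible by the number of units of the field with p^d elements for
    every d <= B; the 2 in B + 2 ensures that p^2 - 1 divides n as well.\<close>
  define D where "D = (\<Prod>d\<in>{1..B + 2}. ?p ^ d - 1)"
  define n where "n = m * (B' * D)"
  have Dd: "(?p ^ d - 1) dvd D" if "1 \<le> d" "d \<le> B + 2" for d
    unfolding D_def using that by (intro dvd_prodI) auto
  have nD: "\<not> ?p dvd D"
    unfolding D_def using prime_dvd_prod_iff[OF _ p_prime, of "{1..B + 2}" "%d. ?p ^ d - 1"] not_p_dvd_power_minus_1 by auto
  have np: "\<not> ?p dvd n" unfolding n_def using am B' nD by (intro not_p_dvd_mult)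
  then have n0: "n > 0" by (cases n) auto
  have "(?p\<^sup>2 - 1) dvd n" unfolding n_def using Dd[of 2] by simp
  moreover have "\<exists>a. \<forall>x\<in>F. (sg ^^ (?p ^ a)) x = x"
    if \<pi>: "\<pi> ^ n = (of_nat ?p :: 'p qp_bar)" and sg: "sg \<in> Gal" "!!z. z \<in> mu n ==> sg z = z" "sg \<pi> = \<pi>" for \<pi> sg
  proof (intro exI ballI, rule ccontr)
    fix x assume x: "x \<in> F" and nfix: "(sg ^^ (?p ^ a)) x ~= x"
    note \<pi>0 = w_uniformizer[OF \<pi> n0]
    \<comment> \<open>The p-part of the order of \<open>sg\<close> on F is removed: s^m fixes x with
      m prime to p.\<close>
    define s where "s = sg ^^ (?p ^ a)"
    have s: "s \<in> Gal" unfolding s_def using sg(1) by (rule Gal_pow)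
    have s_mu: "s z = z" if "z \<in> mu n" for z unfolding s_def using sg(2)[OF that] by (rule funpow_fixed)
    have s_pi: "s \<pi> = \<pi>" unfolding s_def using sg(3) by (rule funpow_fixed)
    have sm: "(s ^^ m) x = x"
      using perm_fact_fixed[OF F(1), of sg x] F(2)[OF sg(1)] field_hom_injective[OF Gal_hom[OF sg(1)]] x am(1)
      by (simp add: s_def funpow_mult c_def)
    have m0: "of_nat m ~= (0 :: 'p qp_bar)" using am(3) by simp
    have mu_mn: "\<eta> \<in> mu n" if "\<eta> \<in> mu m" for \<eta> :: "'p qp_bar"
      using that by (simp add: mu_def n_def power_mult)
    \<comment> \<open>The projection of x to the \<eta>-eigenspace of s, up to the factor m; over
      all m-th roots of unity the components add up to m x.\<close>
    define zz where "zz \<eta> = (\<Sum>i<m. inverse \<eta> ^ i * (s ^^ i) x)" for \<eta>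
    have eig: "s (zz \<eta>) = \<eta> * zz \<eta>" if \<eta>: "\<eta> \<in> mu m" for \<eta>
    proof -
      define G where "G i = inverse \<eta> ^ i * (s ^^ i) x" for i
      have \<eta>0: "\<eta> ~= 0" using \<eta> am(3) by (rule mu_neq_0)
      have "inverse \<eta> ^ m = 1" using \<eta> by (simp add: mu_def power_inverse)
      then have "G m = G 0" by (simp add: G_def sm)
      moreover have "(\<Sum>i<m. G (Suc i)) + G 0 = (\<Sum>i<m. G i) + G m"
        by (metis add.commute sum.lessThan_Suc sum.lessThan_Suc_shift)
      ultimately have shift: "(\<Sum>i<m. G (Suc i)) = (\<Sum>i<m. G i)" by simp
      have "s (zz \<eta>) = (\<Sum>i<m. inverse \<eta> ^ i * (s ^^ Suc i) x)"
        by (simp add: zz_def Gal_sum[OF s] Gal_simps s s_mu[OF mu_mn[OF \<eta>]])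
      also have "\<dots> = (\<Sum>i<m. \<eta> * G (Suc i))" using \<eta>0 by (intro sum.cong) (simp_all add: G_def)
      also have "\<dots> = \<eta> * (\<Sum>i<m. G (Suc i))" by (simp only: sum_distrib_left)
      also have "\<dots> = \<eta> * zz \<eta>" unfolding shift by (simp add: zz_def G_def)
      finally show ?thesis .
    qed
    have total: "(\<Sum>\<eta>\<in>mu m. zz \<eta>) = of_nat m * x"
    proof -
      have "(\<Sum>\<eta>\<in>mu m. zz \<eta>) = (\<Sum>i<m. (\<Sum>\<eta>\<in>mu m. inverse \<eta> ^ i) * (s ^^ i) x)"
        unfolding zz_def by (subst sum.swap) (simp add: sum_distrib_right)
      also have "\<dots> = (\<Sum>i\<in>{0}. (\<Sum>\<eta>\<in>mu m. inverse \<eta> ^ i) * (s ^^ i) x)"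
        using am mu_sum_zero[of _ m] by (intro sum.mono_neutral_right) auto
      also have "\<dots> = of_nat m * x" using card_mu(1)[OF m0] by simp
      finally show ?thesis .
    qed
    have "\<exists>\<eta>\<in>mu m. \<eta> ~= 1 \<and> zz \<eta> ~= 0"
    proof (rule ccontr)
      assume none: "\<not> ?thesis"
      have one: "1 \<in> (mu m :: 'p qp_bar set)" by (simp add: mu_def)
      have "(\<Sum>\<eta>\<in>mu m. zz \<eta>) = (\<Sum>\<eta>\<in>{1}. zz \<eta>)"
        using none one card_mu(2)[OF m0] by (intro sum.mono_neutral_right) auto
      then have "of_nat m * x = zz 1" by (simp add: total)
      moreover have "s (zz 1) = zz 1" using eig[OF one] by simp
      ultimately have "s (of_nat m * x) = of_nat m * x" by simp
      then have "of_nat m * s x = of_nat m * x" by (simp add: Gal_simps s)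
      then have "s x = x" using m0 by simp
      then show False using nfix by (simp add: s_def)
    qed
    then obtain \<eta> where \<eta>: "\<eta> \<in> mu m" "\<eta> ~= 1" "zz \<eta> ~= 0" by blast
    define z where "z = zz \<eta>"
    have z0: "z ~= 0" using \<eta> by (simp add: z_def)
    have sz: "s z = \<eta> * z" using eig[OF \<eta>(1)] by (simp add: z_def)
    have s_iter: "(s ^^ i) x \<in> F" for i by (induction i) (use x F(2)[OF s] in auto)
    have card_z: "card (gorb z) \<le> B"
    proof -
      let ?h = "%(e, y). \<Sum>i<m. inverse e ^ i * y i"
      let ?X = "(mu m :: 'p qp_bar set) \<times> PiE {..<m} (%_. F)"
      have "gorb z \<subseteq> ?h ` ?X"
      proof
        fix t assume "t \<in> gorb z"
        then obtain \<tau> where \<tau>: "\<tau> \<in> Gal" "t = \<tau> z" by (auto simp: gorb_def)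
        define y where "y = restrict (%i. \<tau> ((s ^^ i) x)) {..<m}"
        have "t = ?h (\<tau> \<eta>, y)"
          by (simp add: \<tau> z_def zz_def Gal_sum Gal_simps y_def)
        moreover have "(\<tau> \<eta>, y) \<in> ?X" using Gal_mu[OF \<tau>(1) \<eta>(1)] F(2)[OF \<tau>(1) s_iter] by (auto simp: y_def)
        ultimately show "t \<in> ?h ` ?X" by blast
      qed
      moreover have finX: "finite ?X" using card_mu(2)[OF m0] F(1) by (intro finite_cartesian_product finite_PiE) auto
      ultimately have "card (gorb z) \<le> card (?h ` ?X)" by (intro card_mono) auto
      also have "\<dots> \<le> card ?X" using finX by (rule card_image_le)
      also have "\<dots> = B" using card_mu(1)[OF m0] by (simp add: card_cartesian_product card_PiE B_def c_def)
      finally show ?thesis .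
    qed
    obtain k where k: "w z = real_of_int k / real (card (gorb z))"
      "w (z ^ card (gorb z) / of_nat ?p powi k) = 0" "z ^ card (gorb z) / of_nat ?p powi k ~= 0"
      using w_unit_part[OF z0] by blast
    define u where "u = z ^ card (gorb z) / of_nat ?p powi k"
    have u: "u ~= 0" "w u = 0" using k by (simp_all add: u_def)
    obtain e n' where n': "card (gorb z) = ?p ^ e * n'" "\<not> ?p dvd n'" "n' > 0"
      using p_part[OF card_gorb_pos[of z]] by blast
    have "n' dvd fact B"
    proof -
      have "n' dvd card (gorb z)" using n'(1) by simp
      also have "card (gorb z) dvd fact B" by (intro dvd_fact) (use Suc_leI[OF card_gorb_pos[of z]] card_z in linarith)+
      finally show ?thesis .
    qed
    then have n'B: "n' dvd B'" using coprime_p[OF n'(2), of b] unfolding B'(1) by (simp add: coprime_dvd_mult_right_iff)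
    have red_orb: "w y = 0" "y ~= 0" if "y \<in> gorb u" for y
      using that u by (auto simp: gorb_def w_Gal Gal_eq_0_iff)
    have "\<exists>d. 1 \<le> d \<and> d \<le> card (red ` gorb u) \<and> red u ^ (?p ^ d - 1) = 1"
    proof (rule frobenius_periodic)
      show "x ^ ?p \<in> red ` gorb u" if xx: "x \<in> red ` gorb u" for x
      proof -
        obtain y where y: "y \<in> gorb u" "x = red y" using xx by blast
        obtain \<tau> where \<tau>: "\<tau> \<in> Gal" "red (\<tau> y) = red y ^ ?p"
          using red_gpoly[OF red_orb(2,1)[OF y(1)]] by blast
        have "\<tau> y \<in> gorb u" using gorb_trans[OF y(1) gorb_Gal[OF \<tau>(1)]] .
        then show ?thesis using \<tau> y by (metis image_eqI)
      qed
      show "red u ~= 0" using u by (subst red_eq_0_iff) (auto simp: wge_def)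
    qed (auto intro: p_pos dest: fpb_power_inj)
    then obtain d where d: "1 \<le> d" "d \<le> card (red ` gorb u)" "red u ^ (?p ^ d - 1) = 1" by blast
    have "card (red ` gorb u) \<le> card (gorb u)" by (rule card_image_le) simp
    also have "\<dots> \<le> card (gorb z)"
    proof -
      have "gorb u \<subseteq> (%t. t ^ card (gorb z) / of_nat ?p powi k) ` gorb z"
      proof
        fix t assume "t \<in> gorb u"
        then obtain \<tau> where \<tau>: "\<tau> \<in> Gal" "t = \<tau> u" by (auto simp: gorb_def)
        have "\<tau> (of_nat ?p powi k) = of_nat ?p powi k"
          by (cases "k \<ge> 0") (auto simp: power_int_def Gal_simps \<tau>(1))
        then have "t = (\<tau> z) ^ card (gorb z) / of_nat ?p powi k"
          by (simp add: \<tau>(2) u_def Gal_simps \<tau>(1))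
        then show "t \<in> (%t. t ^ card (gorb z) / of_nat ?p powi k) ` gorb z" using gorb_Gal[OF \<tau>(1)] by blast
      qed
      then have "card (gorb u) \<le> card ((%t. t ^ card (gorb z) / of_nat ?p powi k) ` gorb z)"
        by (intro card_mono finite_imageI finite_gorb)
      also have "\<dots> \<le> card (gorb z)" by (rule card_image_le[OF finite_gorb])
      finally show ?thesis .
    qed
    finally have dB: "d \<le> B" using d(2) card_z by linarith
    have dvdn: "n' * (?p ^ d - 1) dvd n"
    proof -
      have "(?p ^ d - 1) dvd D" using d(1) dB by (intro Dd) auto
      then show ?thesis unfolding n_def by (rule dvd_mult[OF mult_dvd_mono[OF n'B]])
    qed
    obtain q where q: "n = n' * q" using dvd_trans[OF dvd_triv_left dvdn] by (elim dvdE)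
    \<comment> \<open>w z = k / (p^e n') and w \<pi> = 1 / n with n = n' q, so this quotient is a
      unit, and its n'-th power is u.\<close>
    define v where "v = z ^ (?p ^ e) / \<pi> powi (k * int q)"
    have v0: "v ~= 0" using z0 \<pi>0(1) by (simp add: v_def)
    have vn: "v ^ n' = u"
    proof -
      have "(\<pi> powi (k * int q)) ^ n' = \<pi> powi (int n * k)"
        by (simp add: q power_int_mult[symmetric] flip: power_int_of_nat) (simp add: mult_ac)
      also have "\<dots> = of_nat ?p powi k" by (simp add: power_int_mult \<pi>)
      finally show ?thesis by (simp add: v_def u_def power_divide n'(1) flip: power_mult)
    qed
    have wv: "w v = 0"
    proof -
      have "real n' * w v = 0" using w_power[OF v0, of n'] vn u by simp
      then show ?thesis using n'(3) by simp
    qed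
    have vw: "wge v 0" using wv by (simp add: wge_def)
    have sv: "s v = \<eta> ^ (?p ^ e) * v"
    proof -
      have "s (\<pi> powi i) = \<pi> powi i" for i
        by (cases "i \<ge> 0") (auto simp: power_int_def Gal_simps s s_pi)
      then show ?thesis by (simp add: v_def Gal_simps s sz power_mult_distrib)
    qed
    have "red v ^ (n' * (?p ^ d - 1)) = 1"
      using d(3) vn red_power[OF vw, of n'] by (simp add: power_mult)
    \<comment> \<open>The residue class of v is that of a root of unity fixed by s, so s preserves
      it; on the other hand s multiplies v by \<eta>^(p^e).\<close>
    then have "red v \<in> mu n" using dvdn by (auto simp: mu_def power_mult elim!: dvdE)
    then obtain t where t: "t \<in> mu n" "red t = red v" using np by (rule red_mu_surj)
    have "red (s v) = red (s t)" by (rule red_Gal[OF vw wge_mu'[OF t(1) n0] _ s]) (simp add: t)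
    then have "red (s v) = red v" using s_mu[OF t(1)] t(2) by simp
    moreover have \<eta>w: "wge \<eta> 0" using \<eta>(1) am(3) by (rule wge_mu')
    then have "red (s v) = red \<eta> ^ (?p ^ e) * red v"
      unfolding sv using vw by (simp add: red_mult wge_power red_power)
    moreover have "red v ~= 0" using v0 wv by (simp add: red_eq_0_iff[OF vw])
    ultimately have "red \<eta> ^ (?p ^ e) = 1 ^ (?p ^ e)" by simp
    then have "red \<eta> = 1" by (rule fpb_power_p_power_inj)
    then have "\<eta> = 1" using red_mu_eq_1[OF \<eta>(1) am(2)] by blast
    then show False using \<eta>(2) by simp
  qed
  ultimately show ?thesis using that n0 np by blast
qed

text \<open>The ratio of \<open>sg \<pi>\<close> to \<pi> is an n-th root of unity congruent to 1,
  and reduction is injective on such roots.\<close>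

lemma wild_uniformizer:
  assumes sg: "(sg :: 'p qp_bar => _) \<in> wild_inertia" and n: "n > 0" "\<not> CARD('p) dvd n" "\<pi> ^ n = (of_nat CARD('p) :: 'p qp_bar)"
  shows "sg \<pi> = \<pi>"
proof -
  note \<pi>0 = w_uniformizer[OF n(3,1)]
  have I: "(sg :: 'p qp_bar => _) \<in> inertia" using sg by (simp add: wild_inertia_def)
  then have G: "sg \<in> Gal" by (rule inertia_Gal)
  define z where "z = sg \<pi> / \<pi>"
  have "sg \<pi> ^ n = sg (\<pi> ^ n)" using G by (simp add: Gal_simps)
  then have "z ^ n = 1" using \<pi>0(1) by (simp add: z_def power_divide n(3) Gal_simps G p_pos)
  then have z: "z \<in> mu n" by (simp add: mu_def)
  have "z - 1 \<in> max_ideal_bar" using sg \<pi>0(1) by (simp add: wild_inertia_def z_def)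
  then have "red z = red 1" using red_eq_iff[OF wge_mu'[OF z n(1)] wge_1] by (auto simp: max_ideal_bar_iff)
  then have "z = 1" using red_mu_eq_1[OF z n(2)] red_1 by simp
  then show ?thesis using \<pi>0(1) by (simp add: z_def)
qed

text \<open>The ratio is a unit, whose residue class inertia fixes; this turns the cocycle relation
  for powers of \<open>sg\<close> into multiplicativity after reduction.\<close>

lemma inertia_ratio_power:
  assumes sg: "(sg :: 'p qp_bar => _) \<in> inertia" and x: "x ~= 0"
  shows "red ((sg ^^ n) x / x) = red (sg x / x) ^ n"
proof (induction n)
  case 0
  then show ?case using x by (simp add: red_1)
next
  case (Suc n)
  have G: "sg \<in> Gal" using sg by (rule inertia_Gal)
  have Gn: "sg ^^ n \<in> Gal" using G by (rule Gal_pow)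
  have unit: "wge (\<tau> x / x) 0" if "\<tau> \<in> Gal" for \<tau>
    using x that by (simp add: wge_def w_divide w_Gal Gal_eq_0_iff)
  have eq: "(sg ^^ Suc n) x / x = sg ((sg ^^ n) x / x) * (sg x / x)"
    using x by (simp add: Gal_simps G)
  have "red ((sg ^^ Suc n) x / x) = red (sg ((sg ^^ n) x / x)) * red (sg x / x)"
    unfolding eq using unit[OF Gn] unit[OF G] by (intro red_mult) (simp_all add: wge_Gal[OF G])
  then show ?case using inertia_red[OF sg unit[OF Gn]] Suc by (simp add: mult.commute)
qed

text \<open>The wild element below is the pro-\<open>p\<close> part of \<open>sg\<close>, the limit of the powers \<open>sg\<^bsup>e j\<^esup>\<close> where
  \<open>e j\<close> tends to 1 in \<open>\<int>\<^sub>p\<close> and to 0 in \<open>\<int>\<^sub>l\<close> for the primes \<open>l ~= p\<close>.\<close>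

lemma wild_approximation:
  assumes sg: "(sg :: 'p qp_bar => _) \<in> inertia" and F: "!!x. x \<in> F ==> (sg ^^ (CARD('p) ^ a)) x = x"
  obtains \<nu> where "\<nu> \<in> wild_inertia" "!!x. x \<in> F ==> \<nu> x = sg x"
proof -
  let ?p = "CARD('p)"
  have "\<exists>m a. fact j = ?p ^ a * m \<and> \<not> ?p dvd m" for j :: nat
    using p_part[of "fact j"] by (metis fact_gt_zero)
  then obtain M A where M: "!!j :: nat. fact j = ?p ^ A j * M j" "!!j. \<not> ?p dvd M j" by metis
  \<comment> \<open>By Euler's theorem e j is 1 modulo p^j, and it is divisible by every m <= j
    prime to p.\<close>
  define e where "e j = M j ^ totient (?p ^ j)" for j
  have G: "sg \<in> Gal" using sg by (rule inertia_Gal)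
  have e1: "[e j = 1] (mod ?p ^ b)" if "b \<le> j" for b j
  proof -
    have "[e j = 1] (mod ?p ^ j)"
      unfolding e_def using coprime_p[OF M(2)] by (rule euler_theorem)
    then show ?thesis using that by (meson cong_dvd_modulus_nat le_imp_power_dvd)
  qed
  have e0: "m dvd e j" if "\<not> ?p dvd m" "m \<le> j" for m j
  proof -
    have "m > 0" using that(1) by (cases m) auto
    then have "m dvd fact j" using that by (intro dvd_fact) auto
    then have "m dvd M j" using coprime_p[OF that(1), of "A j"] unfolding M(1)[of j]
      by (simp add: coprime_dvd_mult_right_iff)
    moreover have "totient (?p ^ j) > 0" using p_pos by (simp add: totient_gt_0_iff)
    ultimately show ?thesis unfolding e_def by (metis dvd_power dvd_trans)
  qed
  \<comment> \<open>Modulo the factorial of the orbit size, which kills the action of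
    \<open>sg\<close> on the orbit of x, the exponents e j are eventually constant by the Chinese
    remainder theorem. So the powers of \<open>sg\<close> converge pointwise.\<close>
  have per: "\<exists>J. \<forall>j\<ge>J. (sg ^^ e j) x = (sg ^^ e J) x" for x
  proof -
    define P where "P = (fact (card (gorb x)) :: nat)"
    have "(sg ^^ P) x = x"
      unfolding P_def
      by (rule perm_fact_fixed[OF finite_gorb gorb_trans[OF _ gorb_Gal[OF G]] field_hom_injective[OF Gal_hom[OF G]] gorb_self])
    obtain b m where bm: "P = ?p ^ b * m" "\<not> ?p dvd m" using p_part[of P] unfolding P_def by (metis fact_gt_zero)
    have "(sg ^^ e j) x = (sg ^^ e (b + m)) x" if "j \<ge> b + m" for j
    proof -
      have "[e j = e (b + m)] (mod ?p ^ b)" using e1[of b j] e1[of b "b + m"] that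
        by (meson cong_sym cong_trans le_add1 order_trans)
      moreover have "[e j = e (b + m)] (mod m)"
        using e0[OF bm(2), of j] e0[OF bm(2), of "b + m"] that by (simp add: Cong.cong_def)
      ultimately have "[e j = e (b + m)] (mod P)"
        unfolding bm(1) using coprime_p[OF bm(2), of b]
        by (intro coprime_cong_mult_nat) (simp_all add: coprime_commute)
      then have *: "e j mod P = e (b + m) mod P" by (simp add: Cong.cong_def)
      have red: "(sg ^^ i) x = (sg ^^ (i mod P)) x" for i
      proof -
        have "(sg ^^ i) x = (sg ^^ (i mod P + P * (i div P))) x" by simp
        also have "\<dots> = (sg ^^ (i mod P)) (((sg ^^ P) ^^ (i div P)) x)"
          by (simp only: funpow_add funpow_mult comp_apply)
        also have "\<dots> = (sg ^^ (i mod P)) x" using funpow_fixed[of "sg ^^ P" x, OF \<open>(sg ^^ P) x = x\<close>] by simp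
        finally show ?thesis .
      qed
      show ?thesis using red[of "e j"] red[of "e (b + m)"] * by simp
    qed
    then show ?thesis by blast
  qed
  then obtain J where J: "!!x j. j \<ge> J x ==> (sg ^^ e j) x = (sg ^^ e (J x)) x" by metis
  define \<nu> where "\<nu> x = (sg ^^ e (J x)) x" for x
  have ev: "\<nu> x = (sg ^^ e j) x" if "j \<ge> J x" for x j using J[OF that] by (simp add: \<nu>_def)
  have Gp: "sg ^^ i \<in> Gal" for i using G by (rule Gal_pow)
  have \<nu>G: "\<nu> \<in> Gal"
  proof (rule GalI, rule field_homI)
    fix x y
    define j where "j = Max {J x, J y, J (x + y), J (x * y)}"
    have j: "J x \<le> j" "J y \<le> j" "J (x + y) \<le> j" "J (x * y) \<le> j" by (auto simp: j_def)
    show "\<nu> (x + y) = \<nu> x + \<nu> y" "\<nu> (x * y) = \<nu> x * \<nu> y"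
      using j by (simp_all only: ev Gal_add[OF Gp] Gal_mult[OF Gp])
    show "\<nu> 1 = 1" by (simp add: \<nu>_def Gal_1[OF Gp])
    show "\<nu> (to_ac c) = to_ac c" for c by (simp add: \<nu>_def Gal_to_ac[OF Gp])
  qed
  have \<nu>I: "\<nu> \<in> inertia"
    unfolding inertia_iff using \<nu>G inertia_red[OF inertia_pow[OF sg]] by (simp add: \<nu>_def)
  have "\<nu> x / x - 1 \<in> max_ideal_bar" if x: "x ~= 0" for x
  proof -
    have unit: "wge (\<tau> x / x) 0" "\<tau> x / x ~= 0" "w (\<tau> x / x) = 0" if "\<tau> \<in> Gal" for \<tau>
      using x that by (simp_all add: wge_def w_divide w_Gal Gal_eq_0_iff)
    have "red (sg x / x) ~= 0" using red_eq_0_iff[OF unit(1)[OF G]] unit[OF G] by simp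
    \<comment> \<open>The value of the tame character at x has order prime to p, so e j annihilates
      it for large j.\<close>
    then obtain m where m: "m > 0" "\<not> ?p dvd m" "red (sg x / x) \<in> mu m" by (rule fpb_root_of_unity)
    define j where "j = max m (J x)"
    have "m dvd e j" using m by (intro e0) (auto simp: j_def)
    then have "red (sg x / x) ^ e j = 1" using m(3) by (auto simp: mu_def power_mult elim!: dvdE)
    then have "red (\<nu> x / x) = red 1"
      using ev[of x j] inertia_ratio_power[OF sg x, of "e j"] by (simp add: j_def red_1)
    then show ?thesis using red_eq_iff[OF unit(1)[OF \<nu>G] wge_1] by (auto simp: max_ideal_bar_iff)
  qed
  then have "\<nu> \<in> wild_inertia" using \<nu>I by (auto simp: wild_inertia_def)
  moreover have "\<nu> x = sg x" if x: "x \<in> F" for x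
  proof -
    define j where "j = max a (J x)"
    have "[e j = 1] (mod ?p ^ a)" by (intro e1) (simp add: j_def)
    moreover have "e j \<ge> 1"
    proof -
      have "M j ~= 0" using M(2)[of j] by (intro notI) simp
      then show ?thesis by (simp add: e_def Suc_le_eq)
    qed
    ultimately obtain q where q: "e j = 1 + ?p ^ a * q"
      by (metis cong_to_1_nat dvdE le_add_diff_inverse)
    have "(sg ^^ e j) x = sg (((sg ^^ (?p ^ a)) ^^ q) x)" by (simp add: q funpow_mult)
    also have "\<dots> = sg x" using funpow_fixed[of "sg ^^ (?p ^ a)" x, OF F[OF x]] by simp
    finally show ?thesis using ev[of x j] by (simp add: j_def)
  qed
  ultimately show ?thesis using that by blast
qed

end

subsection \<open>The tame quotient of the Galois group\<close>

text \<open>The interface between arithmetic and linear algebra. J stands for the elements fixing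
  \<zeta> and \<pi>, and d is the value of \<open>\<omega>2\<close> at g, of exact order p^2 - 1. On
  inertia the cyclotomic character is the (p + 1)-st power of \<open>\<omega>2\<close>, whence the
  exponents (p + 1) t. By \<open>wild\<close> and \<open>wildJ\<close>, wild inertia and the
  inertial part of J have the same image under r.\<close>

locale tame_rep =
  fixes r :: "'p :: prime_card local_rep" and \<omega>2 :: "('p qp_bar => 'p qp_bar) => 'p fp_bar"
    and g \<phi> :: "'p qp_bar => 'p qp_bar" and J :: "('p qp_bar => 'p qp_bar) set" and d :: "'p fp_bar" and N :: nat
  assumes r_comp: "sg \<in> Gal ==> \<tau> \<in> Gal ==> r (sg \<circ> \<tau>) = r sg ** r \<tau>"
    and r_id: "r id = mat 1"
    and N: "\<not> CARD('p) dvd N"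
    and gI: "g \<in> inertia" and \<phi>G: "\<phi> \<in> Gal" and J_Gal: "J \<subseteq> Gal"
    and inertia_sub: "inertia \<subseteq> (Gal :: ('p qp_bar => 'p qp_bar) set)"
    and J_comp: "i \<in> J ==> j \<in> J ==> i \<circ> j \<in> J"
    and J_p: "j \<in> J ==> \<exists>a. r (j ^^ (CARD('p) ^ a)) = mat 1"
    and J_normal: "j \<in> J ==> \<tau> \<in> Gal ==> \<exists>j'\<in>J. j \<circ> \<tau> = \<tau> \<circ> j'"
    and dec: "sg \<in> Gal ==> \<exists>s i. \<exists>j\<in>J. sg = g ^^ s \<circ> \<phi> ^^ i \<circ> j"
    and decI: "sg \<in> inertia ==>
      \<exists>t. \<exists>j\<in>J \<inter> inertia. sg = g ^^ t \<circ> j \<and> cyclo sg = d ^ ((CARD('p) + 1) * t) \<and> \<omega>2 sg = d ^ t"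
    and comm: "\<exists>j\<in>J. \<phi> \<circ> g = g ^^ CARD('p) \<circ> \<phi> \<circ> j"
    and gN: "g ^^ N \<in> J \<inter> inertia"
    and wild: "\<nu> \<in> wild_inertia ==> \<nu> \<in> J \<inter> inertia \<and> cyclo \<nu> = 1"
    and wildJ: "j \<in> J \<inter> inertia ==> \<exists>\<nu>\<in>wild_inertia. r \<nu> = r j"
    and d: "prim d ((CARD('p))\<^sup>2 - 1)"
    and cyclo_g: "cyclo g = d ^ (CARD('p) + 1)" and \<omega>2_g: "\<omega>2 g = d"
    and inertia_conj: "\<tau> \<in> Gal ==> \<exists>sg\<in>inertia. \<tau> \<circ> g = sg \<circ> \<tau>"
    and cyclo_nz: "sg \<in> Gal ==> cyclo sg ~= 0"

section \<open>The cyclotomic character and the construction of the tame data\<close>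

context residue
begin

lemma of_nat_p_qpb: "(of_nat CARD('p) :: 'p qp_bar) ~= 0" using p_pos by simp

lemma cyclo_eq:
  assumes z: "prim (z :: 'p qp_bar) CARD('p)" and sg: "sg \<in> Gal" "sg z = z ^ n"
  shows "cyclo sg = of_nat n"
proof -
  let ?p = "CARD('p)"
  have red_exp: "x ^ (n mod ?p) = x ^ n" if "x ^ ?p = 1" for x :: "'p qp_bar"
  proof -
    have "x ^ n = x ^ (?p * (n div ?p) + n mod ?p)" by simp
    also have "\<dots> = x ^ (n mod ?p)" unfolding power_add power_mult that by simp
    finally show ?thesis by simp
  qed
  have "(THE m. m < ?p \<and> (\<forall>x. x ^ ?p = 1 --> sg x = x ^ m)) = n mod ?p"
  proof (rule the_equality, intro conjI allI impI)
    show "n mod ?p < ?p" using p_pos by simp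
    fix x :: "'p qp_bar" assume x: "x ^ ?p = 1"
    then have "x \<in> mu ?p" by (simp add: mu_def)
    then obtain t where t: "x = z ^ t" using prim_mu_cases[OF z of_nat_p_qpb] by blast
    have "sg x = (sg z) ^ t" unfolding t by (rule Gal_power[OF sg(1)])
    also have "\<dots> = x ^ n" unfolding sg(2) t by (simp add: mult.commute flip: power_mult)
    finally show "sg x = x ^ (n mod ?p)" using red_exp[OF x] by simp
  next
    fix m assume m: "m < ?p \<and> (\<forall>x. x ^ ?p = 1 --> sg x = x ^ m)"
    have "z ^ ?p = 1" using prim_mu[OF z] by (simp add: mu_def)
    then have "z ^ m = z ^ n" using m sg(2) by metis
    then have "m mod ?p = n mod ?p" using prim_power_eq_iff[OF z p_pos] by blast
    then show "m = n mod ?p" using m by simp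
  qed
  then have "cyclo sg = of_nat (n mod ?p)" by (simp add: cyclo_def)
  also have "\<dots> = of_nat (?p * (n div ?p) + n mod ?p)" by (simp only: of_nat_add of_nat_mult of_nat_p_fpb mult_zero_left add_0)
  finally show ?thesis by simp
qed

lemma cyclo_exponent:
  assumes sg: "sg \<in> Gal"
  shows "\<exists>z n. prim (z :: 'p qp_bar) CARD('p) \<and> n < CARD('p) \<and> sg z = z ^ n \<and> cyclo sg = of_nat n"
proof -
  obtain z :: "'p qp_bar" where z: "prim z CARD('p)" using prim_exists[OF of_nat_p_qpb] by blast
  have "sg z \<in> mu CARD('p)" by (rule Gal_mu[OF sg prim_mu[OF z]])
  then obtain n where n: "sg z = z ^ n" "n < CARD('p)" by (rule prim_mu_cases[OF z of_nat_p_qpb])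
  then show ?thesis using z cyclo_eq[OF z sg n(1)] by blast
qed

lemma cyclo_neq_0:
  assumes sg: "sg \<in> Gal"
  shows "cyclo sg ~= (0 :: 'p fp_bar)"
proof
  assume 0: "cyclo sg = 0"
  obtain z n where z: "prim (z :: 'p qp_bar) CARD('p)" "n < CARD('p)" "sg z = z ^ n" "cyclo sg = of_nat n"
    using cyclo_exponent[OF sg] by blast
  have "CARD('p) dvd n" using z(4) 0 by (simp add: of_nat_fpb_eq_0_iff)
  then have "n = 0" using z(2) by (metis dvd_imp_le gr0I not_less)
  then have "sg z = sg 1" using z(3) by (simp add: Gal_1[OF sg])
  then have "z ^ 1 = 1" by (simp add: Gal_eq_iff[OF sg])
  then have "CARD('p) dvd 1" using primD[OF z(1)] by blast
  then show False using p_gt_1 by simp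
qed

lemma w_eq_0_of_red: "wge x 0 ==> red x ~= 0 ==> x ~= 0 \<and> w x = 0"
  using red_eq_0_iff[of x] by (auto simp: wge_def)

text \<open>With l = z - 1, the expansion of (1 + l)^p = 1 divided by l reads l^(p-1) = - p (1 + Y),
  where Y lies in the maximal ideal because l does.\<close>

lemma prim_p_uniformizer:
  assumes z: "prim (z :: 'p qp_bar) CARD('p)"
  shows "red z = 1" "z ~= 1" "w (z - 1) = 1 / real (CARD('p) - 1)"
proof -
  let ?p = "CARD('p)"
  have zp: "z ^ ?p = 1" using prim_mu[OF z] by (simp add: mu_def)
  have zw: "wge z 0" by (rule wge_mu'[OF prim_mu[OF z] p_pos])
  have "red z ^ ?p = 1 ^ ?p" using red_power[OF zw, of ?p] by (simp add: zp red_1)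
  then show rz: "red z = 1" by (rule fpb_power_inj)
  show z1: "z ~= 1"
  proof
    assume "z = 1"
    then have "z ^ 1 = 1" by simp
    then have "CARD('p) dvd 1" using primD[OF z] by blast
    then show False using p_gt_1 by simp
  qed
  define l where "l = z - 1"
  have l0: "l ~= 0" using z1 by (simp add: l_def)
  have lw: "wge l 0" unfolding l_def by (intro wge_diff zw wge_1)
  have rl: "red l = 0" unfolding l_def using zw by (simp add: red_diff rz red_1)
  obtain q where q: "?p = Suc q" using p_pos by (cases "?p") auto
  have q0: "q > 0" using p_gt_1 q by simp
  have "1 = (l + 1) ^ ?p" by (simp add: l_def zp)
  also have "\<dots> = (\<Sum>k\<le>Suc q. of_nat (?p choose k) * l ^ k)"
    unfolding binomial_ring q by simp
  also have "\<dots> = 1 + (\<Sum>k\<le>q. of_nat (?p choose Suc k) * l ^ Suc k)"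
    unfolding sum.atMost_Suc_shift by simp
  also have "(\<Sum>k\<le>q. of_nat (?p choose Suc k) * l ^ Suc k) = l * (\<Sum>k\<le>q. of_nat (?p choose Suc k) * l ^ k)"
    unfolding sum_distrib_left by (rule sum.cong) (simp_all add: mult_ac)
  finally have "l * (\<Sum>k\<le>q. of_nat (?p choose Suc k) * l ^ k) = 0" by simp
  then have S: "(\<Sum>k\<le>q. of_nat (?p choose Suc k) * l ^ k) = 0" using l0 by (simp only: mult_eq_0_iff simp_thms)
  define c where "c k = (?p choose Suc k) div ?p" for k
  have c: "?p choose Suc k = ?p * c k" if "k < q" for k
  proof -
    have "?p dvd (?p choose Suc k)" using that q by (intro dvd_choose_prime p_prime) auto
    then show ?thesis by (simp add: c_def)
  qed
  define Y where "Y = (\<Sum>k\<in>{1..<q}. of_nat (c k) * l ^ k)"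
  have "(\<Sum>k\<le>q. of_nat (?p choose Suc k) * l ^ k) = (\<Sum>k<q. of_nat (?p choose Suc k) * l ^ k) + l ^ q"
    unfolding lessThan_Suc_atMost[symmetric] sum.lessThan_Suc by (simp add: q)
  also have "(\<Sum>k<q. of_nat (?p choose Suc k) * l ^ k) = (\<Sum>k<q. of_nat ?p * (of_nat (c k) * l ^ k))"
    by (rule sum.cong) (simp_all only: lessThan_iff c of_nat_mult mult.assoc)
  also have "\<dots> = of_nat ?p * (\<Sum>k<q. of_nat (c k) * l ^ k)" by (simp only: sum_distrib_left)
  also have "(\<Sum>k<q. of_nat (c k) * l ^ k) = 1 + Y"
  proof -
    have "{..<q} = insert 0 {1..<q}" using q0 by auto
    moreover have "c 0 = 1" using p_pos by (simp add: c_def)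
    ultimately show ?thesis by (simp add: Y_def)
  qed
  finally have lq: "l ^ q = - (of_nat ?p * (1 + Y))" using S by (simp add: eq_neg_iff_add_eq_0 add.commute)
  have Yw: "wge Y 0" unfolding Y_def by (intro wge_sum wge_mult_0 wge_of_nat wge_power lw)
  have "red Y = (\<Sum>k\<in>{1..<q}. of_nat (c k) * red l ^ k)"
    unfolding Y_def by (subst red_sum) (simp_all add: wge_mult_0 wge_of_nat wge_power lw red_mult red_of_nat red_power)
  also have "\<dots> = 0" by (rule sum.neutral) (auto simp: rl power_0_left)
  finally have "red (1 + Y) = 1" using Yw by (simp add: red_add red_1)
  moreover have "wge (1 + Y) 0" by (intro wge_add wge_1 Yw)
  ultimately have Y1: "1 + Y ~= 0" "w (1 + Y) = 0" using w_eq_0_of_red[of "1 + Y"] by simp_all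
  have "w (l ^ q) = 1" unfolding lq using Y1 p_pos by (simp add: w_uminus w_mult w_p)
  then have "real q * w l = 1" using l0 by (simp add: w_power)
  then show "w (z - 1) = 1 / real (?p - 1)" using q0 q by (simp add: l_def field_simps)
qed

text \<open>Apply \<open>tame_character\<close> to z - 1 for a primitive p-th root of unity z, of
  valuation 1 / (p - 1). If sg z = z^m, the ratio of sg (z - 1) to z - 1 is 1 + z + ... + z^(m-1),
  which reduces to m, the value of the cyclotomic character.\<close>

lemma cyclo_inertia:
  assumes sg: "(sg :: 'p qp_bar => _) \<in> inertia" and n: "n > 0" "(CARD('p) - 1) dvd n"
    and \<pi>: "\<pi> ^ n = (of_nat CARD('p) :: 'p qp_bar)" "sg \<pi> = \<eta> * \<pi>" "\<eta> \<in> mu n"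
  shows "cyclo sg = red \<eta> ^ (n div (CARD('p) - 1))"
proof -
  let ?p = "CARD('p)"
  have G: "sg \<in> Gal" using sg by (rule inertia_Gal)
  obtain z m where z: "prim (z :: 'p qp_bar) ?p" "sg z = z ^ m" "cyclo sg = of_nat m"
    using cyclo_exponent[OF G] by blast
  note zz = prim_p_uniformizer[OF z(1)]
  have zw: "wge z 0" by (rule wge_mu'[OF prim_mu[OF z(1)] p_pos])
  obtain k where k: "n = (?p - 1) * k" using n(2) by (elim dvdE)
  have p1: "?p - 1 > 0" using p_gt_1 by simp
  have k': "n div (?p - 1) = k" using p1 by (simp add: k)
  have "k > 0" using n(1) k by (cases k) auto
  then have "1 / real (?p - 1) = real k / real n" using p1 by (simp add: k)
  then have "red (sg (z - 1) / (z - 1)) = red \<eta> ^ k"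
    using zz by (intro tame_character[OF sg n(1) \<pi>]) simp_all
  moreover have "sg (z - 1) / (z - 1) = (\<Sum>i<m. z ^ i)"
    using zz(2) power_diff_1_eq[of z m] by (simp add: Gal_diff[OF G] Gal_1[OF G] z(2))
  moreover have "red (\<Sum>i<m. z ^ i) = of_nat m"
    by (subst red_sum) (simp_all add: wge_power zw red_power zz(1))
  ultimately show ?thesis unfolding z(3) k' by metis
qed

lemma inertia_inv:
  assumes sg: "(sg :: 'p qp_bar => _) \<in> inertia"
  shows "inv_into UNIV sg \<in> inertia"
  unfolding inertia_iff
proof (intro conjI allI impI)
  have G: "sg \<in> Gal" using sg by (rule inertia_Gal)
  show Gi: "inv_into UNIV sg \<in> Gal" by (rule Gal_inv[OF G])
  fix x :: "'p qp_bar" assume "wge x 0"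
  then have "wge (inv_into UNIV sg x) 0" by (simp add: wge_Gal[OF Gi])
  then show "red (inv_into UNIV sg x) = red x"
    using inertia_red[OF sg] by (metis Gal_inv_right[OF G])
qed

theorem tame_rep_exists:
  fixes r :: "'p local_rep"
  assumes \<pi>2: "\<pi>2 ^ ((CARD('p))\<^sup>2 - 1) = (of_nat CARD('p) :: 'p qp_bar)"
    and \<omega>2: "!!sg. sg \<in> inertia ==> \<omega>2 sg = red (sg \<pi>2 / \<pi>2)"
    and r_comp: "!!sg \<tau>. sg \<in> Gal ==> \<tau> \<in> Gal ==> r (sg \<circ> \<tau>) = r sg ** r \<tau>"
    and F0: "finite F0" "!!sg. sg \<in> Gal ==> (\<forall>x\<in>F0. sg x = x) ==> r sg = mat 1"
  shows "\<exists>g \<phi> J d N. tame_rep r \<omega>2 g \<phi> J d N"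
proof -
  let ?p = "CARD('p)"
  \<comment> \<open>Closed under the Galois group, as \<open>tame_level\<close> requires.\<close>
  define F where "F = (\<Union>x\<in>F0. gorb x)"
  have F: "finite F" "!!sg x. sg \<in> Gal ==> x \<in> F ==> sg x \<in> F"
    using F0(1) by (auto simp: F_def intro: gorb_trans gorb_Gal)
  have rF: "r sg = mat 1" if "sg \<in> Gal" "!!x. x \<in> F ==> sg x = x" for sg
  proof (rule F0(2)[OF that(1)], rule ballI)
    fix x assume "x \<in> F0"
    then have "x \<in> F" unfolding F_def using gorb_self by blast
    then show "sg x = x" by (rule that(2))
  qed
  obtain N where N: "N > 0" "\<not> ?p dvd N" "(?p\<^sup>2 - 1) dvd N"
    and lev: "!!\<pi> sg. \<pi> ^ N = (of_nat ?p :: 'p qp_bar) ==> sg \<in> Gal ==> (!!z. z \<in> mu N ==> sg z = z) ==> sg \<pi> = \<pi> ==>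
       \<exists>a. \<forall>x\<in>F. (sg ^^ (?p ^ a)) x = x"
  proof (rule tame_level[of F])
    show "finite F" by (rule F)
    show "sg x \<in> F" if "sg \<in> Gal" "x \<in> F" for sg x using that by (rule F(2))
    fix n
    assume n: "n > 0" "\<not> ?p dvd n" "(?p\<^sup>2 - 1) dvd n"
      and lv: "!!\<pi> sg. \<pi> ^ n = (of_nat ?p :: 'p qp_bar) ==> sg \<in> Gal ==> (!!z. z \<in> mu n ==> sg z = z) ==> sg \<pi> = \<pi> ==>
       \<exists>a. \<forall>x\<in>F. (sg ^^ (?p ^ a)) x = x"
    show ?thesis by (rule that[OF n lv])
  qed
  have psq: "?p\<^sup>2 - 1 = (?p - 1) * (?p + 1)" by (simp add: power2_eq_square algebra_simps)
  obtain M where M: "N = (?p\<^sup>2 - 1) * M" using N(3) by (elim dvdE)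
  have M0: "M > 0" using N(1) M by (cases M) auto
  have p2: "?p\<^sup>2 - 1 > 0" using N(1) M by (cases "?p\<^sup>2 - 1") auto
  have N0: "of_nat N ~= (0 :: 'p qp_bar)" using N(1) by simp
  obtain \<zeta> :: "'p qp_bar" where \<zeta>: "prim \<zeta> N" using prim_exists[OF N0] by blast
  have \<zeta>mu: "\<zeta> \<in> mu N" by (rule prim_mu[OF \<zeta>])
  \<comment> \<open>\<pi> is chosen as a root of the given \<pi>2, so that the given
    \<open>\<omega>2\<close> can be evaluated through \<pi>.\<close>
  obtain \<pi> where "\<pi> ^ M = \<pi>2" using nth_root_exists[OF M0] by metis
  then have \<pi>: "\<pi> ^ N = (of_nat ?p :: 'p qp_bar)" "\<pi> ^ M = \<pi>2"
    using \<pi>2 by (simp_all add: M mult.commute power_mult)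
  note \<pi>0 = w_uniformizer(1)[OF \<pi>(1) N(1)]
  have mult_pi: "\<exists>t<N. sg \<pi> = \<zeta> ^ t * \<pi>" if sg: "sg \<in> Gal" for sg
  proof -
    have "sg \<pi> ^ N = sg (\<pi> ^ N)" by (rule Gal_power[OF sg, symmetric])
    then have "(sg \<pi> / \<pi>) ^ N = 1" using p_pos by (simp add: \<pi>(1) power_divide Gal_of_nat[OF sg])
    then have "sg \<pi> / \<pi> \<in> mu N" by (simp add: mu_def)
    then obtain t where "sg \<pi> / \<pi> = \<zeta> ^ t" "t < N" by (rule prim_mu_cases[OF \<zeta> N0])
    then show ?thesis using \<pi>0 by (auto simp: field_simps)
  qed
  have mult_zeta: "\<exists>i. sg \<zeta> = \<zeta> ^ (?p ^ i)" if sg: "sg \<in> Gal" for sg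
    using Gal_on_mu[OF sg \<zeta>mu N(2)] by blast
  have pw: "sg (\<zeta> ^ k) = sg \<zeta> ^ k" if "sg \<in> Gal" for sg k by (rule Gal_power[OF that])
  define J where "J = {sg \<in> Gal. sg \<zeta> = \<zeta> \<and> sg \<pi> = \<pi>}"
  have J_Gal: "j \<in> Gal" if "j \<in> J" for j using that by (simp add: J_def)
  have Ifix: "sg \<zeta> = \<zeta>" if "sg \<in> inertia" for sg by (rule inertia_mu[OF that \<zeta>mu N(2)])
  \<comment> \<open>Up to J an automorphism is known by its values at \<zeta> and \<pi>; the
    decompositions below are all checked on these two elements.\<close>
  have quot: "\<exists>j\<in>J. \<tau> = sg \<circ> j \<and> j = inv_into UNIV sg \<circ> \<tau>"
    if st: "sg \<in> Gal" "\<tau> \<in> Gal" "sg \<zeta> = \<tau> \<zeta>" "sg \<pi> = \<tau> \<pi>" for sg \<tau>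
  proof (intro bexI conjI)
    show "\<tau> = sg \<circ> (inv_into UNIV sg \<circ> \<tau>)" using st by (simp add: fun_eq_iff Gal_inv_right)
    show "inv_into UNIV sg \<circ> \<tau> \<in> J"
      using st by (simp add: J_def Gal_comp Gal_inv Gal_inv_left flip: st(3,4))
  qed simp
  obtain g where g: "g \<in> inertia" "g \<pi> = \<zeta> * \<pi>" by (rule tame_generator[OF N(1,2) \<zeta>mu \<pi>(1)])
  have gG: "g \<in> Gal" using g(1) by (rule inertia_Gal)
  have gt: "(g ^^ t) \<pi> = \<zeta> ^ t * \<pi>" "(g ^^ t) \<zeta> = \<zeta>" for t
  proof -
    show "(g ^^ t) \<pi> = \<zeta> ^ t * \<pi>"
      by (induction t) (simp_all add: g(2) Gal_mult[OF gG] Gal_power[OF gG] Ifix[OF g(1)])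
    show "(g ^^ t) \<zeta> = \<zeta>" using Ifix[OF g(1)] by (rule funpow_fixed)
  qed
  have gtI: "g ^^ t \<in> inertia" "g ^^ t \<in> Gal" for t
    using inertia_pow[OF g(1)] Gal_pow[OF gG] by blast+
  obtain \<phi> where \<phi>: "\<phi> \<in> Gal" "\<phi> \<zeta> = \<zeta> ^ ?p" by (rule Frobenius_exists[OF \<zeta> N(2)])
  have \<phi>i: "(\<phi> ^^ i) \<zeta> = \<zeta> ^ (?p ^ i)" for i
    by (induction i) (simp_all add: pw[OF \<phi>(1)] \<phi>(2) flip: power_mult)
  define d where "d = red \<zeta> ^ M"
  have \<zeta>w: "wge (\<zeta> ^ k) 0" for k by (rule wge_power[OF wge_mu'[OF \<zeta>mu N(1)]])
  have "prim (red \<zeta> ^ (N div (?p\<^sup>2 - 1))) (?p\<^sup>2 - 1)"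
    by (rule prim_power_dvd[OF red_prim[OF \<zeta> N(2)] N(3,1)])
  moreover have "N div (?p\<^sup>2 - 1) = M" using p2 by (simp add: M)
  ultimately have d: "prim d (?p\<^sup>2 - 1)" by (simp add: d_def)
  have chars: "cyclo sg = d ^ ((?p + 1) * t)" "\<omega>2 sg = d ^ t"
    if sg: "sg \<in> inertia" "sg \<pi> = \<zeta> ^ t * \<pi>" for sg t
  proof -
    have G: "sg \<in> Gal" using sg(1) by (rule inertia_Gal)
    have Nd: "N = (?p - 1) * ((?p + 1) * M)" unfolding M psq by (simp only: mult.assoc)
    have p1: "?p - 1 > 0" using p_gt_1 by simp
    have rz: "red (\<zeta> ^ t) = red \<zeta> ^ t" using \<zeta>w[of 1] by (simp add: red_power)
    have "cyclo sg = red (\<zeta> ^ t) ^ (N div (?p - 1))"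
      using Nd by (intro cyclo_inertia[OF sg(1) N(1) _ \<pi>(1) sg(2) mu_power[OF \<zeta>mu]]) simp
    also have "N div (?p - 1) = (?p + 1) * M" using p1 Nd by (metis nonzero_mult_div_cancel_left not_less_zero)
    finally have c: "cyclo sg = red \<zeta> ^ (t * ((?p + 1) * M))" by (simp only: rz power_mult)
    have "t * ((?p + 1) * M) = M * ((?p + 1) * t)" by (simp only: mult_ac)
    then show "cyclo sg = d ^ ((?p + 1) * t)" using c by (simp only: d_def power_mult)
    have "sg \<pi>2 = (sg \<pi>) ^ M" unfolding \<pi>(2)[symmetric] by (rule Gal_power[OF G])
    also have "\<dots> = \<zeta> ^ (t * M) * \<pi>2" unfolding sg(2) power_mult_distrib \<pi>(2) power_mult ..
    finally have "sg \<pi>2 / \<pi>2 = \<zeta> ^ (t * M)" using \<pi>0 \<pi>(2) by auto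
    then have "\<omega>2 sg = red \<zeta> ^ (t * M)" using \<omega>2[OF sg(1)] \<zeta>w[of 1] by (simp add: red_power)
    also have "\<dots> = d ^ t" unfolding d_def by (simp add: mult.commute flip: power_mult)
    finally show "\<omega>2 sg = d ^ t" .
  qed
  have r_id: "r id = mat 1" by (rule rF) simp_all
  have Jlev: "\<exists>a. \<forall>x\<in>F. (j ^^ (?p ^ a)) x = x" if j: "j \<in> J" for j
  proof (rule lev[OF \<pi>(1)])
    show "j z = z" if "z \<in> mu N" for z
    proof -
      obtain t where "z = \<zeta> ^ t" using prim_mu_cases[OF \<zeta> N0 \<open>z \<in> mu N\<close>] by blast
      then show ?thesis using j pw[of j t] by (simp add: J_def)
    qed
  qed (use j in \<open>simp_all add: J_def\<close>)
  have "tame_rep r \<omega>2 g \<phi> J d N"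
  proof
    show "r (sg \<circ> \<tau>) = r sg ** r \<tau>" if "sg \<in> Gal" "\<tau> \<in> Gal" for sg \<tau> using that by (rule r_comp)
    show "r id = mat 1" by (rule r_id)
    show "\<not> ?p dvd N" by (rule N)
    show "g \<in> inertia" by (rule g)
    show "\<phi> \<in> Gal" by (rule \<phi>)
    show "J \<subseteq> Gal" using J_Gal by blast
    show "inertia \<subseteq> (Gal :: ('p qp_bar => 'p qp_bar) set)" using inertia_Gal by blast
    show "i \<circ> j \<in> J" if "i \<in> J" "j \<in> J" for i j using that by (simp add: J_def Gal_comp)
    show "\<exists>a. r (j ^^ (?p ^ a)) = mat 1" if j: "j \<in> J" for j
      using Jlev[OF j] rF[OF Gal_pow[OF J_Gal[OF j]]] by blast
    show "\<exists>j'\<in>J. j \<circ> \<tau> = \<tau> \<circ> j'" if j: "j \<in> J" and \<tau>: "\<tau> \<in> Gal" for j \<tau>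
    proof -
      have jG: "j \<in> Gal" by (rule J_Gal[OF j])
      obtain k where k: "\<tau> \<zeta> = \<zeta> ^ (?p ^ k)" using mult_zeta[OF \<tau>] by blast
      obtain t where t: "\<tau> \<pi> = \<zeta> ^ t * \<pi>" using mult_pi[OF \<tau>] by blast
      have "\<tau> \<zeta> = (j \<circ> \<tau>) \<zeta>" using j by (simp add: k pw[OF jG] J_def)
      moreover have "\<tau> \<pi> = (j \<circ> \<tau>) \<pi>" using j by (simp add: t pw[OF jG] Gal_mult[OF jG] J_def)
      ultimately show ?thesis using quot[OF \<tau> Gal_comp[OF jG \<tau>]] by blast
    qed
    show "\<exists>s i. \<exists>j\<in>J. sg = g ^^ s \<circ> \<phi> ^^ i \<circ> j" if sg: "sg \<in> Gal" for sg
    proof -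
      obtain i where i: "sg \<zeta> = \<zeta> ^ (?p ^ i)" using mult_zeta[OF sg] by blast
      have \<phi>iG: "\<phi> ^^ i \<in> Gal" by (rule Gal_pow[OF \<phi>(1)])
      obtain e where e: "e < N" "(\<phi> ^^ i) \<pi> = \<zeta> ^ e * \<pi>" using mult_pi[OF \<phi>iG] by blast
      obtain t where t: "sg \<pi> = \<zeta> ^ t * \<pi>" using mult_pi[OF sg] by blast
      \<comment> \<open>\<phi>^i multiplies \<pi> by \<zeta>^e; the summand N - e undoes this,
        exponents being taken modulo N.\<close>
      define s where "s = t + (N - e)"
      have "\<zeta> ^ N = 1" using \<zeta>mu by (simp add: mu_def)
      moreover have "s + e = t + N" using e(1) by (simp add: s_def)
      ultimately have se: "\<zeta> ^ s * \<zeta> ^ e = \<zeta> ^ t" by (metis mult.right_neutral power_add)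
      have "(g ^^ s \<circ> \<phi> ^^ i) \<zeta> = sg \<zeta>" by (simp add: \<phi>i pw[OF gtI(2)] gt i)
      moreover have "(g ^^ s \<circ> \<phi> ^^ i) \<pi> = sg \<pi>"
        by (simp add: e(2) Gal_mult[OF gtI(2)] pw[OF gtI(2)] gt t mult_ac flip: se)
      ultimately show ?thesis
        using quot[OF Gal_comp[OF gtI(2) \<phi>iG] sg, of s] by blast
    qed
    show "\<exists>t. \<exists>j\<in>J \<inter> inertia. sg = g ^^ t \<circ> j \<and> cyclo sg = d ^ ((?p + 1) * t) \<and> \<omega>2 sg = d ^ t"
      if sg: "sg \<in> inertia" for sg
    proof -
      have G: "sg \<in> Gal" using sg by (rule inertia_Gal)
      obtain t where t: "sg \<pi> = \<zeta> ^ t * \<pi>" using mult_pi[OF G] by blast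
      have "\<exists>j\<in>J. sg = g ^^ t \<circ> j \<and> j = inv_into UNIV (g ^^ t) \<circ> sg"
        by (rule quot[OF gtI(2) G]) (simp_all add: gt t Ifix[OF sg])
      then obtain j where j: "j \<in> J" "sg = g ^^ t \<circ> j" "j = inv_into UNIV (g ^^ t) \<circ> sg" by blast
      have "j \<in> inertia" unfolding j(3) by (rule inertia_comp[OF inertia_inv[OF gtI(1)] sg])
      then show ?thesis using j(1,2) chars[OF sg t] by blast
    qed
    show "\<exists>j\<in>J. \<phi> \<circ> g = g ^^ ?p \<circ> \<phi> \<circ> j"
    proof -
      obtain e where e: "\<phi> \<pi> = \<zeta> ^ e * \<pi>" using mult_pi[OF \<phi>(1)] by blast
      have "(g ^^ ?p \<circ> \<phi>) \<zeta> = (\<phi> \<circ> g) \<zeta>" by (simp add: \<phi>(2) pw[OF gtI(2)] gt Ifix[OF g(1)])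
      moreover have "(g ^^ ?p \<circ> \<phi>) \<pi> = (\<phi> \<circ> g) \<pi>"
        by (simp add: e g(2) Gal_mult[OF gtI(2)] Gal_mult[OF \<phi>(1)] pw[OF gtI(2)] gt \<phi>(2) mult_ac)
      ultimately show ?thesis
        using quot[OF Gal_comp[OF gtI(2) \<phi>(1)] Gal_comp[OF \<phi>(1) gG]] by blast
    qed
    show "g ^^ N \<in> J \<inter> inertia" using gt[of N] gtI[of N] \<zeta>mu by (simp add: J_def mu_def)
    show "\<nu> \<in> J \<inter> inertia \<and> cyclo \<nu> = 1" if \<nu>: "\<nu> \<in> wild_inertia" for \<nu>
    proof -
      have I: "\<nu> \<in> inertia" using \<nu> by (simp add: wild_inertia_def)
      have "\<nu> \<pi> = \<pi>" by (rule wild_uniformizer[OF \<nu> N(1,2) \<pi>(1)])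
      then show ?thesis using I Ifix[OF I] inertia_Gal[OF I] chars(1)[OF I, of 0] by (simp add: J_def)
    qed
    show "\<exists>\<nu>\<in>wild_inertia. r \<nu> = r j" if j: "j \<in> J \<inter> inertia" for j
    proof -
      have jJ: "j \<in> J" "j \<in> inertia" using j by blast+
      obtain a where a: "!!x. x \<in> F ==> (j ^^ (?p ^ a)) x = x" using Jlev[OF jJ(1)] by blast
      obtain \<nu> where \<nu>: "\<nu> \<in> wild_inertia" "!!x. x \<in> F ==> \<nu> x = j x"
        using wild_approximation[OF jJ(2) a] by metis
      have jG: "j \<in> Gal" by (rule J_Gal[OF jJ(1)])
      have \<nu>G: "\<nu> \<in> Gal" using \<nu>(1) by (intro inertia_Gal) (simp add: wild_inertia_def)
      \<comment> \<open>\<nu> and j agree on F, so they differ by an element that r sends to the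
        identity.\<close>
      let ?i = "inv_into UNIV j \<circ> \<nu>"
      have iG: "?i \<in> Gal" by (rule Gal_comp[OF Gal_inv[OF jG] \<nu>G])
      have "r ?i = mat 1" using \<nu>(2) by (intro rF[OF iG]) (simp add: Gal_inv_left[OF jG])
      moreover have "\<nu> = j \<circ> ?i" by (simp add: fun_eq_iff Gal_inv_right[OF jG])
      ultimately have "r \<nu> = r j" using r_comp[OF jG iG] by simp
      then show ?thesis using \<nu>(1) by blast
    qed
    show "prim d (?p\<^sup>2 - 1)" by (rule d)
    show "cyclo g = d ^ (?p + 1)" "\<omega>2 g = d" using chars[OF g(1), of 1] g(2) by simp_all
    show "\<exists>sg\<in>inertia. \<tau> \<circ> g = sg \<circ> \<tau>" if \<tau>: "\<tau> \<in> Gal" for \<tau>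
    proof (intro bexI)
      show "\<tau> \<circ> g \<circ> inv_into UNIV \<tau> \<in> inertia" by (rule inertia_conj[OF g(1) \<tau>])
      show "\<tau> \<circ> g = \<tau> \<circ> g \<circ> inv_into UNIV \<tau> \<circ> \<tau>" by (simp add: fun_eq_iff Gal_inv_left[OF \<tau>])
    qed
    show "cyclo sg ~= (0 :: 'p fp_bar)" if "sg \<in> Gal" for sg using that by (rule cyclo_neq_0)
  qed
  then show ?thesis by blast
qed

end

subsection \<open>The decomposition group\<close>

context
  fixes \<iota> :: "q_bar => 'p :: prime_card qp_bar"
  assumes \<iota>: "field_hom \<iota>"
begin

lemma iota_rat_fixed:
  assumes "sg \<in> Gal"
  shows "sg (\<iota> (to_ac (q :: rat))) = \<iota> (to_ac q)"
proof -
  interpret field_hom \<iota> by (rule \<iota>)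
  interpret t: field_hom "to_ac :: rat => q_bar" by unfold_locales auto
  interpret s: field_hom sg by (rule Gal_hom[OF assms])
  obtain a b where "q = of_int a / of_int b" by (metis Fract_of_int_quotient Rat_cases)
  then have "\<iota> (to_ac q) = of_int a / of_int b" by (simp add: t.hom_div hom_div t.hom_of_int hom_of_int)
  then show ?thesis by (simp add: s.hom_div s.hom_of_int)
qed

text \<open>\<open>sg\<close> permutes the roots of the transported minimal polynomial of x, whose
  coefficients are rational, and all these roots lie in the range of \<open>\<iota>\<close>.\<close>

lemma iota_range_stable:
  assumes "sg \<in> Gal"
  shows "sg (\<iota> x) \<in> range \<iota>"
proof -
  interpret field_hom \<iota> by (rule \<iota>)
  interpret s: field_hom sg by (rule Gal_hom[OF assms])
  define P where "P = (\<Prod>y\<in>gorb x. [:- y, 1:])"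
  interpret mp: map_poly_idom_hom \<iota> ..
  interpret mps: map_poly_idom_hom sg ..
  have Q: "map_poly \<iota> P = (\<Prod>y\<in>gorb x. [:- \<iota> y, 1:])"
    by (simp add: P_def mp.hom_prod hom_uminus)
  have "map_poly sg (map_poly \<iota> P) = map_poly \<iota> P"
  proof (rule poly_eqI)
    fix i
    have "coeff P i = to_ac (coeff (gpoly x) i)"
      unfolding P_def gpoly[symmetric] by (simp add: coeff_map_poly)
    then show "coeff (map_poly sg (map_poly \<iota> P)) i = coeff (map_poly \<iota> P) i"
      by (simp add: coeff_map_poly iota_rat_fixed[OF assms])
  qed
  moreover have "poly (map_poly \<iota> P) (\<iota> x) = 0"
    unfolding Q by (auto simp: poly_prod intro!: prod_zero)
  ultimately have "poly (map_poly \<iota> P) (sg (\<iota> x)) = 0"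
    by (metis s.poly_map_poly s.hom_zero)
  then show ?thesis unfolding Q by (auto simp: poly_prod)
qed

lemma iota_decomp:
  assumes "sg \<in> Gal"
  shows "\<iota> (decomp \<iota> sg x) = sg (\<iota> x)"
  unfolding decomp_def by (rule f_the_inv_into_f[OF field_hom_injective[OF \<iota>] iota_range_stable[OF assms]])

lemma decomp_Gal:
  assumes "sg \<in> Gal"
  shows "decomp \<iota> sg \<in> Gal"
proof (rule GalI, rule field_homI)
  interpret field_hom \<iota> by (rule \<iota>)
  interpret s: field_hom sg by (rule Gal_hom[OF assms])
  note inj = injD[OF field_hom_injective[OF \<iota>]]
  note d = iota_decomp[OF assms]
  show "decomp \<iota> sg (x + y) = decomp \<iota> sg x + decomp \<iota> sg y" for x y
    by (rule inj) (simp add: d hom_add s.hom_add)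
  show "decomp \<iota> sg (x * y) = decomp \<iota> sg x * decomp \<iota> sg y" for x y
    by (rule inj) (simp add: d hom_mult s.hom_mult)
  show "decomp \<iota> sg 1 = 1" by (rule inj) (simp add: d)
  show "decomp \<iota> sg (to_ac c) = to_ac c" for c by (rule inj) (simp add: d iota_rat_fixed[OF assms])
qed

lemma decomp_comp:
  assumes "sg \<in> Gal" "\<tau> \<in> Gal"
  shows "decomp \<iota> (sg \<circ> \<tau>) = decomp \<iota> sg \<circ> decomp \<iota> \<tau>"
proof
  fix x
  show "decomp \<iota> (sg \<circ> \<tau>) x = (decomp \<iota> sg \<circ> decomp \<iota> \<tau>) x"
    by (rule injD[OF field_hom_injective[OF \<iota>]]) (simp add: iota_decomp assms Gal_comp)
qed

end

section \<open>The Krull topology and restriction to the decomposition group\<close>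

lemma krull_open_nhd:
  assumes "openin krull_topology U" "sg \<in> U"
  obtains F where "finite F" "{\<tau> \<in> Gal. \<forall>x\<in>F. \<tau> x = sg x} \<subseteq> U"
proof -
  have "generate_topology_on {{\<tau> \<in> Gal. \<forall>x\<in>F. \<tau> x = sg x} | sg F. sg \<in> Gal \<and> finite F} U"
    using assms(1) unfolding krull_topology_def openin_topology_generated_by_iff .
  then have "sg \<in> U ==> \<exists>F. finite F \<and> {\<tau> \<in> Gal. \<forall>x\<in>F. \<tau> x = sg x} \<subseteq> U"
  proof (induction rule: generate_topology_on.induct)
    case Empty
    then show ?case by simp
  next
    case (Int A B)
    then obtain F G where "finite F" "{\<tau> \<in> Gal. \<forall>x\<in>F. \<tau> x = sg x} \<subseteq> A"
      "finite G" "{\<tau> \<in> Gal. \<forall>x\<in>G. \<tau> x = sg x} \<subseteq> B" by blast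
    then show ?case by (intro exI[of _ "F \<union> G"]) auto
  next
    case (UN K)
    then obtain A where "A \<in> K" "sg \<in> A" by blast
    with UN.IH[of A] show ?case by blast
  next
    case (Basis S)
    then obtain sg' F where S: "S = {\<tau> \<in> Gal. \<forall>x\<in>F. \<tau> x = sg' x}" "finite F" by blast
    then have "{\<tau> \<in> Gal. \<forall>x\<in>F. \<tau> x = sg x} \<subseteq> S" using Basis.prems by auto
    then show ?case using S(2) by blast
  qed
  then show ?thesis using assms(2) that by blast
qed

text \<open>Points of a discrete group are open, so the kernel of \<open>\<rho>\<close> contains the
  pointwise stabilizer of a finite set F; the image of F under \<open>\<iota>\<close> then serves
  for r.\<close>

lemma local_rep:
  fixes \<iota> :: "q_bar => 'p :: prime_card qp_bar" and \<rho> :: "(q_bar => q_bar) => 'a :: field ^ 2 ^ 2"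
  assumes \<iota>: "field_hom \<iota>" and hom: "\<rho> \<in> hom abs_galois GL2"
    and cont: "continuous_map krull_topology (discrete_topology (carrier GL2)) \<rho>"
  defines "r \<equiv> \<rho> \<circ> decomp \<iota>"
  shows "!!sg \<tau>. sg \<in> Gal ==> \<tau> \<in> Gal ==> r (sg \<circ> \<tau>) = r sg ** r \<tau>"
    and "\<exists>F. finite F \<and> (\<forall>sg\<in>Gal. (\<forall>x\<in>F. sg x = x) --> r sg = mat 1)"
proof -
  have mult: "\<rho> (sg \<circ> \<tau>) = \<rho> sg ** \<rho> \<tau>" if "sg \<in> Gal" "\<tau> \<in> Gal" for sg \<tau>
    using hom_mult[OF hom that] by (simp only: abs_galois_def GL2_def monoid.select_convs)
  have inv: "invertible (\<rho> sg)" if "sg \<in> Gal" for sg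
    using hom_in_carrier[OF hom that] by (simp add: GL2_def)
  show "r (sg \<circ> \<tau>) = r sg ** r \<tau>" if "sg \<in> Gal" "\<tau> \<in> Gal" for sg \<tau>
  proof -
    have "r (sg \<circ> \<tau>) = \<rho> (decomp \<iota> sg \<circ> decomp \<iota> \<tau>)" by (simp add: r_def decomp_comp[OF \<iota> that])
    also have "\<dots> = \<rho> (decomp \<iota> sg) ** \<rho> (decomp \<iota> \<tau>)" by (intro mult decomp_Gal[OF \<iota>] that)
    finally show ?thesis by (simp add: r_def)
  qed
  have one: "\<rho> id = mat 1"
  proof -
    have "\<rho> id ** \<rho> id = \<rho> id" using mult[of id id] by (simp add: Gal_id)
    moreover obtain B where "B ** \<rho> id = mat 1" using inv[OF Gal_id] by (auto simp: invertible_def)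
    ultimately show ?thesis by (metis matrix_mul_assoc matrix_mul_lid)
  qed
  have "invertible (mat 1 :: 'a ^ 2 ^ 2)" unfolding invertible_def by (rule exI[of _ "mat 1"]) simp
  then have "openin (discrete_topology (carrier GL2)) {mat 1 :: 'a ^ 2 ^ 2}" by (simp add: GL2_def)
  with cont have "openin krull_topology {sg \<in> topspace krull_topology. \<rho> sg \<in> {mat 1}}"
    by (rule openin_continuous_map_preimage)
  moreover have "id \<in> {sg \<in> topspace krull_topology. \<rho> sg \<in> {mat 1}}"
  proof -
    have "id \<in> {\<tau> \<in> Gal. \<forall>x\<in>{}. \<tau> x = (id :: q_bar => _) x}" by simp
    then have "id \<in> (topspace krull_topology :: (q_bar => _) set)"
      unfolding krull_topology_def topology_generated_by_topspace
      by (intro UnionI CollectI exI[of _ id] exI[of _ "{}"] conjI) (rule refl, auto)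
    then show ?thesis using one by simp
  qed
  ultimately obtain F where F: "finite F"
    "{\<tau> \<in> Gal. \<forall>x\<in>F. \<tau> x = id x} \<subseteq> {sg \<in> topspace krull_topology. \<rho> sg \<in> {mat 1}}"
    by (rule krull_open_nhd)
  have "r sg = mat 1" if sg: "sg \<in> Gal" "\<forall>x\<in>\<iota> ` F. sg x = x" for sg
  proof -
    have "decomp \<iota> sg x = x" if "x \<in> F" for x
      by (rule injD[OF field_hom_injective[OF \<iota>]]) (use sg that in \<open>simp add: iota_decomp[OF \<iota>]\<close>)
    then have "decomp \<iota> sg \<in> {\<tau> \<in> Gal. \<forall>x\<in>F. \<tau> x = id x}" using decomp_Gal[OF \<iota> sg(1)] by simp
    then show ?thesis using F(2) by (auto simp: r_def)
  qed
  then show "\<exists>F. finite F \<and> (\<forall>sg\<in>Gal. (\<forall>x\<in>F. sg x = x) --> r sg = mat 1)"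
    using F(1) by (intro exI[of _ "\<iota> ` F"]) auto
qed

no_notation fps_nth (infixl "$" 75)

section \<open>Two by two matrices\<close>

lemma mat2_entry [simp]:
  "mat2 a b c d $ 1 $ 1 = a" "mat2 a b c d $ 1 $ 2 = b" "mat2 a b c d $ 2 $ 1 = c" "mat2 a b c d $ 2 $ 2 = d"
  by (simp_all add: mat2_def)

lemma mat2_eqI:
  "A $ 1 $ 1 = B $ 1 $ 1 ==> A $ 1 $ 2 = B $ 1 $ 2 ==> A $ 2 $ 1 = B $ 2 $ 1 ==> A $ 2 $ 2 = B $ 2 $ 2 ==> A = (B :: 'a ^ 2 ^ 2)"
  by (simp add: vec_eq_iff forall_2)

lemma mat2_cases: "(A :: 'a :: zero ^ 2 ^ 2) = mat2 (A $ 1 $ 1) (A $ 1 $ 2) (A $ 2 $ 1) (A $ 2 $ 2)"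
  by (rule mat2_eqI) simp_all

lemma mat2_eq_iff [simp]: "mat2 a b c d = mat2 a' b' c' d' \<longleftrightarrow> a = a' \<and> b = b' \<and> c = c' \<and> d = d'"
  by (metis mat2_entry)

lemma mat2_mult [simp]:
  "mat2 a b c d ** mat2 a' b' c' d' =
     mat2 (a * a' + b * c') (a * b' + b * d') (c * a' + d * c') (c * b' + d * d' :: 'a :: semiring_1)"
  by (rule mat2_eqI) (simp_all add: matrix_matrix_mult_def sum_2)

lemma mat2_one: "(mat 1 :: 'a :: semiring_1 ^ 2 ^ 2) = mat2 1 0 0 1"
  by (rule mat2_eqI) (simp_all add: mat_def)

lemma det_mat2_eq: "det (mat2 a b c d) = a * d - b * (c :: 'a :: comm_ring_1)"
  by (simp add: det_2)

lemma trace_mat2: "trace (mat2 a b c (d :: 'a :: comm_ring_1)) = a + d"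
  by (simp add: trace_def sum_2)

lemma scale_mat2 [simp]: "scale_mat k (mat2 a b c d) = mat2 (k * a) (k * b) (k * c) (k * (d :: 'a :: mult_zero))"
  by (rule mat2_eqI) (simp_all add: scale_mat_def)

lemma scale_mat_mult: "scale_mat k A ** B = scale_mat k (A ** B)" "B ** scale_mat k A = scale_mat k (B ** (A :: 'a :: field ^ 2 ^ 2))"
  by (rule mat2_eqI; simp add: scale_mat_def matrix_matrix_mult_def sum_2 algebra_simps)+

lemma scale_mat_scale: "scale_mat k (scale_mat l A) = scale_mat (k * l) (A :: 'a :: field ^ 2 ^ 2)"
  by (simp add: scale_mat_def vec_eq_iff mult.assoc)

lemma scale_mat_1: "scale_mat 1 (A :: 'a :: field ^ 2 ^ 2) = A"
  by (simp add: scale_mat_def vec_eq_iff)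

lemma scale_mat_vec: "scale_mat k A *v v = k *s ((A :: 'a :: field ^ 2 ^ 2) *v v)"
  by (simp add: scale_mat_def vec_eq_iff matrix_vector_mult_def sum_2 algebra_simps)

lemma invertible_mat2: "invertible (mat2 a b c d) \<longleftrightarrow> a * d - b * c ~= (0 :: 'a :: field)"
  by (simp add: invertible_det_nz det_mat2_eq)

lemma
  assumes "invertible (A :: 'a :: field ^ 'n ^ 'n)"
  shows matrix_inv_right: "A ** matrix_inv A = mat 1" and matrix_inv_left: "matrix_inv A ** A = mat 1"
proof -
  have "A ** matrix_inv A = mat 1 \<and> matrix_inv A ** A = mat 1"
    using assms unfolding invertible_def matrix_inv_def by (rule someI_ex)
  then show "A ** matrix_inv A = mat 1" "matrix_inv A ** A = mat 1" by blast+
qed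

lemma inv_cancel:
  fixes P A B :: "'a :: field ^ 'n ^ 'n"
  assumes "invertible P" "P ** A = P ** B"
  shows "A = B"
proof -
  have "matrix_inv P ** (P ** A) = matrix_inv P ** (P ** B)" using assms(2) by simp
  then show ?thesis by (simp add: matrix_mul_assoc matrix_inv_left[OF assms(1)])
qed

text \<open>Conjugacy as an intertwining relation, the form in which matrices are composed and
  compared below.\<close>

lemma rep_equiv_iff:
  fixes r r' :: "'g => 'a :: field ^ 2 ^ 2"
  shows "rep_equiv_on S r r' \<longleftrightarrow> (\<exists>P. invertible P \<and> (\<forall>g\<in>S. r g ** P = P ** r' g))"
proof -
  have "A = P ** B ** matrix_inv P \<longleftrightarrow> A ** P = P ** B" if P: "invertible P" for A B P :: "'a ^ 2 ^ 2"
  proof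
    assume "A = P ** B ** matrix_inv P"
    then show "A ** P = P ** B" using matrix_inv_left[OF P] by (simp flip: matrix_mul_assoc)
  next
    assume "A ** P = P ** B"
    then have "A ** P ** matrix_inv P = P ** B ** matrix_inv P" by simp
    then show "A = P ** B ** matrix_inv P" using matrix_inv_right[OF P] by (simp flip: matrix_mul_assoc)
  qed
  then show ?thesis unfolding rep_equiv_on_def by blast
qed

lemma intertwine_two:
  fixes P P' :: "'a :: field ^ 2 ^ 2"
  assumes P: "invertible P" "invertible P'" and A: "!!g. g \<in> S ==> r g ** P = P ** A g" "!!g. g \<in> S ==> r g ** P' = P' ** B g"
  shows "\<exists>Q. invertible Q \<and> (\<forall>g\<in>S. A g ** Q = Q ** B g)"
proof (intro exI[of _ "matrix_inv P ** P'"] conjI ballI)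
  have iP: "invertible (matrix_inv P)" using P(1) by (metis invertible_def matrix_inv_left matrix_inv_right)
  then show "invertible (matrix_inv P ** P')" using P(2) by (rule invertible_mult)
  fix g assume g: "g \<in> S"
  have PP: "P ** (matrix_inv P ** P') = P'" by (simp add: matrix_mul_assoc matrix_inv_right[OF P(1)])
  have "P ** (A g ** (matrix_inv P ** P')) = P ** (matrix_inv P ** P' ** B g)"
  proof -
    have "P ** (A g ** (matrix_inv P ** P')) = r g ** (P ** (matrix_inv P ** P'))"
      by (simp only: matrix_mul_assoc A(1)[OF g])
    also have "\<dots> = P' ** B g" unfolding PP by (rule A(2)[OF g])
    also have "\<dots> = P ** (matrix_inv P ** P') ** B g" unfolding PP ..
    finally show ?thesis by (simp only: matrix_mul_assoc)
  qed
  then show "A g ** (matrix_inv P ** P') = matrix_inv P ** P' ** B g" by (rule inv_cancel[OF P(1)])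
qed

lemma sim_trace_det:
  fixes P A B :: "'a :: field ^ 2 ^ 2"
  assumes "invertible P" "A ** P = P ** B"
  shows "trace A = trace B" "det A = det B"
proof -
  have eq: "A = P ** B ** matrix_inv P"
    using assms(2) matrix_inv_right[OF assms(1)] by (metis matrix_mul_assoc matrix_mul_rid)
  have "trace A = trace (matrix_inv P ** (P ** B))" unfolding eq by (rule trace_mul_sym)
  then show "trace A = trace B" by (simp add: matrix_mul_assoc matrix_inv_left[OF assms(1)])
  have "det A * det P = det P * det B" using assms(2) by (metis det_mul)
  moreover have "det P ~= 0" using assms(1) by (simp add: invertible_det_nz)
  ultimately show "det A = det B" by simp
qed

lemma sim_upper:
  assumes "invertible P" "mat2 x u 0 y ** P = P ** mat2 x' u' 0 (y' :: 'a :: field)"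
  shows "x = x' \<and> y = y' \<or> x = y' \<and> y = x'"
proof -
  have s: "x + y = x' + y'" "x * y = x' * y'"
    using sim_trace_det[OF assms] by (simp_all add: trace_mat2 det_mat2_eq)
  have "(x - x') * (x - y') = x * x - x * (x' + y') + x' * y'" by (simp add: algebra_simps)
  also have "\<dots> = 0" by (simp add: algebra_simps flip: s)
  finally have "x = x' \<or> x = y'" by simp
  then show ?thesis using s(1) by auto
qed

text \<open>A nontrivial unipotent matrix has a single eigenline. The base change must respect it,
  so it is upper triangular and preserves the order of the diagonal entries.\<close>

lemma sim_upper_unip:
  assumes P: "invertible P" "mat2 x u 0 y ** P = P ** mat2 x' u' 0 (y' :: 'a :: field)"
    and "mat2 1 v 0 1 ** P = P ** mat2 1 v' 0 1" "v ~= 0"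
  shows "x = x' \<and> y = y'"
proof -
  obtain a b c d where abcd: "P = mat2 a b c d" by (metis mat2_cases)
  have c: "c = 0" using assms(3,4) by (simp add: abcd)
  then have "a ~= 0" "d ~= 0" using P(1) by (auto simp: abcd invertible_mat2)
  then show ?thesis using P(2) c by (simp add: abcd mult.commute)
qed

lemma vec2_eq_iff: "(v :: 'a ^ 2) = v' \<longleftrightarrow> v $ 1 = v' $ 1 \<and> v $ 2 = v' $ 2"
  by (simp add: vec_eq_iff forall_2)

lemma mat_vec2: "((A :: 'a :: semiring_1 ^ 2 ^ 2) *v v) $ i = A $ i $ 1 * v $ 1 + A $ i $ 2 * v $ 2"
  by (simp add: matrix_vector_mult_def sum_2)

lemma parallel_cases:
  fixes v w :: "'a :: field ^ 2"
  assumes "v ~= 0"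
  shows "(\<exists>x. w = x *s v) \<or> v $ 1 * w $ 2 - w $ 1 * v $ 2 ~= 0"
proof (cases "v $ 1 = 0")
  case True
  then have v2: "v $ 2 ~= 0" using assms by (simp add: vec2_eq_iff)
  then have "w = (w $ 2 / v $ 2) *s v \<or> w $ 1 ~= 0" using True by (auto simp: vec2_eq_iff)
  then show ?thesis using True v2 by auto
next
  case False
  then have "w $ 1 = (w $ 1 / v $ 1) * v $ 1" by simp
  moreover have "w $ 2 = (w $ 1 / v $ 1) * v $ 2" if "v $ 1 * w $ 2 - w $ 1 * v $ 2 = 0"
    using that False by (simp add: field_simps)
  ultimately show ?thesis by (auto simp: vec2_eq_iff intro!: exI[of _ "w $ 1 / v $ 1"])
qed

text \<open>P depends on v alone, so a whole family of matrices with the common eigenvector v is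
  triangularized at once.\<close>

lemma line_triangular:
  fixes v :: "'a :: field ^ 2"
  assumes "v ~= 0"
  shows "\<exists>P. invertible P \<and> (\<forall>A x. A *v v = x *s v --> (\<exists>u y. A ** P = P ** mat2 x u 0 y))"
proof (cases "v $ 1 = 0")
  case True
  then have v2: "v $ 2 ~= 0" using assms by (simp add: vec2_eq_iff)
  show ?thesis
  proof (intro exI[of _ "mat2 0 1 (v $ 2) 0"] conjI allI impI)
    show "invertible (mat2 0 1 (v $ 2) 0)" using v2 by (simp add: invertible_mat2)
    fix A x assume A: "A *v v = x *s v"
    obtain a b c d where abcd: "A = mat2 a b c d" by (metis mat2_cases)
    have "b = 0" "d = x" using A v2 True by (simp_all add: vec2_eq_iff mat_vec2 abcd)
    then show "\<exists>u y. A ** mat2 0 1 (v $ 2) 0 = mat2 0 1 (v $ 2) 0 ** mat2 x u 0 y"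
      using v2 by (intro exI[of _ "c / v $ 2"] exI[of _ a]) (simp add: abcd mult.commute)
  qed
next
  case False
  show ?thesis
  proof (intro exI[of _ "mat2 (v $ 1) 0 (v $ 2) 1"] conjI allI impI)
    show "invertible (mat2 (v $ 1) 0 (v $ 2) 1)" using False by (simp add: invertible_mat2)
    fix A x assume A: "A *v v = x *s v"
    obtain a b c d where abcd: "A = mat2 a b c d" by (metis mat2_cases)
    have "a * v $ 1 + b * v $ 2 = x * v $ 1" "c * v $ 1 + d * v $ 2 = x * v $ 2"
      using A by (simp_all add: vec2_eq_iff mat_vec2 abcd)
    then show "\<exists>u y. A ** mat2 (v $ 1) 0 (v $ 2) 1 = mat2 (v $ 1) 0 (v $ 2) 1 ** mat2 x u 0 y"
      using False by (intro exI[of _ "b / v $ 1"] exI[of _ "d - b / v $ 1 * v $ 2"]) (simp add: abcd mult.commute)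
  qed
qed

lemma ex_eigenvector:
  fixes A :: "'a :: alg_closed_field ^ 2 ^ 2"
  shows "\<exists>x v. v ~= 0 \<and> A *v v = x *s v"
proof -
  obtain a b c d where A: "A = mat2 a b c d" by (metis mat2_cases)
  have "\<exists>x. poly [:a * d - b * c, - (a + d), 1:] x = 0" by (rule alg_closed_imp_poly_has_root) simp
  then obtain x where "poly [:a * d - b * c, - (a + d), 1:] x = 0" by blast
  then have x: "x * x = a * x + d * x - a * d + b * c" by (simp add: algebra_simps)
  show ?thesis
  proof (cases "b = 0 \<and> x = a")
    case True
    then show ?thesis
      by (intro exI[of _ d] exI[of _ "vector [0, 1]"]) (simp add: vec2_eq_iff mat_vec2 A)
  next
    case False
    then show ?thesis
      by (intro exI[of _ x] exI[of _ "vector [b, x - a]"]) (auto simp: vec2_eq_iff mat_vec2 A algebra_simps x)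
  qed
qed

lemma triangularizable:
  fixes A :: "'a :: alg_closed_field ^ 2 ^ 2"
  shows "\<exists>P x u y. invertible P \<and> A ** P = P ** mat2 x u 0 y"
  using ex_eigenvector[of A] line_triangular by metis

lemma invariant_line:
  fixes v w :: "'a :: field ^ 2"
  assumes U: "vec.subspace U" "U ~= UNIV" and v: "v \<in> U" "v ~= 0" and w: "w \<in> U"
  shows "\<exists>x. w = x *s v"
proof (rule ccontr)
  assume "\<not> ?thesis"
  then have D: "v $ 1 * w $ 2 - w $ 1 * v $ 2 ~= 0" (is "?D ~= 0") using parallel_cases[OF v(2), of w] by blast
  have "z \<in> U" for z
  proof -
    have "z = ((z $ 1 * w $ 2 - z $ 2 * w $ 1) / ?D) *s v + ((v $ 1 * z $ 2 - v $ 2 * z $ 1) / ?D) *s w" (is "z = ?z")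
    proof -
      have "?D * (?z $ 1) = ?D * z $ 1" "?D * (?z $ 2) = ?D * z $ 2"
        using D by (simp_all add: distrib_left) (simp_all add: algebra_simps)
      then show ?thesis using D by (simp only: vec2_eq_iff mult_left_cancel simp_thms)
    qed
    moreover have "?z \<in> U" by (intro vec.subspace_add vec.subspace_scale U v w)
    ultimately show ?thesis by simp
  qed
  then show False using U(2) by blast
qed

lemma line_not_irreducible:
  assumes v: "v ~= (0 :: 'a :: field ^ 2)" and S: "!!sg. sg \<in> S ==> \<exists>x. r sg *v v = x *s v"
  shows "\<not> irreducible_rep S r"
proof
  assume irr: "irreducible_rep S r"
  define U where "U = range (%x. x *s v)"
  have "vec.subspace U"
    unfolding vec.subspace_def
  proof (intro conjI ballI allI)
    show "0 \<in> U" unfolding U_def by (rule range_eqI[of _ _ 0]) simp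
    show "x + y \<in> U" if "x \<in> U" "y \<in> U" for x y
    proof -
      obtain a b where "x = a *s v" "y = b *s v" using \<open>x \<in> U\<close> \<open>y \<in> U\<close> by (auto simp: U_def)
      then have "x + y = (a + b) *s v" by simp
      then show ?thesis unfolding U_def by blast
    qed
    show "c *s x \<in> U" if "x \<in> U" for c x using that by (auto simp: U_def)
  qed
  moreover have "\<forall>sg\<in>S. \<forall>u\<in>U. r sg *v u \<in> U"
  proof (intro ballI)
    fix sg u assume sg: "sg \<in> S" and "u \<in> U"
    then obtain x where x: "u = x *s v" by (auto simp: U_def)
    obtain y where "r sg *v v = y *s v" using S[OF sg] by blast
    then have "r sg *v u = (x * y) *s v" by (simp add: x vec.scale)
    then show "r sg *v u \<in> U" unfolding U_def by blast
  qed
  ultimately have "U = {0} \<or> U = UNIV" using irr unfolding irreducible_rep_def by blast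
  moreover have "v \<in> U" unfolding U_def by (rule range_eqI[of _ _ 1]) simp
  ultimately have UU: "U = UNIV" using v by blast
  have "vector [1, 0] \<in> U" "vector [0, 1] \<in> U" unfolding UU by blast+
  then obtain x y where "vector [1, 0] = x *s v" "vector [0, 1] = y *s v" unfolding U_def by blast
  then have "x * v $ 1 = 1" "x * v $ 2 = 0" "y * v $ 1 = 0" "y * v $ 2 = 1" by (auto simp: vec2_eq_iff)
  then show False by (metis mult_eq_0_iff zero_neq_one)
qed

section \<open>Local representations\<close>

context tame_rep
begin

section \<open>Characters and reducible representations\<close>

lemma p_gt_1: "CARD('p) > 1" using prime_gt_1_nat[OF prime_card[where ?'a = 'p]] .

lemma gG: "g \<in> Gal" using gI inertia_sub by blast

lemma gtG: "g ^^ t \<in> Gal" using gG by (rule Gal_pow)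

lemma r_inv: "sg \<in> Gal ==> r sg ** r (inv_into UNIV sg) = mat 1"
proof -
  assume sg: "sg \<in> Gal"
  have "sg \<circ> inv_into UNIV sg = id" using sg by (simp add: fun_eq_iff Gal_inv_right)
  then show ?thesis using r_comp[OF sg Gal_inv[OF sg]] r_id by simp
qed

lemma r_vec_inj:
  assumes sg: "sg \<in> Gal" and "r sg *v x = r sg *v y"
  shows "x = y"
proof -
  have "r (inv_into UNIV sg) ** r sg = mat 1" using r_inv[OF sg] by (simp add: matrix_left_right_inverse)
  then show ?thesis using assms(2) by (metis matrix_vector_mul_assoc matrix_vector_mul_lid)
qed

lemma r_inv_vec: "sg \<in> Gal ==> r sg *v (r (inv_into UNIV sg) *v x) = x"
  using r_inv by (metis matrix_vector_mul_assoc matrix_vector_mul_lid)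

text \<open>Characters that factor through the image of r, so that \<open>J_p\<close> applies to
  them.\<close>

definition rchar :: "(('p qp_bar => 'p qp_bar) => 'p fp_bar) => bool" where
  "rchar ch \<longleftrightarrow> ch id = 1 \<and> (\<forall>sg\<in>Gal. \<forall>\<tau>\<in>Gal. ch (sg \<circ> \<tau>) = ch sg * ch \<tau>) \<and> (\<forall>sg\<in>Gal. r sg = mat 1 --> ch sg = 1)"

lemma triangular_comp:
  assumes P: "invertible P" and M: "!!sg. sg \<in> Gal ==> r sg ** P = P ** mat2 (c1 sg) (u sg) 0 (c2 sg)"
    and "sg \<in> Gal" "\<tau> \<in> Gal"
  shows "c1 (sg \<circ> \<tau>) = c1 sg * c1 \<tau>" "c2 (sg \<circ> \<tau>) = c2 sg * c2 \<tau>" "u (sg \<circ> \<tau>) = c1 sg * u \<tau> + u sg * c2 \<tau>"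
proof -
  have "P ** mat2 (c1 (sg \<circ> \<tau>)) (u (sg \<circ> \<tau>)) 0 (c2 (sg \<circ> \<tau>)) = r sg ** (r \<tau> ** P)"
    using M[OF Gal_comp[OF assms(3,4)]] r_comp[OF assms(3,4)] by (simp flip: matrix_mul_assoc)
  also have "\<dots> = r sg ** P ** mat2 (c1 \<tau>) (u \<tau>) 0 (c2 \<tau>)" by (simp add: M[OF assms(4)] matrix_mul_assoc)
  also have "\<dots> = P ** (mat2 (c1 sg) (u sg) 0 (c2 sg) ** mat2 (c1 \<tau>) (u \<tau>) 0 (c2 \<tau>))"
    by (simp add: M[OF assms(3)] flip: matrix_mul_assoc)
  finally have "mat2 (c1 (sg \<circ> \<tau>)) (u (sg \<circ> \<tau>)) 0 (c2 (sg \<circ> \<tau>)) = mat2 (c1 sg) (u sg) 0 (c2 sg) ** mat2 (c1 \<tau>) (u \<tau>) 0 (c2 \<tau>)"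
    by (rule inv_cancel[OF P])
  then show "c1 (sg \<circ> \<tau>) = c1 sg * c1 \<tau>" "c2 (sg \<circ> \<tau>) = c2 sg * c2 \<tau>" "u (sg \<circ> \<tau>) = c1 sg * u \<tau> + u sg * c2 \<tau>"
    by simp_all
qed

lemma triangular_one:
  fixes P A :: "'p fp_bar ^ 2 ^ 2"
  assumes "invertible P" "A ** P = P ** mat2 x u 0 y" "A = mat 1"
  shows "x = 1" "u = 0" "y = (1 :: 'p fp_bar)"
proof -
  have "P ** mat2 1 0 0 1 = P ** mat2 x u 0 y" using assms(2,3) by (simp flip: mat2_one)
  then have "mat2 1 0 0 1 = mat2 x u 0 y" by (rule inv_cancel[OF assms(1)])
  then show "x = 1" "u = 0" "y = 1" by simp_all
qed

lemma triangular_rchar: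
  assumes P: "invertible P" and M: "!!sg. sg \<in> Gal ==> r sg ** P = P ** mat2 (c1 sg) (u sg) 0 (c2 sg)"
  shows "rchar c1" "rchar c2"
  using triangular_comp[OF assms] triangular_one[OF P M] r_id by (auto simp: rchar_def)

lemma rchar_pow:
  assumes "rchar ch" "sg \<in> Gal"
  shows "ch (sg ^^ n) = ch sg ^ n"
proof (induction n)
  case 0
  then show ?case using assms(1) unfolding rchar_def by (simp add: id_def)
next
  case (Suc n)
  have "ch (sg \<circ> sg ^^ n) = ch sg * ch (sg ^^ n)" using assms Gal_pow[OF assms(2)] unfolding rchar_def by blast
  then show ?case by (simp only: funpow.simps(2) Suc power_Suc)
qed

text \<open>J acts through elements of p-power order, and in characteristic p the only root of unity
  of p-power order is 1.\<close>

lemma rchar_J: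
  assumes ch: "rchar ch" and j: "j \<in> J"
  shows "ch j = 1"
proof -
  have jG: "j \<in> Gal" using j J_Gal by blast
  obtain a where "r (j ^^ (CARD('p) ^ a)) = mat 1" using J_p[OF j] by blast
  then have "ch (j ^^ (CARD('p) ^ a)) = 1" using ch Gal_pow[OF jG] unfolding rchar_def by blast
  then have "ch j ^ (CARD('p) ^ a) = 1 ^ (CARD('p) ^ a)" by (simp add: rchar_pow[OF ch jG])
  then show ?thesis by (rule fpb_power_p_power_inj)
qed

lemma prim_cyclo_g: "prim (cyclo g) (CARD('p) - 1)"
proof -
  have e: "(CARD('p))\<^sup>2 - 1 = (CARD('p) - 1) * (CARD('p) + 1)" by (simp add: power2_eq_square algebra_simps)
  have "(CARD('p) - 1) * (CARD('p) + 1) > 0" using p_gt_1 by simp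
  then have "prim (d ^ (((CARD('p))\<^sup>2 - 1) div (CARD('p) - 1))) (CARD('p) - 1)"
    unfolding e using d[unfolded e] by (intro prim_power_dvd) (simp_all only: dvd_triv_left)
  moreover have "((CARD('p))\<^sup>2 - 1) div (CARD('p) - 1) = CARD('p) + 1"
    unfolding e using p_gt_1 by (intro nonzero_mult_div_cancel_left) simp
  ultimately show ?thesis by (simp only: cyclo_g)
qed

lemma rchar_neq_0: "rchar ch ==> sg \<in> Gal ==> ch sg ~= 0"
proof -
  assume *: "rchar ch" "sg \<in> Gal"
  have "sg \<circ> inv_into UNIV sg = id" using *(2) by (simp add: fun_eq_iff Gal_inv_right)
  then have "ch sg * ch (inv_into UNIV sg) = 1" using * Gal_inv[OF *(2)] unfolding rchar_def by metis
  then show ?thesis by auto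
qed

text \<open>The relation between \<phi> and g gives ch(g)^p = ch(g), so ch(g) is a (p - 1)-st root
  of unity and hence a power of the cyclotomic value at g; J contributes nothing.\<close>

lemma rchar_inertia:
  assumes ch: "rchar ch"
  shows "\<exists>m<CARD('p) - 1. \<forall>sg\<in>inertia. ch sg = cyclo sg ^ m"
proof -
  have mult: "ch (sg \<circ> \<tau>) = ch sg * ch \<tau>" if "sg \<in> Gal" "\<tau> \<in> Gal" for sg \<tau> using ch that unfolding rchar_def by blast
  obtain j where j: "j \<in> J" "\<phi> \<circ> g = g ^^ CARD('p) \<circ> \<phi> \<circ> j" using comm by blast
  have jG: "j \<in> Gal" using j J_Gal by blast
  have "ch \<phi> * ch g = ch (g ^^ CARD('p) \<circ> \<phi> \<circ> j)" using mult[OF \<phi>G gG] j(2) by simp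
  also have "\<dots> = ch g ^ CARD('p) * ch \<phi>"
    by (simp add: mult Gal_comp gtG \<phi>G jG rchar_pow[OF ch gG] rchar_J[OF ch j(1)])
  finally have "ch \<phi> * ch g ^ CARD('p) = ch \<phi> * ch g" by (simp only: mult.commute)
  then have "ch g ^ CARD('p) = ch g" using rchar_neq_0[OF ch \<phi>G] by simp
  moreover have "CARD('p) = Suc (CARD('p) - 1)" using p_gt_1 by simp
  ultimately have "ch g * ch g ^ (CARD('p) - 1) = ch g * 1" by (metis mult.right_neutral power_Suc)
  then have "ch g ^ (CARD('p) - 1) = 1" using rchar_neq_0[OF ch gG] by simp
  then have "ch g \<in> mu (CARD('p) - 1)" by (simp add: mu_def)
  moreover have "of_nat (CARD('p) - 1) ~= (0 :: 'p fp_bar)"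
    using p_gt_1 by (auto simp: of_nat_fpb_eq_0_iff dest: dvd_imp_le)
  ultimately obtain m where m: "ch g = cyclo g ^ m" "m < CARD('p) - 1"
    using prim_mu_cases[OF prim_cyclo_g] by blast
  have "ch sg = cyclo sg ^ m" if sg: "sg \<in> inertia" for sg
  proof -
    obtain t j where t: "j \<in> J" "sg = g ^^ t \<circ> j" "cyclo sg = d ^ ((CARD('p) + 1) * t)" using decI[OF sg] by blast
    have "ch sg = ch g ^ t * 1"
      using t(1) J_Gal by (simp add: t(2) mult gtG subsetD rchar_pow[OF ch gG] rchar_J[OF ch])
    also have "\<dots> = d ^ ((CARD('p) + 1) * m * t)" by (simp only: mult_1_right m(1) cyclo_g power_mult)
    also have "(CARD('p) + 1) * m * t = (CARD('p) + 1) * t * m" by (simp only: mult_ac)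
    also have "d ^ \<dots> = cyclo sg ^ m" by (simp only: t(3) power_mult)
    finally show ?thesis .
  qed
  then show ?thesis using m(2) by blast
qed

lemma reducible_triangular:
  assumes "\<not> irreducible_rep Gal r"
  shows "\<exists>P c1 u c2. invertible P \<and> (\<forall>sg\<in>Gal. r sg ** P = P ** mat2 (c1 sg) (u sg) 0 (c2 sg))"
proof -
  obtain U where U: "vec.subspace U" "\<forall>sg\<in>Gal. \<forall>v\<in>U. r sg *v v \<in> U" "U ~= {0}" "U ~= UNIV"
    using assms unfolding irreducible_rep_def by blast
  have "0 \<in> U" using U(1) by (rule vec.subspace_0)
  then obtain v where v: "v \<in> U" "v ~= 0" using U(3) by blast
  obtain P where P: "invertible P" "!!A x. A *v v = x *s v ==> \<exists>u y. A ** P = P ** mat2 x u 0 y"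
    using line_triangular[OF v(2)] by blast
  have "\<exists>x u y. r sg ** P = P ** mat2 x u 0 y" if "sg \<in> Gal" for sg
  proof -
    have "r sg *v v \<in> U" using U(2) that v(1) by blast
    then obtain x where "r sg *v v = x *s v" using invariant_line[OF U(1,4) v] by blast
    then show ?thesis using P(2) by blast
  qed
  then have "\<forall>sg. \<exists>x u y. sg \<in> Gal --> r sg ** P = P ** mat2 x u 0 y" by blast
  then obtain c1 u c2 where "!!sg. sg \<in> Gal ==> r sg ** P = P ** mat2 (c1 sg) (u sg) 0 (c2 sg)"
    by (auto simp only: choice_iff)
  then show ?thesis using P(1) by blast
qed

lemma wild_trivial_inertia:
  assumes "\<forall>\<nu>\<in>wild_inertia. r \<nu> = mat 1" "sg \<in> inertia"
  shows "\<exists>t. r sg = r (g ^^ t) \<and> cyclo sg = d ^ ((CARD('p) + 1) * t) \<and> \<omega>2 sg = d ^ t"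
proof -
  obtain t j where t: "j \<in> J \<inter> inertia" "sg = g ^^ t \<circ> j" "cyclo sg = d ^ ((CARD('p) + 1) * t)" "\<omega>2 sg = d ^ t"
    using decI[OF assms(2)] by blast
  have "r j = mat 1" using wildJ[OF t(1)] assms(1) by auto
  moreover have "j \<in> Gal" using t(1) J_Gal by blast
  ultimately have "r sg = r (g ^^ t)" using r_comp[OF gtG, of j t] by (simp add: t(2))
  then show ?thesis using t by blast
qed

lemma diagonal_pow:
  assumes "r sg ** P = P ** mat2 x 0 0 y" "sg \<in> Gal"
  shows "r (sg ^^ n) ** P = P ** mat2 (x ^ n) 0 0 (y ^ n)"
proof (induction n)
  case 0
  then show ?case using r_id by (simp add: id_def flip: mat2_one)
next
  case (Suc n)
  have "r (sg ^^ Suc n) ** P = r sg ** (r (sg ^^ n) ** P)"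
    by (simp only: funpow.simps(2) r_comp[OF assms(2) Gal_pow[OF assms(2)]] matrix_mul_assoc)
  also have "\<dots> = P ** mat2 x 0 0 y ** mat2 (x ^ n) 0 0 (y ^ n)" by (simp add: Suc matrix_mul_assoc assms(1))
  also have "\<dots> = P ** mat2 (x ^ Suc n) 0 0 (y ^ Suc n)" by (simp flip: matrix_mul_assoc)
  finally show ?case .
qed

text \<open>Distinct eigenvalues can be separated by a unipotent base change. For equal ones the
  off-diagonal entry of g^n grows like n; at n = N it vanishes because wild inertia acts trivially,
  and N is prime to p.\<close>

lemma g_diagonal:
  assumes w1: "\<forall>\<nu>\<in>wild_inertia. r \<nu> = mat 1"
    and P: "invertible P" and M: "r g ** P = P ** mat2 x u 0 y" and x: "x ~= 0"
  shows "\<exists>k. r g ** (P ** mat2 1 k 0 1) = P ** mat2 1 k 0 1 ** mat2 x 0 0 y"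
proof (cases "x = y")
  case False
  define k where "k = u / (y - x)"
  have "k * (y - x) = u" using False by (simp add: k_def)
  then have "u = k * y - k * x" by (simp add: right_diff_distrib)
  then have "x * k + u = k * y" by (simp add: mult.commute)
  then have "mat2 x u 0 y ** mat2 1 k 0 1 = mat2 1 k 0 1 ** mat2 x 0 0 y" by simp
  then show ?thesis using M by (intro exI[of _ k]) (metis matrix_mul_assoc)
next
  case True
  define v where "v = u / x"
  have u: "u = v * x" using x by (simp add: v_def)
  have pow: "r (g ^^ n) ** P = P ** mat2 (x ^ n) (of_nat n * x ^ n * v) 0 (x ^ n)" for n
  proof (induction n)
    case 0
    then show ?case using r_id by (simp add: id_def flip: mat2_one)
  next
    case (Suc n)
    have "r (g ^^ Suc n) ** P = r g ** (r (g ^^ n) ** P)"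
      by (simp only: funpow.simps(2) r_comp[OF gG gtG] matrix_mul_assoc)
    also have "\<dots> = P ** mat2 x u 0 x ** mat2 (x ^ n) (of_nat n * x ^ n * v) 0 (x ^ n)"
      by (simp add: Suc matrix_mul_assoc M True)
    also have "\<dots> = P ** mat2 (x ^ Suc n) (of_nat (Suc n) * x ^ Suc n * v) 0 (x ^ Suc n)"
      by (simp add: u algebra_simps flip: matrix_mul_assoc)
    finally show ?case .
  qed
  obtain \<nu> where "\<nu> \<in> wild_inertia" "r \<nu> = r (g ^^ N)" using wildJ[OF gN] by blast
  then have "r (g ^^ N) = mat 1" using w1 by auto
  then have "of_nat N * x ^ N * v = 0" by (rule triangular_one(2)[OF P pow])
  then have "v = 0" using x N by (simp add: of_nat_fpb_eq_0_iff)
  then have "u = 0" by (simp add: u)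
  then show ?thesis using M by (intro exI[of _ 0]) (simp flip: mat2_one)
qed

text \<open>On inertia r is given by powers of the diagonalized g. For splitting, every \<tau>
  satisfies \<tau> g = sg \<tau> with sg in inertia and c1 sg = c1 g; comparing upper right entries
  gives u'(\<tau>) (c2 g - c1 g) = 0.\<close>

lemma tame_split:
  assumes w1: "\<forall>\<nu>\<in>wild_inertia. r \<nu> = mat 1"
    and P: "invertible P" and M: "!!sg. sg \<in> Gal ==> r sg ** P = P ** mat2 (c1 sg) (u sg) 0 (c2 sg)"
  shows "\<exists>Q. invertible Q \<and> (\<forall>sg\<in>inertia. r sg ** Q = Q ** mat2 (c1 sg) 0 0 (c2 sg))"
    and "c1 g ~= c2 g ==> split_rep r"
proof -
  have ch: "rchar c1" "rchar c2" by (rule triangular_rchar[OF P M], assumption)+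
  obtain k where k: "r g ** (P ** mat2 1 k 0 1) = P ** mat2 1 k 0 1 ** mat2 (c1 g) 0 0 (c2 g)"
    using g_diagonal[OF w1 P M[OF gG] rchar_neq_0[OF ch(1) gG]] by blast
  define Q where "Q = P ** mat2 1 k 0 1"
  have Q: "invertible Q" unfolding Q_def by (intro invertible_mult P) (simp add: invertible_mat2)
  define u' where "u' sg = c1 sg * k + u sg - k * c2 sg" for sg
  have M': "r sg ** Q = Q ** mat2 (c1 sg) (u' sg) 0 (c2 sg)" if "sg \<in> Gal" for sg
  proof -
    have "r sg ** Q = P ** (mat2 (c1 sg) (u sg) 0 (c2 sg) ** mat2 1 k 0 1)"
      unfolding Q_def by (simp add: M[OF that] matrix_mul_assoc flip: matrix_mul_assoc[of P])
    also have "\<dots> = P ** (mat2 1 k 0 1 ** mat2 (c1 sg) (u' sg) 0 (c2 sg))" by (simp add: u'_def)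
    finally show ?thesis unfolding Q_def by (simp only: matrix_mul_assoc)
  qed
  have u'I: "u' sg = 0" if sg: "sg \<in> inertia" for sg
  proof -
    obtain t where "r sg = r (g ^^ t)" using wild_trivial_inertia[OF w1 sg] by blast
    then have "r sg ** Q = Q ** mat2 (c1 g ^ t) 0 0 (c2 g ^ t)"
      using diagonal_pow[OF k[folded Q_def] gG] by simp
    moreover have "sg \<in> Gal" using sg inertia_sub by blast
    ultimately have "Q ** mat2 (c1 sg) (u' sg) 0 (c2 sg) = Q ** mat2 (c1 g ^ t) 0 0 (c2 g ^ t)" using M' by simp
    then have "mat2 (c1 sg) (u' sg) 0 (c2 sg) = mat2 (c1 g ^ t) 0 0 (c2 g ^ t)" by (rule inv_cancel[OF Q])
    then show ?thesis by simp
  qed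
  show "\<exists>Q. invertible Q \<and> (\<forall>sg\<in>inertia. r sg ** Q = Q ** mat2 (c1 sg) 0 0 (c2 sg))"
    using Q M' u'I inertia_sub by (metis subsetD)
  assume ne: "c1 g ~= c2 g"
  have "u' \<tau> = 0" if \<tau>: "\<tau> \<in> Gal" for \<tau>
  proof -
    obtain sg where sg: "sg \<in> inertia" "\<tau> \<circ> g = sg \<circ> \<tau>" using inertia_conj[OF \<tau>] by blast
    have sgG: "sg \<in> Gal" using sg(1) inertia_sub by blast
    have t1: "c1 (\<tau> \<circ> g) = c1 \<tau> * c1 g" "u' (\<tau> \<circ> g) = c1 \<tau> * u' g + u' \<tau> * c2 g"
      by (rule triangular_comp[OF Q M' \<tau> gG], assumption)+
    have t2: "c1 (sg \<circ> \<tau>) = c1 sg * c1 \<tau>" "u' (sg \<circ> \<tau>) = c1 sg * u' \<tau> + u' sg * c2 \<tau>"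
      by (rule triangular_comp[OF Q M' sgG \<tau>], assumption)+
    have "c1 \<tau> * c1 g = c1 sg * c1 \<tau>" using t1(1)[unfolded sg(2) t2(1)] by (rule sym)
    then have "c1 \<tau> * c1 g = c1 \<tau> * c1 sg" by (simp only: mult.commute)
    then have "c1 sg = c1 g" using rchar_neq_0[OF ch(1) \<tau>] by (metis mult_left_cancel)
    moreover have "u' \<tau> * c2 g = c1 sg * u' \<tau>" using t1(2)[unfolded sg(2) t2(2)] u'I[OF gI] u'I[OF sg(1)] by auto
    ultimately have "u' \<tau> * (c2 g - c1 g) = 0" by (simp add: right_diff_distrib mult.commute)
    then show ?thesis using ne by simp
  qed
  then have "\<forall>sg\<in>Gal. r sg ** Q = Q ** mat2 (c1 sg) 0 0 (c2 sg)" using M' by simp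
  then show "split_rep r" unfolding split_rep_def rep_equiv_iff using Q by blast
qed

text \<open>Wild inertia lies in J, on which both diagonal characters are trivial.\<close>

lemma split_wild_trivial:
  assumes "split_rep r" "\<nu> \<in> wild_inertia"
  shows "r \<nu> = mat 1"
proof -
  obtain P c1 c2 where P: "invertible P" "!!sg. sg \<in> Gal ==> r sg ** P = P ** mat2 (c1 sg) 0 0 (c2 sg)"
    using assms(1) unfolding split_rep_def rep_equiv_iff by blast
  have \<nu>: "\<nu> \<in> J" "\<nu> \<in> Gal" using wild[OF assms(2)] J_Gal by blast+
  have "c1 \<nu> = 1" "c2 \<nu> = 1" using triangular_rchar[OF P] rchar_J[OF _ \<nu>(1)] by blast+
  then have "r \<nu> ** P = mat 1 ** P" using P(2)[OF \<nu>(2)] by (simp flip: mat2_one)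
  then show ?thesis using matrix_inv_right[OF P(1)] by (metis matrix_mul_assoc matrix_mul_rid)
qed

end

section \<open>Fixed vectors of J and irreducible representations\<close>

lemma mat_vec_cancel:
  fixes P :: "'a :: field ^ 'n ^ 'n"
  assumes "invertible P" "P *v x = P *v y"
  shows "x = y"
proof -
  have "matrix_inv P *v (P *v x) = matrix_inv P *v (P *v y)" using assms(2) by simp
  then show ?thesis by (simp add: matrix_vector_mul_assoc matrix_inv_left[OF assms(1)])
qed

context tame_rep
begin

lemma J_unipotent:
  assumes j: "j \<in> J" and P: "invertible P" and M: "r j ** P = P ** mat2 x u 0 y"
  shows "x = 1" "y = 1"
proof -
  have jG: "j \<in> Gal" using j J_Gal by blast
  have pow: "\<exists>v. r (j ^^ n) ** P = P ** mat2 (x ^ n) v 0 (y ^ n)" for n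
  proof (induction n)
    case 0
    then show ?case using r_id by (intro exI[of _ 0]) (simp add: id_def flip: mat2_one)
  next
    case (Suc n)
    then obtain v where v: "r (j ^^ n) ** P = P ** mat2 (x ^ n) v 0 (y ^ n)" by blast
    have "r (j ^^ Suc n) ** P = r j ** (r (j ^^ n) ** P)"
      by (simp only: funpow.simps(2) r_comp[OF jG Gal_pow[OF jG]] matrix_mul_assoc)
    also have "\<dots> = P ** mat2 x u 0 y ** mat2 (x ^ n) v 0 (y ^ n)" by (simp only: v matrix_mul_assoc M)
    also have "\<dots> = P ** mat2 (x ^ Suc n) (x * v + u * y ^ n) 0 (y ^ Suc n)" by (simp flip: matrix_mul_assoc)
    finally show ?case by blast
  qed
  obtain a where a: "r (j ^^ (CARD('p) ^ a)) = mat 1" using J_p[OF j] by blast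
  obtain v where v: "r (j ^^ (CARD('p) ^ a)) ** P = P ** mat2 (x ^ (CARD('p) ^ a)) v 0 (y ^ (CARD('p) ^ a))"
    using pow by blast
  have "x ^ (CARD('p) ^ a) = 1 ^ (CARD('p) ^ a)" "y ^ (CARD('p) ^ a) = 1 ^ (CARD('p) ^ a)"
    using triangular_one[OF P v a] by simp_all
  then show "x = 1" "y = 1" by (blast dest: fpb_power_p_power_inj)+
qed

lemma J_trace:
  assumes "j \<in> J"
  shows "trace (r j) = 2"
proof -
  obtain P x u y where P: "invertible P" "r j ** P = P ** mat2 x u 0 y" using triangularizable by blast
  show ?thesis using sim_trace_det(1)[OF P] J_unipotent[OF assms P] by (simp add: trace_mat2)
qed

text \<open>Every element of J has trace 2. If i in J is a nontrivial unipotent with upper right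
  entry u, and j in J has lower left entry c in the same basis, then the traces of i j and j differ
  by u c, so c = 0. Hence the vector fixed by i is an eigenvector of all of J, with eigenvalue
  1.\<close>

lemma J_fixed_vector: "\<exists>v. v ~= 0 \<and> (\<forall>j\<in>J. r j *v v = v)"
proof (cases "\<forall>j\<in>J. r j = mat 1")
  case True
  have "(vector [1, 0] :: 'p fp_bar ^ 2) ~= 0" by (simp add: vec2_eq_iff)
  then show ?thesis using True by (metis matrix_vector_mul_lid)
next
  case False
  then obtain i where i: "i \<in> J" "r i ~= mat 1" by blast
  obtain P x u y where P: "invertible P" "r i ** P = P ** mat2 x u 0 y" using triangularizable by blast
  note xy = J_unipotent[OF i(1) P]
  have u: "u ~= 0"
  proof
    assume "u = 0"
    then have "r i ** P ** matrix_inv P = P ** matrix_inv P" using P(2) xy by (simp flip: mat2_one)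
    then show False using i(2) matrix_inv_right[OF P(1)] by (simp flip: matrix_mul_assoc)
  qed
  define v where "v = P *v vector [1, 0]"
  have v0: "v ~= 0"
  proof
    assume "v = 0"
    then have "P *v vector [1, 0] = P *v 0" by (simp add: v_def)
    then have "vector [1, 0] = (0 :: 'p fp_bar ^ 2)" by (rule mat_vec_cancel[OF P(1)])
    then show False by (simp add: vec2_eq_iff)
  qed
  have "r j *v v = v" if j: "j \<in> J" for j
  proof -
    obtain a b c e where "matrix_inv P ** r j ** P = mat2 a b c e" by (metis mat2_cases)
    then have M: "r j ** P = P ** mat2 a b c e"
      using matrix_inv_right[OF P(1)] by (metis matrix_mul_assoc matrix_mul_lid)
    have G: "i \<in> Gal" "j \<in> Gal" using i(1) j J_Gal by blast+
    have ae: "a + e = 2" using sim_trace_det(1)[OF P(1) M] J_trace[OF j] by (simp add: trace_mat2)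
    have "r (i \<circ> j) ** P = r i ** (r j ** P)" by (simp only: r_comp[OF G] matrix_mul_assoc)
    also have "\<dots> = P ** mat2 x u 0 y ** mat2 a b c e" by (simp only: M matrix_mul_assoc P(2))
    also have "\<dots> = P ** mat2 (a + u * c) (b + u * e) c e" by (simp add: xy flip: matrix_mul_assoc)
    finally have auce: "a + u * c + e = 2"
      using sim_trace_det(1)[OF P(1)] J_trace[OF J_comp[OF i(1) j]] by (metis trace_mat2)
    have "u * c = (a + u * c + e) - (a + e)" by simp
    also have "\<dots> = 0" unfolding ae auce by simp
    finally have "u * c = 0" .
    then have c: "c = 0" using u by simp
    have "a = 1" using J_unipotent(1)[OF j P(1), of a b e] M c by simp
    have "r j *v v = P *v (mat2 a b c e *v vector [1, 0])"
      by (simp only: v_def matrix_vector_mul_assoc M)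
    also have "mat2 a b c e *v vector [1, 0] = vector [1, 0]"
      by (simp add: vec2_eq_iff mat_vec2 c \<open>a = 1\<close>)
    finally show ?thesis by (simp add: v_def)
  qed
  then show ?thesis using v0 by blast
qed

text \<open>The fixed space of J is nonzero and, by \<open>J_normal\<close>, stable under the whole
  group.\<close>

lemma irreducible_J:
  assumes irr: "irreducible_rep Gal r" and j: "j \<in> J"
  shows "r j = mat 1"
proof -
  define U where "U = {v. \<forall>j\<in>J. r j *v v = v}"
  have "vec.subspace U"
    unfolding vec.subspace_def U_def
    by (simp add: matrix_vector_right_distrib vec.scale)
  moreover have "\<forall>sg\<in>Gal. \<forall>v\<in>U. r sg *v v \<in> U"
  proof (intro ballI)
    fix sg :: "'p qp_bar => 'p qp_bar" and v assume sg: "sg \<in> Gal" and v: "v \<in> U"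
    have "r i *v (r sg *v v) = r sg *v v" if i: "i \<in> J" for i
    proof -
      obtain i' where i': "i' \<in> J" "i \<circ> sg = sg \<circ> i'" using J_normal[OF i sg] by blast
      have G: "i \<in> Gal" "i' \<in> Gal" using i i' J_Gal by blast+
      have "r i ** r sg = r sg ** r i'" using r_comp[OF G(1) sg] r_comp[OF sg G(2)] i'(2) by simp
      then have "r i *v (r sg *v v) = r sg *v (r i' *v v)" by (simp only: matrix_vector_mul_assoc)
      also have "r i' *v v = v" using v i'(1) by (simp add: U_def)
      finally show ?thesis .
    qed
    then show "r sg *v v \<in> U" by (simp add: U_def)
  qed
  ultimately have "U = {0} \<or> U = UNIV" using irr unfolding irreducible_rep_def by blast
  moreover obtain v where "v ~= 0" "v \<in> U" using J_fixed_vector by (auto simp: U_def)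
  ultimately have "U = UNIV" by blast
  then have "\<forall>x. r j *v x = mat 1 *v x" using j by (auto simp: U_def)
  then show ?thesis by (rule matrix_eq[THEN iffD2])
qed

lemma eigen_pow:
  assumes "r sg *v v = x *s v" "sg \<in> Gal"
  shows "r (sg ^^ n) *v v = (x ^ n) *s v"
proof (induction n)
  case 0
  then show ?case using r_id by (simp add: id_def)
next
  case (Suc n)
  have "r (sg ^^ Suc n) *v v = r sg *v (r (sg ^^ n) *v v)"
    by (simp only: funpow.simps(2) r_comp[OF assms(2) Gal_pow[OF assms(2)]] matrix_vector_mul_assoc)
  also have "\<dots> = (x ^ n) *s (x *s v)" by (simp only: Suc vec.scale assms(1))
  also have "\<dots> = (x ^ Suc n) *s v" by (simp add: mult.commute)
  finally show ?case .
qed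

text \<open>By \<open>dec\<close> every automorphism is composed of powers of g and \<phi> and an
  element of J, and J acts trivially, so v would span a stable line.\<close>

lemma common_eigenvector:
  assumes irr: "irreducible_rep Gal r" and v: "v ~= 0" "r g *v v = x *s v" "r \<phi> *v v = y *s v"
  shows False
proof -
  have "\<exists>z. r sg *v v = z *s v" if sg: "sg \<in> Gal" for sg
  proof -
    obtain s i j where s: "j \<in> J" "sg = g ^^ s \<circ> \<phi> ^^ i \<circ> j" using dec[OF sg] by blast
    have G: "j \<in> Gal" "\<phi> ^^ i \<in> Gal" using s(1) J_Gal Gal_pow[OF \<phi>G] by blast+
    have "r sg = r (g ^^ s) ** r (\<phi> ^^ i) ** r j"
      using r_comp[OF Gal_comp[OF gtG G(2)] G(1), of s] r_comp[OF gtG G(2), of s] by (simp only: s(2))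
    then have "r sg *v v = r (g ^^ s) *v (r (\<phi> ^^ i) *v v)"
      using irreducible_J[OF irr s(1)] by (simp add: matrix_vector_mul_assoc)
    then have "r sg *v v = (y ^ i * x ^ s) *s v"
      by (simp add: eigen_pow[OF v(3) \<phi>G] eigen_pow[OF v(2) gG] vec.scale)
    then show ?thesis by blast
  qed
  then show False using line_not_irreducible[OF v(1)] irr by blast
qed

lemma d_psq: "d ^ (CARD('p) * CARD('p)) = d"
proof -
  have "d ^ ((CARD('p))\<^sup>2 - 1) = 1" unfolding primD[OF d] by (rule dvd_refl)
  moreover have "CARD('p) * CARD('p) = Suc ((CARD('p))\<^sup>2 - 1)" using p_gt_1 by (simp add: power2_eq_square)
  ultimately show ?thesis by (simp only: power_Suc mult_1_right)
qed

text \<open>The inverse of \<phi> carries an x-eigenvector of g to an x^p-eigenvector. If it stayed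
  on the same line, or if x^p = x so that g is scalar, g and \<phi> would share an eigenvector. So
  the eigenvalues are x and x^p, and applying the inverse of \<phi> once more shows that x^(p^2) is
  again x.\<close>

lemma irreducible_eigen:
  assumes irr: "irreducible_rep Gal r"
  shows "\<exists>P x. invertible P \<and> r g ** P = P ** mat2 x 0 0 (x ^ CARD('p)) \<and>
    x ^ CARD('p) ~= x \<and> x ^ (CARD('p) * CARD('p)) = x \<and> x ~= 0"
proof -
  let ?p = "CARD('p)"
  define \<phi>' where "\<phi>' = inv_into UNIV \<phi>"
  obtain x v where v: "v ~= 0" "r g *v v = x *s v" using ex_eigenvector by blast
  have shift: "r g *v (r \<phi>' *v z) = (y ^ ?p) *s (r \<phi>' *v z)" if "r g *v z = y *s z" for y z
  proof (rule r_vec_inj[OF \<phi>G])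
    obtain j where j: "j \<in> J" "\<phi> \<circ> g = g ^^ ?p \<circ> \<phi> \<circ> j" using comm by blast
    have G: "j \<in> Gal" using j(1) J_Gal by blast
    have "r \<phi> ** r g = r (g ^^ ?p) ** r \<phi>"
      using r_comp[OF \<phi>G gG] r_comp[OF Gal_comp[OF gtG \<phi>G] G, of ?p] r_comp[OF gtG \<phi>G, of ?p] irreducible_J[OF irr j(1)]
      by (simp add: j(2))
    then have "r \<phi> *v (r g *v y') = r (g ^^ ?p) *v (r \<phi> *v y')" for y'
      by (simp only: matrix_vector_mul_assoc)
    then have "r \<phi> *v (r g *v (r \<phi>' *v z)) = r (g ^^ ?p) *v (r \<phi> *v (r \<phi>' *v z))" .
    also have "\<dots> = (y ^ ?p) *s z" unfolding \<phi>'_def r_inv_vec[OF \<phi>G] by (rule eigen_pow[OF that gG])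
    also have "\<dots> = r \<phi> *v ((y ^ ?p) *s (r \<phi>' *v z))" unfolding vec.scale \<phi>'_def r_inv_vec[OF \<phi>G] ..
    finally show "r \<phi> *v (r g *v (r \<phi>' *v z)) = r \<phi> *v ((y ^ ?p) *s (r \<phi>' *v z))" .
  qed
  define u where "u = r \<phi>' *v v"
  have u: "r g *v u = (x ^ ?p) *s u" unfolding u_def by (rule shift[OF v(2)])
  have \<phi>u: "r \<phi> *v u = v" unfolding u_def \<phi>'_def by (rule r_inv_vec[OF \<phi>G])
  have np: "\<not> (\<exists>c. u = c *s v)"
  proof
    assume "\<exists>c. u = c *s v"
    then obtain c where c: "u = c *s v" by blast
    have "c *s (r \<phi> *v v) = v" using \<phi>u unfolding c vec.scale .
    then have "c ~= 0" using v(1) by auto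
    then have "r \<phi> *v v = inverse c *s v" using \<open>c *s (r \<phi> *v v) = v\<close> by (metis left_inverse vector_smult_assoc vector_smult_lid)
    then show False by (rule common_eigenvector[OF irr v])
  qed
  define P where "P = mat2 (v $ 1) (u $ 1) (v $ 2) (u $ 2)"
  have P: "invertible P" using np parallel_cases[OF v(1), of u] by (simp add: P_def invertible_mat2 mult.commute)
  have M: "r g ** P = P ** mat2 x 0 0 (x ^ ?p)"
  proof -
    obtain a b c e where A: "r g = mat2 a b c e" by (metis mat2_cases)
    show ?thesis using v(2) u by (simp add: A P_def vec2_eq_iff mat_vec2 mult.commute)
  qed
  have act: "r g *v (P *v z) = P *v (mat2 x 0 0 (x ^ ?p) *v z)" for z by (simp only: matrix_vector_mul_assoc M)
  have ne: "x ^ ?p ~= x"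
  proof
    assume eq: "x ^ ?p = x"
    obtain y z where z: "z ~= 0" "r \<phi> *v z = y *s z" using ex_eigenvector by blast
    have zP: "z = P *v (matrix_inv P *v z)" by (simp add: matrix_vector_mul_assoc matrix_inv_right[OF P])
    have "mat2 x 0 0 (x ^ ?p) *v t = x *s t" for t by (simp add: vec2_eq_iff mat_vec2 eq)
    then have "r g *v z = x *s z" using act[of "matrix_inv P *v z"] zP by (metis vec.scale)
    then show False by (rule common_eigenvector[OF irr z(1) _ z(2)])
  qed
  have x0: "x ~= 0" using ne p_gt_1 by (auto simp: power_0_left)
  define y where "y = r \<phi>' *v u"
  have "y ~= 0"
  proof
    assume "y = 0"
    then have "r \<phi> *v y = 0" by simp
    then have "u = 0" unfolding y_def \<phi>'_def r_inv_vec[OF \<phi>G] .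
    then show False using np by (metis vector_smult_lzero)
  qed
  have y: "r g *v y = ((x ^ ?p) ^ ?p) *s y" unfolding y_def by (rule shift[OF u])
  define t where "t = matrix_inv P *v y"
  have yt: "y = P *v t" by (simp add: t_def matrix_vector_mul_assoc matrix_inv_right[OF P])
  have "P *v (mat2 x 0 0 (x ^ ?p) *v t) = P *v (((x ^ ?p) ^ ?p) *s t)" using y unfolding yt act vec.scale .
  then have "mat2 x 0 0 (x ^ ?p) *v t = ((x ^ ?p) ^ ?p) *s t" by (rule mat_vec_cancel[OF P])
  then have "x * t $ 1 = (x ^ ?p) ^ ?p * t $ 1" "x ^ ?p * t $ 2 = (x ^ ?p) ^ ?p * t $ 2"
    by (simp_all add: vec2_eq_iff mat_vec2)
  moreover have "t ~= 0" using \<open>y ~= 0\<close> yt by auto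
  moreover have "(x ^ ?p) ^ ?p ~= x ^ ?p" using ne fpb_power_inj by blast
  ultimately have "(x ^ ?p) ^ ?p = x" by (auto simp: vec2_eq_iff)
  then show ?thesis using P M ne x0 by (intro exI[of _ P] exI[of _ x]) (simp add: power_mult)
qed

text \<open>Write x = d^m and m = p a + b in base p. Since d^(p^2) = d, raising to the p-th power
  swaps the digits. They differ because x^p ~= x, and exchanging the basis vectors arranges a <
  b.\<close>

lemma irreducible_inertia:
  assumes irr: "irreducible_rep Gal r"
  shows "\<exists>P a b. invertible P \<and> a < b \<and> b \<le> CARD('p) - 1 \<and>
    (\<forall>sg\<in>inertia. r sg ** P = P ** scale_mat (cyclo sg ^ a) (mat2 (\<omega>2 sg ^ (b - a)) 0 0 (\<omega>2 sg ^ (CARD('p) * (b - a)))))"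
proof -
  let ?p = "CARD('p)"
  obtain P x where P: "invertible P" "r g ** P = P ** mat2 x 0 0 (x ^ ?p)"
    and x: "x ^ ?p ~= x" "x ^ (?p * ?p) = x" "x ~= 0"
    using irreducible_eigen[OF irr] by blast
  have psq: "?p * ?p = Suc (?p\<^sup>2 - 1)" using p_gt_1 by (simp add: power2_eq_square)
  have "x * x ^ (?p\<^sup>2 - 1) = x * 1" using x(2) unfolding psq power_Suc by simp
  then have "x ^ (?p\<^sup>2 - 1) = 1" using x(3) by simp
  then have "x \<in> mu (?p\<^sup>2 - 1)" by (simp add: mu_def)
  moreover have "of_nat (?p\<^sup>2 - 1) ~= (0 :: 'p fp_bar)"
  proof
    assume "of_nat (?p\<^sup>2 - 1) = (0 :: 'p fp_bar)"
    then have "?p dvd ?p\<^sup>2 - 1" by (simp add: of_nat_fpb_eq_0_iff)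
    moreover have "?p dvd Suc (?p\<^sup>2 - 1)" unfolding psq[symmetric] by (rule dvd_triv_left)
    ultimately have "?p dvd Suc (?p\<^sup>2 - 1) - (?p\<^sup>2 - 1)" by (rule dvd_diff_nat[rotated])
    moreover have "Suc n - n = 1" for n :: nat by simp
    ultimately show False using p_gt_1 by (simp only: nat_dvd_1_iff_1)
  qed
  ultimately obtain m where m: "x = d ^ m" "m < ?p\<^sup>2 - 1" using prim_mu_cases[OF d] by blast
  define a b where "a = m div ?p" and "b = m mod ?p"
  have mab: "m = ?p * a + b" by (simp add: a_def b_def)
  have "m < ?p * ?p" using m(2) by (simp add: power2_eq_square)
  then have a: "a < ?p" unfolding a_def by (rule less_mult_imp_div_less)
  have b: "b < ?p" unfolding b_def using p_gt_1 by simp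
  have e: "?p * m = ?p * ?p * a + ?p * b" by (simp add: mab distrib_left)
  have "x ^ ?p = d ^ (?p * m)" by (simp add: m(1) mult.commute flip: power_mult)
  also have "\<dots> = (d ^ (?p * ?p)) ^ a * d ^ (?p * b)" unfolding e power_add power_mult ..
  also have "\<dots> = d ^ (?p * b + a)" unfolding d_psq by (simp add: power_add mult.commute)
  finally have xp: "x ^ ?p = d ^ (?p * b + a)" .
  have ab: "a ~= b" using x(1) xp m(1) mab by auto
  have final: "\<forall>sg\<in>inertia. r sg ** Q = Q ** scale_mat (cyclo sg ^ a) (mat2 (\<omega>2 sg ^ (b - a)) 0 0 (\<omega>2 sg ^ (?p * (b - a))))"
    if Q: "r g ** Q = Q ** mat2 (d ^ (?p * a + b)) 0 0 (d ^ (?p * b + a))" and "a < b" for a b Q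
  proof
    fix sg :: "'p qp_bar => 'p qp_bar" assume sg: "sg \<in> inertia"
    obtain t where t: "r sg = r (g ^^ t)" "cyclo sg = d ^ ((?p + 1) * t)" "\<omega>2 sg = d ^ t"
      using wild_trivial_inertia[OF _ sg] irreducible_J[OF irr] wild by blast
    obtain k where k: "b = a + k" using \<open>a < b\<close> less_imp_add_positive by blast
    have "cyclo sg ^ a * \<omega>2 sg ^ (b - a) = d ^ ((?p + 1) * t * a + t * k)"
      "cyclo sg ^ a * \<omega>2 sg ^ (?p * (b - a)) = d ^ ((?p + 1) * t * a + t * (?p * k))"
      unfolding t k by (simp_all only: power_add power_mult diff_add_inverse)
    moreover have "(?p + 1) * t * a + t * k = (?p * a + b) * t" "(?p + 1) * t * a + t * (?p * k) = (?p * b + a) * t"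
      by (simp_all add: k algebra_simps)
    ultimately have "cyclo sg ^ a * \<omega>2 sg ^ (b - a) = (d ^ (?p * a + b)) ^ t"
      "cyclo sg ^ a * \<omega>2 sg ^ (?p * (b - a)) = (d ^ (?p * b + a)) ^ t"
      by (simp_all only: power_mult)
    then show "r sg ** Q = Q ** scale_mat (cyclo sg ^ a) (mat2 (\<omega>2 sg ^ (b - a)) 0 0 (\<omega>2 sg ^ (?p * (b - a))))"
      unfolding t(1) diagonal_pow[OF Q gG] by simp
  qed
  show ?thesis
  proof (cases "a < b")
    case True
    have "r g ** P = P ** mat2 (d ^ (?p * a + b)) 0 0 (d ^ (?p * b + a))" using P(2) unfolding xp unfolding m(1) mab .
    from final[OF this True] show ?thesis using P(1) True b by (intro exI[of _ P] exI[of _ a] exI[of _ b]) simp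
  next
    case False
    define Q where "Q = P ** mat2 0 1 1 0"
    have Q: "invertible Q" unfolding Q_def by (intro invertible_mult P) (simp add: invertible_mat2)
    have "r g ** Q = P ** (mat2 x 0 0 (x ^ ?p) ** mat2 0 1 1 0)" unfolding Q_def by (simp only: matrix_mul_assoc P(2))
    also have "\<dots> = P ** (mat2 0 1 1 0 ** mat2 (x ^ ?p) 0 0 x)" by simp
    also have "\<dots> = Q ** mat2 (x ^ ?p) 0 0 x" unfolding Q_def by (simp only: matrix_mul_assoc)
    finally have "r g ** Q = Q ** mat2 (d ^ (?p * b + a)) 0 0 (d ^ (?p * a + b))"
      unfolding xp unfolding m(1) mab .
    moreover have "b < a" using False ab by simp
    ultimately show ?thesis using final[of Q b a] Q a by (intro exI[of _ Q] exI[of _ b] exI[of _ a]) simp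
  qed
qed

end

subsection \<open>Twisting\<close>

lemma twist_equiv:
  fixes r r' :: "'g => 'a :: field ^ 2 ^ 2"
  assumes "rep_equiv_on S r A" "!!sg. sg \<in> S ==> r' sg = scale_mat (f sg) (r sg)"
  shows "rep_equiv_on S r' (%sg. scale_mat (f sg) (A sg))"
proof -
  obtain P where P: "invertible P" "!!sg. sg \<in> S ==> r sg ** P = P ** A sg"
    using assms(1) unfolding rep_equiv_iff by blast
  have "r' sg ** P = P ** scale_mat (f sg) (A sg)" if "sg \<in> S" for sg
    by (simp only: assms(2)[OF that] scale_mat_mult P(2)[OF that])
  then show ?thesis unfolding rep_equiv_iff using P(1) by blast
qed

lemma rep_equiv_cong:
  assumes "rep_equiv_on S r A" "!!sg. sg \<in> S ==> A sg = B sg"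
  shows "rep_equiv_on S r B"
  using assms unfolding rep_equiv_on_def by metis

text \<open>Nonvanishing of f is included so that the relation can be reversed, which gives both
  directions of each invariance.\<close>

definition twist_of :: "(('p qp_bar => 'p qp_bar) => 'p fp_bar) => 'p :: prime_card local_rep => 'p local_rep => bool" where
  "twist_of f r r' \<longleftrightarrow> (\<forall>sg\<in>Gal. f sg ~= 0 \<and> r' sg = scale_mat (f sg) (r sg))"

lemma twist_of_sym: "twist_of f r r' ==> twist_of (%sg. inverse (f sg)) r' r"
  by (simp add: twist_of_def scale_mat_scale scale_mat_1)

lemma twist_irreducible:
  assumes tw: "twist_of f r r'" and irr: "irreducible_rep Gal r"
  shows "irreducible_rep Gal r'"
  unfolding irreducible_rep_def
proof (intro allI impI)
  fix U :: "('a fp_bar ^ 2) set" assume U: "vec.subspace U \<and> (\<forall>sg\<in>Gal. \<forall>v\<in>U. r' sg *v v \<in> U)"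
  have "r sg *v v \<in> U" if "sg \<in> Gal" "v \<in> U" for sg v
  proof -
    have "r sg = scale_mat (inverse (f sg)) (r' sg)" using twist_of_sym[OF tw] that(1) by (simp add: twist_of_def)
    then have "r sg *v v = inverse (f sg) *s (r' sg *v v)" by (simp only: scale_mat_vec)
    moreover have "r' sg *v v \<in> U" using U that by blast
    ultimately show ?thesis using U vec.subspace_scale by metis
  qed
  then show "U = {0} \<or> U = UNIV" using irr U unfolding irreducible_rep_def by blast
qed

lemma twist_split:
  assumes tw: "twist_of f r r'" and s: "split_rep r"
  shows "split_rep r'"
proof -
  obtain c1 c2 where "rep_equiv_on Gal r (%sg. mat2 (c1 sg) 0 0 (c2 sg))" using s unfolding split_rep_def by blast
  then have "rep_equiv_on Gal r' (%sg. scale_mat (f sg) (mat2 (c1 sg) 0 0 (c2 sg)))"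
    by (rule twist_equiv) (use tw in \<open>simp add: twist_of_def\<close>)
  then have "rep_equiv_on Gal r' (%sg. mat2 (f sg * c1 sg) 0 0 (f sg * c2 sg))" by simp
  then show ?thesis
    unfolding split_rep_def by (intro exI[of _ "%sg. f sg * c1 sg"] exI[of _ "%sg. f sg * c2 sg"])
qed

lemma twist_cyclo_extension:
  assumes tw: "twist_of f r r'" and c: "cyclo_extension r z"
  shows "cyclo_extension r' z"
proof -
  obtain c1 c2 u where c: "\<not> split_rep r" "rep_equiv_on Gal r (%sg. mat2 (c1 sg) (u sg) 0 (c2 sg))"
    "\<forall>sg\<in>Gal. c1 sg / c2 sg = cyclo sg" "\<forall>sg\<in>Gal. z sg = u sg / c2 sg"
    using c unfolding cyclo_extension_def by blast
  have f: "f sg ~= 0" if "sg \<in> Gal" for sg using tw that by (simp add: twist_of_def)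
  have "rep_equiv_on Gal r' (%sg. scale_mat (f sg) (mat2 (c1 sg) (u sg) 0 (c2 sg)))"
    using c(2) by (rule twist_equiv) (use tw in \<open>simp add: twist_of_def\<close>)
  then have "rep_equiv_on Gal r' (%sg. mat2 (f sg * c1 sg) (f sg * u sg) 0 (f sg * c2 sg))" by simp
  moreover have "\<forall>sg\<in>Gal. (f sg * c1 sg) / (f sg * c2 sg) = cyclo sg" "\<forall>sg\<in>Gal. z sg = (f sg * u sg) / (f sg * c2 sg)"
    using c(3,4) f by simp_all
  moreover have "\<not> split_rep r'" using c(1) twist_split[OF twist_of_sym[OF tw]] by blast
  ultimately show ?thesis
    unfolding cyclo_extension_def
    by (intro conjI exI[of _ "%sg. f sg * c1 sg"] exI[of _ "%sg. f sg * c2 sg"] exI[of _ "%sg. f sg * u sg"])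
qed

lemma twist_invariants:
  assumes tw: "twist_of f r r'"
  shows "irreducible_rep Gal r' \<longleftrightarrow> irreducible_rep Gal r" "split_rep r' \<longleftrightarrow> split_rep r"
    "tres_ramifiee r' \<longleftrightarrow> tres_ramifiee r"
proof -
  note tw' = twist_of_sym[OF tw]
  show "irreducible_rep Gal r' \<longleftrightarrow> irreducible_rep Gal r" using twist_irreducible[OF tw] twist_irreducible[OF tw'] by blast
  show "split_rep r' \<longleftrightarrow> split_rep r" using twist_split[OF tw] twist_split[OF tw'] by blast
  have "cyclo_extension r' z \<longleftrightarrow> cyclo_extension r z" for z
    using twist_cyclo_extension[OF tw] twist_cyclo_extension[OF tw'] by blast
  then show "tres_ramifiee r' \<longleftrightarrow> tres_ramifiee r" by (simp add: tres_ramifiee_def peu_ramifiee_def)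
qed

section \<open>Comparison of the weights\<close>

definition tw :: "nat => nat => (nat \<times> nat) set => (nat \<times> nat) set" where
  "tw p c W = (%(a, b). ((a + c) mod (p - 1), b)) ` W"

text \<open>\<open>reducible_weights\<close> with the two conditions on the representation turned
  into booleans, which separates the arithmetic of the table from Galois theory.\<close>

definition RW :: "bool => bool => nat => nat => (nat \<times> nat) set" where
  "RW s t p b =
    (if 1 < b \<and> b < p - 1 \<and> \<not> s then {(0, b)}
     else if 1 < b \<and> b < p - 2 \<and> s then {(0, b), (b, p - 1 - b)}
     else if b = p - 2 \<and> p > 3 \<and> s then {(0, p - 2), (p - 2, p), (p - 2, 1)}
     else if b = p - 1 then {(0, p - 1)}
     else if b = 1 \<and> t then {(0, p)}
     else if b = 1 \<and> p > 3 \<and> s then {(0, p), (0, 1), (1, p - 2)}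
     else if b = 1 \<and> p = 3 \<and> s then {(0, 3), (0, 1), (1, 3), (1, 1)}
     else {(0, p), (0, 1)})"

definition kW :: "nat => (nat \<times> nat) set => nat" where
  "kW p W = Min ((%(a, b). kf p a b + 2) ` W)"

lemma tw_tw: "tw p c (tw p c' W) = tw p (c' + c) W"
  unfolding tw_def image_image by (rule image_cong) (auto simp: mod_simps add.assoc)

lemma tw_cong: "c mod (p - 1) = c' mod (p - 1) ==> tw p c W = tw p c' W"
  unfolding tw_def by (rule image_cong) (auto intro: mod_add_cong)

lemma tw_0: "(!!a b. (a, b) \<in> W ==> a < p - 1) ==> tw p 0 W = W"
  unfolding tw_def by (force simp: image_iff)

lemma RW_bounds:
  assumes "p \<ge> 3" "1 \<le> b" "b \<le> p - 1" "(x, y) \<in> RW s t p b"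
  shows "x < p - 1" "1 \<le> y" "y \<le> p"
proof -
  have if_sub: "(if c then A else B) \<subseteq> C" if "c ==> A \<subseteq> C" "B \<subseteq> C" for c and A B C :: "(nat \<times> nat) set"
    using that by simp
  have "RW s t p b \<subseteq> {..<p - 1} \<times> {1..p}"
    unfolding RW_def using assms(1-3) by (intro if_sub) auto
  then show "x < p - 1" "1 \<le> y" "y \<le> p" using assms(4) by auto
qed

lemma finite_RW: "finite (RW s t p b)" by (simp add: RW_def)

lemma RW_last: "p \<ge> 3 ==> RW s t p (p - 1) = {(0, p - 1)}"
  by (auto simp: RW_def)

text \<open>In the split case the two characters can be listed in either order, which replaces b by
  p - 1 - b and twists by b; the table has to be consistent with this.\<close>

lemma RW_swap:
  assumes "p \<ge> 3" "1 \<le> b" "b \<le> p - 2"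
  shows "tw p b (RW True False p (p - 1 - b)) = RW True False p b"
proof -
  consider "p = 3" | "p > 3" "b = 1" | "p > 3" "b = p - 2" "b ~= 1" | "1 < b" "b < p - 2" using assms by linarith
  then show ?thesis
  proof cases
    case 1
    then have "b = 1" using assms by simp
    with 1 show ?thesis by (auto simp: RW_def tw_def)
  next
    case 2
    have e: "p - 2 + 1 = p - 1" using 2 by linarith
    have "(p - 2 + 1) mod (p - 1) = 0" unfolding e by simp
    then show ?thesis using 2 by (auto simp: RW_def tw_def numeral_eq_Suc)
  next
    case 3
    then have e: "1 + b = p - 1" "p - 1 - b = 1" by linarith+
    have "(1 + b) mod (p - 1) = 0" unfolding e(1) by simp
    then show ?thesis using 3 e(2) by (auto simp: RW_def tw_def)
  next
    case 4
    then have "p - 1 - b + b = p - 1" "1 < p - 1 - b" "p - 1 - b < p - 2" "p - 1 - (p - 1 - b) = b" by linarith+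
    then show ?thesis using 4 by (auto simp: RW_def tw_def)
  qed
qed

section \<open>Comparison of the closed formulas\<close>

lemma kf_small: "a + b < p ==> 1 \<le> b ==> kf p a b + 2 = p * a + a + b + 1"
  by (simp add: kf_def algebra_simps)

lemma kf_p: "1 \<le> p ==> kf p a p + 2 = p * a + a + p + 1"
  by (simp add: kf_def algebra_simps)

lemma kf_large:
  assumes "a + b = p + s" "b < p"
  shows "kf p a b + 2 = p * s + s + 2 * p + 1 - b"
  using assms by (simp add: kf_def algebra_simps)

text \<open>The weight with twist a attains Serre's value. The other weight falls under the second
  formula of \<open>kf\<close> with quotient a, which is never smaller.\<close>

lemma kW_irreducible:
  assumes "a < b" "b \<le> p - 1"
  shows "kW p {(a, b - a), (b - 1, p + 1 - (b - a))} = p * a + b + 1"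
proof -
  have 1: "kf p a (b - a) + 2 = p * a + b + 1" using assms kf_small[of a "b - a" p] by simp
  have "kf p (b - 1) (p + 1 - (b - a)) + 2 \<ge> p * a + b + 1"
  proof (cases "b = a + 1")
    \<comment> \<open>Here the second weight has index p, where the first formula of
      \<open>kf\<close> applies instead.\<close>
    case True
    then have "p + 1 - (b - a) = p" "b - 1 = a" by simp_all
    then show ?thesis using kf_p[of p a] True assms by simp
  next
    case False
    have "b - 1 + (p + 1 - (b - a)) = p + a" "p + 1 - (b - a) < p" using assms False by linarith+
    then show ?thesis using kf_large[of "b - 1" "p + 1 - (b - a)" p a] assms False by linarith
  qed
  then show ?thesis using 1 by (simp add: kW_def)
qed

text \<open>The case of equal inertial characters. At a = 0 the weight occurs in degree p - 2, which
  is the origin of the exceptional value p in Serre's recipe.\<close>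

lemma kW_scalar:
  assumes "p \<ge> 3" "a \<le> p - 2"
  shows "kW p {(a, p - 1)} = (if a = 0 then p else p * a + a + 1)"
proof (cases a)
  case 0
  then show ?thesis using kf_small[of 0 "p - 1" p] assms by (simp add: kW_def)
next
  case (Suc s)
  have "kf p a (p - 1) + 2 = p * s + s + 2 * p + 1 - (p - 1)" using Suc assms by (intro kf_large) auto
  then show ?thesis using Suc assms by (simp add: kW_def algebra_simps)
qed

text \<open>The cases follow the rows of the table for split representations; in each of them the
  weight (a, b - a) attains the minimum.\<close>

lemma kW_tame:
  assumes p: "p \<ge> 3" and ab: "a < b" "b \<le> p - 2"
  shows "kW p (tw p a (RW True False p (b - a))) = p * a + b + 1"
proof -
  have am: "a mod (p - 1) = a" "b mod (p - 1) = b" "(a + 1) mod (p - 1) = a + 1" "a + (b - a) = b"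
    using ab by simp_all
  consider "p = 3" | "p > 3" "b - a = 1" | "p > 3" "b - a = p - 2" "b - a ~= 1" | "1 < b - a" "b - a < p - 2" using assms by linarith
  then show ?thesis
  proof cases
    case 1
    then have "a = 0" "b = 1" using ab by simp_all
    with 1 show ?thesis by (simp add: RW_def tw_def kW_def kf_def)
  next
    case 2
    then have "b = a + 1" using ab by simp
    then have RW: "tw p a (RW True False p (b - a)) = {(a, p), (a, 1), (a + 1, p - 2)}"
      using 2 am by (auto simp: RW_def tw_def add.commute)
    have k1: "kf p a 1 + 2 = p * a + a + 2" using kf_small[of a 1 p] ab p by simp
    have k2: "kf p (a + 1) (p - 2) + 2 \<ge> p * a + a + 2"
    proof (cases a)
      case 0
      then show ?thesis using kf_small[of "a + 1" "p - 2" p] 2 by simp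
    next
      case (Suc s)
      have "kf p (a + 1) (p - 2) + 2 = p * s + s + 2 * p + 1 - (p - 2)" using Suc 2 by (intro kf_large) auto
      then show ?thesis using Suc 2 by (simp add: algebra_simps)
    qed
    show ?thesis unfolding RW kW_def using k1 k2 kf_p[of p a] p \<open>b = a + 1\<close> by simp
  next
    case 3
    then have "a = 0" "b = p - 2" using ab by simp_all
    have RW: "tw p a (RW True False p (b - a)) = {(0, p - 2), (p - 2, p), (p - 2, 1)}"
      using 3 \<open>a = 0\<close> by (auto simp: RW_def tw_def)
    have "p * (p - 2) \<ge> 3 * (p - 2)" using p by (intro mult_le_mono1)
    then have "kf p (p - 2) p + 2 \<ge> p - 1" "kf p (p - 2) 1 + 2 \<ge> p - 1"
      using kf_p[of p "p - 2"] kf_small[of "p - 2" 1 p] p by simp_all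
    moreover have "kf p 0 (p - 2) + 2 = p - 1" using kf_small[of 0 "p - 2" p] 3 by simp
    moreover have "p - 1 = Suc (p - 2)" using p by linarith
    ultimately show ?thesis unfolding RW kW_def using \<open>a = 0\<close> \<open>b = p - 2\<close> p by (auto simp: min_def)
  next
    case 4
    have RW: "tw p a (RW True False p (b - a)) = {(a, b - a), (b, p - 1 - (b - a))}"
      using 4 am by (auto simp: RW_def tw_def add.commute)
    have k1: "kf p a (b - a) + 2 = p * a + b + 1" using kf_small[of a "b - a" p] ab by simp
    have k2: "kf p b (p - 1 - (b - a)) + 2 \<ge> p * a + b + 1"
    proof (cases a)
      case 0
      then show ?thesis using kf_small[of b "p - 1 - (b - a)" p] 4 by simp
    next
      case (Suc s)
      have e: "b + (p - 1 - (b - a)) = p + s" using Suc 4 ab by linarith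
      show ?thesis using kf_large[OF e] Suc 4 ab by (simp add: algebra_simps)
    qed
    show ?thesis unfolding RW kW_def using k1 k2 by simp
  qed
qed

text \<open>The exponent of the quotient of the two inertial characters, normalized to 1..p-1, is
  \<beta> - \<alpha> or \<beta> - \<alpha> + p - 1. The second occurs for \<beta> <= \<alpha> and
  accounts for the minimum and maximum in Serre's formula.\<close>

lemma kW_wild:
  assumes p: "p \<ge> 3" and \<alpha>: "\<alpha> \<le> p - 2" and \<beta>: "1 \<le> \<beta>" "\<beta> \<le> p - 1"
  shows "kW p (tw p \<alpha> (RW False t p (if \<beta> > \<alpha> then \<beta> - \<alpha> else \<beta> + (p - 1) - \<alpha>))) =
    (if \<beta> ~= \<alpha> + 1 then 1 + p * min \<alpha> \<beta> + max \<alpha> \<beta>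
     else if t then p + 1 + \<alpha> * (p + 1) else 2 + \<alpha> * (p + 1))"
proof -
  have am: "\<alpha> mod (p - 1) = \<alpha>" using \<alpha> p by simp
  define b where "b = (if \<beta> > \<alpha> then \<beta> - \<alpha> else \<beta> + (p - 1) - \<alpha>)"
  \<comment> \<open>The value b = p - 1 arises twice, from \<beta> = \<alpha> and from \<alpha> = 0,
    \<beta> = p - 1; both go through \<open>kW_scalar\<close>.\<close>
  consider "\<beta> = \<alpha> + 1" | "\<beta> > \<alpha> + 1" "b < p - 1" | "\<beta> = p - 1" "\<alpha> = 0" "\<beta> ~= 1" | "\<beta> = \<alpha>" | "\<beta> < \<alpha>"
    using \<alpha> \<beta> by (fastforce simp: b_def)
  then show ?thesis unfolding b_def[symmetric]
  proof cases
    case 1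
    then have "b = 1" by (simp add: b_def)
    then have "tw p \<alpha> (RW False t p b) = (if t then {(\<alpha>, p)} else {(\<alpha>, p), (\<alpha>, 1)})"
      using p am by (auto simp: RW_def tw_def)
    then show "kW p (tw p \<alpha> (RW False t p b)) = (if \<beta> ~= \<alpha> + 1 then 1 + p * min \<alpha> \<beta> + max \<alpha> \<beta>
     else if t then p + 1 + \<alpha> * (p + 1) else 2 + \<alpha> * (p + 1))"
      using 1 kf_p[of p \<alpha>] kf_small[of \<alpha> 1 p] p \<alpha> by (simp add: kW_def algebra_simps)
  next
    case 2
    then have b: "b = \<beta> - \<alpha>" "b > 1" by (auto simp: b_def)
    then have "tw p \<alpha> (RW False t p b) = {(\<alpha>, b)}" using am 2 by (simp add: RW_def tw_def)
    then show "kW p (tw p \<alpha> (RW False t p b)) = (if \<beta> ~= \<alpha> + 1 then 1 + p * min \<alpha> \<beta> + max \<alpha> \<beta>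
     else if t then p + 1 + \<alpha> * (p + 1) else 2 + \<alpha> * (p + 1))"
      using 2 b kf_small[of \<alpha> b p] \<beta> p by (simp add: kW_def)
  next
    case 3
    then have "b = p - 1" using p by (simp add: b_def)
    then have "tw p \<alpha> (RW False t p b) = {(\<alpha>, p - 1)}" using RW_last[OF p] am by (simp add: tw_def)
    then show "kW p (tw p \<alpha> (RW False t p b)) = (if \<beta> ~= \<alpha> + 1 then 1 + p * min \<alpha> \<beta> + max \<alpha> \<beta>
     else if t then p + 1 + \<alpha> * (p + 1) else 2 + \<alpha> * (p + 1))"
      using kW_scalar[OF p \<alpha>] 3 p by simp
  next
    case 4
    then have "b = p - 1" by (simp add: b_def)
    then have "tw p \<alpha> (RW False t p b) = {(\<alpha>, p - 1)}" using RW_last[OF p] am by (simp add: tw_def)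
    then show "kW p (tw p \<alpha> (RW False t p b)) = (if \<beta> ~= \<alpha> + 1 then 1 + p * min \<alpha> \<beta> + max \<alpha> \<beta>
     else if t then p + 1 + \<alpha> * (p + 1) else 2 + \<alpha> * (p + 1))"
      using kW_scalar[OF p \<alpha>] 4 \<beta> by simp
  next
    case 5
    then have b: "b = \<beta> + (p - 1) - \<alpha>" "b > 1 \<or> b = 1" "b < p - 1" using \<alpha> \<beta> by (auto simp: b_def)
    have b1: "b > 1" using 5 \<alpha> \<beta> b(1) p by linarith
    have tw: "tw p \<alpha> (RW False t p b) = {(\<alpha>, b)}" using am b(3) b1 by (simp add: RW_def tw_def)
    obtain s where s: "\<beta> = Suc s" using \<beta> by (cases \<beta>) auto
    have e: "\<alpha> + b = p + s" using b(1) s 5 \<alpha> p by linarith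
    have "kf p \<alpha> b + 2 = p * s + s + 2 * p + 1 - b" using b(3) by (intro kf_large[OF e]) simp
    also have "\<dots> = 1 + p * \<beta> + \<alpha>" using b(1) s 5 \<alpha> p by (simp add: algebra_simps)
    finally show "kW p (tw p \<alpha> (RW False t p b)) = (if \<beta> ~= \<alpha> + 1 then 1 + p * min \<alpha> \<beta> + max \<alpha> \<beta>
     else if t then p + 1 + \<alpha> * (p + 1) else 2 + \<alpha> * (p + 1))"
      using tw 5 by (simp add: kW_def min_def max_def)
  qed
qed

section \<open>Exponents of inertial characters and weight sets\<close>

context tame_rep
begin

lemma cyclo_pow_mod:
  assumes "(sg :: 'p qp_bar => _) \<in> inertia" "m mod (CARD('p) - 1) = n mod (CARD('p) - 1)"
  shows "cyclo sg ^ m = cyclo sg ^ n"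
proof -
  let ?q = "CARD('p) - 1"
  obtain t where t: "cyclo sg = d ^ ((CARD('p) + 1) * t)" using decI[OF assms(1)] by blast
  have "(CARD('p) + 1) * t * ?q = ((CARD('p))\<^sup>2 - 1) * t" by (simp add: power2_eq_square algebra_simps)
  then have "cyclo sg ^ ?q = (d ^ ((CARD('p))\<^sup>2 - 1)) ^ t" by (simp only: t flip: power_mult)
  also have "d ^ ((CARD('p))\<^sup>2 - 1) = 1" unfolding primD[OF d] by (rule dvd_refl)
  finally have one: "cyclo sg ^ ?q = 1" by simp
  have "cyclo sg ^ k = cyclo sg ^ (k mod ?q)" for k
  proof -
    have "cyclo sg ^ k = cyclo sg ^ (?q * (k div ?q) + k mod ?q)" by simp
    then show ?thesis unfolding power_add power_mult one by simp
  qed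
  then show ?thesis using assms(2) by metis
qed

lemma cyclo_g_eq: "cyclo g ^ m = cyclo g ^ n \<longleftrightarrow> m mod (CARD('p) - 1) = n mod (CARD('p) - 1)"
  using p_gt_1 by (intro prim_power_eq_iff[OF prim_cyclo_g]) simp

lemma inertia_cyclo_nz: "(sg :: 'p qp_bar => _) \<in> inertia ==> cyclo sg ~= 0"
  using cyclo_nz inertia_sub by blast

text \<open>The common normal form to which the reducible rules of both definitions are brought
  before exponents are compared.\<close>

definition shape :: "nat => nat => bool" where
  "shape m n \<longleftrightarrow> (\<exists>P u. invertible P \<and> (\<forall>sg\<in>inertia. r sg ** P = P ** mat2 (cyclo sg ^ m) (u sg) 0 (cyclo sg ^ n)))"

text \<open>The eigenvalues at g determine the exponents up to order. A wild element acting
  nontrivially singles out a line and so fixes the order too.\<close>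

lemma shape_unique:
  assumes "shape m n" "shape m' n'"
  shows "m mod (CARD('p) - 1) = m' mod (CARD('p) - 1) \<and> n mod (CARD('p) - 1) = n' mod (CARD('p) - 1) \<or>
    m mod (CARD('p) - 1) = n' mod (CARD('p) - 1) \<and> n mod (CARD('p) - 1) = m' mod (CARD('p) - 1)"
    and "\<exists>\<nu>\<in>wild_inertia. r \<nu> ~= mat 1 ==>
      m mod (CARD('p) - 1) = m' mod (CARD('p) - 1) \<and> n mod (CARD('p) - 1) = n' mod (CARD('p) - 1)"
proof -
  obtain P u where P: "invertible P" "!!sg. sg \<in> inertia ==> r sg ** P = P ** mat2 (cyclo sg ^ m) (u sg) 0 (cyclo sg ^ n)"
    using assms(1) unfolding shape_def by blast
  obtain P' u' where P': "invertible P'" "!!sg. sg \<in> inertia ==> r sg ** P' = P' ** mat2 (cyclo sg ^ m') (u' sg) 0 (cyclo sg ^ n')"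
    using assms(2) unfolding shape_def by blast
  have "\<exists>Q. invertible Q \<and> (\<forall>sg\<in>inertia. mat2 (cyclo sg ^ m) (u sg) 0 (cyclo sg ^ n) ** Q = Q ** mat2 (cyclo sg ^ m') (u' sg) 0 (cyclo sg ^ n'))"
    by (rule intertwine_two[OF P(1) P'(1) P(2) P'(2)])
  then obtain Q where Q: "invertible Q" "!!sg. sg \<in> inertia ==>
      mat2 (cyclo sg ^ m) (u sg) 0 (cyclo sg ^ n) ** Q = Q ** mat2 (cyclo sg ^ m') (u' sg) 0 (cyclo sg ^ n')" by blast
  show "m mod (CARD('p) - 1) = m' mod (CARD('p) - 1) \<and> n mod (CARD('p) - 1) = n' mod (CARD('p) - 1) \<or>
    m mod (CARD('p) - 1) = n' mod (CARD('p) - 1) \<and> n mod (CARD('p) - 1) = m' mod (CARD('p) - 1)"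
    using sim_upper[OF Q(1) Q(2)[OF gI]] unfolding cyclo_g_eq .
  assume "\<exists>\<nu>\<in>wild_inertia. r \<nu> ~= mat 1"
  then obtain \<nu> where \<nu>: "\<nu> \<in> wild_inertia" "r \<nu> ~= mat 1" by blast
  then have I: "\<nu> \<in> inertia" "cyclo \<nu> = 1" using wild[OF \<nu>(1)] by blast+
  have "u \<nu> ~= 0"
  proof
    assume "u \<nu> = 0"
    then have "r \<nu> ** P = mat 1 ** P" using P(2)[OF I(1)] I(2) by (simp flip: mat2_one)
    then have "r \<nu> ** P ** matrix_inv P = mat 1 ** P ** matrix_inv P" by simp
    then show False using \<nu>(2) matrix_inv_right[OF P(1)] by (simp flip: matrix_mul_assoc)
  qed
  moreover have "mat2 1 (u \<nu>) 0 1 ** Q = Q ** mat2 1 (u' \<nu>) 0 1" using Q(2)[OF I(1)] unfolding I(2) power_one .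
  ultimately show "m mod (CARD('p) - 1) = m' mod (CARD('p) - 1) \<and> n mod (CARD('p) - 1) = n' mod (CARD('p) - 1)"
    using sim_upper_unip[OF Q(1) Q(2)[OF gI]] unfolding cyclo_g_eq by blast
qed

lemma shape_of_equiv:
  assumes "rep_equiv_on inertia r (%sg. scale_mat (cyclo sg ^ c) (mat2 (x sg) (u sg) 0 1))"
    and "!!sg. sg \<in> inertia ==> cyclo sg ^ c * x sg = cyclo sg ^ m"
  shows "shape m c"
proof -
  obtain P where P: "invertible P" "\<forall>sg\<in>inertia. r sg ** P = P ** scale_mat (cyclo sg ^ c) (mat2 (x sg) (u sg) 0 1)"
    using assms(1) unfolding rep_equiv_iff by blast
  have "\<forall>sg\<in>inertia. r sg ** P = P ** mat2 (cyclo sg ^ m) (cyclo sg ^ c * u sg) 0 (cyclo sg ^ c)"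
    using P(2) assms(2) by simp
  then show ?thesis unfolding shape_def using P(1)
    by (intro exI[of _ P] exI[of _ "%sg. cyclo sg ^ c * u sg"] conjI)
qed

lemma equiv_of_shape:
  assumes "shape m n" and c: "c mod (CARD('p) - 1) = n mod (CARD('p) - 1)"
    and x: "!!sg. sg \<in> inertia ==> cyclo sg ^ c * x sg = cyclo sg ^ m"
  shows "\<exists>u. rep_equiv_on inertia r (%sg. scale_mat (cyclo sg ^ c) (mat2 (x sg) (u sg) 0 1))"
proof -
  obtain P u where P: "invertible P" "!!sg. sg \<in> inertia ==> r sg ** P = P ** mat2 (cyclo sg ^ m) (u sg) 0 (cyclo sg ^ n)"
    using assms(1) unfolding shape_def by blast
  have R: "r sg ** P = P ** scale_mat (cyclo sg ^ c) (mat2 (x sg) (u sg / cyclo sg ^ c) 0 1)" if "sg \<in> inertia" for sg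
    using P(2)[OF that] x[OF that] cyclo_pow_mod[OF that c] inertia_cyclo_nz[OF that] by simp
  show ?thesis
    unfolding rep_equiv_iff by (intro exI[of _ "%sg. u sg / cyclo sg ^ c"] exI[of _ P] conjI ballI P(1) R)
qed

lemma powi_shift: "y ~= 0 ==> y ^ a * y powi (int b - int a) = (y :: 'p fp_bar) ^ b"
  by (simp add: power_int_diff)

text \<open>Inversion of the twist rule: a chain of twists collapses to a single exponent c, since
  irreducibility, splitness and being tres ramifiee are invariant under twisting.\<close>

lemma weight_set_cases:
  fixes r0 :: "'p local_rep"
  assumes p3: "CARD('p) \<ge> 3"
  shows "has_weight_set \<omega>2 r0 W ==> \<exists>c.
    irreducible_rep Gal r0 \<and> (\<exists>b. 1 \<le> b \<and> b \<le> CARD('p) - 1 \<and>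
      rep_equiv_on inertia r0 (%sg. scale_mat (cyclo sg ^ c) (mat2 (\<omega>2 sg ^ b) 0 0 (\<omega>2 sg ^ (CARD('p) * b)))) \<and>
      W = tw CARD('p) c {(0, b), (b - 1, CARD('p) + 1 - b)}) \<or>
    \<not> irreducible_rep Gal r0 \<and> (\<exists>b u. 1 \<le> b \<and> b \<le> CARD('p) - 1 \<and>
      rep_equiv_on inertia r0 (%sg. scale_mat (cyclo sg ^ c) (mat2 (cyclo sg ^ b) (u sg) 0 1)) \<and>
      W = tw CARD('p) c (RW (split_rep r0) (tres_ramifiee r0) CARD('p) b))"
proof (induction rule: has_weight_set.induct)
  case (irreducible r0 b)
  have "tw CARD('p) 0 {(0, b), (b - 1, CARD('p) + 1 - b)} = {(0, b), (b - 1, CARD('p) + 1 - b)}"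
    using irreducible(2,3) p3 by (intro tw_0) auto
  then show ?case using irreducible by (intro exI[of _ 0]) (auto simp: scale_mat_1)
next
  case (reducible r0 b u)
  have "reducible_weights r0 b = RW (split_rep r0) (tres_ramifiee r0) CARD('p) b"
    by (simp only: reducible_weights_def RW_def Let_def)
  also have "\<dots> = tw CARD('p) 0 (RW (split_rep r0) (tres_ramifiee r0) CARD('p) b)"
    using RW_bounds(1)[OF p3 reducible(2,3)] by (intro tw_0[symmetric])
  finally show ?case using reducible by (intro exI[of _ 0]) (auto simp: scale_mat_1)
next
  case (twist r0 W r' c')
  have tw: "twist_of (%sg. cyclo sg ^ c') r0 r'" using twist(2) cyclo_nz by (simp add: twist_of_def)
  note inv = twist_invariants[OF tw]
  have r': "r' sg = scale_mat (cyclo sg ^ c') (r0 sg)" if "sg \<in> inertia" for sg using twist(2) inertia_sub that by blast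
  have eq: "rep_equiv_on inertia r' (%sg. scale_mat (cyclo sg ^ (c + c')) (A sg))"
    if "rep_equiv_on inertia r0 (%sg. scale_mat (cyclo sg ^ c) (A sg))" for c A
    using twist_equiv[OF that r'] by (simp add: scale_mat_scale power_add mult.commute)
  have W: "(%(a, b). ((a + c') mod (CARD('p) - 1), b)) ` tw CARD('p) c V = tw CARD('p) (c + c') V" for c V
    unfolding tw_tw[symmetric] by (simp only: tw_def)
  obtain c where c: "irreducible_rep Gal r0 \<and> (\<exists>b. 1 \<le> b \<and> b \<le> CARD('p) - 1 \<and>
      rep_equiv_on inertia r0 (%sg. scale_mat (cyclo sg ^ c) (mat2 (\<omega>2 sg ^ b) 0 0 (\<omega>2 sg ^ (CARD('p) * b)))) \<and>
      W = tw CARD('p) c {(0, b), (b - 1, CARD('p) + 1 - b)}) \<or>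
    \<not> irreducible_rep Gal r0 \<and> (\<exists>b u. 1 \<le> b \<and> b \<le> CARD('p) - 1 \<and>
      rep_equiv_on inertia r0 (%sg. scale_mat (cyclo sg ^ c) (mat2 (cyclo sg ^ b) (u sg) 0 1)) \<and>
      W = tw CARD('p) c (RW (split_rep r0) (tres_ramifiee r0) CARD('p) b))"
    using twist.IH by blast
  show ?case
    unfolding inv
  proof (rule exI[of _ "c + c'"], rule disj_forward[OF c])
    assume "irreducible_rep Gal r0 \<and> (\<exists>b. 1 \<le> b \<and> b \<le> CARD('p) - 1 \<and>
      rep_equiv_on inertia r0 (%sg. scale_mat (cyclo sg ^ c) (mat2 (\<omega>2 sg ^ b) 0 0 (\<omega>2 sg ^ (CARD('p) * b)))) \<and>
      W = tw CARD('p) c {(0, b), (b - 1, CARD('p) + 1 - b)})"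
    then obtain b where b: "irreducible_rep Gal r0" "1 \<le> b" "b \<le> CARD('p) - 1"
      "rep_equiv_on inertia r0 (%sg. scale_mat (cyclo sg ^ c) (mat2 (\<omega>2 sg ^ b) 0 0 (\<omega>2 sg ^ (CARD('p) * b))))"
      "W = tw CARD('p) c {(0, b), (b - 1, CARD('p) + 1 - b)}" by blast
    show "irreducible_rep Gal r0 \<and> (\<exists>b. 1 \<le> b \<and> b \<le> CARD('p) - 1 \<and>
      rep_equiv_on inertia r' (%sg. scale_mat (cyclo sg ^ (c + c')) (mat2 (\<omega>2 sg ^ b) 0 0 (\<omega>2 sg ^ (CARD('p) * b)))) \<and>
      (%(a, b). ((a + c') mod (CARD('p) - 1), b)) ` W = tw CARD('p) (c + c') {(0, b), (b - 1, CARD('p) + 1 - b)})"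
      by (intro conjI exI[of _ b] b(1-3) eq[OF b(4)]) (simp only: b(5) W)
  next
    assume "\<not> irreducible_rep Gal r0 \<and> (\<exists>b u. 1 \<le> b \<and> b \<le> CARD('p) - 1 \<and>
      rep_equiv_on inertia r0 (%sg. scale_mat (cyclo sg ^ c) (mat2 (cyclo sg ^ b) (u sg) 0 1)) \<and>
      W = tw CARD('p) c (RW (split_rep r0) (tres_ramifiee r0) CARD('p) b))"
    then obtain b u where b: "\<not> irreducible_rep Gal r0" "1 \<le> b" "b \<le> CARD('p) - 1"
      "rep_equiv_on inertia r0 (%sg. scale_mat (cyclo sg ^ c) (mat2 (cyclo sg ^ b) (u sg) 0 1))"
      "W = tw CARD('p) c (RW (split_rep r0) (tres_ramifiee r0) CARD('p) b)" by blast
    show "\<not> irreducible_rep Gal r0 \<and> (\<exists>b u. 1 \<le> b \<and> b \<le> CARD('p) - 1 \<and>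
      rep_equiv_on inertia r' (%sg. scale_mat (cyclo sg ^ (c + c')) (mat2 (cyclo sg ^ b) (u sg) 0 1)) \<and>
      (%(a, b). ((a + c') mod (CARD('p) - 1), b)) ` W = tw CARD('p) (c + c') (RW (split_rep r0) (tres_ramifiee r0) CARD('p) b))"
      by (intro conjI exI[of _ b] exI[of _ u] b(1-3) eq[OF b(4)]) (simp only: b(5) W)
  qed
qed

lemma weight_set_bounds:
  assumes p3: "CARD('p) \<ge> 3" and W: "has_weight_set \<omega>2 r W"
  shows "finite W" "W ~= {}" "!!a b. (a, b) \<in> W ==> a \<le> CARD('p) - 2 \<and> 1 \<le> b \<and> b \<le> CARD('p)"
proof -
  obtain c V where V: "W = tw CARD('p) c V" "finite V" "V ~= {}" "!!a b. (a, b) \<in> V ==> 1 \<le> b \<and> b \<le> CARD('p)"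
  proof -
    obtain c where "(\<exists>b. 1 \<le> b \<and> b \<le> CARD('p) - 1 \<and> W = tw CARD('p) c {(0, b), (b - 1, CARD('p) + 1 - b)}) \<or>
      (\<exists>b. 1 \<le> b \<and> b \<le> CARD('p) - 1 \<and> W = tw CARD('p) c (RW (split_rep r) (tres_ramifiee r) CARD('p) b))"
      using weight_set_cases[OF p3 W] by blast
    then show ?thesis
    proof (elim disjE exE conjE)
      fix b assume b: "1 \<le> b" "b \<le> CARD('p) - 1" "W = tw CARD('p) c {(0, b), (b - 1, CARD('p) + 1 - b)}"
      show ?thesis by (rule that[OF b(3)]) (use b in auto)
    next
      fix b assume b: "1 \<le> b" "b \<le> CARD('p) - 1" "W = tw CARD('p) c (RW (split_rep r) (tres_ramifiee r) CARD('p) b)"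
      have ne: "RW (split_rep r) (tres_ramifiee r) CARD('p) b ~= {}" by (simp add: RW_def)
      show ?thesis by (rule that[OF b(3) finite_RW ne]) (use RW_bounds(2,3)[OF p3 b(1,2)] in blast)
    qed
  qed
  show "finite W" "W ~= {}" using V by (simp_all add: tw_def)
  fix a b assume "(a, b) \<in> W"
  then obtain a' where "(a', b) \<in> V" "a = (a' + c) mod (CARD('p) - 1)" by (auto simp: V(1) tw_def)
  moreover have "(a' + c) mod (CARD('p) - 1) < CARD('p) - 1" using p_gt_1 by simp
  ultimately show "a \<le> CARD('p) - 2 \<and> 1 \<le> b \<and> b \<le> CARD('p)" using V(4)[of a' b] by linarith
qed

lemma untwist:
  assumes "rep_equiv_on inertia r (%sg. scale_mat (cyclo sg ^ c) (A sg))"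
  shows "\<exists>r0. rep_equiv_on inertia r0 A \<and> twist_of (%sg. cyclo sg ^ c) r0 r"
proof (intro exI conjI)
  let ?r0 = "%sg. scale_mat (inverse (cyclo sg ^ c)) (r sg)"
  have "rep_equiv_on inertia ?r0 (%sg. scale_mat (inverse (cyclo sg ^ c)) (scale_mat (cyclo sg ^ c) (A sg)))"
    using assms by (rule twist_equiv) simp
  then show "rep_equiv_on inertia ?r0 A"
    by (rule rep_equiv_cong) (simp add: scale_mat_scale scale_mat_1 inertia_cyclo_nz)
  show "twist_of (%sg. cyclo sg ^ c) ?r0 r"
    using cyclo_nz by (simp add: twist_of_def scale_mat_scale scale_mat_1)
qed

lemma weight_set_irreducibleI:
  assumes "irreducible_rep Gal r" "1 \<le> b" "b \<le> CARD('p) - 1"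
    and "rep_equiv_on inertia r (%sg. scale_mat (cyclo sg ^ c) (mat2 (\<omega>2 sg ^ b) 0 0 (\<omega>2 sg ^ (CARD('p) * b))))"
  shows "has_weight_set \<omega>2 r (tw CARD('p) c {(0, b), (b - 1, CARD('p) + 1 - b)})"
proof -
  obtain r0 where r0: "rep_equiv_on inertia r0 (%sg. mat2 (\<omega>2 sg ^ b) 0 0 (\<omega>2 sg ^ (CARD('p) * b)))"
    "twist_of (%sg. cyclo sg ^ c) r0 r" using untwist[OF assms(4)] by blast
  have "has_weight_set \<omega>2 r0 {(0, b), (b - 1, CARD('p) + 1 - b)}"
    by (rule has_weight_set.irreducible) (use assms r0 twist_invariants(1)[OF r0(2)] in auto)
  then show ?thesis unfolding tw_def
    by (rule has_weight_set.twist) (use r0(2) in \<open>simp add: twist_of_def\<close>)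
qed

lemma weight_set_reducibleI:
  assumes "\<not> irreducible_rep Gal r" "1 \<le> b" "b \<le> CARD('p) - 1"
    and "rep_equiv_on inertia r (%sg. scale_mat (cyclo sg ^ c) (mat2 (cyclo sg ^ b) (u sg) 0 1))"
  shows "has_weight_set \<omega>2 r (tw CARD('p) c (RW (split_rep r) (tres_ramifiee r) CARD('p) b))"
proof -
  obtain r0 where r0: "rep_equiv_on inertia r0 (%sg. mat2 (cyclo sg ^ b) (u sg) 0 1)"
    "twist_of (%sg. cyclo sg ^ c) r0 r" using untwist[OF assms(4)] by blast
  have "has_weight_set \<omega>2 r0 (reducible_weights r0 b)"
    by (rule has_weight_set.reducible) (use assms r0 twist_invariants(1)[OF r0(2)] in auto)
  also have "reducible_weights r0 b = RW (split_rep r) (tres_ramifiee r) CARD('p) b"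
    unfolding twist_invariants(2,3)[OF r0(2)] by (simp only: reducible_weights_def RW_def Let_def)
  finally show ?thesis unfolding tw_def
    by (rule has_weight_set.twist) (use r0(2) in \<open>simp add: twist_of_def\<close>)
qed

text \<open>Existence and uniqueness for both relations at once, in the form needed to evaluate the
  two definite descriptions.\<close>

definition weights_agree :: bool where
  "weights_agree \<longleftrightarrow> (\<exists>W. has_weight_set \<omega>2 r W \<and> (\<forall>W'. has_weight_set \<omega>2 r W' --> W' = W) \<and>
     has_serre_weight \<omega>2 r (kW CARD('p) W) \<and> (\<forall>k. has_serre_weight \<omega>2 r k --> k = kW CARD('p) W))"

lemma weights_agreeI:
  assumes "has_weight_set \<omega>2 r W" "!!W'. has_weight_set \<omega>2 r W' ==> W' = W"
    and "has_serre_weight \<omega>2 r k" "!!k'. has_serre_weight \<omega>2 r k' ==> k' = k" "kW CARD('p) W = k"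
  shows weights_agree
  unfolding weights_agree_def by (intro exI[of _ W] conjI allI impI; (unfold assms(5))?; (rule assms)?; assumption?)

text \<open>In the irreducible case, the eigenvalues \<open>d\<^sup>x, d\<^sup>y\<close> of the tame generator determine the weight
  set: an exponent \<open>x = (p + 1) s + t\<close> with \<open>t \<le> p\<close> gives the weight \<open>(s, t)\<close>.\<close>

lemma irreducible_exponents:
  assumes "rep_equiv_on inertia r (%sg. scale_mat (cyclo sg ^ a) (mat2 (\<omega>2 sg ^ n) 0 0 (\<omega>2 sg ^ (CARD('p) * n))))"
    and "rep_equiv_on inertia r (%sg. scale_mat (cyclo sg ^ a') (mat2 (\<omega>2 sg ^ n') 0 0 (\<omega>2 sg ^ (CARD('p) * n'))))"
  defines "x \<equiv> (CARD('p) + 1) * a + n" and "y \<equiv> (CARD('p) + 1) * a + CARD('p) * n"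
    and "x' \<equiv> (CARD('p) + 1) * a' + n'" and "y' \<equiv> (CARD('p) + 1) * a' + CARD('p) * n'"
    and "q \<equiv> (CARD('p))\<^sup>2 - 1"
  shows "x mod q = x' mod q \<and> y mod q = y' mod q \<or> x mod q = y' mod q \<and> y mod q = x' mod q"
proof -
  obtain P where P: "invertible P" "!!sg. sg \<in> inertia ==> r sg ** P = P ** scale_mat (cyclo sg ^ a) (mat2 (\<omega>2 sg ^ n) 0 0 (\<omega>2 sg ^ (CARD('p) * n)))"
    using assms(1) unfolding rep_equiv_iff by blast
  obtain P' where P': "invertible P'" "!!sg. sg \<in> inertia ==> r sg ** P' = P' ** scale_mat (cyclo sg ^ a') (mat2 (\<omega>2 sg ^ n') 0 0 (\<omega>2 sg ^ (CARD('p) * n')))"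
    using assms(2) unfolding rep_equiv_iff by blast
  have M: "scale_mat (cyclo g ^ a) (mat2 (\<omega>2 g ^ n) 0 0 (\<omega>2 g ^ (CARD('p) * n))) = mat2 (d ^ ((CARD('p) + 1) * a + n)) 0 0 (d ^ ((CARD('p) + 1) * a + CARD('p) * n))" for a n
    unfolding cyclo_g \<omega>2_g scale_mat2 power_add power_mult by simp
  have "\<exists>Q. invertible Q \<and> (\<forall>sg\<in>{g}. mat2 (d ^ x) 0 0 (d ^ y) ** Q = Q ** mat2 (d ^ x') 0 0 (d ^ y'))"
  proof (rule intertwine_two[OF P(1) P'(1)])
    show "r sg ** P = P ** mat2 (d ^ x) 0 0 (d ^ y)" "r sg ** P' = P' ** mat2 (d ^ x') 0 0 (d ^ y')" if "sg \<in> {g}" for sg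
      using that P(2)[OF gI] P'(2)[OF gI] unfolding M x_def y_def x'_def y'_def by simp_all
  qed
  then obtain Q where Q: "invertible Q" "mat2 (d ^ x) 0 0 (d ^ y) ** Q = Q ** mat2 (d ^ x') 0 0 (d ^ y')" by blast
  have "(1::nat) < (CARD('p))\<^sup>2" using p_gt_1 one_less_power[of "CARD('p)" 2] by simp
  then have "d ^ i = d ^ j \<longleftrightarrow> i mod q = j mod q" for i j unfolding q_def by (intro prim_power_eq_iff[OF d]) simp
  then show ?thesis using sim_upper[OF Q] by simp
qed

text \<open>Division by p + 1: the identity p n = (p + 1) (n - 1) + (p + 1 - n) is where the second
  weight comes from.\<close>

lemma exponent_weight:
  assumes n: "1 \<le> n" "n \<le> CARD('p) - 1"
  defines "E \<equiv> %x. ((x div (CARD('p) + 1)) mod (CARD('p) - 1), x mod (CARD('p) + 1))"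
  shows "tw CARD('p) a {(0, n), (n - 1, CARD('p) + 1 - n)} = {E ((CARD('p) + 1) * a + n), E ((CARD('p) + 1) * a + CARD('p) * n)}"
proof -
  obtain k where k: "n = Suc k" using n(1) by (cases n) auto
  obtain l where l: "CARD('p) = n + l" using n(2) by (metis le_Suc_ex le_trans diff_le_self)
  have e: "(CARD('p) + 1) * a + CARD('p) * n = (CARD('p) + 1) * (a + k) + (CARD('p) + 1 - n)"
    by (simp add: k l algebra_simps)
  have dm: "((CARD('p) + 1) * s + t) div (CARD('p) + 1) = s" "((CARD('p) + 1) * s + t) mod (CARD('p) + 1) = t"
    if "t < CARD('p) + 1" for s t
    using that by (simp_all only: div_mult_self4 mod_mult_self4 div_less mod_less add_0_right)
  have lt: "n < CARD('p) + 1" "CARD('p) + 1 - n < CARD('p) + 1" using n by linarith+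
  have "E ((CARD('p) + 1) * a + n) = (a mod (CARD('p) - 1), n)"
    "E ((CARD('p) + 1) * a + CARD('p) * n) = ((a + k) mod (CARD('p) - 1), CARD('p) + 1 - n)"
    unfolding e E_def dm[OF lt(1)] dm[OF lt(2)] by (rule refl)+
  then show ?thesis by (simp add: tw_def k add.commute)
qed

lemma agree_irreducible:
  assumes p3: "CARD('p) \<ge> 3" and irr: "irreducible_rep Gal r"
  shows weights_agree
proof -
  let ?p = "CARD('p)"
  obtain P a b where P: "invertible P" and ab: "a < b" "b \<le> ?p - 1"
    and "\<forall>sg\<in>inertia. r sg ** P = P ** scale_mat (cyclo sg ^ a) (mat2 (\<omega>2 sg ^ (b - a)) 0 0 (\<omega>2 sg ^ (?p * (b - a))))"
    using irreducible_inertia[OF irr] by blast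
  then have eq: "rep_equiv_on inertia r (%sg. scale_mat (cyclo sg ^ a) (mat2 (\<omega>2 sg ^ (b - a)) 0 0 (\<omega>2 sg ^ (?p * (b - a)))))"
    unfolding rep_equiv_iff by blast
  have n: "1 \<le> b - a" "b - a \<le> ?p - 1" using ab by simp_all
  define W where "W = tw ?p a {(0, b - a), (b - a - 1, ?p + 1 - (b - a))}"
  have "(b - a - 1 + a) mod (?p - 1) = b - 1" "a mod (?p - 1) = a" using ab by simp_all
  then have W: "W = {(a, b - a), (b - 1, ?p + 1 - (b - a))}" by (simp add: W_def tw_def)
  have k: "kW ?p W = ?p * a + b + 1" unfolding W by (rule kW_irreducible[OF ab])
  have psq: "?p\<^sup>2 - 1 = (?p + 1) * (?p - 1)" by (simp add: power2_eq_square algebra_simps)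
  have "has_weight_set \<omega>2 r W" unfolding W_def by (rule weight_set_irreducibleI[OF irr n eq])
  moreover have "W' = W" if W': "has_weight_set \<omega>2 r W'" for W'
  proof -
    obtain c n' where n': "1 \<le> n'" "n' \<le> ?p - 1" "W' = tw ?p c {(0, n'), (n' - 1, ?p + 1 - n')}"
      "rep_equiv_on inertia r (%sg. scale_mat (cyclo sg ^ c) (mat2 (\<omega>2 sg ^ n') 0 0 (\<omega>2 sg ^ (?p * n'))))"
      using weight_set_cases[OF p3 W'] irr by blast
    \<comment> \<open>As p^2 - 1 = (p + 1) (p - 1), a residue modulo p^2 - 1 determines the
      remainder modulo p + 1 and the quotient modulo p - 1.\<close>
    have E: "x div (?p + 1) mod (?p - 1) = y div (?p + 1) mod (?p - 1) \<and> x mod (?p + 1) = y mod (?p + 1)"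
      if "x mod (?p\<^sup>2 - 1) = y mod (?p\<^sup>2 - 1)" for x y
    proof -
      have m: "z mod (?p\<^sup>2 - 1) mod (?p + 1) = z mod (?p + 1)" "z mod (?p\<^sup>2 - 1) div (?p + 1) = z div (?p + 1) mod (?p - 1)" for z
        unfolding psq mod_mult2_eq[of z]
        by (simp_all only: div_mult_self4 mod_mult_self4 mod_mod_trivial mod_div_trivial add_0_right add_is_0 one_neq_zero simp_thms)
      show ?thesis using m[of x] m[of y] that by simp
    qed
    define f where "f x = (x div (?p + 1) mod (?p - 1), x mod (?p + 1))" for x
    have f: "f x = f y" if "x mod (?p\<^sup>2 - 1) = y mod (?p\<^sup>2 - 1)" for x y using E[OF that] by (simp add: f_def)
    have "{f x', f y'} = {f x, f y}"
      if "x' mod (?p\<^sup>2 - 1) = x mod (?p\<^sup>2 - 1) \<and> y' mod (?p\<^sup>2 - 1) = y mod (?p\<^sup>2 - 1) \<or>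
        x' mod (?p\<^sup>2 - 1) = y mod (?p\<^sup>2 - 1) \<and> y' mod (?p\<^sup>2 - 1) = x mod (?p\<^sup>2 - 1)" for x y x' y'
      using that
    proof (elim disjE conjE)
      assume h: "x' mod (?p\<^sup>2 - 1) = x mod (?p\<^sup>2 - 1)" "y' mod (?p\<^sup>2 - 1) = y mod (?p\<^sup>2 - 1)"
      show ?thesis unfolding f[OF h(1)] f[OF h(2)] ..
    next
      assume h: "x' mod (?p\<^sup>2 - 1) = y mod (?p\<^sup>2 - 1)" "y' mod (?p\<^sup>2 - 1) = x mod (?p\<^sup>2 - 1)"
      show ?thesis unfolding f[OF h(1)] f[OF h(2)] by (rule insert_commute)
    qed
    from this[OF irreducible_exponents[OF n'(4) eq]] show ?thesis
      unfolding n'(3) W_def exponent_weight[OF n] exponent_weight[OF n'(1,2)] f_def .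
  qed
  moreover have "has_serre_weight \<omega>2 r (?p * a + b + 1)"
    by (rule has_serre_weight.irreducible[OF irr ab eq])
  moreover have "k' = ?p * a + b + 1" if "has_serre_weight \<omega>2 r k'" for k'
    using that
  proof cases
    case (irreducible a' b')
    have e: "(?p + 1) * u + (v - u) = ?p * u + v" "(?p + 1) * u + ?p * (v - u) = ?p * v + u" if uv: "u < v" for u v :: nat
    proof -
      obtain l where "v = u + l" using less_imp_add_positive[OF uv] by blast
      then show "(?p + 1) * u + (v - u) = ?p * u + v" "(?p + 1) * u + ?p * (v - u) = ?p * v + u"
        by (simp_all add: algebra_simps)
    qed
    \<comment> \<open>Among pairs of base p digits only (p - 1, p - 1) reaches p^2 - 1, so below it
      congruent numbers are equal.\<close>
    have small: "?p * u + v < ?p\<^sup>2 - 1" if "u \<le> ?p - 1" "v \<le> ?p - 1" "u ~= ?p - 1 \<or> v ~= ?p - 1" for u v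
    proof -
      obtain q where q: "?p = Suc q" using p_gt_1 by (cases "?p") auto
      have "?p * u + v < q * q + 2 * q"
      proof (cases "u = q")
        case True
        then show ?thesis using that q by (simp add: algebra_simps)
      next
        case False
        then have "u + 1 \<le> q" using that q by simp
        then have "?p * (u + 1) \<le> ?p * q" by (rule mult_le_mono2)
        then show ?thesis using that q by (simp add: algebra_simps)
      qed
      then show ?thesis by (simp add: q power2_eq_square)
    qed
    have digits: "u = u' \<and> v = v'" if "?p * u + v = ?p * u' + v'" "v \<le> ?p - 1" "v' \<le> ?p - 1" for u v u' v'
    proof -
      have "v < ?p" "v' < ?p" using that p_gt_1 by linarith+
      then have "(?p * u + v) mod ?p = v" "(?p * u' + v') mod ?p = v'" by simp_all
      then have "v = v'" using that(1) by simp
      then show ?thesis using that(1) p_gt_1 by simp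
    qed
    have ls: "a \<le> ?p - 1" "b \<le> ?p - 1" "a' \<le> ?p - 1" "b' \<le> ?p - 1" "a ~= ?p - 1" "a' ~= ?p - 1"
      using ab irreducible(3,4) by linarith+
    have mods: "(?p * a + b) mod (?p\<^sup>2 - 1) = ?p * a + b" "(?p * b + a) mod (?p\<^sup>2 - 1) = ?p * b + a"
      "(?p * a' + b') mod (?p\<^sup>2 - 1) = ?p * a' + b'" "(?p * b' + a') mod (?p\<^sup>2 - 1) = ?p * b' + a'"
      using ls by (intro mod_less small; simp)+
    have "?p * a + b = ?p * a' + b' \<or> ?p * a + b = ?p * b' + a'"
      using irreducible_exponents[OF eq irreducible(5)] unfolding e[OF ab(1)] e[OF irreducible(3)] mods
      by (elim disjE conjE) ((rule disjI1, assumption) | (rule disjI2, assumption))+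
    then have "a = a' \<and> b = b'"
    proof
      assume "?p * a + b = ?p * a' + b'"
      then show ?thesis using ls by (intro digits)
    next
      assume "?p * a + b = ?p * b' + a'"
      then have "a = b' \<and> b = a'" using ls by (intro digits)
      then show ?thesis using ab(1) irreducible(3) by simp
    qed
    then show ?thesis using irreducible(1) by simp
  qed (erule notE, rule irr)+
  ultimately show ?thesis using k by (rule weights_agreeI)
qed

text \<open>On inertia the diagonal characters are powers of the cyclotomic one. With trivial wild
  inertia the restriction is diagonal, so both orders of the characters are realized.\<close>

lemma reducible_shape:
  assumes "\<not> irreducible_rep Gal r"
  shows "\<exists>m n. m < CARD('p) - 1 \<and> n < CARD('p) - 1 \<and> shape m n \<and>
    ((\<forall>\<nu>\<in>wild_inertia. r \<nu> = mat 1) --> shape n m \<and> (m ~= n --> split_rep r) \<and>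
      (\<exists>P. invertible P \<and> (\<forall>sg\<in>inertia. r sg ** P = P ** mat2 (cyclo sg ^ m) 0 0 (cyclo sg ^ n))))"
proof -
  obtain P c1 u c2 where P: "invertible P" "!!sg. sg \<in> Gal ==> r sg ** P = P ** mat2 (c1 sg) (u sg) 0 (c2 sg)"
    using reducible_triangular[OF assms] by blast
  have ch: "rchar c1" "rchar c2" by (rule triangular_rchar[OF P], assumption)+
  obtain m where m: "m < CARD('p) - 1" "!!sg. sg \<in> inertia ==> c1 sg = cyclo sg ^ m" using rchar_inertia[OF ch(1)] by blast
  obtain n where n: "n < CARD('p) - 1" "!!sg. sg \<in> inertia ==> c2 sg = cyclo sg ^ n" using rchar_inertia[OF ch(2)] by blast
  have "\<forall>sg\<in>inertia. r sg ** P = P ** mat2 (cyclo sg ^ m) (u sg) 0 (cyclo sg ^ n)"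
    using P(2) m(2) n(2) inertia_sub by auto
  then have sh: "shape m n" unfolding shape_def using P(1) by blast
  moreover have "shape n m \<and> (m ~= n --> split_rep r) \<and>
      (\<exists>P. invertible P \<and> (\<forall>sg\<in>inertia. r sg ** P = P ** mat2 (cyclo sg ^ m) 0 0 (cyclo sg ^ n)))"
    if w: "\<forall>\<nu>\<in>wild_inertia. r \<nu> = mat 1"
  proof -
    note ts = tame_split[OF w P]
    obtain Q where Q: "invertible Q" "!!sg. sg \<in> inertia ==> r sg ** Q = Q ** mat2 (cyclo sg ^ m) 0 0 (cyclo sg ^ n)"
      using ts(1) m(2) n(2) by auto
    define R where "R = Q ** mat2 0 1 1 0"
    have R: "invertible R" unfolding R_def by (intro invertible_mult Q) (simp add: invertible_mat2)
    have "r sg ** R = R ** mat2 (cyclo sg ^ n) 0 0 (cyclo sg ^ m)" if "sg \<in> inertia" for sg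
    proof -
      have "r sg ** R = Q ** (mat2 (cyclo sg ^ m) 0 0 (cyclo sg ^ n) ** mat2 0 1 1 0)"
        unfolding R_def by (simp only: matrix_mul_assoc Q(2)[OF that])
      also have "\<dots> = Q ** (mat2 0 1 1 0 ** mat2 (cyclo sg ^ n) 0 0 (cyclo sg ^ m))" by simp
      finally show ?thesis unfolding R_def by (simp only: matrix_mul_assoc)
    qed
    then have "shape n m" unfolding shape_def using R by (intro exI[of _ R] exI[of _ "%_. 0"]) simp
    moreover have "split_rep r" if "m ~= n"
    proof (rule ts(2))
      show "c1 g ~= c2 g" using that m n unfolding m(2)[OF gI] n(2)[OF gI] cyclo_g_eq by simp
    qed
    ultimately show ?thesis using Q by blast
  qed
  ultimately show ?thesis using m(1) n(1) by blast
qed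

lemma agree_tame:
  assumes p3: "CARD('p) \<ge> 3" and red: "\<not> irreducible_rep Gal r" and w: "\<forall>\<nu>\<in>wild_inertia. r \<nu> = mat 1"
  shows weights_agree
proof -
  let ?p = "CARD('p)"
  have nw: "\<not> (\<exists>\<nu>\<in>wild_inertia. r \<nu> ~= mat 1)" using w by blast
  obtain m n where mn: "m < ?p - 1" "n < ?p - 1" "shape m n" "shape n m" "m ~= n --> split_rep r"
    "\<exists>P. invertible P \<and> (\<forall>sg\<in>inertia. r sg ** P = P ** mat2 (cyclo sg ^ m) 0 0 (cyclo sg ^ n))"
    using reducible_shape[OF red] w by blast
  define a b where "a = min m n" and "b = max m n"
  have ab: "a \<le> b" "b \<le> ?p - 2" "b < ?p - 1" using mn by (auto simp: a_def b_def)
  have abm: "a mod (?p - 1) = a" "b mod (?p - 1) = b" using ab by simp_all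
  have sh: "shape a b" "shape b a" using mn(3,4) by (auto simp: a_def b_def min_def max_def)
  have sp: "split_rep r" if "a ~= b" using mn(5) that by (auto simp: a_def b_def)
  have nt: "\<not> tres_ramifiee r" if "split_rep r" using that by (simp add: tres_ramifiee_def cyclo_extension_def)
  \<comment> \<open>For a = b inertia acts by scalars; the normalized exponent of the quotient is
    then p - 1 rather than 0, because b ranges over 1..p-1 in the table.\<close>
  define W where "W = (if a = b then {(a, ?p - 1)} else tw ?p a (RW True False ?p (b - a)))"
  have uniq: "W' = W" if W': "has_weight_set \<omega>2 r W'" for W'
  proof -
    obtain c b' u where c: "1 \<le> b'" "b' \<le> ?p - 1" "W' = tw ?p c (RW (split_rep r) (tres_ramifiee r) ?p b')"
      "rep_equiv_on inertia r (%sg. scale_mat (cyclo sg ^ c) (mat2 (cyclo sg ^ b') (u sg) 0 1))"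
      using weight_set_cases[OF p3 W'] red by blast
    have "shape (c + b') c" by (rule shape_of_equiv[OF c(4)]) (simp add: power_add)
    note cong = shape_unique(1)[OF this sh(2), unfolded abm]
    have b'0: "b' = ?p - 1" if "(c + b') mod (?p - 1) = c mod (?p - 1)"
    proof -
      have "(?p - 1) dvd b'" using that by (metis add_diff_cancel_left' mod_eq_dvd_iff_nat le_add1)
      then show ?thesis using c(1,2) by (metis dvd_imp_le le_antisym less_le_trans zero_less_one)
    qed
    show ?thesis
    proof (cases "a = b")
      case True
      then have "c mod (?p - 1) = a" "b' = ?p - 1" using cong b'0 by auto
      then show ?thesis using True RW_last[OF p3] by (simp add: c(3) W_def tw_def)
    next
      case False
      then have ab': "a < b" using ab(1) by simp
      have W'': "W' = tw ?p c (RW True False ?p b')" using sp[OF False] nt c(3) by simp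
      from cong show ?thesis
      proof
        assume *: "(c + b') mod (?p - 1) = b \<and> c mod (?p - 1) = a"
        have "(a + b') mod (?p - 1) = b" using * by (metis mod_add_left_eq)
        have b'ne: "b' ~= ?p - 1"
        proof
          assume "b' = ?p - 1"
          then have "a mod (?p - 1) = b" using \<open>(a + b') mod (?p - 1) = b\<close> by (simp only: mod_add_self2)
          then show False using ab' abm by simp
        qed
        have "b' = b - a"
        proof (cases "a + b' < ?p - 1")
          case True
          then show ?thesis using \<open>(a + b') mod (?p - 1) = b\<close> by simp
        next
          case False
          then have "(a + b') mod (?p - 1) = a + b' - (?p - 1)" using ab ab' c(2) b'ne by (subst le_mod_geq) simp_all
          then show ?thesis using \<open>(a + b') mod (?p - 1) = b\<close> ab' c(2) False by linarith
        qed
        then show ?thesis using * tw_cong[of c ?p a] abm False by (simp add: W'' W_def)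
      next
        \<comment> \<open>The two characters in the opposite order; \<open>RW_swap\<close>
          identifies the resulting sets.\<close>
        assume *: "(c + b') mod (?p - 1) = a \<and> c mod (?p - 1) = b"
        have e: "(b + b') mod (?p - 1) = a" using * by (metis mod_add_left_eq)
        have "b' = ?p - 1 - (b - a)"
        proof (cases "b + b' < ?p - 1")
          case True
          then show ?thesis using e ab' by simp
        next
          case False
          then have "(b + b') mod (?p - 1) = (b + b' - (?p - 1)) mod (?p - 1)" by (intro le_mod_geq) simp
          also have "\<dots> = b + b' - (?p - 1)" using ab c(2) by (intro mod_less) linarith
          finally show ?thesis using e ab' ab c(2) False by linarith
        qed
        then have "W' = tw ?p b (RW True False ?p (?p - 1 - (b - a)))"
          using * tw_cong[of c ?p b] abm by (simp add: W'')
        also have "\<dots> = tw ?p a (tw ?p (b - a) (RW True False ?p (?p - 1 - (b - a))))"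
          using ab' by (simp add: tw_tw)
        also have "\<dots> = W" using RW_swap[OF p3, of "b - a"] ab ab' False by (simp add: W_def)
        finally show ?thesis .
      qed
    qed
  qed
  have ex: "\<exists>W'. has_weight_set \<omega>2 r W'"
  proof -
    define b' where "b' = (if a = b then ?p - 1 else b - a)"
    have b': "1 \<le> b'" "b' \<le> ?p - 1" using ab p3 by (auto simp: b'_def)
    have "a + b' = b \<or> a + b' = b + (?p - 1)" using ab by (auto simp: b'_def)
    then have e: "(a + b') mod (?p - 1) = b mod (?p - 1)" by (elim disjE) (simp_all only: mod_add_self2)
    then have "\<exists>u. rep_equiv_on inertia r (%sg. scale_mat (cyclo sg ^ a) (mat2 (cyclo sg ^ b') (u sg) 0 1))"
      by (intro equiv_of_shape[OF sh(2) refl]) (simp add: cyclo_pow_mod[OF _ e] flip: power_add)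
    then show ?thesis using weight_set_reducibleI[OF red b'] by blast
  qed
  have hw: "has_weight_set \<omega>2 r W" using ex uniq by blast
  have k: "kW ?p W = (if (a, b) = (0, 0) then ?p else ?p * a + b + 1)"
    using kW_scalar[OF p3, of a] kW_tame[OF p3, of a b] ab by (auto simp: W_def)
  note hw uniq
  moreover have "has_serre_weight \<omega>2 r (if (a, b) = (0, 0) then ?p else ?p * a + b + 1)"
  proof (rule has_serre_weight.tame[OF red w ab(1,2)])
    obtain P where P: "invertible P" "!!sg. sg \<in> inertia ==> r sg ** P = P ** mat2 (cyclo sg ^ m) 0 0 (cyclo sg ^ n)"
      using mn(6) by blast
    define Q where "Q = (if n \<le> m then P else P ** mat2 0 1 1 0)"
    have Q: "invertible Q" unfolding Q_def using P(1) by (auto intro!: invertible_mult simp: invertible_mat2)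
    have "r sg ** Q = Q ** scale_mat (cyclo sg ^ a) (mat2 (cyclo sg ^ (b - a)) 0 0 1)" if "sg \<in> inertia" for sg
    proof (cases "n \<le> m")
      case True
      then show ?thesis using P(2)[OF that] by (simp add: Q_def a_def b_def flip: power_add)
    next
      case False
      have "r sg ** Q = P ** (mat2 (cyclo sg ^ m) 0 0 (cyclo sg ^ n) ** mat2 0 1 1 0)"
        using False by (simp only: Q_def if_False matrix_mul_assoc P(2)[OF that])
      also have "\<dots> = P ** (mat2 0 1 1 0 ** mat2 (cyclo sg ^ n) 0 0 (cyclo sg ^ m))" by simp
      also have "\<dots> = Q ** mat2 (cyclo sg ^ n) 0 0 (cyclo sg ^ m)" using False by (simp only: Q_def if_False matrix_mul_assoc)
      finally show ?thesis using False by (simp add: a_def b_def flip: power_add)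
    qed
    then show "rep_equiv_on inertia r (%sg. scale_mat (cyclo sg ^ a) (mat2 (cyclo sg ^ (b - a)) 0 0 1))"
      unfolding rep_equiv_iff using Q by blast
  qed
  moreover have "k' = (if (a, b) = (0, 0) then ?p else ?p * a + b + 1)" if "has_serre_weight \<omega>2 r k'" for k'
    using that
  proof cases
    case (tame a' b')
    have "shape b' a'"
      using tame(4) by (intro shape_of_equiv[OF tame(6)]) (simp flip: power_add)
    moreover have "a' mod (?p - 1) = a'" "b' mod (?p - 1) = b'" using tame(4,5) p3 by simp_all
    ultimately have "b' = b \<and> a' = a \<or> b' = a \<and> a' = b" using shape_unique(1)[OF _ sh(2)] abm by metis
    then have "a' = a \<and> b' = b" using tame(4) ab(1) by auto
    then show ?thesis using tame(1) by (simp add: HOL.induct_conj_def)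
  qed ((rule notE[OF red], assumption) | (rule notE[OF nw], assumption))+
  ultimately show ?thesis using k by (rule weights_agreeI)
qed

lemma agree_wild:
  assumes p3: "CARD('p) \<ge> 3" and red: "\<not> irreducible_rep Gal r" and w: "\<exists>\<nu>\<in>wild_inertia. r \<nu> ~= mat 1"
  shows weights_agree
proof -
  let ?p = "CARD('p)"
  have nt: "\<not> (\<forall>\<nu>\<in>wild_inertia. r \<nu> = mat 1)" using w by blast
  \<comment> \<open>A split representation is trivial on wild inertia, so only the nonsplit rows of
    the table occur.\<close>
  have ns: "\<not> split_rep r" using w split_wild_trivial by blast
  obtain m \<alpha> where m: "m < ?p - 1" "\<alpha> < ?p - 1" "shape m \<alpha>" using reducible_shape[OF red] by blast
  \<comment> \<open>\<alpha> is normalized to 0..p-2 but \<beta> to 1..p-1, so the residue 0 becomes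
    p - 1.\<close>
  define \<beta> where "\<beta> = (if m = 0 then ?p - 1 else m)"
  have \<beta>: "1 \<le> \<beta>" "\<beta> \<le> ?p - 1" "\<beta> mod (?p - 1) = m mod (?p - 1)" using m p3 by (auto simp: \<beta>_def)
  have \<alpha>: "\<alpha> \<le> ?p - 2" "\<alpha> mod (?p - 1) = \<alpha>" using m by simp_all
  have range_eq: "x = y" if "x mod (?p - 1) = y mod (?p - 1)" "1 \<le> x" "x \<le> ?p - 1" "1 \<le> y" "y \<le> ?p - 1" for x y
  proof (cases "x = ?p - 1 \<or> y = ?p - 1")
    case True
    then have "(?p - 1) dvd x" "(?p - 1) dvd y" using that(1) by (auto simp: mod_eq_0_iff_dvd dest: sym)
    then show ?thesis using that(2-) by (metis dvd_imp_le le_antisym less_le_trans zero_less_one)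
  next
    case False
    then show ?thesis using that by simp
  qed
  define b where "b = (if \<beta> > \<alpha> then \<beta> - \<alpha> else \<beta> + (?p - 1) - \<alpha>)"
  have b: "1 \<le> b" "b \<le> ?p - 1" using \<alpha> \<beta> by (auto simp: b_def)
  have ab: "(\<alpha> + b) mod (?p - 1) = m mod (?p - 1)"
  proof -
    have "\<alpha> + b = \<beta> \<or> \<alpha> + b = \<beta> + (?p - 1)" using \<alpha> \<beta> by (auto simp: b_def)
    then show ?thesis using \<beta>(3) by (elim disjE) (simp_all only: mod_add_self2)
  qed
  define W where "W = tw ?p \<alpha> (RW False (tres_ramifiee r) ?p b)"
  define k where "k = (if \<beta> ~= \<alpha> + 1 then 1 + ?p * min \<alpha> \<beta> + max \<alpha> \<beta>
     else if tres_ramifiee r then ?p + 1 + \<alpha> * (?p + 1) else 2 + \<alpha> * (?p + 1))"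
  have kW: "kW ?p W = k" unfolding W_def k_def b_def by (rule kW_wild[OF p3 \<alpha>(1) \<beta>(1,2)])
  have "\<exists>u. rep_equiv_on inertia r (%sg. scale_mat (cyclo sg ^ \<alpha>) (mat2 (cyclo sg ^ b) (u sg) 0 1))"
    by (intro equiv_of_shape[OF m(3) refl]) (simp add: cyclo_pow_mod[OF _ ab] flip: power_add)
  then have "has_weight_set \<omega>2 r W" using weight_set_reducibleI[OF red b] ns unfolding W_def by auto
  moreover have "W' = W" if W': "has_weight_set \<omega>2 r W'" for W'
  proof -
    obtain c b' u where c: "1 \<le> b'" "b' \<le> ?p - 1" "W' = tw ?p c (RW (split_rep r) (tres_ramifiee r) ?p b')"
      "rep_equiv_on inertia r (%sg. scale_mat (cyclo sg ^ c) (mat2 (cyclo sg ^ b') (u sg) 0 1))"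
      using weight_set_cases[OF p3 W'] red by blast
    have "shape (c + b') c" by (rule shape_of_equiv[OF c(4)]) (simp add: power_add)
    then have cong: "(c + b') mod (?p - 1) = m mod (?p - 1)" "c mod (?p - 1) = \<alpha> mod (?p - 1)"
      using shape_unique(2)[OF _ m(3) w] by blast+
    have "(\<alpha> + b') mod (?p - 1) = (\<alpha> + b) mod (?p - 1)"
      using cong ab by (metis mod_add_left_eq)
    then have "[\<alpha> + b' = \<alpha> + b] (mod (?p - 1))" by (simp only: Cong.cong_def)
    then have "b' mod (?p - 1) = b mod (?p - 1)" by (simp only: cong_add_lcancel_nat) (simp only: Cong.cong_def)
    then have "b' = b" by (rule range_eq[OF _ c(1,2) b])
    then show ?thesis using tw_cong[OF cong(2)] ns by (simp add: c(3) W_def)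
  qed
  moreover have "has_serre_weight \<omega>2 r k"
  proof -
    have "\<exists>u. rep_equiv_on inertia r (%sg. scale_mat (cyclo sg ^ \<alpha>) (mat2 (cyclo sg powi (int \<beta> - int \<alpha>)) (u sg) 0 1))"
      by (intro equiv_of_shape[OF m(3) refl]) (simp add: powi_shift inertia_cyclo_nz cyclo_pow_mod[OF _ \<beta>(3)])
    then obtain u where u: "rep_equiv_on inertia r (%sg. scale_mat (cyclo sg ^ \<alpha>) (mat2 (cyclo sg powi (int \<beta> - int \<alpha>)) (u sg) 0 1))" by blast
    note rules = has_serre_weight.generic_wild[OF red w \<alpha>(1) \<beta>(1,2) u] has_serre_weight.peu[OF red w \<alpha>(1) \<beta>(1,2) u]
      has_serre_weight.tres[OF red w \<alpha>(1) \<beta>(1,2) u]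
    show ?thesis unfolding k_def using rules by (simp only: split: if_split) blast
  qed
  moreover have "k' = k" if "has_serre_weight \<omega>2 r k'" for k'
  proof -
    have *: "\<alpha>' = \<alpha> \<and> \<beta>' = \<beta>" if "\<alpha>' \<le> ?p - 2" "1 \<le> \<beta>'" "\<beta>' \<le> ?p - 1"
      "rep_equiv_on inertia r (%sg. scale_mat (cyclo sg ^ \<alpha>') (mat2 (cyclo sg powi (int \<beta>' - int \<alpha>')) (u sg) 0 1))" for \<alpha>' \<beta>' u
    proof -
      have "shape \<beta>' \<alpha>'" by (rule shape_of_equiv[OF that(4)]) (simp add: powi_shift inertia_cyclo_nz)
      then have "\<beta>' mod (?p - 1) = \<beta> mod (?p - 1)" "\<alpha>' mod (?p - 1) = \<alpha>"
        using shape_unique(2)[OF _ m(3) w] \<beta>(3) \<alpha>(2) by metis+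
      moreover have "\<alpha>' mod (?p - 1) = \<alpha>'" using that(1) p3 by simp
      ultimately show ?thesis using range_eq[OF _ that(2,3) \<beta>(1,2)] by simp
    qed
    from that show ?thesis
    proof cases
      case (generic_wild \<alpha>' \<beta>' u)
      then show ?thesis using *[OF generic_wild(4-7)] by (simp add: k_def)
    next
      case (peu \<alpha>' \<beta>' u)
      then show ?thesis using *[OF peu(4-7)] by (simp add: k_def)
    next
      case (tres \<alpha>' \<beta>' u)
      then show ?thesis using *[OF tres(4-7)] by (simp add: k_def)
    qed ((rule notE[OF red], assumption) | (rule notE[OF nt], assumption))+
  qed
  ultimately show ?thesis using kW by (rule weights_agreeI)
qed

theorem all_agree: "CARD('p) \<ge> 3 ==> weights_agree"
  using agree_irreducible agree_tame agree_wild by blast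

end

theorem theorem3p4:
  fixes \<iota> :: "q_bar \<Rightarrow> 'p :: prime_card qp_bar"
    and \<omega>2 :: "('p qp_bar \<Rightarrow> 'p qp_bar) \<Rightarrow> 'p fp_bar"
    and \<rho> :: "(q_bar \<Rightarrow> q_bar) \<Rightarrow> 'p fp_bar ^ 2 ^ 2"
  assumes "odd CARD('p)"
    and "field_hom \<iota>"
    and "fundamental_character2 \<omega>2"
    and "\<rho> \<in> hom abs_galois GL2"
    and "continuous_map krull_topology (discrete_topology (carrier GL2)) \<rho>"
    and "odd_rep \<rho>"
    and "irreducible_rep (carrier abs_galois) \<rho>"
  shows "serre_k \<iota> \<omega>2 \<rho> = k_min_set TYPE('p) (serre_weights \<iota> \<omega>2 \<rho>)"
proof -
  let ?r = "\<rho> \<circ> decomp \<iota>"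
  have p3: "CARD('p) \<ge> 3"
    using assms(1) prime_gt_1_nat[OF prime_card[where ?'a = 'p]] by (cases "CARD('p) = 2") auto
  obtain red \<pi> where red: "red 1 = 1"
      "\<forall>x\<in>integers_bar. \<forall>y\<in>integers_bar. red (x + y) = red x + red y \<and> red (x * y) = red x * red y"
    and \<pi>: "\<pi> ^ ((CARD('p))\<^sup>2 - 1) = (of_nat CARD('p) :: 'p qp_bar)" "\<forall>\<sigma>\<in>inertia. \<omega>2 \<sigma> = red (\<sigma> \<pi> / \<pi>)"
    using assms(3) unfolding fundamental_character2_def by blast
  \<comment> \<open>The reduction map is the very one that defines \<open>\<omega>2\<close>, which
    makes the values of both characters at g comparable.\<close>
  interpret residue red by unfold_locales (use red in auto)
  note r = local_rep[OF assms(2,4,5)]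
  obtain F where F: "finite F" "\<And>\<sigma>. \<sigma> \<in> Gal \<Longrightarrow> \<forall>x\<in>F. \<sigma> x = x \<Longrightarrow> ?r \<sigma> = mat 1" using r(2) by blast
  have "\<exists>g \<phi> J d N. tame_rep ?r \<omega>2 g \<phi> J d N"
    by (rule tame_rep_exists[OF \<pi>(1) _ r(1) F]) (use \<pi>(2) in blast)
  then obtain g \<phi> J d N where "tame_rep ?r \<omega>2 g \<phi> J d N" by blast
  then interpret t: tame_rep ?r \<omega>2 g \<phi> J d N .
  obtain W where W: "has_weight_set \<omega>2 ?r W" "\<And>W'. has_weight_set \<omega>2 ?r W' \<Longrightarrow> W' = W"
    and k: "has_serre_weight \<omega>2 ?r (kW CARD('p) W)" "\<And>k. has_serre_weight \<omega>2 ?r k \<Longrightarrow> k = kW CARD('p) W"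
    using t.all_agree[OF p3] unfolding t.weights_agree_def by blast
  note bounds = t.weight_set_bounds[OF p3 W(1)]
  have "serre_weights \<iota> \<omega>2 \<rho> = W" unfolding serre_weights_def by (rule the_equality) (fact W)+
  moreover have "serre_k \<iota> \<omega>2 \<rho> = kW CARD('p) W" unfolding serre_k_def by (rule the_equality) (fact k)+
  moreover have "k_min TYPE('p) ` W = (\<lambda>(a, b). kf CARD('p) a b + 2) ` W"
    by (rule image_cong) (use bounds(3) k_min_eq[OF p3] in auto)
  ultimately show ?thesis by (simp add: k_min_set_def kW_def)
qed

end
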